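(* Let $\Gamma_B$ be a $5$-large PL triangulation of $\mathbb S^3$ with an arbitrary $n$-colouring having at least one vertex of each colour, and let $\Gamma_A=\mathbb S^0*\cdots*\mathbb S^0$ ($n$ factors), where the two vertices of the $i$-th factor have colour $i$. Then $X_{\Gamma_A,\Gamma_B}$ is a $4$-dimensional closed connected PL manifold with (Gromov) hyperbolic fundamental group.
   Context: All simplicial complexes are finite, and the empty set counts as a simplex of every complex. An $n$-coloured simplicial complex is a simplicial complex whose vertex set is partitioned into $n$ labelled (possibly empty) classes, the colours $1,\dots,n$, so that adjacent vertices have different colours. Let $\Gamma_A,\Gamma_B$ be $n$-coloured with colour classes $A_1,\dots,A_n$ and $B_1,\dots,B_n$. Let $K=\prod_{i=1}^n (A_i*B_i)$, a product of complete bipartite graphs, viewed as a cube complex. A vertex $(x_1,\dots,x_n)$ of $K$, $x_i\in A_i\sqcup B_i$, is identified with the pair $(\mathfrak a,\mathfrak b)$, $\mathfrak a=\{x_i: x_i\in A_i\}$, $\mathfrak b=\{x_i: x_i\in B_i\}$. The coupled link cube complex $X_{\Gamma_A,\Gamma_B}$ is the full subcomplex of $K$ (all cubes all of whose vertices belong to it) on the vertices $(\mathfrak a,\mathfrak b)$ such that $\mathfrak a$ is a (possibly empty) simplex of $\Gamma_A$ and $\mathfrak b$ is a (possibly empty) simplex of $\Gamma_B$. $\mathbb S^0$ is the discrete complex with two vertices and $*$ is the simplicial join. A simplicial complex is $5$-large if it is flag (every set of pairwise adjacent vertices spans a simplex) and contains no cycle of length $4$ in its $1$-skeleton both of whose pairs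 of opposite vertices are non-adjacent. A PL triangulation of a $d$-manifold is a triangulation in which the link of each vertex is a PL $(d-1)$-sphere; a PL manifold is a manifold that can be equipped with a PL triangulation. *)

theory Defs
  imports "HOL-Analysis.Analysis" "HOL-Algebra.Generated_Groups"
begin

section \<open>Abstract simplicial complexes\<close>

definition abstract_complex :: "'v set set \<Rightarrow> bool" where
  "abstract_complex K \<longleftrightarrow> finite (\<Union>K) \<and> {} \<in> K \<and> (\<forall>\<sigma>\<in>K. \<forall>\<tau>\<subseteq>\<sigma>. \<tau> \<in> K)"

definition adjacent_in :: "'v set set \<Rightarrow> 'v \<Rightarrow> 'v \<Rightarrow> bool" where
  "adjacent_in K u v \<longleftrightarrow> u \<noteq> v \<and> {u, v} \<in> K"

definition flag_complex :: "'v set set \<Rightarrow> bool" where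
  "flag_complex K \<longleftrightarrow>
     (\<forall>\<sigma>\<subseteq>\<Union>K. (\<forall>u\<in>\<sigma>. \<forall>v\<in>\<sigma>. u \<noteq> v \<longrightarrow> adjacent_in K u v) \<longrightarrow> \<sigma> \<in> K)"

definition five_large :: "'v set set \<Rightarrow> bool" where
  "five_large K \<longleftrightarrow> flag_complex K \<and>
     \<not> (\<exists>a b c d. distinct [a, b, c, d] \<and>
          adjacent_in K a b \<and> adjacent_in K b c \<and> adjacent_in K c d \<and> adjacent_in K d a \<and>
          \<not> adjacent_in K a c \<and> \<not> adjacent_in K b d)"

definition link_of :: "'v set set \<Rightarrow> 'v \<Rightarrow> 'v set set" where
  "link_of K v = {\<tau>. v \<notin> \<tau> \<and> insert v \<tau> \<in> K}"

definition discrete_complex :: "'v set \<Rightarrow> 'v set set" where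
  "discrete_complex V = insert {} {{v} |v. v \<in> V}"

definition S0 :: "bool set set" where
  "S0 = discrete_complex UNIV"

text \<open>In both joins, the simplices are the disjoint unions of one (possibly empty) simplex of
  each factor.\<close>

definition join_complex :: "'a set set \<Rightarrow> 'b set set \<Rightarrow> ('a + 'b) set set" where
  "join_complex K L = {\<sigma> <+> \<tau> |\<sigma> \<tau>. \<sigma> \<in> K \<and> \<tau> \<in> L}"

definition join_family :: "'i set \<Rightarrow> ('i \<Rightarrow> 'v set set) \<Rightarrow> ('i \<times> 'v) set set" where
  "join_family I K = {Sigma I \<sigma> |\<sigma>. \<forall>i\<in>I. \<sigma> i \<in> K i}"

text \<open>A colouring is a map from the vertices to the colours; values off the vertex set are
  irrelevant.\<close>

definition coloured_complex :: "nat \<Rightarrow> 'v set set \<Rightarrow> ('v \<Rightarrow> nat) \<Rightarrow> bool" where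
  "coloured_complex n K c \<longleftrightarrow> abstract_complex K \<and> (\<forall>v\<in>\<Union>K. c v \<in> {1..n}) \<and>
     (\<forall>u v. adjacent_in K u v \<longrightarrow> c u \<noteq> c v)"

definition colour_class :: "'v set set \<Rightarrow> ('v \<Rightarrow> nat) \<Rightarrow> nat \<Rightarrow> 'v set" where
  "colour_class K c i = {v \<in> \<Union>K. c v = i}"


section \<open>Geometric realization and PL homeomorphism\<close>

text \<open>Points are given by barycentric coordinates; for finite complexes the product topology on
  \<open>'v \<Rightarrow> real\<close> induces the usual topology of the realization.\<close>

definition closed_simplex :: "'v set \<Rightarrow> ('v \<Rightarrow> real) set" where
  "closed_simplex \<sigma> = {x. (\<forall>v. 0 \<le> x v) \<and> (\<forall>v. v \<notin> \<sigma> \<longrightarrow> x v = 0) \<and> sum x \<sigma> = 1}"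

definition realization :: "'v set set \<Rightarrow> ('v \<Rightarrow> real) set" where
  "realization K = (\<Union>\<sigma>\<in>K. closed_simplex \<sigma>)"

definition affine_extension :: "'w set set \<Rightarrow> ('w \<Rightarrow> 'v \<Rightarrow> real) \<Rightarrow> ('w \<Rightarrow> real) \<Rightarrow> 'v \<Rightarrow> real" where
  "affine_extension M \<phi> x = (\<lambda>v. \<Sum>w\<in>\<Union>M. x w * \<phi> w v)"

text \<open>\<open>M\<close>, with its vertices placed at the points given by \<open>\<phi>\<close>, is a subdivision of \<open>K\<close>: every
  simplex of \<open>M\<close> is spanned inside one simplex of \<open>K\<close>, and the spanned simplices fit together to
  the whole of the realization of \<open>K\<close>.\<close>

definition is_subdivision :: "'w set set \<Rightarrow> ('w \<Rightarrow> 'v \<Rightarrow> real) \<Rightarrow> 'v set set \<Rightarrow> bool" where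
  "is_subdivision M \<phi> K \<longleftrightarrow> abstract_complex M \<and>
     (\<forall>\<tau>\<in>M. \<exists>\<sigma>\<in>K. \<phi> ` \<tau> \<subseteq> closed_simplex \<sigma>) \<and>
     bij_betw (affine_extension M \<phi>) (realization M) (realization K)"

text \<open>Two complexes are PL homeomorphic if they have isomorphic subdivisions. As all complexes are
  finite, natural numbers suffice as names of the vertices of the subdivision.\<close>

definition PL_homeomorphic :: "'v set set \<Rightarrow> 'w set set \<Rightarrow> bool" where
  "PL_homeomorphic K L \<longleftrightarrow> (\<exists>(M :: nat set set) \<phi> \<psi>. is_subdivision M \<phi> K \<and> is_subdivision M \<psi> L)"

text \<open>The boundary of the \<open>d\<close>-simplex, that is, the standard PL \<open>(d-1)\<close>-sphere.\<close>

definition simplex_boundary :: "nat \<Rightarrow> nat set set" where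
  "simplex_boundary d = {\<sigma>. \<sigma> \<subset> {..d}}"


section \<open>PL manifolds\<close>

definition PL_triangulates :: "nat \<Rightarrow> 'v set set \<Rightarrow> 'x topology \<Rightarrow> bool" where
  "PL_triangulates d K X \<longleftrightarrow> abstract_complex K \<and>
     top_of_set (realization K) homeomorphic_space X \<and>
     (\<forall>v\<in>\<Union>K. PL_homeomorphic (link_of K v) (simplex_boundary d))"

definition topological_manifold :: "nat \<Rightarrow> 'x topology \<Rightarrow> bool" where
  "topological_manifold d X \<longleftrightarrow> Hausdorff_space X \<and> second_countable X \<and>
     (\<forall>x\<in>topspace X. \<exists>U. openin X U \<and> x \<in> U \<and>
        subtopology X U homeomorphic_space Euclidean_space d)"

definition closed_connected_PL_manifold :: "nat \<Rightarrow> 'x topology \<Rightarrow> bool" where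
  "closed_connected_PL_manifold d X \<longleftrightarrow> topological_manifold d X \<and>
     compact_space X \<and> connected_space X \<and> topspace X \<noteq> {} \<and>
     (\<exists>K :: nat set set. PL_triangulates d K X)"


section \<open>The coupled link cube complex\<close>

text \<open>A cube of a product of graphs is a choice of one cell (a vertex or an edge) in each factor;
  its vertices are obtained by choosing one vertex of each of these cells.\<close>

definition product_cubes :: "'i set \<Rightarrow> ('i \<Rightarrow> 'v set set) \<Rightarrow> ('i \<Rightarrow> 'v set) set" where
  "product_cubes I G = (\<Pi>\<^sub>E i\<in>I. G i - {{}})"

definition cube_vertices :: "'i set \<Rightarrow> ('i \<Rightarrow> 'v set) \<Rightarrow> ('i \<Rightarrow> 'v) set" where
  "cube_vertices I e = Pi\<^sub>E I e"

definition geometric_cube :: "'i set \<Rightarrow> ('i \<Rightarrow> 'v set) \<Rightarrow> ('i \<Rightarrow> 'v \<Rightarrow> real) set" where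
  "geometric_cube I e = (\<Pi>\<^sub>E i\<in>I. closed_simplex (e i))"

definition coupled_vertex ::
  "nat \<Rightarrow> 'a set set \<Rightarrow> 'b set set \<Rightarrow> (nat \<Rightarrow> 'a + 'b) \<Rightarrow> bool" where
  "coupled_vertex n \<Gamma>\<^sub>A \<Gamma>\<^sub>B x \<longleftrightarrow>
     {a. \<exists>i\<in>{1..n}. x i = Inl a} \<in> \<Gamma>\<^sub>A \<and> {b. \<exists>i\<in>{1..n}. x i = Inr b} \<in> \<Gamma>\<^sub>B"

definition coupled_link_cubes ::
  "nat \<Rightarrow> 'a set set \<Rightarrow> ('a \<Rightarrow> nat) \<Rightarrow> 'b set set \<Rightarrow> ('b \<Rightarrow> nat) \<Rightarrow> (nat \<Rightarrow> ('a + 'b) set) set" where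
  "coupled_link_cubes n \<Gamma>\<^sub>A c\<^sub>A \<Gamma>\<^sub>B c\<^sub>B =
     {e \<in> product_cubes {1..n}
            (\<lambda>i. join_complex (discrete_complex (colour_class \<Gamma>\<^sub>A c\<^sub>A i))
                              (discrete_complex (colour_class \<Gamma>\<^sub>B c\<^sub>B i))).
        \<forall>x\<in>cube_vertices {1..n} e. coupled_vertex n \<Gamma>\<^sub>A \<Gamma>\<^sub>B x}"

text \<open>The underlying space, as a subset of the product of the realizations of the graphs. The
  coordinates outside \<open>{1..n}\<close> are constant and do not affect the topology.\<close>

definition coupled_link_space ::
  "nat \<Rightarrow> 'a set set \<Rightarrow> ('a \<Rightarrow> nat) \<Rightarrow> 'b set set \<Rightarrow> ('b \<Rightarrow> nat) \<Rightarrow> (nat \<Rightarrow> 'a + 'b \<Rightarrow> real) set" where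
  "coupled_link_space n \<Gamma>\<^sub>A c\<^sub>A \<Gamma>\<^sub>B c\<^sub>B =
     (\<Union>e\<in>coupled_link_cubes n \<Gamma>\<^sub>A c\<^sub>A \<Gamma>\<^sub>B c\<^sub>B. geometric_cube {1..n} e)"


section \<open>Fundamental groups and hyperbolic groups\<close>

definition loops_at :: "'x::topological_space set \<Rightarrow> 'x \<Rightarrow> (real \<Rightarrow> 'x) set" where
  "loops_at S x = {p. path p \<and> path_image p \<subseteq> S \<and> pathstart p = x \<and> pathfinish p = x}"

text \<open>Paths are functions on all of \<open>real\<close>; the relation \<^const>\<open>homotopic_paths\<close> ignores their
  values outside \<open>{0..1}\<close>.\<close>

definition fundamental_group :: "'x::topological_space set \<Rightarrow> 'x \<Rightarrow> (real \<Rightarrow> 'x) set monoid" where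
  "fundamental_group S x =
     \<lparr>carrier = loops_at S x // {(p, q). homotopic_paths S p q},
      monoid.mult = (\<lambda>P Q. {r. \<exists>p\<in>P. \<exists>q\<in>Q. homotopic_paths S (p +++ q) r}),
      one = {r. homotopic_paths S (\<lambda>_. x) r}\<rparr>"

definition word_length :: "('g, 'm) monoid_scheme \<Rightarrow> 'g set \<Rightarrow> 'g \<Rightarrow> nat" where
  "word_length G S g =
     (LEAST k. \<exists>ws. length ws = k \<and> set ws \<subseteq> S \<union> m_inv G ` S \<and>
        foldr (\<otimes>\<^bsub>G\<^esub>) ws \<one>\<^bsub>G\<^esub> = g)"

definition word_dist :: "('g, 'm) monoid_scheme \<Rightarrow> 'g set \<Rightarrow> 'g \<Rightarrow> 'g \<Rightarrow> real" where
  "word_dist G S g h = real (word_length G S (inv\<^bsub>G\<^esub> g \<otimes>\<^bsub>G\<^esub> h))"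

text \<open>Gromov's four-point condition. It is the inequality
  \<open>min (x|y) (y|z) - \<delta> \<le> (x|z)\<close> between Gromov products based at \<open>w\<close>, multiplied out.\<close>

definition Gromov_hyperbolic_on :: "'p set \<Rightarrow> ('p \<Rightarrow> 'p \<Rightarrow> real) \<Rightarrow> bool" where
  "Gromov_hyperbolic_on P d \<longleftrightarrow>
     (\<exists>\<delta>\<ge>0. \<forall>x\<in>P. \<forall>y\<in>P. \<forall>z\<in>P. \<forall>w\<in>P.
        d x z + d y w \<le> max (d x y + d z w) (d y z + d x w) + 2 * \<delta>)"

definition hyperbolic_group :: "('g, 'm) monoid_scheme \<Rightarrow> bool" where
  "hyperbolic_group G \<longleftrightarrow> group G \<and>
     (\<exists>S. finite S \<and> S \<subseteq> carrier G \<and> generate G S = carrier G \<and>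
        Gromov_hyperbolic_on (carrier G) (word_dist G S))"

end

theory Submission
 imports Defs "HOL-Real_Asymp.Real_Asymp" "HOL-Homology.Homology"
begin

text \<open>Write \<open>V\<close> for the vertex set of \<open>\<Gamma>\<close>. The space \<open>X\<close> is obtained by reflecting the chamber
 \<open>P = {f : V \<rightarrow> [0,1]. supp f \<in> \<Gamma>}\<close> in its mirrors \<open>f v = 1\<close>, the sign of the reflection in \<open>f v = 1\<close>
 depending on the colour of \<open>v\<close> only.

 Fundamental group: crossing mirrors identifies the group with the words of even colour parities in the
 right-angled Coxeter group of the 1-skeleton of \<open>\<Gamma>\<close>; injectivity is the homotopy invariance of the word of
 mirrors crossed. As \<open>\<Gamma>\<close> has no empty square, word intervals are thin, and Coxeter medians make them guessed
 geodesics, so the four-point condition holds.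

 Manifold: the link of the centre of \<open>P\<close> is \<open>\<Gamma>\<close> itself, which is only known to be a topological sphere. To avoid
 Moise's theorem, fix a vertex \<open>v0\<close>. By Brown's argument the complement of the open star of \<open>v0\<close> in \<open>|\<Gamma>|\<close> is a
 cone over the link of \<open>v0\<close>, rel boundary. Hence \<open>P\<close> is homeomorphic, respecting mirrors, to the polyhedron
 \<open>P'\<close> given by \<open>f w \<le> 1\<close> for \<open>w \<noteq> v0\<close> and \<open>f v0 + 1/2 \<le> (\<Sum>w\<noteq>v0. f w)\<close>, which avoids the centre.
 The reflected polyhedron \<open>X'\<close> is a slice of a cone of non-negative functions; its tangent cones are products of
 lines with tangent cones of \<open>\<Gamma>\<close>, so only the PL links of vertices of \<open>\<Gamma>\<close> matter for its triangulation.\<close>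

text \<open>PL topology is linearised here. A complex is replaced by the cone of non-negative
  functions supported on its simplices, and a subdivision by a linear bijection of such cones (a
  \<open>fan\<close>). Common refinements and the triangulation of \<open>X'\<close> then come from
  one construction, \<open>barycentric_fan\<close>, which wants a cone cut out by linear equations
  and support conditions. The mirror of the colour of \<open>v0\<close>, a minimum of two distances,
  is therefore encoded by complementary slack coordinates. No homeomorphism between the two
  reflected spaces is written down: both chambers are images of the compact product of
  \<open>D\<close> and [0,1] under maps with equal fibres and corresponding mirrors. The 1/2 in
  \<open>P'\<close> could be any number strictly between 0 and 1: positive, to stay off the centre;
  below 1, to keep the new face off the mirrors where \<open>f v0\<close> = 0. On the group side,
  Coxeter intervals are not geodesics for generators of the subgroup, so the hyperbolicity criterion
  asks only for sets that are coarsely thin; the absence of empty squares enters in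
  \<open>thin_intervals\<close> alone.\<close>

notation iff (infixr "<->" 25)

section \<open>Geometric group theory: hyperbolicity of even-colour subgroups of right-angled
  Coxeter groups\<close>

section \<open>Hyperbolicity from guessed geodesics\<close>

text \<open>Akin to the guessing-geodesics criteria of Masur-Schleimer and Bowditch. Instead of
  connectedness of the sets \<open>L x y\<close>, \<open>centre\<close> is assumed: a point common
  to three guesses measures a Gromov product.\<close>

locale guessed_geodesics =
 fixes Z :: "'z set" and \<rho> :: "'z => 'z => nat" and L :: "'z => 'z => 'z set" and \<delta> :: nat
 assumes refl: "x : Z ==> \<rho> x x = 0"
  and sym: "[|x : Z; y : Z|] ==> \<rho> x y = \<rho> y x"
  and tri: "[|x : Z; y : Z; z : Z|] ==> \<rho> x z <= \<rho> x y + \<rho> y z"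
  and geodesic: "[|x : Z; y : Z|] ==> \<exists>p. p 0 = x & p (\<rho> x y) = y & (\<forall>i\<le>\<rho> x y. p i : Z) \<and>
    (\<forall>i j. i <= j & j <= \<rho> x y --> \<rho> (p i) (p j) = j - i)"
  and L_sub: "[|x : Z; y : Z|] ==> L x y <= Z"
  and thin: "[|x : Z; y : Z; z : Z; u : L x y|] ==> \<exists>u'\<in>L x z Un L z y. \<rho> u u' <= \<delta>"
  and small: "[|x : Z; y : Z; \<rho> x y <= 1; u : L x y|] ==> \<rho> u x <= \<delta>"
  and centre: "[|x : Z; y : Z; w : Z|] ==> L x y Int L x w Int L y w ~= {}"
begin

text \<open>Bisection: \<open>thin\<close> at the midpoint moves \<open>u\<close> by at most
  \<delta> into the guess of one half of the path, so k halvings cost \<delta> each, and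
  \<open>small\<close> ends the descent. The loss is logarithmic in the length.\<close>

lemma near_path:
 assumes "i <= j" "j - i <= 2 ^ k" "\<And>m. [|i <= m; m <= j|] ==> p m : Z"
  and "\<And>m. [|i <= m; m < j|] ==> \<rho> (p m) (p (Suc m)) <= 1" and "u : L (p i) (p j)"
 shows "\<exists>m. i <= m & m <= j & \<rho> u (p m) <= \<delta> * (k + 1)"
 using assms
proof (induction k arbitrary: i j u)
 case 0
 hence "j = i | j = Suc i" by auto
 hence "\<rho> (p i) (p j) <= 1" using 0 refl by auto
 hence "\<rho> u (p i) <= \<delta>" using small 0 by auto
 thus ?case using 0 by auto
next
 case (Suc k)
 define m where "m = i + (j - i) div 2"
 have m: "i <= m" "m <= j" "m - i <= 2 ^ k" "j - m <= 2 ^ k"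
  using Suc.prems(1,2) by (auto simp: m_def)
 have Z: "p i : Z" "p j : Z" "p m : Z" using Suc.prems m by auto
 obtain u' where u': "u' : L (p i) (p m) Un L (p m) (p j)" "\<rho> u u' <= \<delta>"
  using thin[OF Z] Suc.prems(5) by blast
 have uZ: "u : Z" "u' : Z" using L_sub Z u' Suc.prems by blast+
 obtain l where l: "i <= l" "l <= j" "\<rho> u' (p l) <= \<delta> * (k + 1)"
 proof (cases "u' : L (p i) (p m)")
  case True
  hence "\<exists>l. i <= l & l <= m & \<rho> u' (p l) <= \<delta> * (k + 1)"
   using Suc.prems m by (intro Suc.IH) auto
  then obtain l where "i <= l" "l <= m" "\<rho> u' (p l) <= \<delta> * (k + 1)" by blast
  thus ?thesis using that[of l] m by linarith
 next
  case False
  hence "u' : L (p m) (p j)" using u' by auto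
  hence "\<exists>l. m <= l & l <= j & \<rho> u' (p l) <= \<delta> * (k + 1)"
   using Suc.prems m by (intro Suc.IH) auto
  then obtain l where "m <= l" "l <= j" "\<rho> u' (p l) <= \<delta> * (k + 1)" by blast
  thus ?thesis using that[of l] m by linarith
 qed
 have "\<rho> u (p l) <= \<rho> u u' + \<rho> u' (p l)" using tri uZ Suc.prems l by auto
 hence "\<rho> u (p l) <= \<delta> * (Suc k + 1)" using l u' by (simp add: algebra_simps)
 thus ?case using l by blast
qed

definition geod :: "(nat => 'z) => nat => bool" where
 "geod p N <-> (\<forall>i\<le>N. p i : Z) & (\<forall>i j. i <= j & j <= N --> \<rho> (p i) (p j) = j - i)"

definition dist_to :: "(nat => 'z) => nat => 'z => nat" where
 "dist_to p N u = Min ((%m. \<rho> u (p m)) ` {..N})"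

lemma dist_to_le: "m <= N ==> dist_to p N u <= \<rho> u (p m)"
 unfolding dist_to_def by (rule Min_le) auto

lemma dist_to_attained: "\<exists>m\<le>N. \<rho> u (p m) = dist_to p N u"
proof -
 have "dist_to p N u : (%m. \<rho> u (p m)) ` {..N}" unfolding dist_to_def by (rule Min_in) auto
 thus ?thesis by auto
qed

text \<open>The logarithmic bound becomes uniform by an extremal argument: at the worst distance t
  only a window of length 6t of the geodesic matters, and \<delta> times the logarithm of 6t is
  below t for large t.\<close>

lemma guess_near_geodesic:
 obtains D where "\<And>p N u. [|geod p N; u : L (p 0) (p N)|] ==> \<exists>m\<le>N. \<rho> u (p m) <= D"
proof -
 have "eventually (%k::nat. 6 * real \<delta> * (real k + 4) < 2 ^ k) sequentially" by real_asymp
 then obtain k0 where k0: "\<And>k::nat. k \<ge> k0 ==> 6 * real \<delta> * (real k + 4) < 2 ^ k"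
  unfolding eventually_sequentially by blast
 have k0': "6 * \<delta> * (k + 4) < 2 ^ k" if "k \<ge> k0" for k
 proof -
  have "real (6 * \<delta> * (k + 4)) < real (2 ^ k)" using k0[OF that] by (simp add: algebra_simps)
  thus ?thesis by linarith
 qed
 \<comment> \<open>2^k0 makes the exponential estimate available for t > T; 2\<delta> lets t absorb
   the errors of two uses of \<open>thin\<close>.\<close>
 define T where "T = 2 ^ k0 + 2 * \<delta> + 1"
 \<comment> \<open>The least k with 6t \<le> 2^k satisfies 2^(k-1) < 6t, and the choice of
   \<open>k0\<close> turns this into \<delta>(k+3) < t.\<close>
 have key: "\<exists>k. 6 * t <= 2 ^ k & \<delta> * (k + 3) < t" if tT: "t > T" for t
 proof -
  have "\<exists>k. 6 * t <= 2 ^ k" by (meson less_exp less_imp_le)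
  then obtain k where k: "6 * t <= 2 ^ k" "\<forall>l<k. ~ 6 * t <= 2 ^ l"
   using exists_least_iff[of "%k. 6 * t <= 2 ^ k"] by blast
  obtain l where l: "k = Suc l" using k tT T_def by (cases k) auto
  have l2: "2 ^ l < 6 * t" using k l by auto
  have "k0 <= l"
  proof (rule ccontr)
   assume "~ k0 <= l"
   hence "k <= k0" using l by auto
   hence "(2::nat) ^ k <= 2 ^ k0" by simp
   thus False using k(1) tT unfolding T_def by linarith
  qed
  hence "6 * (\<delta> * (l + 4)) < 6 * t" using k0'[of l] l2 by (simp add: mult.assoc)
  thus ?thesis using k l by (intro exI[of _ k]) (auto simp: algebra_simps)
 qed
 have bound: "dist_to p N u <= T" if g: "geod p N" and u: "u : L (p 0) (p N)" for p N u
 proof (rule ccontr)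
  assume neg: "~ dist_to p N u <= T"
  \<comment> \<open>Geodesics of length at most N only: \<open>near_path\<close> bounds their
    distances, so a worst case exists, and subsegments of the worst geodesic still compete.\<close>
  define S where "S = {dist_to q M v |q M v. M <= N & geod q M & v : L (q 0) (q M)}"
  have "s <= \<delta> * (N + 1)" if "s : S" for s
  proof -
   obtain q M v where q: "s = dist_to q M v" "M <= N" "geod q M" "v : L (q 0) (q M)"
    using \<open>s : S\<close> S_def by auto
   have "M <= 2 ^ N" using q(2) by (meson le_trans less_exp less_imp_le)
   hence "\<exists>m. 0 <= m & m <= M & \<rho> v (q m) <= \<delta> * (N + 1)"
    using q by (intro near_path) (auto simp: geod_def)
   thus ?thesis using dist_to_le q by (metis le_trans)
  qed
  hence fin: "finite S" by (meson finite_nat_set_iff_bounded_le)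
  have inS: "dist_to p N u : S" using S_def g u by auto
  define t where "t = Max S"
  have tT: "t > T" using neg inS fin Max_ge t_def by (metis le_trans not_le)
  have "t : S" using Max_in fin inS t_def by blast
  then obtain q M v where q: "t = dist_to q M v" "M <= N" "geod q M" "v : L (q 0) (q M)"
   using S_def by auto
  have qZ: "\<And>i. i <= M ==> q i : Z" and qd: "\<And>i j. [|i <= j; j <= M|] ==> \<rho> (q i) (q j) = j - i"
   using q(3) by (auto simp: geod_def)
  have qd': "\<rho> (q i) (q j) = (if i <= j then j - i else i - j)" if "i <= M" "j <= M" for i j
   using that qd sym qZ by (metis nat_le_linear)
  have vZ: "v : Z" using L_sub q qZ by blast
  have far: "t <= \<rho> v (q m)" if "m <= M" for m using dist_to_le that q by auto
  have sub: "dist_to r K s <= t" if "K <= N" "geod r K" "s : L (r 0) (r K)" for r K s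
   using Max_ge fin t_def S_def that by blast
  obtain m0 where m0: "m0 <= M" "\<rho> v (q m0) = t" using dist_to_attained q by metis
  \<comment> \<open>Truncated subtraction and \<open>min\<close> clip the window to the geodesic. A
    clipped end leaves a degenerate guess from a point to itself, which \<open>small\<close>
    controls.\<close>
  define i where "i = m0 - 3 * t"
  define j where "j = min M (m0 + 3 * t)"
  have ij: "i <= j" "j <= M" "i <= M" "i <= m0" "m0 <= j" using m0 by (auto simp: i_def j_def)
  obtain v1 where v1: "v1 : L (q 0) (q i) Un L (q i) (q M)" "\<rho> v v1 <= \<delta>"
   using thin[of "q 0" "q M" "q i" v] q qZ ij by auto
  have v1Z: "v1 : Z" using L_sub qZ v1 ij by blast
  show False
  proof (cases "v1 : L (q 0) (q i)")
   case True
   have "dist_to q i v1 <= t" using sub True q ij by (auto simp: geod_def)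
   then obtain m where m: "m <= i" "\<rho> v1 (q m) <= t" using dist_to_attained by metis
   have vm: "\<rho> v (q m) <= t + \<delta>" using tri[of v v1 "q m"] v1Z vZ qZ m ij v1 by auto
   have "\<rho> (q m) (q m0) <= \<rho> v (q m) + \<rho> v (q m0)"
    using tri[of "q m" v "q m0"] sym[of v "q m"] vZ qZ m m0 ij by auto
   hence "m0 - m <= 2 * t + \<delta>" using vm m0 qd'[of m m0] m ij by auto
   \<comment> \<open>\<open>m\<close> \<le> \<open>i\<close> together with \<open>m0 - m\<close> <
     3t is possible only if the window was clipped at 0.\<close>
   hence "i = 0" using m tT T_def i_def by auto
   hence "\<rho> v1 (q 0) <= \<delta>" using small[of "q 0" "q 0" v1] True qZ refl by auto
   hence "\<rho> v (q 0) <= 2 * \<delta>" using tri[of v v1 "q 0"] v1Z vZ qZ v1 by auto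
   thus False using far[of 0] tT T_def by auto
  next
   case False
   hence "v1 : L (q i) (q M)" using v1 by auto
   then obtain v2 where v2: "v2 : L (q i) (q j) Un L (q j) (q M)" "\<rho> v1 v2 <= \<delta>"
    using thin[of "q i" "q M" "q j" v1] qZ ij by auto
   have v2Z: "v2 : Z" using L_sub qZ v2 ij by blast
   have vv2: "\<rho> v v2 <= 2 * \<delta>" using tri[of v v1 v2] v1Z vZ v2Z v1 v2 by auto
   show False
   proof (cases "v2 : L (q i) (q j)")
    case True
    obtain k where k: "6 * t <= 2 ^ k" "\<delta> * (k + 3) < t" using key tT by blast
    have "j - i <= 2 ^ k" using k(1) by (auto simp: i_def j_def)
    hence "\<exists>m. i <= m & m <= j & \<rho> v2 (q m) <= \<delta> * (k + 1)"
     using True qZ qd ij by (intro near_path) auto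
    then obtain m where m: "m <= j" "\<rho> v2 (q m) <= \<delta> * (k + 1)" by auto
    have "\<rho> v (q m) <= \<delta> * (k + 3)"
     using tri[of v v2 "q m"] v2Z vZ qZ m ij vv2 by (simp add: algebra_simps)
    thus False using far[of m] m ij k by auto
   next
    case False
    hence v2L: "v2 : L (q j) (q M)" using v2 by auto
    define r where "r = (%k. q (j + k))"
    have "geod r (M - j)" using qZ qd ij by (auto simp: geod_def r_def)
    moreover have "v2 : L (r 0) (r (M - j))" using v2L ij by (simp add: r_def)
    ultimately have "dist_to r (M - j) v2 <= t" using sub q by (meson diff_le_self le_trans)
    then obtain k where k: "k <= M - j" "\<rho> v2 (r k) <= t" using dist_to_attained by metis
    define m where "m = j + k"
    have m: "j <= m" "m <= M" "\<rho> v2 (q m) <= t" using k ij by (auto simp: m_def r_def)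
    have vm: "\<rho> v (q m) <= t + 2 * \<delta>" using tri[of v v2 "q m"] v2Z vZ qZ m vv2 by auto
    have "\<rho> (q m0) (q m) <= \<rho> v (q m) + \<rho> v (q m0)"
     using tri[of "q m0" v "q m"] sym[of v "q m0"] vZ qZ m m0 ij by auto
    hence "m - m0 <= 2 * t + 2 * \<delta>" using vm m0 qd'[of m0 m] m ij by auto
    hence "j = M" using m tT T_def j_def by auto
    hence "\<rho> v2 (q M) <= \<delta>" using small[of "q M" "q M" v2] v2L qZ refl by auto
    hence "\<rho> v (q M) <= 3 * \<delta>" using tri[of v v2 "q M"] v2Z vZ qZ vv2 by auto
    moreover obtain k where "\<delta> * (k + 3) < t" using key[OF tT] by blast
    moreover have "3 * \<delta> <= \<delta> * (k + 3)" by (simp add: algebra_simps)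
    ultimately show False using far[of M] by linarith
   qed
  qed
 qed
 show thesis
 proof (rule that)
  fix p N u
  assume "geod p N" "u : L (p 0) (p N)"
  thus "\<exists>m\<le>N. \<rho> u (p m) <= T" using bound dist_to_attained by metis
 qed
qed

text \<open>Up to constants, the Gromov product of x and y at w is the distance from w to
  \<open>L x y\<close>: \<open>lower\<close> holds for every point of the guess,
  \<open>upper\<close> for the one given by \<open>centre\<close>. Thinness then compares the
  products.\<close>

theorem Gromov_hyperbolic: "Gromov_hyperbolic_on Z (%x y. real (\<rho> x y))"
proof -
 obtain D where D: "\<And>p N u. [|geod p N; u : L (p 0) (p N)|] ==> \<exists>m\<le>N. \<rho> u (p m) <= D"
  using guess_near_geodesic by blast
 have near: "\<rho> x u + \<rho> u y <= \<rho> x y + 2 * D" if "x : Z" "y : Z" "u : L x y" for x y u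
 proof -
  obtain p where p: "p 0 = x" "p (\<rho> x y) = y" "geod p (\<rho> x y)"
   using geodesic \<open>x : Z\<close> \<open>y : Z\<close> unfolding geod_def by blast
  then obtain m where m: "m <= \<rho> x y" "\<rho> u (p m) <= D" using D[of p "\<rho> x y" u] \<open>u : L x y\<close> by auto
  have Z: "u : Z" "p m : Z" using L_sub that p m by (auto simp: geod_def)
  have "\<rho> (p 0) (p m) = m - 0" "\<rho> (p m) (p (\<rho> x y)) = \<rho> x y - m" using p(3) m unfolding geod_def by blast+
  hence "\<rho> x (p m) + \<rho> (p m) y = \<rho> x y" using p m by simp
  moreover have "\<rho> x u <= \<rho> x (p m) + \<rho> u (p m)" using tri[of x "p m" u] sym Z that by auto
  moreover have "\<rho> u y <= \<rho> u (p m) + \<rho> (p m) y" using tri[of u "p m" y] Z that by auto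
  ultimately show ?thesis using m by auto
 qed
 have lower: "\<rho> w x + \<rho> w y <= \<rho> x y + 2 * \<rho> w u + 2 * D"
  if "x : Z" "y : Z" "w : Z" "u : L x y" for x y w u
 proof -
  have Z: "u : Z" using L_sub that by auto
  show ?thesis using near[OF that(1,2,4)] tri[of w u x] tri[of w u y] sym[of u x] Z that by auto
 qed
 have upper: "\<exists>u\<in>L x y. 2 * \<rho> w u + \<rho> x y <= \<rho> w x + \<rho> w y + 4 * D"
  if "x : Z" "y : Z" "w : Z" for x y w
 proof -
  obtain u where u: "u : L x y" "u : L x w" "u : L y w" using centre \<open>x : Z\<close> \<open>y : Z\<close> \<open>w : Z\<close> by blast
  have Z: "u : Z" using L_sub u that by auto
  have "\<rho> x u + \<rho> u w <= \<rho> x w + 2 * D" "\<rho> y u + \<rho> u w <= \<rho> y w + 2 * D"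
   using near u that by auto
  moreover have "\<rho> x y <= \<rho> x u + \<rho> y u" using tri[of x u y] sym[of u y] Z that by auto
  ultimately have "2 * \<rho> w u + \<rho> x y <= \<rho> w x + \<rho> w y + 4 * D"
   using sym[of x w] sym[of y w] sym[of u w] Z that by auto
  thus ?thesis using u by blast
 qed
 \<comment> \<open>6D is 4D from \<open>upper\<close> plus 2D from \<open>lower\<close>, and passing
   from \<open>u\<close> to \<open>u'\<close> costs 2\<delta>.\<close>
 have *: "\<rho> x z + \<rho> y w <= max (\<rho> x y + \<rho> z w) (\<rho> y z + \<rho> x w) + 2 * (3 * D + \<delta>)"
  if Z: "x : Z" "y : Z" "z : Z" "w : Z" for x y z w
 proof -
  obtain u where u: "u : L x z" "2 * \<rho> w u + \<rho> x z <= \<rho> w x + \<rho> w z + 4 * D"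
   using upper[of x z w] Z by auto
  obtain u' where u': "u' : L x y Un L y z" "\<rho> u u' <= \<delta>" using thin[of x z y u] u Z by auto
  have "u : Z" "u' : Z" using L_sub u u' Z by blast+
  hence wu: "\<rho> w u' <= \<rho> w u + \<delta>" using tri[of w u u'] Z u' by auto
  have "\<rho> w x + \<rho> w y <= \<rho> x y + 2 * \<rho> w u' + 2 * D | \<rho> w y + \<rho> w z <= \<rho> y z + 2 * \<rho> w u' + 2 * D"
   using lower[of x y w u'] lower[of y z w u'] u' Z by auto
  thus ?thesis using u(2) wu sym[of w x] sym[of w y] sym[of w z] Z by auto
 qed
 show ?thesis
  unfolding Gromov_hyperbolic_on_def
 proof (intro exI[of _ "real (3 * D + \<delta>)"] conjI ballI)
  fix x y z w assume "x : Z" "y : Z" "z : Z" "w : Z"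
  hence "real (\<rho> x z + \<rho> y w) <= real (max (\<rho> x y + \<rho> z w) (\<rho> y z + \<rho> x w) + 2 * (3 * D + \<delta>))"
   using * by (intro of_nat_mono) auto
  thus "real (\<rho> x z) + real (\<rho> y w)
    <= max (real (\<rho> x y) + real (\<rho> z w)) (real (\<rho> y z) + real (\<rho> x w)) + 2 * real (3 * D + \<delta>)"
   by (simp add: of_nat_max)
 qed simp
qed

end

section \<open>Words in right-angled Coxeter groups\<close>

locale racg =
 fixes adj :: "'b => 'b => bool"
 assumes adj_sym: "adj s t ==> adj t s" and adj_irrefl: "~ adj s s"
begin

lemma adj_commute: "adj s t <-> adj t s"
 using adj_sym by blast

text \<open>Some occurrence of \<open>s\<close> can be exchanged to the front, all letters before it
  commuting with \<open>s\<close>.\<close>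

primrec init :: "'b => 'b list => bool" where
 "init s [] <-> False"
| "init s (x # w) <-> x = s | (adj s x & init s w)"

primrec red :: "'b list => bool" where
 "red [] <-> True"
| "red (s # w) <-> ~ init s w & red w"

text \<open>Left multiplication by a generator on reduced words: an \<open>s\<close> that can be
  moved to the front cancels.\<close>

definition push :: "'b => 'b list => 'b list" where
 "push s w = (if init s w then remove1 s w else s # w)"

text \<open>The projections of a word to all pairs of non-commuting letters determine the word up to
 exchanges of neighbouring commuting letters.\<close>

definition tr :: "'b list => 'b => 'b => 'b list" where
 "tr w a b = (if adj a b then [] else filter (%x. x = a | x = b) w)"

definition norm :: "'b list => 'b list" where
 "norm u = foldr push u []"

text \<open>Equality in the Coxeter group, decided by reduced forms up to commutation; no
  presentation or quotient type appears.\<close>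

definition weq :: "'b list => 'b list => bool" where
 "weq u v <-> tr (norm u) = tr (norm v)"

definition wlen :: "'b list => nat" where
 "wlen u = length (norm u)"

lemma init_in_set: "init s w ==> s : set w"
 by (induction w) auto

text \<open>Makes \<open>init\<close> a property of the commutation class: it is read off the
  projections, so the operations built on it respect exchanges of commuting letters.\<close>

lemma init_iff_tr: "init s w <-> (\<forall>t. ~ adj s t --> tr w s t ~= [] & hd (tr w s t) = s)"
proof (induction w)
 case Nil
 thus ?case using adj_irrefl by (auto simp: tr_def)
next
 case (Cons x w)
 consider "x = s" | "x ~= s" "adj s x" | "x ~= s" "~ adj s x" by blast
 thus ?case
 proof cases
  case 2
  hence "tr (x # w) s t = tr w s t" if "~ adj s t" for t
   using that by (auto simp: tr_def)
  thus ?thesis using Cons 2 by auto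
 next
  case 3
  hence "hd (tr (x # w) s x) = x" by (simp add: tr_def)
  thus ?thesis using 3 by auto
 qed (auto simp: tr_def)
qed

lemma length_remove1_less: "s : set w ==> length (remove1 s w) < length w"
 by (induction w) auto

lemma tr_Cons: "tr (s # w) a b = (if ~ adj a b & (a = s | b = s) then s # tr w a b else tr w a b)"
 by (auto simp: tr_def)

lemma tr_Cons_cong: "tr w = tr w' ==> tr (s # w) = tr (s # w')"
 by (intro ext) (simp add: tr_Cons)

lemma tr_sym: "tr w a b = tr w b a"
 using adj_commute[of a b] by (auto simp: tr_def intro!: filter_cong)

lemma tr_remove1:
 assumes "init s w"
 shows "tr (remove1 s w) a b = (if ~ adj a b & (a = s | b = s) then tl (tr w a b) else tr w a b)"
proof (cases "~ adj a b & (a = s | b = s)")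
 case True
 have "~ adj s b ==> remove1 s (tr w s b) = tl (tr w s b)" for b
  using assms init_iff_tr[of s w] by (metis list.exhaust_sel remove1.simps(2))
 hence "remove1 s (tr w a b) = tl (tr w a b)" using True adj_sym tr_sym by metis
 thus ?thesis using True by (simp add: tr_def filter_remove1)
next
 case False
 thus ?thesis by (auto simp: tr_def filter_remove1 remove1_idem)
qed

lemma init_cong: "tr w = tr w' ==> init s w = init s w'"
 by (simp add: init_iff_tr)

lemma push_cong: "tr w = tr w' ==> tr (push s w) = tr (push s w')"
 by (intro ext) (use init_cong[of w w' s] in \<open>auto simp: push_def tr_remove1 tr_Cons\<close>)

lemma init_remove1_adj: "adj s x ==> init x (remove1 s w) = init x w"
 by (induction w) (auto simp: adj_irrefl adj_commute)

lemma red_remove1: "[|red w; init s w|] ==> red (remove1 s w)"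
 by (induction w) (auto simp: init_remove1_adj)

lemma red_push: "red w ==> red (push s w)"
 by (auto simp: push_def red_remove1)

lemma not_init_remove1: "[|red w; init s w|] ==> ~ init s (remove1 s w)"
 by (induction w) auto

lemma tr_Cons_remove1:
 assumes "init s w" shows "tr (s # remove1 s w) = tr w"
proof (intro ext)
 fix a b
 have "~ adj s b ==> s # tl (tr w s b) = tr w s b" for b
  using assms init_iff_tr[of s w] by (metis list.exhaust_sel)
 hence "~ adj a b & (a = s | b = s) ==> s # tl (tr w a b) = tr w a b"
  using adj_sym tr_sym by metis
 thus "tr (s # remove1 s w) a b = tr w a b"
  using assms by (auto simp: tr_Cons tr_remove1)
qed

lemma push_push: "red w ==> tr (push s (push s w)) = tr w"
 using not_init_remove1[of w s] tr_Cons_remove1[of s w] by (auto simp: push_def)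

lemma push_commute:
 assumes "adj s t" shows "tr (push s (push t w)) = tr (push t (push s w))"
proof -
 have "s ~= t" using assms adj_irrefl by auto
 have "adj t s" using assms adj_sym by auto
 have 1: "init s (push t w) = init s w" "init t (push s w) = init t w"
  using assms \<open>adj t s\<close> \<open>s ~= t\<close> by (auto simp: push_def init_remove1_adj)
 have "tr (s # t # w) = tr (t # s # w)" for w
  by (intro ext) (use \<open>s ~= t\<close> assms \<open>adj t s\<close> in \<open>auto simp: tr_Cons\<close>)
 thus ?thesis using 1 \<open>s ~= t\<close> by (auto simp: push_def remove1_commute)
qed

lemma foldr_push_cong: "tr w = tr w' ==> tr (foldr push u w) = tr (foldr push u w')"
 by (induction u) (auto intro: push_cong)

lemma red_foldr_push: "red w ==> red (foldr push u w)"
 by (induction u) (auto intro: red_push)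

lemma red_norm: "red (norm u)"
 unfolding norm_def by (rule red_foldr_push) simp

lemma foldr_push_init:
 assumes "init s u"
 shows "tr (foldr push u w) = tr (push s (foldr push (remove1 s u) w))"
 using assms
proof (induction u)
 case (Cons x u)
 show ?case
 proof (cases "x = s")
  case False
  hence x: "adj s x" "init s u" using Cons by auto
  have "tr (push x (foldr push u w)) = tr (push x (push s (foldr push (remove1 s u) w)))"
   using Cons x by (intro push_cong) auto
  also have "\<dots> = tr (push s (push x (foldr push (remove1 s u) w)))"
   using push_commute[OF adj_sym[OF x(1)]] .
  finally show ?thesis using False by simp
 qed simp
qed simp

lemma tr_eq_Nil: "tr [] = tr w ==> w = []"
proof (cases w)
 case (Cons x v)
 assume "tr [] = tr w"
 hence "tr [] x x = tr w x x" by simp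
 thus ?thesis using Cons adj_irrefl by (auto simp: tr_def)
qed

text \<open>Words act on reduced words through \<open>push\<close>. An initial letter may be
  performed last (\<open>foldr_push_init\<close>), so words that agree up to commutation act
  alike.\<close>

lemma foldr_push_tr:
 assumes "red w" "tr u = tr u'"
 shows "tr (foldr push u w) = tr (foldr push u' w)"
 using assms(2)
proof (induction u arbitrary: u')
 case Nil
 hence "u' = []" by (rule tr_eq_Nil)
 thus ?case by simp
next
 case (Cons s u)
 have s: "init s u'" using init_cong[OF Cons.prems, of s] by simp
 have "tr u = tr (remove1 s u')"
 proof (intro ext)
  fix a b
  show "tr u a b = tr (remove1 s u') a b"
   using fun_cong[OF fun_cong[OF Cons.prems[symmetric]], of a b] s
   by (auto simp: tr_remove1 tr_Cons)
 qed
 hence "tr (push s (foldr push u w)) = tr (push s (foldr push (remove1 s u') w))"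
  using Cons.IH push_cong by blast
 thus ?case using foldr_push_init[OF s] by simp
qed

text \<open>Van der Waerden's method: the group is realised by its action on reduced words. Since
  reduction leaves the action unchanged, \<open>weq\<close> is compatible with concatenation
  (\<open>weq_append\<close>).\<close>

lemma foldr_push_norm:
 assumes "red w" shows "tr (foldr push (norm u) w) = tr (foldr push u w)"
proof (induction u)
 case (Cons s u)
 show ?case
 proof (cases "init s (norm u)")
  case True
  have "tr (foldr push (norm (s # u)) w) = tr (foldr push (remove1 s (norm u)) w)"
   using True by (simp add: norm_def push_def)
  also have "\<dots> = tr (push s (push s (foldr push (remove1 s (norm u)) w)))"
   using push_push red_foldr_push[OF assms] by simp
  also have "\<dots> = tr (push s (foldr push (norm u) w))"
   using foldr_push_init[OF True] push_cong by metis
  also have "\<dots> = tr (push s (foldr push u w))" using Cons push_cong by blast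
  finally show ?thesis by simp
 next
  case False
  hence "tr (foldr push (norm (s # u)) w) = tr (push s (foldr push (norm u) w))"
   by (simp add: norm_def push_def)
  thus ?thesis using push_cong[OF Cons, of s] by simp
 qed
qed (simp add: norm_def)

lemma norm_append: "norm (u @ v) = foldr push u (norm v)"
 by (simp add: norm_def)

lemma weq_refl [simp]: "weq u u" by (simp add: weq_def)
lemma weq_sym: "weq u v ==> weq v u" by (simp add: weq_def)
lemma weq_trans [trans]: "weq u v ==> weq v w ==> weq u w" by (simp add: weq_def)

lemma weq_append:
 assumes "weq u u'" "weq v v'" shows "weq (u @ v) (u' @ v')"
proof -
 have "tr (foldr push u (norm v)) = tr (foldr push (norm u) (norm v))"
  by (rule foldr_push_norm[OF red_norm, symmetric])
 also have "\<dots> = tr (foldr push (norm u') (norm v))"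
  using assms(1) by (intro foldr_push_tr[OF red_norm]) (simp add: weq_def)
 also have "\<dots> = tr (foldr push u' (norm v))" by (rule foldr_push_norm[OF red_norm])
 also have "\<dots> = tr (foldr push u' (norm v'))"
  using assms(2) by (intro foldr_push_cong) (simp add: weq_def)
 finally show ?thesis by (simp add: weq_def norm_append)
qed

lemma tr_norm_red: "red w ==> tr (norm w) = tr w"
proof (induction w)
 case (Cons s w)
 hence "tr (norm w) = tr w" "~ init s w" by auto
 hence "~ init s (norm w)" using init_cong by blast
 hence "norm (s # w) = s # norm w" by (simp add: norm_def push_def)
 thus ?case using \<open>tr (norm w) = tr w\<close> by (intro ext) (simp add: tr_Cons)
qed (simp add: norm_def)

lemma weq_norm: "weq (norm u) u"
 by (simp add: weq_def tr_norm_red red_norm)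

lemma tr_imp_weq: "[|red u; red v; tr u = tr v|] ==> weq u v"
 by (simp add: weq_def tr_norm_red)

lemma weq_cancel: "weq (s # s # u) u"
 using push_push[OF red_norm] by (simp add: weq_def norm_def)

lemma weq_rev_cancel: "weq (rev u @ u) []"
proof (induction u)
 case (Cons s u)
 have "weq (rev u @ (s # s # u)) (rev u @ u)" by (intro weq_append weq_cancel weq_refl)
 thus ?case using Cons weq_trans by auto
qed simp

lemma weq_rev_cancel': "weq (u @ rev u) []"
 using weq_rev_cancel[of "rev u"] by simp

lemma weq_rev:
 assumes "weq u v" shows "weq (rev u) (rev v)"
proof -
 have "weq (rev u @ []) (rev u @ (v @ rev v))"
  by (intro weq_append weq_refl weq_sym[OF weq_rev_cancel'])
 also have "weq (rev u @ (v @ rev v)) (rev u @ (u @ rev v))"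
  by (intro weq_append weq_refl weq_sym[OF assms])
 also have "weq (rev u @ (u @ rev v)) ([] @ rev v)"
  unfolding append_assoc[symmetric] by (intro weq_append weq_refl weq_rev_cancel)
 finally show ?thesis by simp
qed

lemma tr_mset:
 assumes "tr u = tr v" shows "mset u = mset v"
proof (rule multiset_eqI)
 fix x
 have "length (tr u x x) = length (tr v x x)" using assms by simp
 moreover have "length (tr w x x) = count (mset w) x" for w
  using adj_irrefl[of x] by (induction w) (auto simp: tr_def)
 ultimately show "count (mset u) x = count (mset v) x" by simp
qed

lemma wlen_cong: "weq u v ==> wlen u = wlen v"
 using tr_mset mset_eq_length by (metis weq_def wlen_def)

lemma wlen_red: "red u ==> wlen u = length u"
 using tr_mset mset_eq_length tr_norm_red by (metis wlen_def)

lemma length_foldr_push: "length (foldr push u w) <= length u + length w"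
proof (induction u)
 case (Cons s u)
 thus ?case by (auto simp: push_def length_remove1)
qed simp

lemma wlen_le: "wlen u <= length u"
 using length_foldr_push[of u "[]"] by (simp add: wlen_def norm_def)

lemma wlen_rev: "wlen (rev u) = wlen u"
proof -
 have *: "wlen (rev u) <= wlen u" for u
 proof -
  have "wlen (rev u) = wlen (rev (norm u))" by (intro wlen_cong weq_rev weq_sym[OF weq_norm])
  also have "\<dots> <= length (rev (norm u))" by (rule wlen_le)
  finally show ?thesis by (simp add: wlen_def)
 qed
 show ?thesis using *[of u] *[of "rev u"] by simp
qed

lemma wlen_append: "wlen (u @ v) <= wlen u + wlen v"
proof -
 have "wlen (u @ v) = wlen (norm u @ norm v)" by (intro wlen_cong weq_append weq_sym[OF weq_norm])
 also have "\<dots> <= length (norm u @ norm v)" by (rule wlen_le)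
 finally show ?thesis by (simp add: wlen_def)
qed

lemma wlen_0: "wlen u = 0 <-> weq u []"
 using tr_eq_Nil[of "norm u"] by (auto simp: wlen_def weq_def norm_def)

lemma set_push: "set (push s w) <= insert s (set w)"
 using set_remove1_subset by (auto simp: push_def)

lemma set_norm: "set (norm u) <= set u"
proof (induction u)
 case (Cons s u)
 thus ?case using set_push[of s "norm u"] by (auto simp: norm_def)
qed (simp add: norm_def)

lemma even_norm: "even (length (filter P (norm u))) <-> even (length (filter P u))"
proof (induction u)
 case (Cons s u)
 have "even (length (filter P (push s w))) <-> even (length (filter P (s # w)))" for w
 proof (cases "init s w")
  case True
  hence "mset w = mset (s # remove1 s w)" using init_in_set by (simp add: mset_remove1)
  hence "mset (filter P w) = mset (filter P (s # remove1 s w))" by (metis mset_filter)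
  hence "length (filter P w) = length (filter P (s # remove1 s w))" using mset_eq_length by blast
  thus ?thesis using True by (auto simp: push_def)
 qed (simp add: push_def)
 thus ?case using Cons by (simp add: norm_def)
qed (simp add: norm_def)

lemma init_append: "init s a ==> init s (a @ b)"
 by (induction a) auto

lemma init_appendD: "init s (a @ b) ==> ~ init s a ==> (\<forall>x\<in>set a. adj s x) & init s b"
 by (induction a) auto

text \<open>A first letter of \<open>b\<close> is initial in \<open>a @ z\<close> but not in
  \<open>a\<close>; hence it commutes with all of \<open>a\<close> and can be removed from
  \<open>z\<close>. Induction on \<open>b\<close>.\<close>

lemma prefixes_commute:
 assumes "tr (a @ z) = tr (b @ z')" "red (a @ z)" "\<And>s. init s a ==> init s b ==> False"
 shows "\<forall>x\<in>set a. \<forall>y\<in>set b. adj y x"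
 using assms
proof (induction b arbitrary: z)
 case (Cons s b)
 have s: "init s (a @ z)" "~ init s a" using init_cong[OF Cons.prems(1), of s] Cons.prems(3) by auto
 hence sa: "\<forall>x\<in>set a. adj s x" "init s z" using init_appendD by blast+
 hence "s \<notin> set a" using adj_irrefl by auto
 hence rem: "remove1 s (a @ z) = a @ remove1 s z" by (simp add: remove1_append)
 have "tr (a @ remove1 s z) = tr (b @ z')"
 proof (intro ext)
  fix p q
  show "tr (a @ remove1 s z) p q = tr (b @ z') p q"
   using fun_cong[OF fun_cong[OF Cons.prems(1)], of p q] tr_remove1[OF s(1), of p q] rem
   by (auto simp: tr_Cons)
 qed
 moreover have "red (a @ remove1 s z)" using red_remove1[OF Cons.prems(2) s(1)] rem by simp
 moreover have "init t a ==> init t b ==> False" for t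
  using Cons.prems(3)[of t] init_in_set sa adj_sym by auto
 ultimately have "\<forall>x\<in>set a. \<forall>y\<in>set b. adj y x" using Cons.IH by blast
 thus ?case using sa by auto
qed simp

text \<open>The letters of \<open>u\<close> are moved in front of \<open>v\<close> one by one; a
  cancellation would need a common initial letter.\<close>

lemma red_rev_append:
 assumes "red u" "red v" "\<And>s. init s u ==> init s v ==> False"
 shows "red (rev u @ v)"
 using assms
proof (induction u arbitrary: v)
 case (Cons s u)
 have "red (rev u @ (s # v))"
 proof (rule Cons.IH)
  show "red u" using Cons.prems by simp
  show "red (s # v)" using Cons.prems by auto
  show "init t u ==> init t (s # v) ==> False" for t
   using Cons.prems(1) Cons.prems(3)[of t] by auto
 qed
 thus ?case by simp
qed simp

text \<open>Greedy removal of common initial letters; \<open>a\<close> is the meet in the weak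
  order.\<close>

lemma meet_exists:
 assumes "red u" "red v"
 obtains a u' v' where "tr u = tr (a @ u')" "tr v = tr (a @ v')" "red (a @ u')" "red (a @ v')"
  "\<And>s. init s u' ==> init s v' ==> False"
proof -
 have "\<exists>a u' v'. tr u = tr (a @ u') & tr v = tr (a @ v') & red (a @ u') & red (a @ v') \<and>
   (\<forall>s. ~ (init s u' & init s v'))"
  using assms
 proof (induction "length u" arbitrary: u v rule: less_induct)
  case less
  show ?case
  proof (cases "\<exists>s. init s u & init s v")
   case True
   then obtain s where s: "init s u" "init s v" by blast
   have "length (remove1 s u) < length u"
    using init_in_set[OF s(1)] by (rule length_remove1_less)
   then obtain a u' v' where IH: "tr (remove1 s u) = tr (a @ u')" "tr (remove1 s v) = tr (a @ v')"
     "red (a @ u')" "red (a @ v')" "\<forall>t. ~ (init t u' & init t v')"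
    using less.hyps[of "remove1 s u" "remove1 s v"] red_remove1 s less.prems by blast
   have "tr u = tr (s # a @ u')" "tr v = tr (s # a @ v')"
    using tr_Cons_remove1[OF s(1)] tr_Cons_remove1[OF s(2)]
     tr_Cons_cong[OF IH(1), of s] tr_Cons_cong[OF IH(2), of s] by simp_all
   moreover have "~ init s (a @ u')" "~ init s (a @ v')"
    using init_cong[OF IH(1), of s] init_cong[OF IH(2), of s]
     not_init_remove1[OF less.prems(1) s(1)] not_init_remove1[OF less.prems(2) s(2)] by blast+
   ultimately show ?thesis using IH by (intro exI[of _ "s # a"] exI[of _ u'] exI[of _ v']) auto
  next
   case False
   thus ?thesis using less.prems
    by (intro exI[of _ "[]"] exI[of _ u] exI[of _ v]) auto
  qed
 qed
 thus thesis using that by blast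
qed

definition wd :: "'b list => 'b list => nat" where
 "wd u v = wlen (rev u @ v)"

definition interval :: "'b list => 'b list => 'b list set" where
 "interval u v = {p. wd u p + wd p v = wd u v}"

lemma wd_sym: "wd u v = wd v u"
 using wlen_rev[of "rev u @ v"] by (simp add: wd_def)

lemma wd_refl [simp]: "wd u u = 0"
 by (simp add: wd_def wlen_0 weq_rev_cancel)

lemma weq_insert: "weq (rev u @ w) (rev u @ v @ rev v @ w)"
proof -
 have "weq (rev u @ [] @ w) (rev u @ (v @ rev v) @ w)"
  by (intro weq_append weq_refl weq_sym[OF weq_rev_cancel'])
 thus ?thesis by simp
qed

lemma wd_tri: "wd u w <= wd u v + wd v w"
 using wlen_cong[OF weq_insert[of u w v]] wlen_append[of "rev u @ v" "rev v @ w"]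
 by (simp add: wd_def)

lemma wd_cong:
 assumes "weq u u'" "weq v v'" shows "wd u v = wd u' v'"
 unfolding wd_def by (intro wlen_cong weq_append weq_rev assms)

lemma wd_translate: "wd (rev p @ u) (rev p @ v) = wd u v"
 using wlen_cong[OF weq_insert[of u v p]] by (simp add: wd_def)

lemma wd_red:
 assumes "red u" "red v" "\<And>s. init s u ==> init s v ==> False"
 shows "wd u v = length u + length v"
 using red_rev_append[OF assms] wlen_red by (simp add: wd_def)

lemma weq_append_cancel: "weq (p @ rev p @ x) x"
 using weq_append[OF weq_rev_cancel'[of p] weq_refl[of x]] by simp

text \<open>With \<open>p\<close> moved to the identity, the longest common prefix of \<open>x\<close> and \<open>z\<close> is the median of
 \<open>p\<close>, \<open>x\<close>, \<open>z\<close>.\<close>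

lemma median_prefix:
 assumes "set p <= V" "set x <= V" "set z <= V"
 obtains a u v where "set a <= V" "red (a @ u)" "red (a @ v)"
  "tr (norm (rev p @ x)) = tr (a @ u)" "tr (norm (rev p @ z)) = tr (a @ v)" "wd p (p @ a) = length a"
  "p @ a : interval p x" "p @ a : interval p z" "p @ a : interval x z"
proof -
 obtain a u v where *: "tr (norm (rev p @ x)) = tr (a @ u)" "tr (norm (rev p @ z)) = tr (a @ v)"
   "red (a @ u)" "red (a @ v)" "\<And>s. init s u ==> init s v ==> False"
  using meet_exists[OF red_norm red_norm] by blast
 have red_drop: "red (b @ w) ==> red w" for b w by (induction b) auto
 have red_take: "red (b @ w) ==> red b" for b w
  by (induction b) (auto dest: init_append)
 have "set (a @ u) <= set (rev p @ x)"
  using tr_mset[OF *(1)] set_norm[of "rev p @ x"] by (metis set_mset_mset)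
 hence aV: "set a <= V" using assms by auto
 have eq: "weq (rev p @ x) (a @ u)" "weq (rev p @ z) (a @ v)"
  using * by (auto simp: weq_def tr_norm_red)
 have xe: "weq (p @ (a @ u)) x" "weq (p @ (a @ v)) z"
  using weq_trans[OF weq_append[OF weq_refl weq_sym[OF eq(1)]] weq_append_cancel]
   weq_trans[OF weq_append[OF weq_refl weq_sym[OF eq(2)]] weq_append_cancel] by blast+
 have trans: "wd (p @ b) (p @ c) = wd b c" for b c
  using wd_translate[of "rev p" b c] by simp
 have px: "wd p (p @ b) = wlen b" for b using trans[of "[]" b] by (simp add: wd_def)
 have ax: "wd (p @ a) x = length u" "wd (p @ a) z = length v"
 proof -
  have "wd (p @ a) x = wd a (a @ u)" using wd_cong[OF weq_refl weq_sym[OF xe(1)]] trans by metis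
  also have "\<dots> = wd [] u" using wd_translate[of "rev a" "[]" u] by simp
  finally show "wd (p @ a) x = length u" using wlen_red red_drop * by (simp add: wd_def)
  have "wd (p @ a) z = wd a (a @ v)" using wd_cong[OF weq_refl weq_sym[OF xe(2)]] trans by metis
  also have "\<dots> = wd [] v" using wd_translate[of "rev a" "[]" v] by simp
  finally show "wd (p @ a) z = length v" using wlen_red red_drop * by (simp add: wd_def)
 qed
 have pa: "wd p (p @ a) = length a" using px wlen_red red_take * by simp
 have pp: "wd p x = length a + length u" "wd p z = length a + length v"
  using wd_cong[OF weq_refl weq_sym[OF xe(1)], of p] wd_cong[OF weq_refl weq_sym[OF xe(2)], of p]
   px wlen_red * by (simp_all)
 have "wd x z = wd (a @ u) (a @ v)" using wd_cong[OF weq_sym[OF xe(1)] weq_sym[OF xe(2)]] trans by metis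
 also have "\<dots> = wd u v" using wd_translate[of "rev a" u v] by simp
 also have "\<dots> = length u + length v" using wd_red red_drop * by blast
 finally have xz: "wd x z = length u + length v" .
 show thesis
  using that[OF aV *(3,4,1,2) pa] ax pa pp xz wd_sym[of x "p @ a"]
  by (simp add: interval_def)
qed

text \<open>In a reduced word whose letters commute pairwise no letter repeats, so its length is at
  most the number of letters.\<close>

lemma red_noncommuting:
 assumes "red a" "set a <= V" "finite V" "length a > card V"
 shows "\<exists>x\<in>set a. \<exists>y\<in>set a. x ~= y & ~ adj x y"
proof (rule ccontr)
 assume "~ ?thesis"
 hence c: "\<And>x y. x : set a ==> y : set a ==> x ~= y ==> adj x y" by blast
 have i: "s : set w ==> (\<And>x. x : set w ==> x ~= s ==> adj s x) ==> init s w" for s w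
  by (induction w) auto
 have "distinct a" using assms(1) c
 proof (induction a)
  case (Cons s w)
  have "s \<notin> set w"
  proof
   assume "s : set w"
   hence "init s w" using Cons.prems(2) by (intro i) auto
   thus False using Cons.prems by auto
  qed
  thus ?case using Cons by auto
 qed simp
 hence "length a = card (set a)" by (simp add: distinct_card)
 also have "\<dots> <= card V" using assms card_mono by blast
 finally show False using assms by simp
qed

text \<open>The medians of p, x, z and of p, y, z leave p along prefixes a and b of the reduced word
  from p to z. They share no first letter because p lies between x and y, so they commute
  letterwise. If both were longer than \<open>card V\<close>, each would contain two non-commuting
  letters, and these four would form an empty square.\<close>

lemma thin_intervals:
 assumes V: "finite V" "set p <= V" "set x <= V" "set y <= V" "set z <= V" and p: "p : interval x y"
  and no_square: "\<And>a b c d. [|adj a b; adj b c; adj c d; adj d a; a ~= c; b ~= d|] ==> adj a c | adj b d"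
 shows "\<exists>q\<in>interval x z Un interval z y. set q <= V & wd p q <= card V"
proof -
 obtain a u v where A: "set a <= V" "red (a @ u)" "red (a @ v)" "tr (norm (rev p @ x)) = tr (a @ u)"
   "tr (norm (rev p @ z)) = tr (a @ v)" "wd p (p @ a) = length a" "p @ a : interval x z"
  using median_prefix[of p V x z] V by metis
 obtain b u' v' where B: "set b <= V" "red (b @ u')" "red (b @ v')" "tr (norm (rev p @ y)) = tr (b @ u')"
   "tr (norm (rev p @ z)) = tr (b @ v')" "wd p (p @ b) = length b" "p @ b : interval y z"
  using median_prefix[of p V y z] V by metis
 have red_take: "red (b @ w) ==> red b" for b w
  by (induction b) (auto dest: init_append)
 have disj: False if "init s a" "init s b" for s
 proof -
  have "init s (norm (rev p @ x))" "init s (norm (rev p @ y))"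
   using that init_append init_cong A(4) B(4) by blast+
  moreover define X Y where "X = norm (rev p @ x)" and "Y = norm (rev p @ y)"
  ultimately have i: "init s X" "init s Y" by auto
  \<comment> \<open>A common first letter can be deleted from both words, which gives a shorter way
    from x to y than through p.\<close>
  have "wd x y = wd X Y"
   using wd_translate[of p x y] wd_cong[OF weq_norm weq_norm] X_def Y_def by metis
  also have "\<dots> = wd (s # remove1 s X) (s # remove1 s Y)"
  proof (rule wd_cong)
   have "red (s # remove1 s W)" if "red W" "init s W" for W
    using that not_init_remove1 red_remove1 by auto
   thus "weq X (s # remove1 s X)" "weq Y (s # remove1 s Y)"
    using i red_norm X_def Y_def tr_Cons_remove1 by (auto intro!: tr_imp_weq)
  qed
  also have "\<dots> = wd (remove1 s X) (remove1 s Y)" using wd_translate[of "[s]"] by simp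
  also have "\<dots> <= length (remove1 s X) + length (remove1 s Y)"
   unfolding wd_def using wlen_le[of "rev (remove1 s X) @ remove1 s Y"] by simp
  also have "\<dots> < length X + length Y"
   using i[THEN init_in_set, THEN length_remove1_less] by linarith
  also have "length X + length Y = wd x p + wd p y"
   using wd_sym[of x p] by (simp add: X_def Y_def wd_def wlen_def)
  finally show False using p by (simp add: interval_def)
 qed
 have "\<forall>x\<in>set a. \<forall>y\<in>set b. adj y x"
  using prefixes_commute[of a v b v'] A(3,5) B(5) disj by metis
 hence comm: "\<And>s t. s : set a ==> t : set b ==> adj s t" using adj_sym by blast
 have "length a <= card V | length b <= card V"
 proof (rule ccontr)
  assume "~ ?thesis"
  then obtain s s' t t' where st: "s : set a" "s' : set a" "s ~= s'" "~ adj s s'"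
    "t : set b" "t' : set b" "t ~= t'" "~ adj t t'"
   using red_noncommuting A B V(1) red_take by (metis not_le)
  thus False using no_square[of s t s' t'] comm adj_sym by blast
 qed
 moreover have "p @ b : interval z y" using B(7) wd_sym by (simp add: interval_def add.commute)
 ultimately show ?thesis using A B V by (metis Un_iff set_append Un_least)
qed

lemma median_exists:
 assumes "set p <= V" "set x <= V" "set z <= V"
 shows "\<exists>m. set m <= V & m : interval p x & m : interval p z & m : interval x z"
 using median_prefix[OF assms] assms(1) by (metis Un_least set_append)

end

section \<open>Word metrics\<close>

lemma (in group) foldr_mult_append:
 assumes "set u <= carrier G" "set v <= carrier G"
 shows "foldr (\<otimes>) (u @ v) \<one> = foldr (\<otimes>) u \<one> \<otimes> foldr (\<otimes>) v \<one>"
proof -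
 have c: "set w <= carrier G ==> foldr (\<otimes>) w \<one> : carrier G" for w by (induction w) auto
 show ?thesis using assms by (induction u) (auto simp: c m_assoc)
qed

lemma (in group) foldr_mult_closed: "set w <= carrier G ==> foldr (\<otimes>) w \<one> : carrier G"
 by (induction w) auto

locale generated_group = group G for G (structure) +
 fixes S
 assumes S_sub: "S <= carrier G" and S_inv: "\<And>s. s : S ==> inv s : S"
  and S_gen: "generate G S = carrier G"
begin

lemma S_sym: "S Un m_inv G ` S = S"
 using S_inv by auto

lemma word_exists:
 assumes "g : carrier G" shows "\<exists>ws. set ws <= S & foldr (\<otimes>) ws \<one> = g"
proof -
 have "g : generate G S" using assms S_gen by simp
 thus ?thesis
 proof (induction rule: generate.induct)
  case one
  show ?case by (intro exI[of _ "[]"]) auto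
 next
  case (incl h)
  thus ?case using S_sub by (intro exI[of _ "[h]"]) auto
 next
  case (inv h)
  thus ?case using S_sub S_inv by (intro exI[of _ "[inv h]"]) auto
 next
  case (eng h1 h2)
  then obtain u v where "set u <= S" "foldr (\<otimes>) u \<one> = h1" "set v <= S" "foldr (\<otimes>) v \<one> = h2" by blast
  thus ?case using S_sub foldr_mult_append[of u v] by (intro exI[of _ "u @ v"]) auto
 qed
qed

lemma word_length_def': "word_length G S g = (LEAST k. \<exists>ws. length ws = k & set ws <= S & foldr (\<otimes>) ws \<one> = g)"
 by (simp add: word_length_def S_sym)

lemma word_length_attained:
 assumes "g : carrier G"
 shows "\<exists>ws. length ws = word_length G S g & set ws <= S & foldr (\<otimes>) ws \<one> = g"
proof -
 have "\<exists>k ws. length ws = k & set ws <= S & foldr (\<otimes>) ws \<one> = g" using word_exists[OF assms] by auto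
 thus ?thesis unfolding word_length_def' by (rule LeastI_ex)
qed

lemma word_length_le: "set ws <= S ==> word_length G S (foldr (\<otimes>) ws \<one>) <= length ws"
 unfolding word_length_def' by (rule Least_le) blast

lemma word_length_one: "word_length G S \<one> = 0"
 using word_length_le[of "[]"] by simp

lemma word_length_mult:
 assumes "g : carrier G" "h : carrier G"
 shows "word_length G S (g \<otimes> h) <= word_length G S g + word_length G S h"
proof -
 obtain u v where "length u = word_length G S g" "set u <= S" "foldr (\<otimes>) u \<one> = g"
  "length v = word_length G S h" "set v <= S" "foldr (\<otimes>) v \<one> = h"
  using assms word_length_attained by meson
 thus ?thesis using word_length_le[of "u @ v"] foldr_mult_append[of u v] S_sub by auto
qed

lemma word_length_inv_le:
 assumes "g : carrier G" shows "word_length G S (inv g) <= word_length G S g"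
proof -
 obtain u where u: "length u = word_length G S g" "set u <= S" "foldr (\<otimes>) u \<one> = g"
  using assms word_length_attained by meson
 have "set w <= S ==> foldr (\<otimes>) (rev (map (m_inv G) w)) \<one> = inv (foldr (\<otimes>) w \<one>)" for w
 proof (induction w)
  case (Cons a w)
  have "set (rev (map (m_inv G) w)) <= carrier G" "set [inv a] <= carrier G" "set w <= carrier G"
   using Cons S_sub by auto
  hence "foldr (\<otimes>) (rev (map (m_inv G) w) @ [inv a]) \<one> = inv (foldr (\<otimes>) w \<one>) \<otimes> (inv a \<otimes> \<one>)"
   using Cons foldr_mult_append[of "rev (map (m_inv G) w)" "[inv a]"] by simp
  thus ?case using Cons S_sub foldr_mult_closed[of w] \<open>set w <= carrier G\<close>
   by (auto simp: inv_mult_group)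
 qed simp
 hence "foldr (\<otimes>) (rev (map (m_inv G) u)) \<one> = inv g" using u by simp
 moreover have "set (rev (map (m_inv G) u)) <= S" using u S_inv by auto
 ultimately show ?thesis using word_length_le[of "rev (map (m_inv G) u)"] u by simp
qed

lemma word_length_inv: "g : carrier G ==> word_length G S (inv g) = word_length G S g"
 using word_length_inv_le[of g] word_length_inv_le[of "inv g"] by simp

definition wrho where "wrho g h = word_length G S (inv g \<otimes> h)"

lemma wrho_tri:
 assumes "x : carrier G" "y : carrier G" "z : carrier G" shows "wrho x z <= wrho x y + wrho y z"
proof -
 have "y \<otimes> (inv y \<otimes> z) = z" using assms by (simp add: m_assoc[symmetric])
 hence "(inv x \<otimes> y) \<otimes> (inv y \<otimes> z) = inv x \<otimes> z"
  using assms by (simp add: m_assoc)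
 thus ?thesis using word_length_mult[of "inv x \<otimes> y" "inv y \<otimes> z"] assms by (simp add: wrho_def)
qed

lemma wrho_sym: "[|x : carrier G; y : carrier G|] ==> wrho x y = wrho y x"
 using word_length_inv[of "inv x \<otimes> y"] by (simp add: wrho_def inv_mult_group)

text \<open>Prefixes of a shortest word. No segment is longer than its index difference, and the
  triangle inequality forces equality.\<close>

lemma wrho_geodesic:
 assumes "x : carrier G" "y : carrier G"
 shows "\<exists>p. p 0 = x & p (wrho x y) = y & (\<forall>i\<le>wrho x y. p i : carrier G) \<and>
  (\<forall>i j. i <= j & j <= wrho x y --> wrho (p i) (p j) = j - i)"
proof -
 obtain ws where ws: "length ws = wrho x y" "set ws <= S" "foldr (\<otimes>) ws \<one> = inv x \<otimes> y"
  using word_length_attained[of "inv x \<otimes> y"] assms by (auto simp: wrho_def)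
 define p where "p i = x \<otimes> foldr (\<otimes>) (take i ws) \<one>" for i
 have wc: "set ws <= carrier G" using ws S_sub by auto
 have tc: "set (take i ws) <= carrier G" for i using wc set_take_subset by fast
 have pc: "p i : carrier G" for i using assms foldr_mult_closed[OF tc] by (simp add: p_def)
 have pe: "p (wrho x y) = y" "p 0 = x"
  using ws assms by (auto simp: p_def m_assoc[symmetric])
 have le: "wrho (p i) (p j) <= j - i" if "i <= j" for i j
 proof -
  define v where "v = take (j - i) (drop i ws)"
  have v: "take j ws = take i ws @ v" using that by (metis le_add_diff_inverse take_add v_def)
  have "set v <= set ws" unfolding v_def by (meson order_trans set_drop_subset set_take_subset)
  hence vS: "set v <= S" "set v <= carrier G" using ws S_sub by auto
  have "p j = p i \<otimes> foldr (\<otimes>) v \<one>"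
   using v vS tc assms foldr_mult_append[of "take i ws" v] foldr_mult_closed
   by (auto simp: p_def m_assoc)
  hence "inv (p i) \<otimes> p j = foldr (\<otimes>) v \<one>"
   using pc vS foldr_mult_closed by (simp add: m_assoc[symmetric])
  thus ?thesis using word_length_le[OF vS(1)] by (auto simp: wrho_def v_def)
 qed
 have "wrho (p i) (p j) = j - i" if "i <= j" "j <= wrho x y" for i j
 proof -
  have "wrho x y <= wrho (p 0) (p i) + wrho (p i) (p j) + wrho (p j) (p (wrho x y))"
   using wrho_tri[of "p 0" "p i" "p (wrho x y)"] wrho_tri[of "p i" "p j" "p (wrho x y)"] pc pe assms by simp
  thus ?thesis using le[of 0 i] le[of i j] le[of j "wrho x y"] that by linarith
 qed
 thus ?thesis using pe pc by blast
qed

end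

section \<open>Finite-index colour subgroups are hyperbolic\<close>

text \<open>\<open>G\<close> appears as the group of words with even colour counts: \<theta> is
  onto, and its kernel is \<open>weq\<close> to the empty word. In the application \<open>G\<close>
  is the fundamental group and \<theta> sends a word to a loop across mirrors.\<close>

locale racg_quotient = racg adj + group G for adj :: "'b => 'b => bool" and G :: "('g, 'm) monoid_scheme" (structure) +
 fixes V :: "'b set" and col :: "'b => nat" and n :: nat and \<theta> :: "'b list => 'g"
  and H :: "'b list set"
 assumes finV: "finite V" and col: "\<And>v. v : V ==> col v : {1..n}"
  and no_square: "\<And>a b c d. [|adj a b; adj b c; adj c d; adj d a; a ~= c; b ~= d|] ==> adj a c | adj b d"
  and H_def: "H = {u : lists V. \<forall>i. even (length (filter (%v. col v = i) u))}"
  and \<theta>_surj: "\<theta> ` H = carrier G"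
  and \<theta>_mult: "\<And>u v. [|u : H; v : H|] ==> \<theta> (u @ v) = \<theta> u \<otimes> \<theta> v"
  and \<theta>_one: "\<And>u. u : H ==> \<theta> u = \<one> <-> weq u []"
begin

lemma H_append: "u : H ==> v : H ==> u @ v : H"
 by (auto simp: H_def)

lemma H_rev: "u : H ==> rev u : H"
 by (auto simp: H_def rev_filter[symmetric])

lemma H_Nil: "[] : H"
 by (auto simp: H_def)

lemma \<theta>_closed: "u : H ==> \<theta> u : carrier G"
 using \<theta>_surj by auto

lemma \<theta>_rev: "u : H ==> \<theta> (rev u) = inv (\<theta> u)"
 using \<theta>_mult[of "rev u" u] \<theta>_one[of "rev u @ u"] weq_rev_cancel[of u] H_rev[of u] H_append[of "rev u" u] \<theta>_closed
 by (metis inv_equality)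

lemma \<theta>_eq: "[|u : H; v : H|] ==> \<theta> u = \<theta> v <-> weq u v"
proof -
 assume uv: "u : H" "v : H"
 have "\<theta> u = \<theta> v <-> \<theta> (rev u @ v) = \<one>"
  using uv \<theta>_mult[of "rev u" v] \<theta>_rev[of u] H_rev[of u] \<theta>_closed[of u] \<theta>_closed[of v]
  by (metis inv_closed inv_equality inv_inv l_inv)
 also have "\<dots> <-> weq (rev u @ v) []" using uv H_append H_rev \<theta>_one by blast
 also have "\<dots> <-> weq u v"
 proof
  assume "weq (rev u @ v) []"
  hence "weq (u @ rev u @ v) (u @ [])" by (intro weq_append weq_refl)
  thus "weq u v" using weq_append_cancel[of u v] weq_sym weq_trans by (metis append_Nil2)
 next
  assume "weq u v"
  hence "weq (rev u @ v) (rev u @ u)" by (intro weq_append weq_refl weq_sym[OF \<open>weq u v\<close>])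
  thus "weq (rev u @ v) []" using weq_rev_cancel weq_trans by blast
 qed
 finally show ?thesis .
qed

definition odds :: "'b list => nat set" where
 "odds u = {i. odd (length (filter (%v. col v = i) u))}"

text \<open>A coset representative: one letter for every colour of odd parity. Appending its reverse
  puts a word into \<open>H\<close>.\<close>

definition corr :: "'b list => 'b list" where
 "corr u = map (%i. SOME v. v : V & col v = i) (sorted_list_of_set (odds u))"

lemma odds_sub:
 assumes "u : lists V" shows "odds u <= col ` V" "odds u <= {1..n}"
proof -
 show "odds u <= col ` V"
 proof
  fix i assume "i : odds u"
  hence "filter (%v. col v = i) u ~= []" by (auto simp: odds_def)
  then obtain v where "v : set u" "col v = i" by (auto simp: filter_empty_conv)
  thus "i : col ` V" using assms by auto
 qed
 thus "odds u <= {1..n}" using col by blast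
qed

lemma corr_props:
 assumes "u : lists V"
 shows "corr u : lists V" "length (corr u) <= n" "u @ rev (corr u) : H"
proof -
 define r where "r i = (SOME v. v : V & col v = i)" for i
 have r: "r i : V" "col (r i) = i" if "i : odds u" for i
 proof -
  have "\<exists>v. v : V & col v = i" using odds_sub(1)[OF assms] that by blast
  hence "r i : V & col (r i) = i" unfolding r_def by (rule someI_ex)
  thus "r i : V" "col (r i) = i" by auto
 qed
 have fin: "finite (odds u)" using odds_sub(2)[OF assms] finite_subset by blast
 have c: "corr u = map r (sorted_list_of_set (odds u))" by (simp add: corr_def r_def[abs_def])
 show V: "corr u : lists V" using r fin by (auto simp: c)
 show "length (corr u) <= n" using card_mono[OF _ odds_sub(2)[OF assms]] by (simp add: c)
 have "length (filter (%v. col v = i) (corr u)) = (if i : odds u then 1 else 0)" for i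
 proof -
  have "length (filter (%v. col v = i) (corr u)) = length (filter (%j. j = i) (sorted_list_of_set (odds u)))"
   using r fin by (auto simp: c filter_map intro!: arg_cong[of _ _ length] filter_cong)
  also have "\<dots> = card (set (filter (%j. j = i) (sorted_list_of_set (odds u))))"
   by (rule distinct_card[symmetric]) simp
  also have "\<dots> = card {j : odds u. j = i}" using fin by simp
  also have "\<dots> = (if i : odds u then 1 else 0)"
   by (cases "i : odds u") (auto simp: conj_commute cong: conj_cong)
  finally show ?thesis .
 qed
 thus "u @ rev (corr u) : H" using assms V
  by (auto simp: H_def odds_def rev_filter[symmetric])
qed

text \<open>2n+1 is the length of a Schreier generator: representative, letter, inverse
  representative.\<close>

definition gens :: "'g set" where
 "gens = \<theta> ` {u : H. length u <= 2 * n + 1}"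

lemma gens_finite: "finite gens"
proof -
 have "{u : H. length u <= 2 * n + 1} <= {u. set u <= V & length u <= 2 * n + 1}"
  by (auto simp: H_def)
 thus ?thesis unfolding gens_def
  using finite_lists_length_le[OF finV] finite_subset by blast
qed

lemma gens_sub: "gens <= carrier G"
 using \<theta>_closed by (auto simp: gens_def)

lemma gens_inv: "s : gens ==> inv s : gens"
 unfolding gens_def using \<theta>_rev H_rev by (auto intro!: image_eqI[where x = "rev _"])

text \<open>Schreier rewriting: consecutive prefixes of \<open>u\<close>, each corrected into
  \<open>H\<close>, differ by one generator, and for the full word the correction is empty.\<close>

lemma gens_word:
 assumes "u : H" shows "\<exists>ws. set ws <= gens & length ws = length u & foldr (\<otimes>) ws \<one> = \<theta> u"
proof -
 have "\<exists>ws. set ws <= gens & length ws = length u & foldr (\<otimes>) ws \<one> = \<theta> (u @ rev (corr u))"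
  if "u : lists V" for u
  using that
 proof (induction u rule: rev_induct)
  case Nil
  have "corr [] = []" by (simp add: corr_def odds_def)
  thus ?case using \<theta>_one[OF H_Nil] by (intro exI[of _ "[]"]) auto
 next
  case (snoc x u)
  then obtain ws where ws: "set ws <= gens" "length ws = length u" "foldr (\<otimes>) ws \<one> = \<theta> (u @ rev (corr u))"
   by auto
  have ux: "u : lists V" "u @ [x] : lists V" using snoc by auto
  define h where "h = corr u @ [x] @ rev (corr (u @ [x]))"
  have Hs: "u @ rev (corr u) : H" "(u @ [x]) @ rev (corr (u @ [x])) : H" using corr_props(3) ux by blast+
  have hw: "weq ((u @ rev (corr u)) @ h) ((u @ [x]) @ rev (corr (u @ [x])))"
  proof -
   have "weq (u @ (rev (corr u) @ corr u) @ ([x] @ rev (corr (u @ [x])))) (u @ [] @ ([x] @ rev (corr (u @ [x]))))"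
    by (intro weq_append weq_refl weq_rev_cancel)
   thus ?thesis by (simp add: h_def)
  qed
  have hH: "h : H"
  proof -
   have "even (length (filter P h))" if "even (length (filter P (u @ rev (corr u))))"
     "even (length (filter P ((u @ [x]) @ rev (corr (u @ [x])))))" for P
    using that by (auto simp: h_def rev_filter[symmetric])
   moreover have "h : lists V" using corr_props(1)[OF ux(1)] corr_props(1)[OF ux(2)] ux by (auto simp: h_def)
   ultimately show ?thesis using Hs by (simp add: H_def)
  qed
  have "length h <= 2 * n + 1" using corr_props(2)[OF ux(1)] corr_props(2)[OF ux(2)] by (simp add: h_def)
  hence hg: "\<theta> h : gens" using hH by (auto simp: gens_def)
  have "\<theta> ((u @ [x]) @ rev (corr (u @ [x]))) = \<theta> (u @ rev (corr u)) \<otimes> \<theta> h"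
   using \<theta>_eq hw Hs hH H_append \<theta>_mult by metis
  hence "foldr (\<otimes>) (ws @ [\<theta> h]) \<one> = \<theta> ((u @ [x]) @ rev (corr (u @ [x])))"
   using foldr_mult_append[of ws "[\<theta> h]"] ws hg gens_sub \<theta>_closed[OF hH] by auto
  thus ?case using ws hg by (intro exI[of _ "ws @ [\<theta> h]"]) auto
 qed
 moreover have "corr u = []" using assms by (simp add: corr_def odds_def H_def)
 moreover have "u : lists V" using assms by (simp add: H_def)
 ultimately show ?thesis by fastforce
qed

lemma gens_generate: "generate G gens = carrier G"
proof
 show "generate G gens <= carrier G" using generate_incl[OF gens_sub] .
 show "carrier G <= generate G gens"
 proof
  fix g assume "g : carrier G"
  hence "g : \<theta> ` H" using \<theta>_surj by simp
  then obtain u where "u : H" "\<theta> u = g" by blast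
  then obtain ws where "set ws <= gens" "foldr (\<otimes>) ws \<one> = g" using gens_word by metis
  moreover have "set ws <= gens ==> foldr (\<otimes>) ws \<one> : generate G gens" for ws
   by (induction ws) (auto intro: generate.intros)
  ultimately show "g : generate G gens" by blast
 qed
qed

sublocale gg: generated_group G gens
 by unfold_locales (use gens_sub gens_inv gens_generate in auto)

definition rep :: "'g => 'b list" where
 "rep g = (SOME u. u : H & \<theta> u = g)"

lemma rep: assumes "g : carrier G" shows "rep g : H" "\<theta> (rep g) = g"
proof -
 have "g : \<theta> ` H" using assms \<theta>_surj by simp
 hence "\<exists>u. u : H & \<theta> u = g" by blast
 hence "rep g : H & \<theta> (rep g) = g" unfolding rep_def by (rule someI_ex)
 thus "rep g : H" "\<theta> (rep g) = g" by auto
qed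

lemma norm_in_H: "u : H ==> norm u : H"
 using set_norm[of u] even_norm by (auto simp: H_def)

lemma wrho_\<theta>:
 assumes "u : H" "v : H"
 shows "gg.wrho (\<theta> u) (\<theta> v) = word_length G gens (\<theta> (rev u @ v))"
 using assms by (simp add: gg.wrho_def \<theta>_mult \<theta>_rev H_rev)

lemma wrho_le_wd:
 assumes "u : H" "v : H" shows "gg.wrho (\<theta> u) (\<theta> v) <= wd u v"
proof -
 have h: "rev u @ v : H" using assms H_append H_rev by blast
 have "\<theta> (norm (rev u @ v)) = \<theta> (rev u @ v)" using \<theta>_eq norm_in_H h weq_norm by blast
 moreover obtain ws where "set ws <= gens" "length ws = length (norm (rev u @ v))"
   "foldr (\<otimes>) ws \<one> = \<theta> (norm (rev u @ v))"
  using gens_word norm_in_H h by metis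
 ultimately show ?thesis using gg.word_length_le[of ws] wrho_\<theta>[OF assms] by (simp add: wd_def wlen_def)
qed

text \<open>Every generator has a word of length at most 2n+1. With \<open>wrho_le_wd\<close> the
  two metrics are comparable, so Coxeter intervals can serve as guesses in \<open>G\<close>.\<close>

lemma wd_le_wrho:
 assumes "u : H" "v : H" shows "wd u v <= (2 * n + 1) * gg.wrho (\<theta> u) (\<theta> v)"
proof -
 have h: "rev u @ v : H" using assms H_append H_rev by blast
 obtain ws where ws: "length ws = word_length G gens (\<theta> (rev u @ v))" "set ws <= gens"
   "foldr (\<otimes>) ws \<one> = \<theta> (rev u @ v)"
  using gg.word_length_attained h \<theta>_closed by meson
 have "set ws <= gens ==> \<exists>w\<in>H. foldr (\<otimes>) ws \<one> = \<theta> w & length w <= (2 * n + 1) * length ws" for ws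
 proof (induction ws)
  case Nil
  have "\<theta> [] = \<one>" using \<theta>_one[OF H_Nil] by simp
  thus ?case using H_Nil by (intro bexI[of _ "[]"]) auto
 next
  case (Cons s ws)
  then obtain w where w: "w : H" "foldr (\<otimes>) ws \<one> = \<theta> w" "length w <= (2 * n + 1) * length ws" by auto
  obtain t where "t : H" "length t <= 2 * n + 1" "s = \<theta> t" using Cons.prems by (auto simp: gens_def)
  thus ?case using w H_append \<theta>_mult by (intro bexI[of _ "t @ w"]) auto
 qed
 then obtain w where w: "w : H" "\<theta> (rev u @ v) = \<theta> w" "length w <= (2 * n + 1) * length ws"
  using ws by metis
 hence "weq (rev u @ v) w" using \<theta>_eq h by blast
 hence "wd u v <= length w" using wlen_le[of w] wlen_cong by (simp add: wd_def)
 thus ?thesis using w ws wrho_\<theta>[OF assms] by simp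
qed

text \<open>Points of a Coxeter interval may lie outside the subgroup, but every word is within n of
  it (\<open>near_guess\<close>); hence the n-neighbourhood.\<close>

definition guess :: "'g => 'g => 'g set" where
 "guess g h = {k : carrier G. \<exists>q\<in>interval (rep g) (rep h). set q <= V & wd (rep k) q <= n}"

lemma near_guess:
 assumes "q : lists V"
 shows "\<exists>k\<in>carrier G. wd (rep k) q <= n"
proof -
 define w where "w = q @ rev (corr q)"
 have wH: "w : H" using corr_props(3)[OF assms] by (simp add: w_def)
 have "weq (rep (\<theta> w)) w" using \<theta>_eq rep \<theta>_closed wH by metis
 hence "wd (rep (\<theta> w)) q = wd w q" by (intro wd_cong weq_refl)
 also have "\<dots> = wd (rev (corr q)) []" using wd_translate[of "rev q" "rev (corr q)" "[]"] by (simp add: w_def)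
 also have "\<dots> <= n" using wlen_le[of "corr q"] corr_props(2)[OF assms] by (simp add: wd_def)
 finally show ?thesis using \<theta>_closed wH by blast
qed

lemma rep_V: "g : carrier G ==> set (rep g) <= V"
 using rep(1)[of g] by (auto simp: H_def)

theorem hyperbolic: "hyperbolic_group G"
proof -
 \<comment> \<open>Thinness costs n twice plus \<open>card V\<close>, smallness n plus 2n+1; the
   constant covers both.\<close>
 interpret guessed_geodesics "carrier G" gg.wrho guess "4 * n + 1 + card V"
 proof
  fix x y assume xy: "x : carrier G" "y : carrier G"
  show "gg.wrho x y = gg.wrho y x" using gg.wrho_sym xy .
  show "\<exists>p. p 0 = x & p (gg.wrho x y) = y & (\<forall>i\<le>gg.wrho x y. p i : carrier G) \<and>
    (\<forall>i j. i <= j & j <= gg.wrho x y --> gg.wrho (p i) (p j) = j - i)"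
   using gg.wrho_geodesic xy .
  show "guess x y <= carrier G" by (auto simp: guess_def)
 next
  fix x assume "x : carrier G"
  thus "gg.wrho x x = 0" by (simp add: gg.wrho_def gg.word_length_one)
 next
  fix x y z assume "x : carrier G" "y : carrier G" "z : carrier G"
  thus "gg.wrho x z <= gg.wrho x y + gg.wrho y z" by (rule gg.wrho_tri)
 next
  fix x y z u assume xyz: "x : carrier G" "y : carrier G" "z : carrier G" and u: "u : guess x y"
  obtain q where q: "q : interval (rep x) (rep y)" "set q <= V" "wd (rep u) q <= n" and uG: "u : carrier G"
   using u by (auto simp: guess_def)
  obtain q' where q': "q' : interval (rep x) (rep z) Un interval (rep z) (rep y)" "set q' <= V"
    "wd q q' <= card V"
   using thin_intervals[OF finV q(2) rep_V rep_V rep_V q(1)] xyz no_square by metis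
  obtain k where k: "k : carrier G" "wd (rep k) q' <= n" using near_guess q' by blast
  have "wd (rep u) (rep k) <= wd (rep u) q + wd q q' + wd q' (rep k)"
   using wd_tri[of "rep u" "rep k" q] wd_tri[of q "rep k" q'] by linarith
  also have "\<dots> <= 4 * n + 1 + card V" using q q' k wd_sym[of q' "rep k"] by linarith
  finally have "gg.wrho u k <= 4 * n + 1 + card V"
   using wrho_le_wd[of "rep u" "rep k"] rep uG k by simp
  moreover have "k : guess x z Un guess z y" using k q' by (auto simp: guess_def)
  ultimately show "\<exists>u'\<in>guess x z Un guess z y. gg.wrho u u' <= 4 * n + 1 + card V" by blast
 next
  fix x y u assume xy: "x : carrier G" "y : carrier G" "gg.wrho x y <= 1" and u: "u : guess x y"
  obtain q where q: "q : interval (rep x) (rep y)" "wd (rep u) q <= n" and uG: "u : carrier G"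
   using u by (auto simp: guess_def)
  have "wd (rep x) (rep y) <= (2 * n + 1) * gg.wrho x y" using wd_le_wrho[of "rep x" "rep y"] rep xy by simp
  also have "\<dots> <= (2 * n + 1) * 1" using xy by (intro mult_le_mono2)
  finally have "wd (rep x) q <= 2 * n + 1" using q by (auto simp: interval_def)
  hence "wd (rep u) (rep x) <= 4 * n + 1 + card V"
   using wd_tri[of "rep u" "rep x" q] wd_sym[of q "rep x"] q by linarith
  thus "gg.wrho u x <= 4 * n + 1 + card V" using wrho_le_wd[of "rep u" "rep x"] rep uG xy by simp
 next
  fix x y w assume xyw: "x : carrier G" "y : carrier G" "w : carrier G"
  obtain m where m: "set m <= V" "m : interval (rep w) (rep x)" "m : interval (rep w) (rep y)"
    "m : interval (rep x) (rep y)"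
   using median_exists[OF rep_V rep_V rep_V] xyw by metis
  have m': "m : interval (rep x) (rep w)" "m : interval (rep y) (rep w)"
   using m wd_sym by (auto simp: interval_def add.commute)
  obtain k where "k : carrier G" "wd (rep k) m <= n" using near_guess m by blast
  hence "k : guess x y Int guess x w Int guess y w" using m m' by (auto simp: guess_def)
  thus "guess x y Int guess x w Int guess y w ~= {}" by blast
 qed
 have "word_dist G gens = (%x y. real (gg.wrho x y))"
  by (intro ext) (simp add: word_dist_def gg.wrho_def)
 thus ?thesis
  unfolding hyperbolic_group_def
  using Gromov_hyperbolic gens_finite gens_sub gens_generate group_axioms by auto
qed

end

section \<open>PL topology by linear algebra: complexes as cones of non-negative functions\<close>

section \<open>Simplicial fans\<close>

abbreviation supp :: "('v => real) => 'v set" where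
 "supp f \<equiv> {v. f v ~= 0}"

abbreviation aff where "aff \<equiv> affine_extension"

text \<open>The cone over the realization, which is its slice of total 1
  (\<open>realization_cone\<close>).\<close>

definition cone_of :: "'v set set => ('v => real) set" where
 "cone_of K = {f. (\<forall>v. 0 <= f v) & supp f : K}"

text \<open>\<open>affine_extension\<close> is linear on the cone, so a simplicial fan with rays
  \<phi> is a bijection of cones. \<open>T\<close> need not be convex.\<close>

definition fan :: "'w set set => ('w => 'v => real) => ('v => real) set => bool" where
 "fan K \<phi> T <-> abstract_complex K & bij_betw (aff K \<phi>) (cone_of K) T"

lemma acD:
 assumes "abstract_complex K"
 shows "finite (\<Union>K)" "{} : K" "\<sigma> : K ==> \<tau> <= \<sigma> ==> \<tau> : K" "\<sigma> : K ==> finite \<sigma>" "v : \<Union>K ==> {v} : K" "finite K"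
proof -
 show 1: "finite (\<Union>K)" "{} : K" using assms by (auto simp: abstract_complex_def)
 show "\<sigma> : K ==> \<tau> <= \<sigma> ==> \<tau> : K" using assms by (auto simp: abstract_complex_def)
 show "\<sigma> : K ==> finite \<sigma>" using 1 by (meson Union_upper finite_subset)
 show "v : \<Union>K ==> {v} : K" using assms by (auto simp: abstract_complex_def)
 show "finite K" using 1 by (meson finite_UnionD)
qed

lemma cone_of_supp: "f : cone_of K ==> supp f <= \<Union>K"
 by (auto simp: cone_of_def)

lemma cone_of_nonneg: "f : cone_of K ==> 0 <= f v"
 by (auto simp: cone_of_def)

lemma cone_of_sum_eq: "[|abstract_complex K; f : cone_of K|] ==> sum f (\<Union>K) = sum f (supp f)"
 by (rule sum.mono_neutral_right) (use acD(1)[of K] cone_of_supp[of f K] in auto)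

lemma realization_cone:
 assumes "abstract_complex K"
 shows "realization K = {f : cone_of K. sum f (\<Union>K) = 1}"
proof (intro equalityI subsetI)
 fix f assume "f : realization K"
 then obtain \<sigma> where s: "\<sigma> : K" "\<forall>v. 0 <= f v" "\<forall>v. v \<notin> \<sigma> --> f v = 0" "sum f \<sigma> = 1"
  by (auto simp: realization_def closed_simplex_def)
 hence "supp f <= \<sigma>" by auto
 hence "f : cone_of K" using s acD(3)[OF assms s(1)] by (auto simp: cone_of_def)
 moreover have "sum f (\<Union>K) = sum f \<sigma>"
  by (rule sum.mono_neutral_right) (use s acD[OF assms] in auto)
 ultimately show "f : {f : cone_of K. sum f (\<Union>K) = 1}" using s by auto
next
 fix f assume "f : {f : cone_of K. sum f (\<Union>K) = 1}"
 thus "f : realization K"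
  using cone_of_sum_eq[OF assms, of f]
  by (auto simp: realization_def closed_simplex_def cone_of_def intro!: bexI[of _ "supp f"])
qed

lemma affine_extension_comp:
 "aff K \<phi> (aff Q \<eta> f) = aff Q (%w. aff K \<phi> (\<eta> w)) f"
proof
 fix v
 have "aff K \<phi> (aff Q \<eta> f) v = (\<Sum>u\<in>\<Union>K. \<Sum>w\<in>\<Union>Q. f w * \<eta> w u * \<phi> u v)"
  by (simp add: affine_extension_def sum_distrib_right)
 also have "\<dots> = (\<Sum>w\<in>\<Union>Q. \<Sum>u\<in>\<Union>K. f w * \<eta> w u * \<phi> u v)" by (rule sum.swap)
 finally show "aff K \<phi> (aff Q \<eta> f) v
   = aff Q (%w. aff K \<phi> (\<eta> w)) f v"
  by (simp add: affine_extension_def sum_distrib_left mult.assoc)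
qed

lemma affine_extension_add:
 "aff K \<phi> (%w. a * f w + b * g w) v = a * aff K \<phi> f v + b * aff K \<phi> g v"
 by (simp add: affine_extension_def sum_distrib_left sum.distrib[symmetric] algebra_simps)

lemma affine_extension_scale:
 "aff K \<phi> (%w. a * f w) v = a * aff K \<phi> f v"
 using affine_extension_add[of K \<phi> a f 0 f v] by simp

lemma affine_extension_delta:
 assumes "abstract_complex K" "w : \<Union>K"
 shows "aff K \<phi> (%x. if x = w then 1 else 0) = \<phi> w"
 using acD(1)[OF assms(1)] assms(2)
 by (intro ext) (simp add: affine_extension_def if_distrib[of "%x. x * _"] sum.delta cong: if_cong)

lemma delta_in_cone:
 assumes "abstract_complex K" "w : \<Union>K"
 shows "(%x. if x = w then 1 else 0) : cone_of K"
 using acD(5)[OF assms] by (auto simp: cone_of_def)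

lemma cone_of_scale:
 assumes "abstract_complex K" "f : cone_of K" "\<And>v. 0 <= s v"
 shows "(%v. s v * f v) : cone_of K"
 using assms acD(3)[OF assms(1), of "supp f" "supp (%v. s v * f v)"]
 by (auto simp: cone_of_def)

lemma fan_compose:
 assumes "fan Q \<eta> (cone_of L)" "fan L \<psi> T"
 shows "fan Q (%w. aff L \<psi> (\<eta> w)) T"
proof -
 have "bij_betw (aff L \<psi> o aff Q \<eta>) (cone_of Q) T"
  using assms bij_betw_trans unfolding fan_def by blast
 thus ?thesis using assms(1) by (simp add: fan_def comp_def affine_extension_comp)
qed

lemma fan_vertex:
 assumes "fan Q \<eta> T" "w : \<Union>Q" shows "\<eta> w : T"
proof -
 have "aff Q \<eta> (%x. if x = w then 1 else 0) : T"
  using assms delta_in_cone[of Q w] bij_betwE unfolding fan_def by blast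
 thus ?thesis using affine_extension_delta[of Q w \<eta>] assms unfolding fan_def by metis
qed

lemma zero_in_cone: "abstract_complex K ==> (%_. 0) : cone_of K"
 by (simp add: cone_of_def acD)

lemma affine_extension_zero: "aff K \<phi> (%_. 0) = (%_. 0)"
 by (simp add: affine_extension_def)

lemma fan_vertex_nz:
 assumes "fan Q \<eta> T" "w : \<Union>Q" shows "\<eta> w ~= (%_. 0)"
proof
 assume "\<eta> w = (%_. 0)"
 hence "aff Q \<eta> (%x. if x = w then 1 else 0) = aff Q \<eta> (%_. 0)"
  using affine_extension_delta[of Q w \<eta>] assms affine_extension_zero[of Q \<eta>] by (simp add: fan_def)
 hence "(%x. if x = w then 1 else 0::real) = (%_. 0)"
  using assms delta_in_cone[of Q w] zero_in_cone[of Q] unfolding fan_def bij_betw_def inj_on_def by blast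
 thus False by (metis (full_types) zero_neq_one)
qed

text \<open>The sum of the rays of \<tau> has a simplex of \<open>K\<close> as support, and by
  non-negativity no coordinate of a single ray cancels in that sum.\<close>

lemma fan_subordinate:
 assumes "fan Q \<eta> (cone_of K)" "\<tau> : Q" shows "\<exists>\<sigma>\<in>K. \<forall>w\<in>\<tau>. supp (\<eta> w) <= \<sigma>"
proof -
 have Q: "abstract_complex Q" using assms by (simp add: fan_def)
 define f where "f = (%w. if w : \<tau> then 1 else 0::real)"
 have "f : cone_of Q" using assms by (auto simp: f_def cone_of_def)
 hence g: "aff Q \<eta> f : cone_of K" using assms bij_betwE unfolding fan_def by blast
 have "supp (\<eta> w) <= supp (aff Q \<eta> f)" if "w : \<tau>" for w
 proof (clarify)
  fix v assume nz: "\<eta> w v ~= 0" and z: "aff Q \<eta> f v = 0"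
  have w: "w : \<Union>Q" using that assms by auto
  have nn: "0 <= \<eta> u v" if "u : \<Union>Q" for u by (rule cone_of_nonneg[OF fan_vertex[OF assms(1) that]])
  have "\<forall>u\<in>\<Union>Q. f u * \<eta> u v = 0"
   using z nn acD(1)[OF Q] unfolding affine_extension_def
   by (subst (asm) sum_nonneg_eq_0_iff) (auto simp: f_def)
  hence "f w * \<eta> w v = 0" using w by blast
  thus False using nz that by (simp add: f_def)
 qed
 thus ?thesis using g by (intro bexI[of _ "supp (aff Q \<eta> f)"]) (auto simp: cone_of_def)
qed

text \<open>Scaling each ray to total 1, and the coefficients inversely, restricts the bijection of
  cones to the slices of total 1.\<close>

lemma fan_subdivision:
 assumes f: "fan Q \<eta> (cone_of K)" and K: "abstract_complex K"
 shows "is_subdivision Q (%w v. \<eta> w v / sum (\<eta> w) (\<Union>K)) K"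
proof -
 define s where "s w = sum (\<eta> w) (\<Union>K)" for w
 define \<phi> where "\<phi> w v = \<eta> w v / s w" for w v
 have Q: "abstract_complex Q" using f by (simp add: fan_def)
 have vc: "\<eta> w : cone_of K" if "w : \<Union>Q" for w using fan_vertex[OF f that] .
 have spos: "s w > 0" if w: "w : \<Union>Q" for w
 proof -
  obtain v where v: "\<eta> w v ~= 0" using fan_vertex_nz[OF f w] by blast
  hence "v : \<Union>K" using cone_of_supp[OF vc[OF w]] by auto
  thus ?thesis unfolding s_def
   using v cone_of_nonneg[OF vc[OF w]] acD(1)[OF K]
   by (intro sum_pos2[of _ v]) (auto simp: less_le)
 qed
 have ph: "sum (\<phi> w) (\<Union>K) = 1" "\<phi> w : cone_of K" if "w : \<Union>Q" for w
 proof -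
  show "sum (\<phi> w) (\<Union>K) = 1" using spos[OF that] by (simp add: \<phi>_def sum_divide_distrib[symmetric] s_def[symmetric])
  have "\<phi> w = (%v. (1 / s w) * \<eta> w v)" by (auto simp: \<phi>_def)
  thus "\<phi> w : cone_of K" using cone_of_scale[OF K vc[OF that], of "%_. 1 / s w"] spos[OF that] by simp
 qed
 have aext: "aff Q \<phi> g = aff Q \<eta> (%w. g w / s w)" for g
  by (intro ext) (auto simp: affine_extension_def \<phi>_def)
 have tot: "sum (aff Q \<phi> g) (\<Union>K) = sum g (\<Union>Q)" for g
 proof -
  have "sum (aff Q \<phi> g) (\<Union>K) = (\<Sum>w\<in>\<Union>Q. \<Sum>v\<in>\<Union>K. g w * \<phi> w v)"
   unfolding affine_extension_def by (rule sum.swap)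
  also have "\<dots> = sum g (\<Union>Q)" using ph(1) by (intro sum.cong) (auto simp: sum_distrib_left[symmetric])
  finally show ?thesis .
 qed
 have bij: "bij_betw (aff Q \<phi>) (realization Q) (realization K)"
  unfolding bij_betw_def
 proof (intro conjI inj_onI equalityI subsetI)
  fix g h assume gh: "g : realization Q" "h : realization Q" "aff Q \<phi> g = aff Q \<phi> h"
  have c: "(%w. g w / s w) : cone_of Q" if "g : realization Q" for g
  proof -
   have "g : cone_of Q" using that realization_cone[OF Q] by auto
   hence "(%w. (if w : \<Union>Q then 1 / s w else 0) * g w) : cone_of Q"
    using spos by (intro cone_of_scale[OF Q]) (auto simp: less_imp_le)
   moreover have "(%w. (if w : \<Union>Q then 1 / s w else 0) * g w) = (%w. g w / s w)"
    using cone_of_supp[OF \<open>g : cone_of Q\<close>] by (intro ext) auto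
   ultimately show ?thesis by simp
  qed
  have "(%w. g w / s w) = (%w. h w / s w)"
   using gh c f aext unfolding fan_def bij_betw_def inj_on_def by metis
  hence "g w = h w" if "w : \<Union>Q" for w using spos[OF that] by (metis less_irrefl nonzero_divide_eq_eq divide_cancel_right)
  moreover have "g w = 0 & h w = 0" if "w \<notin> \<Union>Q" for w
   using gh that cone_of_supp[of g Q] cone_of_supp[of h Q] realization_cone[OF Q] by auto
  ultimately show "g = h" by (intro ext) metis
 next
  fix k assume "k : aff Q \<phi> ` realization Q"
  then obtain g where g: "g : cone_of Q" "sum g (\<Union>Q) = 1" "k = aff Q \<phi> g"
   using realization_cone[OF Q] by auto
  have "(%w. (if w : \<Union>Q then 1 / s w else 0) * g w) : cone_of Q"
   using spos g by (intro cone_of_scale[OF Q]) (auto simp: less_imp_le)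
  moreover have "(%w. (if w : \<Union>Q then 1 / s w else 0) * g w) = (%w. g w / s w)"
   using cone_of_supp[OF g(1)] by (intro ext) auto
  ultimately have "k : cone_of K" using g aext f bij_betwE unfolding fan_def by metis
  thus "k : realization K" using tot g realization_cone[OF K] by auto
 next
  fix k assume "k : realization K"
  hence k: "k : cone_of K" "sum k (\<Union>K) = 1" using realization_cone[OF K] by auto
  hence "k : aff Q \<eta> ` cone_of Q" using f by (simp add: fan_def bij_betw_def)
  then obtain g where g: "g : cone_of Q" "aff Q \<eta> g = k" by blast
  define h where "h w = (if w : \<Union>Q then s w else 0) * g w" for w
  have h: "h : cone_of Q" unfolding h_def[abs_def] using spos g by (intro cone_of_scale[OF Q]) (auto simp: less_imp_le)
  have "(%w. h w / s w) = g"
  proof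
   fix w show "h w / s w = g w"
    using spos[of w] cone_of_supp[OF g(1)] by (cases "w : \<Union>Q") (auto simp: h_def)
  qed
  hence e: "aff Q \<phi> h = k" using aext g by simp
  hence "sum h (\<Union>Q) = 1" using tot[of h] k by simp
  thus "k : aff Q \<phi> ` realization Q" using h e realization_cone[OF Q] by auto
 qed
 have "\<exists>\<sigma>\<in>K. \<phi> ` \<tau> <= closed_simplex \<sigma>" if tQ: "\<tau> : Q" for \<tau>
 proof -
  obtain \<sigma> where s: "\<sigma> : K" "\<forall>w\<in>\<tau>. supp (\<eta> w) <= \<sigma>" using fan_subordinate[OF f tQ] by blast
  have "\<phi> w : closed_simplex \<sigma>" if "w : \<tau>" for w
  proof -
   have w: "w : \<Union>Q" using that \<open>\<tau> : Q\<close> by auto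
   have z: "\<forall>v. v \<notin> \<sigma> --> \<phi> w v = 0" using s that by (auto simp: \<phi>_def)
   have "sum (\<phi> w) (\<Union>K) = sum (\<phi> w) \<sigma>"
    by (rule sum.mono_neutral_right) (use s z acD[OF K] in auto)
   thus ?thesis using ph[OF w] cone_of_nonneg[OF ph(2)[OF w]] z by (auto simp: closed_simplex_def)
  qed
  thus ?thesis using s by auto
 qed
 thus ?thesis using Q bij by (simp add: is_subdivision_def \<phi>_def[abs_def] s_def[abs_def])
qed

text \<open>Homogeneity: totals are preserved, and a non-zero point of a cone is a positive multiple
  of a point of the realization.\<close>

lemma subdivision_fan:
 assumes M: "is_subdivision M \<phi> K" and K: "abstract_complex K"
 shows "fan M \<phi> (cone_of K)"
proof -
 have aM: "abstract_complex M" and bij: "bij_betw (aff M \<phi>) (realization M) (realization K)"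
  using M by (auto simp: is_subdivision_def)
 have tot: "sum (aff M \<phi> g) (\<Union>K) = sum g (\<Union>M)" for g
 proof -
  have "sum (\<phi> w) (\<Union>K) = 1" if w: "w : \<Union>M" for w
  proof -
   obtain \<sigma> where s: "\<sigma> : K" "\<phi> ` {w} <= closed_simplex \<sigma>"
    using M acD(5)[OF aM w] unfolding is_subdivision_def by blast
   hence "\<phi> w : realization K" by (auto simp: realization_def)
   thus ?thesis using realization_cone[OF K] by auto
  qed
  moreover have "sum (aff M \<phi> g) (\<Union>K) = (\<Sum>w\<in>\<Union>M. \<Sum>v\<in>\<Union>K. g w * \<phi> w v)"
   unfolding affine_extension_def by (rule sum.swap)
  ultimately show ?thesis by (simp add: sum_distrib_left[symmetric])
 qed
 have norm: "\<exists>t>0. (%v. t * f v) : realization L" if L: "abstract_complex L" "f : cone_of L" "f ~= (%_. 0)"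
  for L :: "'z set set" and f
 proof -
  obtain v where v: "f v ~= 0" using L(3) by blast
  hence "v : \<Union>L" using cone_of_supp[OF L(2)] by auto
  hence p: "sum f (\<Union>L) > 0" using v cone_of_nonneg[OF L(2)] acD(1)[OF L(1)]
   by (intro sum_pos2[of _ v]) (auto simp: less_le)
  thus ?thesis
   using cone_of_scale[OF L(1,2), of "%_. 1 / sum f (\<Union>L)"]
   by (intro exI[of _ "1 / sum f (\<Union>L)"]) (auto simp: realization_cone[OF L(1)] sum_divide_distrib[symmetric])
 qed
 have scl: "aff M \<phi> (%w. a * f w) = (%v. a * aff M \<phi> f v)" for a f
  by (intro ext) (rule affine_extension_scale)
 have inK: "aff M \<phi> f : cone_of K" if fM: "f : cone_of M" for f
 proof (cases "f = (%_. 0)")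
  case True
  thus ?thesis using zero_in_cone[OF K] by (simp add: affine_extension_zero)
 next
  case False
  then obtain t where t: "t > 0" "(%v. t * f v) : realization M" using norm[OF aM fM] by auto
  hence "(%v. t * aff M \<phi> f v) : cone_of K"
   using bij_betwE[OF bij] scl realization_cone[OF K] by fastforce
  hence "(%v. (1/t) * (t * aff M \<phi> f v)) : cone_of K"
   using t by (intro cone_of_scale[OF K, of _ "%_. 1/t"]) auto
  thus ?thesis using t by simp
 qed
 have "bij_betw (aff M \<phi>) (cone_of M) (cone_of K)"
  unfolding bij_betw_def
 proof (intro conjI inj_onI equalityI subsetI)
  fix f g assume fg: "f : cone_of M" "g : cone_of M" "aff M \<phi> f = aff M \<phi> g"
  have s: "sum f (\<Union>M) = sum g (\<Union>M)" using tot[of f] tot[of g] fg by simp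
  have z: "h = (%_. 0)" if "h : cone_of M" "sum h (\<Union>M) = 0" for h
  proof
   fix v
   have "\<forall>w\<in>\<Union>M. h w = 0" using that cone_of_nonneg[OF that(1)] acD(1)[OF aM]
    by (subst (asm) sum_nonneg_eq_0_iff) auto
   thus "h v = 0" using cone_of_supp[OF that(1)] by auto
  qed
  show "f = g"
  proof (cases "sum f (\<Union>M) = 0")
   case True
   thus ?thesis using z fg s by metis
  next
   case False
   define t where "t = 1 / sum f (\<Union>M)"
   have t: "t > 0" using False cone_of_nonneg[OF fg(1)] by (simp add: t_def sum_nonneg less_le)
   have "(%v. t * f v) : realization M" "(%v. t * g v) : realization M"
    using cone_of_scale[OF aM fg(1), of "%_. t"] cone_of_scale[OF aM fg(2), of "%_. t"] t False s
    by (auto simp: realization_cone[OF aM] sum_divide_distrib[symmetric] t_def)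
   moreover have "aff M \<phi> (%v. t * f v) = aff M \<phi> (%v. t * g v)"
    using scl fg by simp
   ultimately have "(%v. t * f v) = (%v. t * g v)" using bij unfolding bij_betw_def inj_on_def by blast
   thus ?thesis using t by (intro ext) (metis less_irrefl mult_cancel_left)
  qed
 next
  fix k assume k: "k : cone_of K"
  show "k : aff M \<phi> ` cone_of M"
  proof (cases "k = (%_. 0)")
   case True
   thus ?thesis using zero_in_cone[OF aM] affine_extension_zero[of M \<phi>] by (metis imageI)
  next
   case False
   then obtain t where t: "t > 0" "(%v. t * k v) : realization K" using norm[OF K k] by auto
   then obtain g where g: "g : realization M" "aff M \<phi> g = (%v. t * k v)"
    using bij unfolding bij_betw_def by (metis imageE)
   have "(%v. (1/t) * g v) : cone_of M" using g t realization_cone[OF aM] by (intro cone_of_scale[OF aM, of _ "%_. 1/t"]) auto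
   moreover have "aff M \<phi> (%v. (1/t) * g v) = k" using scl[of "1/t" g] g t by simp
   ultimately show ?thesis by (metis imageI)
  qed
 qed (use inK in auto)
 thus ?thesis using aM by (simp add: fan_def)
qed

text \<open>Allows vertices to be renamed by natural numbers, as \<open>PL_homeomorphic\<close> and
  the triangulation of the manifold demand.\<close>

lemma fan_relabel:
 fixes K :: "'w set set"
 assumes f: "fan K \<phi> T" and h: "inj_on h (\<Union>K)"
 shows "fan ((`) h ` K) (%u. \<phi> (inv_into (\<Union>K) h u)) T"
proof -
 let ?K = "(`) h ` K" and ?g = "inv_into (\<Union>K) h"
 have aK: "abstract_complex K" using f by (simp add: fan_def)
 have g: "?g (h v) = v" if "v : \<Union>K" for v using h that by simp
 have U: "\<Union>?K = h ` \<Union>K" by auto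
 have "\<tau> : ?K" if "\<sigma> : K" "\<tau> <= h ` \<sigma>" for \<sigma> \<tau>
 proof -
  have "\<tau> = h ` {v : \<sigma>. h v : \<tau>}" using that by auto
  moreover have "{v : \<sigma>. h v : \<tau>} : K" using acD(3)[OF aK that(1)] by auto
  ultimately show ?thesis by blast
 qed
 hence a: "abstract_complex ?K"
  using acD(1,2)[OF aK] U unfolding abstract_complex_def by auto
 define pull where "pull f = (%v. if v : \<Union>K then f (h v) else (0::real))" for f
 have ae: "aff ?K (%u. \<phi> (?g u)) f = aff K \<phi> (pull f)" for f
  unfolding affine_extension_def U by (intro ext) (subst sum.reindex[OF h], auto simp: pull_def g intro!: sum.cong)
 have "bij_betw pull (cone_of ?K) (cone_of K)"
 proof (rule bij_betw_byWitness[where f' = "%f u. if u : h ` \<Union>K then f (?g u) else 0"])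
  show "\<forall>f\<in>cone_of ?K. (%u. if u : h ` \<Union>K then pull f (?g u) else 0) = f"
  proof (intro ballI ext)
   fix f u assume "f : cone_of ?K"
   hence s: "supp f <= h ` \<Union>K" using cone_of_supp[of f ?K] U by simp
   show "(if u : h ` \<Union>K then pull f (?g u) else 0) = f u"
   proof (cases "u : h ` \<Union>K")
    case True
    then obtain v where "v : \<Union>K" "u = h v" by blast
    thus ?thesis using g[of v] by (simp add: pull_def del: Union_iff)
   qed (use s in auto)
  qed
  show "\<forall>f\<in>cone_of K. pull (%u. if u : h ` \<Union>K then f (?g u) else 0) = f"
  proof (intro ballI ext)
   fix f v assume "f : cone_of K"
   hence "supp f <= \<Union>K" using cone_of_supp by blast
   thus "pull (%u. if u : h ` \<Union>K then f (?g u) else 0) v = f v"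
    using g by (cases "v : \<Union>K") (auto simp: pull_def)
  qed
  show "pull ` cone_of ?K <= cone_of K"
  proof (intro image_subsetI)
   fix f assume f: "f : cone_of ?K"
   then obtain \<sigma> where s: "\<sigma> : K" "supp f = h ` \<sigma>" by (auto simp: cone_of_def)
   have "v : \<sigma>" if "v : \<Union>K" "f (h v) ~= 0" for v
   proof -
    have "h v : h ` \<sigma>" using that s by auto
    thus ?thesis using s that inj_on_image_mem_iff[OF h] by blast
   qed
   hence "supp (pull f) <= \<sigma>" by (auto simp: pull_def)
   thus "pull f : cone_of K" using acD(3)[OF aK s(1)] cone_of_nonneg[OF f]
    by (auto simp: cone_of_def pull_def)
  qed
  show "(%f u. if u : h ` \<Union>K then f (?g u) else 0) ` cone_of K <= cone_of ?K"
  proof (intro image_subsetI)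
   fix f assume f: "f : cone_of K"
   have "supp (%u. if u : h ` \<Union>K then f (?g u) else 0) = h ` supp f"
   proof (intro equalityI subsetI)
    fix u assume "u : supp (%u. if u : h ` \<Union>K then f (?g u) else 0)"
    hence "u : h ` \<Union>K" "f (?g u) ~= 0" by (auto split: if_splits)
    thus "u : h ` supp f" using f_inv_into_f[of u h "\<Union>K"] by (intro image_eqI[of _ _ "?g u"]) auto
   next
    fix u assume "u : h ` supp f"
    then obtain v where v: "u = h v" "f v ~= 0" by auto
    hence "v : \<Union>K" using cone_of_supp[OF f] by auto
    thus "u : supp (%u. if u : h ` \<Union>K then f (?g u) else 0)" using v g[of v] by (simp del: Union_iff)
   qed
   thus "(%u. if u : h ` \<Union>K then f (?g u) else 0) : cone_of ?K"
    using f by (auto simp: cone_of_def)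
  qed
 qed
 hence "bij_betw (aff K \<phi> o pull) (cone_of ?K) T"
  using f bij_betw_trans unfolding fan_def by blast
 moreover have "aff ?K (%u. \<phi> (?g u)) = aff K \<phi> o pull" using ae by auto
 ultimately show ?thesis using a by (simp add: fan_def)
qed

definition chains :: "'a set set => 'a set set set" where
 "chains S = {C. C <= S & (\<forall>A\<in>C. \<forall>B\<in>C. A <= B | B <= A)}"

lemma abstract_complex_chains: "finite S ==> abstract_complex (chains S)"
 unfolding abstract_complex_def chains_def by (auto intro: finite_subset[of _ S])

lemma Union_chains: "\<Union>(chains S) = S"
proof
 show "S <= \<Union>(chains S)"
 proof
  fix A assume "A : S" hence "{A} : chains S" by (auto simp: chains_def)
  thus "A : \<Union>(chains S)" by blast
 qed
qed (auto simp: chains_def)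

text \<open>A cone of non-negative functions that is closed under those linear combinations that do not
 enlarge the support has a barycentric fan: one ray in each stratum of constant support.\<close>

lemma barycentric_fan:
 fixes Z :: "('j => real) set"
 assumes J: "finite J" and Z: "\<And>x. x : Z ==> (\<forall>j. 0 <= x j) & supp x <= J" and Z0: "(%_. 0) : Z"
  and closed: "\<And>x y a b. [|x : Z; y : Z; supp y <= supp x; \<And>j. 0 <= a * x j + b * y j|] ==> (%j. a * x j + b * y j) : Z"
  and S: "S = supp ` Z - {{}}"
  and p: "\<And>A. A : S ==> p A : Z & supp (p A) = A"
 shows "fan (chains S) p Z"
proof -
 have "S <= Pow J" using Z S by auto
 hence finS: "finite S" using J by (meson finite_Pow_iff finite_subset)
 let ?ae = "aff (chains S) p"
 have ae: "?ae f j = (\<Sum>A\<in>S. f A * p A j)" for f j by (simp add: affine_extension_def Union_chains)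
 have pnn: "0 <= p A j" if "A : S" for A j using p[OF that] Z by auto
 have fA: "finite A" if "A : S" for A using that \<open>S <= Pow J\<close> J finite_subset by blast
 have supp_ae: "supp (?ae f) = \<Union>(supp f)" if f: "f : cone_of (chains S)" for f
 proof (rule Set.set_eqI, rule iffI)
  fix j assume "j : supp (?ae f)"
  then obtain A where "A : S" "f A * p A j ~= 0" using ae[of f j] by (auto elim: sum.not_neutral_contains_not_neutral)
  thus "j : \<Union>(supp f)" using p[of A] by auto
 next
  fix j assume "j : \<Union>(supp f)"
  then obtain A where A: "f A ~= 0" "j : A" by auto
  hence "A : S" using f by (auto simp: cone_of_def chains_def)
  hence "p A j ~= 0" using p[of A] A by auto
  hence "f A * p A j > 0" using A pnn[OF \<open>A : S\<close>] cone_of_nonneg[OF f] by (simp add: less_le)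
  hence "?ae f j > 0" unfolding ae using finS \<open>A : S\<close> pnn cone_of_nonneg[OF f] by (intro sum_pos2[of _ A]) auto
  thus "j : supp (?ae f)" by simp
 qed
 have top: "\<Union>(supp f) : supp f" if f: "f : cone_of (chains S)" "f ~= (%_. 0)" for f
 proof -
  have fs: "supp f <= S" and ch: "\<forall>A\<in>supp f. \<forall>B\<in>supp f. A <= B | B <= A"
   using f by (auto simp: cone_of_def chains_def)
  have "finite (supp f)" "supp f ~= {}" using fs finS finite_subset f by auto
  moreover have "subset.chain UNIV (supp f)" unfolding subset_chain_def using ch by blast
  ultimately show ?thesis by (rule Union_in_chain)
 qed
 define rem where "rem f A = (%B. if B = A then 0 else f B)" for f :: "'j set => real" and A
 have rem: "rem f A : cone_of (chains S)" if "f : cone_of (chains S)" for f A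
 proof -
  have "supp (rem f A) <= supp f" by (auto simp: rem_def)
  thus ?thesis using that acD(3)[OF abstract_complex_chains[OF finS], of "supp f" "supp (rem f A)"]
   by (auto simp: cone_of_def rem_def)
 qed
 have split: "?ae f j = f A * p A j + ?ae (rem f A) j" if "A : S" for f A j
 proof -
  have "(\<Sum>B\<in>S - {A}. f B * p B j) = (\<Sum>B\<in>S - {A}. rem f A B * p B j)" by (rule sum.cong) (auto simp: rem_def)
  moreover have "(\<Sum>B\<in>S. rem f A B * p B j) = (\<Sum>B\<in>S - {A}. rem f A B * p B j)"
   using finS that by (simp add: sum.remove[of S A] rem_def)
  ultimately show ?thesis unfolding ae using finS that by (simp add: sum.remove[of S A])
 qed
 have small: "~ A <= supp (?ae (rem f A))" if f: "f : cone_of (chains S)" and A: "A = \<Union>(supp f)" "f ~= (%_. 0)" for f A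
 proof
  assume sub: "A <= supp (?ae (rem f A))"
  have AS: "A : S" using top[OF f A(2)] A f by (auto simp: cone_of_def chains_def)
  hence "A ~= {}" using S by auto
  hence nz: "rem f A ~= (%_. 0)" using sub by (auto simp: affine_extension_zero)
  have "A <= \<Union>(supp (rem f A))" using sub supp_ae[OF rem[OF f]] by simp
  moreover have "\<Union>(supp (rem f A)) : supp (rem f A)" by (rule top[OF rem[OF f] nz])
  moreover have "B <= A & B ~= A" if "B : supp (rem f A)" for B
   using that A(1) by (auto simp: rem_def split: if_splits)
  ultimately show False by blast
 qed
 \<comment> \<open>Induction on the support of the image. That support is the top set A of both
   chains; the coefficient of A is forced, because the rest of each combination misses some
   coordinate of A.\<close>
 have inj: "f = g" if fg: "f : cone_of (chains S)" "g : cone_of (chains S)" "?ae f = ?ae g" for f g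
  using fg
 proof (induction "card (supp (?ae f))" arbitrary: f g rule: less_induct)
  case less
  show ?case
  proof (cases "f = (%_. 0) | g = (%_. 0)")
   case True
   have z: "h = (%_. 0)" if "h : cone_of (chains S)" "?ae h = (%_. 0)" for h
   proof (rule ccontr)
    assume "h ~= (%_. 0)"
    hence "\<Union>(supp h) : supp h" using top that by blast
    moreover have "\<Union>(supp h) = {}" using supp_ae[OF that(1)] that(2) by simp
    ultimately have "{} : supp h" by simp
    thus False using that S by (auto simp: cone_of_def chains_def)
   qed
   have "?ae f = (%_. 0)" using True less.prems(3) affine_extension_zero[of "chains S" p] by auto
   thus ?thesis using z[OF less.prems(1)] z[OF less.prems(2)] less.prems(3) by simp
  next
   case False
   define A where "A = \<Union>(supp f)"
   have A': "A = \<Union>(supp g)" using supp_ae less.prems A_def by metis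
   have AS: "A : S" using top[OF less.prems(1)] False A_def less.prems(1) by (auto simp: cone_of_def chains_def)
   have le: "f A <= g A" if L: "f : cone_of (chains S)" "g : cone_of (chains S)" "?ae f = ?ae g" "A = \<Union>(supp g)" "g ~= (%_. 0)"
    for f g
   proof -
    obtain j where j: "j : A" "?ae (rem g A) j = 0" using small[OF L(2,4,5)] by auto
    have "f A * p A j <= ?ae f j" using split[OF AS, of f j] supp_ae[OF rem[OF L(1)]]
     sum_nonneg[of S "%B. rem f A B * p B j"] pnn cone_of_nonneg[OF rem[OF L(1)]] ae[of "rem f A" j] by auto
    also have "\<dots> = g A * p A j" using L(3) split[OF AS, of g j] j by simp
    finally have *: "f A * p A j <= g A * p A j" .
    have "p A j > 0" using j p[OF AS] pnn[OF AS, of j] by (auto simp: less_le)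
    thus ?thesis using * by simp
   qed
   have eq: "f A = g A" using le[of f g] le[of g f] less.prems False A_def A' by (metis order_antisym)
   have e2: "?ae (rem f A) = ?ae (rem g A)"
    using split[OF AS, of f] split[OF AS, of g] eq less.prems(3) by (intro ext) (metis add_left_cancel)
   have "supp (?ae (rem f A)) \<subset> supp (?ae f)"
   proof -
    have "supp (?ae (rem f A)) <= supp (?ae f)" using supp_ae[OF rem[OF less.prems(1)]] supp_ae[OF less.prems(1)]
     by (auto simp: rem_def split: if_splits)
    moreover have "~ A <= supp (?ae (rem f A))" using small[OF less.prems(1) A_def] False by auto
    ultimately show ?thesis using supp_ae[OF less.prems(1)] A_def by auto
   qed
   moreover have "finite (supp (?ae f))" using supp_ae[OF less.prems(1)] A_def fA[OF AS] by simp
   ultimately have "rem f A = rem g A" using less.hyps[OF _ rem[OF less.prems(1)] rem[OF less.prems(2)] e2] psubset_card_mono by metis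
   thus ?thesis using eq by (intro ext) (metis rem_def)
  qed
 qed
 have into: "?ae f : Z" if "f : cone_of (chains S)" for f
  using that
 proof (induction "card (supp (?ae f))" arbitrary: f rule: less_induct)
  case less
  show ?case
  proof (cases "f = (%_. 0)")
   case True
   thus ?thesis using Z0 by (simp add: affine_extension_zero)
  next
   case False
   define A where "A = \<Union>(supp f)"
   have AS: "A : S" using top[OF less.prems(1)] False A_def less.prems(1) by (auto simp: cone_of_def chains_def)
   have sub: "supp (?ae (rem f A)) \<subset> supp (?ae f)"
   proof -
    have "supp (?ae (rem f A)) <= supp (?ae f)" using supp_ae[OF rem[OF less.prems(1)]] supp_ae[OF less.prems(1)]
     by (auto simp: rem_def split: if_splits)
    moreover have "~ A <= supp (?ae (rem f A))" using small[OF less.prems(1) A_def] False by auto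
    ultimately show ?thesis using supp_ae[OF less.prems(1)] A_def by auto
   qed
   have fin: "finite (supp (?ae f))" using supp_ae[OF less.prems(1)] A_def fA[OF AS] by simp
   have "?ae (rem f A) : Z" by (rule less.hyps[OF psubset_card_mono[OF fin sub] rem[OF less.prems(1)]])
   moreover have "?ae f = (%j. f A * p A j + 1 * ?ae (rem f A) j)"
   proof
    fix j show "?ae f j = f A * p A j + 1 * ?ae (rem f A) j" using split[OF AS, of f j] by linarith
   qed
   moreover have "0 <= f A * p A j + 1 * ?ae (rem f A) j" for j
    using pnn[OF AS] cone_of_nonneg[OF less.prems(1)] Z[OF \<open>?ae (rem f A) : Z\<close>] by simp
   moreover have "supp (?ae (rem f A)) <= supp (p A)" using sub supp_ae[OF less.prems(1)] A_def p[OF AS] by auto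
   ultimately show ?thesis using closed[of "p A" "?ae (rem f A)" "f A" 1] p[OF AS] by simp
  qed
 qed
 have onto: "\<exists>f\<in>cone_of (chains S). ?ae f = x" if "x : Z" for x
  using that
 proof (induction "card (supp x)" arbitrary: x rule: less_induct)
  case less
  show ?case
  proof (cases "supp x = {}")
   case True
   hence "x = (%_. 0)" by auto
   thus ?thesis using zero_in_cone[OF abstract_complex_chains[OF finS]] affine_extension_zero[of "chains S" p]
    by (intro bexI[of _ "%_. 0"]) auto
  next
   case False
   define A where "A = supp x"
   have AS: "A : S" using S False less.prems A_def by auto
   have xn: "\<And>j. 0 <= x j" using Z less.prems by auto
   \<comment> \<open>The largest multiple of \<open>p A\<close> that can be subtracted from
     \<open>x\<close>; at a minimising coordinate the remainder vanishes, so its support is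
     smaller.\<close>
   define c where "c = Min ((%j. x j / p A j) ` A)"
   have fin: "finite A" "A ~= {}" using fA[OF AS] False A_def by auto
   have pp: "p A j > 0" if "j : A" for j using p[OF AS] pnn[OF AS, of j] that by (auto simp: less_le)
   have "c : (%j. x j / p A j) ` A" unfolding c_def using fin by (intro Min_in) auto
   then obtain j0 where j0: "j0 : A" "c = x j0 / p A j0" by auto
   have c0: "c > 0" using j0 pp xn[of j0] A_def by (auto simp: less_le)
   have cle: "c * p A j <= x j" for j
   proof (cases "j : A")
    case True
    hence "c <= x j / p A j" unfolding c_def using fin by (intro Min_le) auto
    thus ?thesis using pp[OF True] by (simp add: pos_le_divide_eq)
   next
    case False
    thus ?thesis using p[OF AS] xn by auto
   qed
   define y where "y = (%j. 1 * x j + (- c) * p A j)"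
   have "y : Z" unfolding y_def
   proof (rule closed)
    show "x : Z" by (rule less.prems)
    show "p A : Z" "supp (p A) <= supp x" using p[OF AS] A_def by blast+
    show "0 <= 1 * x j + (- c) * p A j" for j using cle[of j] by simp
   qed
   have out: "x j = 0 & p A j = 0" if "j \<notin> A" for j
   proof
    show "x j = 0" using that unfolding A_def by blast
    show "p A j = 0" using that p[OF AS] by blast
   qed
   have "supp y <= A"
   proof
    fix j assume "j : supp y"
    thus "j : A" using out[of j] by (cases "j : A") (simp_all add: y_def)
   qed
   moreover have "j0 \<notin> supp y" using j0 pp[OF j0(1)] by (simp add: y_def)
   ultimately have sub: "supp y \<subset> A" using j0 by blast
   have "\<exists>f\<in>cone_of (chains S). ?ae f = y"
    using psubset_card_mono[OF fin(1) sub] unfolding A_def by (rule less.hyps[OF _ \<open>y : Z\<close>])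
   then obtain f where f: "f : cone_of (chains S)" "?ae f = y" by blast
   have fA0: "f A = 0"
   proof (rule ccontr)
    assume "f A ~= 0" hence "A <= \<Union>(supp f)" by auto
    thus False using supp_ae[OF f(1)] f sub by auto
   qed
   define g where "g = (%B. if B = A then c else f B)"
   have "supp g = insert A (supp f)" using c0 by (auto simp: g_def)
   moreover have "\<forall>B\<in>supp f. B <= A" using supp_ae[OF f(1)] f sub by auto
   ultimately have "supp g : chains S" using f(1) AS by (auto simp: cone_of_def chains_def)
   hence g: "g : cone_of (chains S)" using c0 cone_of_nonneg[OF f(1)] by (auto simp: cone_of_def g_def)
   have "rem g A = f" using fA0 by (auto simp: rem_def g_def)
   have "?ae g = x"
   proof
    fix j show "?ae g j = x j"
     using split[OF AS, of g j] \<open>rem g A = f\<close> f by (simp add: y_def g_def)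
   qed
   thus ?thesis using g by blast
  qed
 qed
 show ?thesis unfolding fan_def bij_betw_def inj_on_def image_def
  using abstract_complex_chains[OF finS] inj into onto by blast
qed

section \<open>Common refinements and PL homeomorphism\<close>

text \<open>The fibre product \<open>Z\<close> of the two cones over \<open>T\<close> meets the
  hypotheses of \<open>barycentric_fan\<close>, and its projections to both cones are bijective
  because both fans parametrise \<open>T\<close>.\<close>

lemma fan_common_refinement:
 fixes K :: "'v set set" and L :: "'w set set"
 assumes K: "fan K \<phi> T" and L: "fan L \<psi> T"
 obtains Q :: "nat set set" and \<eta> \<omega> where "fan Q \<eta> (cone_of K)" "fan Q \<omega> (cone_of L)"
proof -
 have aK: "abstract_complex K" and aL: "abstract_complex L" using K L by (auto simp: fan_def)
 define Z where "Z = {h :: 'v + 'w => real. h o Inl : cone_of K & h o Inr : cone_of L \<and>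
   aff K \<phi> (h o Inl) = aff L \<psi> (h o Inr)}"
 define S where "S = supp ` Z - {{}}"
 define p where "p A = (SOME x. x : Z & supp x = A)" for A
 have p: "p A : Z & supp (p A) = A" if "A : S" for A
 proof -
  have "\<exists>x. x : Z & supp x = A" using that S_def by auto
  thus ?thesis unfolding p_def by (rule someI_ex)
 qed
 have sub: "supp (h o Inl) <= supp (g o Inl) & supp (h o Inr) <= supp (g o Inr)" if "supp h <= supp g"
  for h g :: "'v + 'w => real"
  using that by auto
 have fanZ: "fan (chains S) p Z"
 proof (rule barycentric_fan[where J = "\<Union>K <+> \<Union>L"])
  show "finite (\<Union>K <+> \<Union>L)" using acD(1)[OF aK] acD(1)[OF aL] by simp
  show "(\<forall>j. 0 <= x j) & supp x <= \<Union>K <+> \<Union>L" if x: "x : Z" for x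
  proof -
   have i: "x o Inl : cone_of K" "x o Inr : cone_of L" using x by (auto simp: Z_def)
   have "0 <= x j & (x j ~= 0 --> j : \<Union>K <+> \<Union>L)" for j
   proof (cases j)
    case (Inl v)
    thus ?thesis using cone_of_nonneg[OF i(1), of v] cone_of_supp[OF i(1)] by auto
   next
    case (Inr v)
    thus ?thesis using cone_of_nonneg[OF i(2), of v] cone_of_supp[OF i(2)] by auto
   qed
   thus ?thesis by blast
  qed
  show "(%_. 0) : Z"
   using zero_in_cone[OF aK] zero_in_cone[OF aL] affine_extension_zero[of K \<phi>] affine_extension_zero[of L \<psi>]
   by (simp add: Z_def comp_def)
  show "(%j. a * x j + b * y j) : Z" if xy: "x : Z" "y : Z" "supp y <= supp x" "\<And>j. 0 <= a * x j + b * y j" for x y a b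
  proof -
   let ?z = "%j. a * x j + b * y j"
   have s: "supp ?z <= supp x" using xy(3) by auto
   have c: "x o Inl : cone_of K" "x o Inr : cone_of L" using xy by (auto simp: Z_def)
   have "?z o Inl : cone_of K" "?z o Inr : cone_of L"
    using acD(3)[OF aK, of "supp (x o Inl)" "supp (?z o Inl)"]
     acD(3)[OF aL, of "supp (x o Inr)" "supp (?z o Inr)"] sub[OF s] c xy(4)
    by (auto simp: cone_of_def)
   moreover have "aff K \<phi> (?z o Inl) = aff L \<psi> (?z o Inr)"
    using xy(1,2) affine_extension_add[of K \<phi> a "x o Inl" b "y o Inl"]
     affine_extension_add[of L \<psi> a "x o Inr" b "y o Inr"]
    by (intro ext) (simp add: Z_def comp_def)
   ultimately show ?thesis by (simp add: Z_def)
  qed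
 qed (auto simp: S_def p[unfolded S_def])
 have aS: "abstract_complex (chains S)" using fanZ by (simp add: fan_def)
 have bL: "bij_betw (%h. h o Inl) Z (cone_of K)" and bR: "bij_betw (%h. h o Inr) Z (cone_of L)"
 proof -
  have injK: "\<And>f g. [|f : cone_of K; g : cone_of K; aff K \<phi> f = aff K \<phi> g|] ==> f = g"
   and injL: "\<And>f g. [|f : cone_of L; g : cone_of L; aff L \<psi> f = aff L \<psi> g|] ==> f = g"
   and imK: "aff K \<phi> ` cone_of K = T" and imL: "aff L \<psi> ` cone_of L = T"
   using K L unfolding fan_def bij_betw_def inj_on_def by blast+
  have glue: "h = g" if "h o Inl = g o Inl" "h o Inr = g o Inr" for h g :: "'v + 'w => real"
  proof
   fix j show "h j = g j" using fun_cong[OF that(1)] fun_cong[OF that(2)] by (cases j) auto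
  qed
  have eq: "h o Inl = g o Inl <-> h o Inr = g o Inr" if "h : Z" "g : Z" for h g
   using that injK injL unfolding Z_def by (metis (mono_tags, lifting) mem_Collect_eq)
  have ex: "\<exists>h\<in>Z. h o Inl = f & h o Inr = g"
   if "f : cone_of K" "g : cone_of L" "aff K \<phi> f = aff L \<psi> g" for f g
  proof -
   have "case_sum f g o Inl = f" "case_sum f g o Inr = g" by auto
   thus ?thesis using that by (intro bexI[of _ "case_sum f g"]) (auto simp: Z_def)
  qed
  show "bij_betw (%h. h o Inl) Z (cone_of K)"
   unfolding bij_betw_def
  proof (intro conjI inj_onI equalityI subsetI)
   fix f assume f: "f : cone_of K"
   hence "aff K \<phi> f : aff L \<psi> ` cone_of L" using imK imL by blast
   then obtain g where "g : cone_of L" "aff K \<phi> f = aff L \<psi> g" by blast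
   then obtain h where "h : Z" "h o Inl = f" using ex[OF f] by metis
   thus "f : (%h. h o Inl) ` Z" by blast
  next
   fix x y assume "x : Z" "y : Z" "x o Inl = y o Inl"
   thus "x = y" using glue eq by blast
  qed (auto simp: Z_def)
  show "bij_betw (%h. h o Inr) Z (cone_of L)"
   unfolding bij_betw_def
  proof (intro conjI inj_onI equalityI subsetI)
   fix f assume f: "f : cone_of L"
   hence "aff L \<psi> f : aff K \<phi> ` cone_of K" using imK imL by blast
   then obtain g where "g : cone_of K" "aff L \<psi> f = aff K \<phi> g" by blast
   then obtain h where "h : Z" "h o Inr = f" using ex[OF _ f] by metis
   thus "f : (%h. h o Inr) ` Z" by blast
  next
   fix x y assume "x : Z" "y : Z" "x o Inr = y o Inr"
   thus "x = y" using glue eq by blast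
  qed (auto simp: Z_def)
 qed
 have "aff (chains S) (%A. p A o Inl) = (%h. h o Inl) o aff (chains S) p"
  "aff (chains S) (%A. p A o Inr) = (%h. h o Inr) o aff (chains S) p"
  by (auto simp: affine_extension_def fun_eq_iff)
 hence f1: "fan (chains S) (%A. p A o Inl) (cone_of K)" "fan (chains S) (%A. p A o Inr) (cone_of L)"
  using fanZ bij_betw_trans[OF _ bL] bij_betw_trans[OF _ bR] by (auto simp: fan_def)
 obtain h :: "('v + 'w) set => nat" where "inj_on h (\<Union>(chains S))"
  using finite_imp_inj_to_nat_seg[OF acD(1)[OF aS]] by blast
 thus thesis using that fan_relabel[OF f1(1)] fan_relabel[OF f1(2)] by blast
qed

lemma PL_homeomorphic_fans:
 fixes Q :: "nat set set"
 assumes "fan Q \<eta> (cone_of K)" "fan Q \<omega> (cone_of L)" "abstract_complex K" "abstract_complex L"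
 shows "PL_homeomorphic K L"
 unfolding PL_homeomorphic_def using fan_subdivision[OF assms(1,3)] fan_subdivision[OF assms(2,4)] by blast

definition EU :: "nat => (nat => real) set" where
 "EU d = {k. \<forall>i\<ge>d. k i = 0}"

text \<open>The boundary of the simplex is the complete fan spanned by the unit vectors and the negative of
 their sum.\<close>

lemma fan_simplex_boundary:
 "fan (simplex_boundary d) (%i j. if i = d then (if j < d then -1 else 0) else if i = j then 1 else 0) (EU d)"
proof -
 let ?K = "simplex_boundary d"
 let ?\<phi> = "%i j. if i = d then (if j < d then -1 else 0) else if i = j then 1 else (0::real)"
 show ?thesis
 proof (cases "d = 0")
  case True
  hence "?K = {{}}" by (auto simp: simplex_boundary_def)
  moreover have "cone_of {{} :: nat set} = {%_. 0}" by (auto simp: cone_of_def)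
  moreover have "EU d = {%_. 0}" using True by (auto simp: EU_def)
  ultimately show ?thesis by (simp add: fan_def abstract_complex_def affine_extension_def)
 next
  case False
  have U: "\<Union>?K = {..d}"
  proof
   show "{..d} <= \<Union>?K"
   proof
    fix i assume "i : {..d}"
    moreover have "{i} ~= {..d}" using False by (metis atMost_iff le0 order_refl singletonD)
    ultimately have "{i} : ?K" by (auto simp: simplex_boundary_def)
    thus "i : \<Union>?K" by blast
   qed
  qed (auto simp: simplex_boundary_def)
  have a: "abstract_complex ?K" unfolding abstract_complex_def U by (auto simp: simplex_boundary_def)
  have ae: "aff ?K ?\<phi> f j = (if j < d then f j - f d else 0)" for f j
  proof -
   have "{..d} = insert d {..<d}" by auto
   hence "aff ?K ?\<phi> f j = f d * ?\<phi> d j + (\<Sum>i<d. f i * ?\<phi> i j)"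
    by (simp add: affine_extension_def U)
   also have "(\<Sum>i<d. f i * ?\<phi> i j) = (\<Sum>i<d. if i = j then f j else 0)" by (rule sum.cong) auto
   also have "\<dots> = (if j < d then f j else 0)" by (simp add: sum.delta)
   finally show ?thesis by auto
  qed
  have cone: "f : cone_of ?K <-> (\<forall>i. 0 <= f i) & (\<forall>i>d. f i = 0) & (\<exists>i\<le>d. f i = 0)" for f
   by (auto simp: cone_of_def simplex_boundary_def psubset_eq subset_iff not_le) (metis not_le)
  have "bij_betw (aff ?K ?\<phi>) (cone_of ?K) (EU d)"
   unfolding bij_betw_def
  proof (intro conjI inj_onI equalityI subsetI)
   fix f g assume fg: "f : cone_of ?K" "g : cone_of ?K" "aff ?K ?\<phi> f = aff ?K ?\<phi> g"
   have d: "f j - f d = g j - g d" if "j < d" for j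
    using fun_cong[OF fg(3), of j] that ae by simp
   have d': "f j - f d = g j - g d" if "j <= d" for j using d[of j] that by (cases "j = d") auto
   obtain i k where "i <= d" "f i = 0" "k <= d" "g k = 0" using fg cone by blast
   hence "f d = g d" using d'[of i] d'[of k] fg cone by (smt (verit))
   show "f = g"
   proof
    fix j show "f j = g j"
     using d'[of j] \<open>f d = g d\<close> fg cone by (cases "j <= d") auto
   qed
  next
   fix k assume k: "k : EU d"
   define m where "m = Min (k ` {..d})"
   have "m : k ` {..d}" unfolding m_def by (rule Min_in) auto
   then obtain i where i: "i <= d" "m = k i" by auto
   have mle: "m <= k j" if "j <= d" for j unfolding m_def using that by (intro Min_le) auto
   define f where "f = (%j. if j <= d then k j - m else 0)"
   have "f : cone_of ?K" using cone i mle by (auto simp: f_def)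
   moreover have "aff ?K ?\<phi> f = k"
    using k by (intro ext) (auto simp: ae f_def EU_def)
   ultimately show "k : aff ?K ?\<phi> ` cone_of ?K" by blast
  qed (auto simp: ae EU_def)
  thus ?thesis using a by (simp add: fan_def)
 qed
qed

text \<open>A homogeneous PL isomorphism between \<open>T\<close> and Euclidean d-space: one complex
  spans fans of both.\<close>

definition PLR :: "nat => ('v => real) set => bool" where
 "PLR d T <-> (\<exists>(L :: nat set set) \<phi> \<psi>. fan L \<phi> T & fan L \<psi> (EU d))"

text \<open>Two common refinements in succession: one over \<open>T\<close>, one over
  \<open>EU d\<close>, which carries the fan of the boundary of the simplex.\<close>

lemma PLR_fan_sphere:
 assumes "fan K \<phi> T" "PLR d T" shows "PL_homeomorphic K (simplex_boundary d)"
proof -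
 obtain L :: "nat set set" and \<phi>' \<psi> where L: "fan L \<phi>' T" "fan L \<psi> (EU d)" using assms(2) by (auto simp: PLR_def)
 obtain Q :: "nat set set" and \<eta> \<omega> where Q: "fan Q \<eta> (cone_of K)" "fan Q \<omega> (cone_of L)"
  using fan_common_refinement[OF assms(1) L(1)] .
 obtain Q' :: "nat set set" and \<eta>' \<omega>' where Q': "fan Q' \<eta>' (cone_of Q)" "fan Q' \<omega>' (cone_of (simplex_boundary d))"
  using fan_common_refinement[OF fan_compose[OF Q(2) L(2)] fan_simplex_boundary] .
 have "abstract_complex K" "abstract_complex (simplex_boundary d)"
  using assms(1) fan_simplex_boundary[of d] by (auto simp: fan_def)
 thus ?thesis using PL_homeomorphic_fans[OF fan_compose[OF Q'(1) Q(1)] Q'(2)] by blast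
qed

text \<open>Composition with the fan of the simplex boundary turns a common subdivision with the
  standard sphere into a fan of Euclidean space.\<close>

lemma PL_sphere_fans:
 assumes "PL_homeomorphic K (simplex_boundary d)" "abstract_complex K"
 obtains M :: "nat set set" and \<phi> \<psi> where "fan M \<phi> (cone_of K)" "fan M \<psi> (EU d)"
proof -
 obtain M :: "nat set set" and \<phi> \<psi> where M: "is_subdivision M \<phi> K" "is_subdivision M \<psi> (simplex_boundary d)"
  using assms(1) by (auto simp: PL_homeomorphic_def)
 have "abstract_complex (simplex_boundary d)" using fan_simplex_boundary[of d] by (simp add: fan_def)
 hence "fan M \<psi> (cone_of (simplex_boundary d))" using subdivision_fan M by blast
 thus thesis using that subdivision_fan[OF M(1) assms(2)] fan_compose fan_simplex_boundary by blast
qed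

section \<open>Tangent cones\<close>

text \<open>The directions in which a point of the cone with support \<sigma> can be left inside the
  cone (\<open>directions_cone_of\<close>).\<close>

definition tcone :: "'v set set => 'v set => ('v => real) set" where
 "tcone K \<sigma> = {g. (\<forall>w. w \<notin> \<sigma> --> 0 <= g w) & supp g Un \<sigma> : K}"

definition directions :: "('v => real) set => ('v => real) => ('v => real) set" where
 "directions C p = {h. \<exists>s0>0. \<forall>s. 0 < s & s <= s0 --> (%v. p v + s * h v) : C}"

lemma cone_of_combine:
 assumes "abstract_complex K" "\<tau> : K" "supp f <= \<tau>" "supp g <= \<tau>" "\<And>v. 0 <= a * f v + b * g v"
 shows "(%v. a * f v + b * g v) : cone_of K"
proof -
 have "supp (%v. a * f v + b * g v) <= \<tau>"
 proof
  fix v assume v: "v : supp (%v. a * f v + b * g v)"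
  show "v : \<tau>"
  proof (rule ccontr)
   assume "v \<notin> \<tau>"
   hence "f v = 0" "g v = 0" using assms(3,4) by blast+
   thus False using v by simp
  qed
 qed
 thus ?thesis using acD(3)[OF assms(1,2)] assms(5) by (auto simp: cone_of_def)
qed

text \<open>A ray that starts at \<open>p\<close> and initially stays in the fan initially stays in one of its simplicial
 cones, which then contains \<open>p\<close>.\<close>

lemma ray_in_fan:
 fixes K :: "'w set set"
 assumes aK: "abstract_complex K" and inj: "inj_on (aff K \<phi>) (cone_of K)"
  and \<alpha>: "\<alpha> : cone_of K" and h: "h : directions (aff K \<phi> ` cone_of K) (aff K \<phi> \<alpha>)"
 shows "\<exists>g\<in>tcone K (supp \<alpha>). aff K \<phi> g = h"
proof -
 let ?A = "aff K \<phi>"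
 let ?p = "?A \<alpha>"
 obtain s0 where s0: "s0 > 0" "\<And>s. 0 < s ==> s <= s0 ==> (%v. ?p v + s * h v) : ?A ` cone_of K"
  using h unfolding directions_def by blast
 define s where "s j = s0 / real (Suc j)" for j
 have s: "0 < s j" "s j <= s0" for j using s0(1) by (auto simp: s_def divide_le_eq)
 have "\<exists>f. f : cone_of K & ?A f = (%v. ?p v + s j * h v)" for j
  using s0(2)[OF s(1)[of j] s(2)[of j]] by (auto simp: image_iff eq_commute)
 then obtain \<beta> where \<beta>: "\<And>j. \<beta> j : cone_of K" "\<And>j. ?A (\<beta> j) = (%v. ?p v + s j * h v)" by metis
 \<comment> \<open>Finitely many simplices: infinitely many of the points p + s j h have preimages
   with one and the same support \<tau>.\<close>
 have "finite ((%j. supp (\<beta> j)) ` UNIV)"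
  by (rule finite_subset[of _ K]) (use acD(6)[OF aK] \<beta>(1) in \<open>auto simp: cone_of_def\<close>)
 then obtain j0 where inf: "infinite {j : UNIV. supp (\<beta> j) = supp (\<beta> j0)}"
  using pigeonhole_infinite[of "UNIV :: nat set"] by blast
 define \<tau> where "\<tau> = supp (\<beta> j0)"
 define I where "I = {j. supp (\<beta> j) = \<tau>}"
 have I: "infinite I" using inf by (simp add: I_def \<tau>_def)
 have \<tau>K: "\<tau> : K" using \<beta>(1)[of j0] by (simp add: \<tau>_def cone_of_def)
 obtain i where i: "i : I" using I by (metis finite.emptyI all_not_in_conv)
 obtain j where j: "j : I" "i < j" using I by (meson infinite_nat_iff_unbounded)
 have sij: "s j < s i" using j(2) s0(1) by (simp add: s_def frac_less2)
 have nn: "0 <= \<beta> k w" for k w using cone_of_nonneg[OF \<beta>(1)] .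
 \<comment> \<open>Extrapolating the preimages at the times s i and s j to time 0 has to give
   non-negative coordinates. Otherwise the defect e would be at most s k times \<beta> i w for
   further times s k of the same family, and these tend to 0.\<close>
 have le: "s j * \<beta> i w <= s i * \<beta> j w" for w
 proof (rule ccontr)
  assume "~ ?thesis"
  hence e: "s j * \<beta> i w - s i * \<beta> j w > 0" by simp
  define e where "e = s j * \<beta> i w - s i * \<beta> j w"
  obtain N :: nat where N: "s0 * \<beta> i w / e < real N" using reals_Archimedean2 by blast
  obtain k where k: "k : I" "max j N < k" using I by (meson infinite_nat_iff_unbounded)
  have sk: "s k < s j" using k s0(1) by (simp add: s_def frac_less2)
  define t where "t = (s j - s k) / (s i - s k)"
  have t: "0 <= t" "t <= 1" using sk sij by (auto simp: t_def)
  have tt: "t * s i + (1 - t) * s k = s j"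
  proof -
   have "t * (s i - s k) = s j - s k" using sk sij by (simp add: t_def)
   thus ?thesis by (simp add: algebra_simps)
  qed
  have "(%v. t * \<beta> i v + (1 - t) * \<beta> k v) : cone_of K"
   using i k t nn by (intro cone_of_combine[OF aK \<tau>K]) (auto simp: I_def)
  moreover have "?A (%v. t * \<beta> i v + (1 - t) * \<beta> k v) = ?A (\<beta> j)"
  proof
   fix v
   have "?A (%v. t * \<beta> i v + (1 - t) * \<beta> k v) v = t * (?p v + s i * h v) + (1 - t) * (?p v + s k * h v)"
    by (simp add: affine_extension_add \<beta>(2))
   also have "\<dots> = ?p v + (t * s i + (1 - t) * s k) * h v" by (simp add: algebra_simps)
   finally show "?A (%v. t * \<beta> i v + (1 - t) * \<beta> k v) v = ?A (\<beta> j) v" by (simp add: tt \<beta>(2))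
  qed
  ultimately have "(%v. t * \<beta> i v + (1 - t) * \<beta> k v) = \<beta> j" using inj \<beta>(1) unfolding inj_on_def by blast
  hence "\<beta> j w = t * \<beta> i w + (1 - t) * \<beta> k w" by metis
  hence "t * \<beta> i w <= \<beta> j w" using t nn[of k w] by simp
  hence "(s i - s k) * (t * \<beta> i w) <= (s i - s k) * \<beta> j w" using sk sij by (intro mult_left_mono) auto
  moreover have "(s i - s k) * (t * \<beta> i w) = (s j - s k) * \<beta> i w" using sk sij by (simp add: t_def)
  ultimately have "(s j - s k) * \<beta> i w <= (s i - s k) * \<beta> j w" by simp
  moreover have "0 <= s k * \<beta> j w" using s(1)[of k] nn by simp
  ultimately have "e <= s k * \<beta> i w" by (simp add: e_def algebra_simps)
  also have "\<dots> = s0 * \<beta> i w / real (Suc k)" by (simp add: s_def)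
  finally have "real (Suc k) * e <= s0 * \<beta> i w" by (simp add: pos_le_divide_eq mult.commute)
  moreover have "s0 * \<beta> i w < real N * e" using N e by (simp add: e_def pos_divide_less_eq)
  moreover have "real N * e <= real (Suc k) * e" using k e by (intro mult_right_mono) (auto simp: e_def)
  ultimately show False by simp
 qed
 define c where "c = 1 / (s i - s j)"
 have c: "c > 0" "c * (s i - s j) = 1" using sij by (auto simp: c_def)
 define \<beta>0 where "\<beta>0 = (%v. (c * s i) * \<beta> j v + (- c * s j) * \<beta> i v)"
 have "0 <= (c * s i) * \<beta> j v + (- c * s j) * \<beta> i v" for v
  using mult_left_mono[OF le[of v], of c] c(1) by (simp add: mult.assoc)
 hence "\<beta>0 : cone_of K" unfolding \<beta>0_def using i j
  by (intro cone_of_combine[OF aK \<tau>K]) (auto simp: I_def)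
 moreover have "?A \<beta>0 = ?p"
 proof
  fix v
  have "?A \<beta>0 v = (c * s i) * (?p v + s j * h v) + (- c * s j) * (?p v + s i * h v)"
   unfolding \<beta>0_def by (simp only: affine_extension_add \<beta>(2))
  also have "\<dots> = (c * (s i - s j)) * ?p v" by (simp add: algebra_simps)
  finally show "?A \<beta>0 v = ?p v" using c by simp
 qed
 ultimately have \<alpha>0: "\<alpha> = \<beta>0" using inj \<alpha> unfolding inj_on_def by metis
 have \<alpha>\<tau>: "supp \<alpha> <= \<tau>"
 proof
  fix v assume v: "v : supp \<alpha>"
  show "v : \<tau>"
  proof (rule ccontr)
   assume "v \<notin> \<tau>"
   hence "\<beta> i v = 0" "\<beta> j v = 0" using i j unfolding I_def by blast+
   thus False using v unfolding \<alpha>0 \<beta>0_def by simp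
  qed
 qed
 define g where "g = (%v. (1 / s i) * \<beta> i v + (- 1 / s i) * \<alpha> v)"
 have "supp g <= \<tau>"
 proof
  fix v assume v: "v : supp g"
  show "v : \<tau>"
  proof (rule ccontr)
   assume "v \<notin> \<tau>"
   hence "\<beta> i v = 0" "\<alpha> v = 0" using i \<alpha>\<tau> unfolding I_def by blast+
   thus False using v by (simp add: g_def)
  qed
 qed
 hence "supp g Un supp \<alpha> : K" using \<alpha>\<tau> acD(3)[OF aK \<tau>K] by simp
 moreover have "0 <= g w" if "w \<notin> supp \<alpha>" for w using that nn[of i w] s(1)[of i] by (simp add: g_def)
 moreover have "?A g = h"
 proof
  fix v
  have "?A g v = (1 / s i) * (?p v + s i * h v) + (- 1 / s i) * ?p v"
   unfolding g_def by (simp only: affine_extension_add \<beta>(2))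
  thus "?A g v = h v" using s(1)[of i] by (simp add: field_simps)
 qed
 ultimately show ?thesis by (auto simp: tcone_def)
qed

lemma small_scale:
 assumes "finite (\<sigma> :: 'v set)" "\<And>v. v : \<sigma> ==> 0 < \<alpha> v"
 obtains s0 where "s0 > (0::real)" "\<And>s v. [|0 < s; s <= s0; v : \<sigma>|] ==> 0 < \<alpha> v + s * (g v :: real)"
proof -
 have "\<exists>s0>0. \<forall>s v. 0 < s & s <= s0 & v : \<sigma> --> 0 < \<alpha> v + s * g v"
  using assms
 proof (induction \<sigma>)
  case empty
  show ?case by (intro exI[of _ 1]) auto
 next
  case (insert x \<sigma>)
  then obtain s0 where s0: "s0 > 0" "\<forall>s v. 0 < s & s <= s0 & v : \<sigma> --> 0 < \<alpha> v + s * g v" by auto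
  define s1 where "s1 = min s0 (\<alpha> x / (2 * (\<bar>g x\<bar> + 1)))"
  have "s1 > 0" using s0 insert.prems[of x] by (simp add: s1_def)
  moreover have "0 < \<alpha> x + s * g x" if "0 < s" "s <= s1" for s
  proof -
   have "s * (2 * (\<bar>g x\<bar> + 1)) <= \<alpha> x" using that by (simp add: s1_def pos_le_divide_eq)
   moreover have "s * \<bar>g x\<bar> \<ge> - (s * g x)" using that by (metis abs_ge_minus_self abs_mult abs_of_pos)
   moreover have "s * (2 * (\<bar>g x\<bar> + 1)) = 2 * s + 2 * (s * \<bar>g x\<bar>)" by (simp add: algebra_simps)
   moreover have "0 <= s * \<bar>g x\<bar>" using that by simp
   ultimately show ?thesis using that by linarith
  qed
  ultimately show ?case using s0 by (intro exI[of _ s1]) (auto simp: s1_def)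
 qed
 thus thesis using that by blast
qed

lemma tcone_step:
 assumes aK: "abstract_complex K" and \<alpha>: "\<alpha> : cone_of K" and g: "g : tcone K (supp \<alpha>)"
 obtains s0 where "s0 > 0" "\<And>s. [|0 < s; s <= s0|] ==> (%v. \<alpha> v + s * g v) : cone_of K"
proof -
 have \<sigma>: "supp g Un supp \<alpha> : K" and off: "\<And>w. w \<notin> supp \<alpha> ==> 0 <= g w" using g by (auto simp: tcone_def)
 have "finite (supp \<alpha>)" using acD(4)[OF aK \<sigma>] by simp
 moreover have "0 < \<alpha> v" if "v : supp \<alpha>" for v using that cone_of_nonneg[OF \<alpha>, of v] by simp
 ultimately obtain s0 where s0: "s0 > 0" "\<And>s v. [|0 < s; s <= s0; v : supp \<alpha>|] ==> 0 < \<alpha> v + s * g v"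
  using small_scale[of "supp \<alpha>" \<alpha> g] by blast
 have "(%v. \<alpha> v + s * g v) : cone_of K" if s: "0 < s" "s <= s0" for s
 proof -
  have "0 <= 1 * \<alpha> v + s * g v" for v
   using s0(2)[OF s, of v] off[of v] s by (cases "v : supp \<alpha>") auto
  hence "(%v. 1 * \<alpha> v + s * g v) : cone_of K" by (intro cone_of_combine[OF aK \<sigma>]) auto
  thus ?thesis by simp
 qed
 thus thesis using that s0(1) by blast
qed

text \<open>A short ray in the cone over \<open>M\<close> maps linearly to a short ray in
  \<open>C\<close>; the converse is \<open>ray_in_fan\<close>.\<close>

lemma tcone_bij:
 assumes f: "fan M \<phi> C" and \<alpha>: "\<alpha> : cone_of M"
 shows "bij_betw (aff M \<phi>) (tcone M (supp \<alpha>)) (directions C (aff M \<phi> \<alpha>))"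
proof -
 let ?A = "aff M \<phi>"
 have aM: "abstract_complex M" and inj: "inj_on ?A (cone_of M)" and im: "?A ` cone_of M = C"
  using f by (auto simp: fan_def bij_betw_def)
 have lin: "?A (%v. \<alpha> v + s * g v) = (%v. ?A \<alpha> v + s * ?A g v)" for s g
  using affine_extension_add[of M \<phi> 1 \<alpha> s g] by (intro ext) simp
 show ?thesis unfolding bij_betw_def
 proof (intro conjI inj_onI equalityI subsetI)
  fix g g' assume g: "g : tcone M (supp \<alpha>)" "g' : tcone M (supp \<alpha>)" "?A g = ?A g'"
  obtain s0 where s0: "s0 > 0" "\<And>s. [|0 < s; s <= s0|] ==> (%v. \<alpha> v + s * g v) : cone_of M"
   using tcone_step[OF aM \<alpha> g(1)] by blast
  obtain s1 where s1: "s1 > 0" "\<And>s. [|0 < s; s <= s1|] ==> (%v. \<alpha> v + s * g' v) : cone_of M"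
   using tcone_step[OF aM \<alpha> g(2)] by blast
  define s where "s = min s0 s1"
  have s: "0 < s" "s <= s0" "s <= s1" using s0 s1 by (auto simp: s_def)
  have "(%v. \<alpha> v + s * g v) = (%v. \<alpha> v + s * g' v)"
   using inj_onD[OF inj _ s0(2)[OF s(1,2)] s1(2)[OF s(1,3)]] lin g(3) by simp
  thus "g = g'" using s(1) by (intro ext) (metis add_left_cancel less_irrefl mult_left_cancel)
 next
  fix h assume "h : ?A ` tcone M (supp \<alpha>)"
  then obtain g where g: "g : tcone M (supp \<alpha>)" "h = ?A g" by blast
  obtain s0 where s0: "s0 > 0" "\<And>s. [|0 < s; s <= s0|] ==> (%v. \<alpha> v + s * g v) : cone_of M"
   using tcone_step[OF aM \<alpha> g(1)] by blast
  have "(%v. ?A \<alpha> v + s * h v) : C" if "0 < s" "s <= s0" for s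
   using s0(2)[OF that] lin[of s g] im g(2) by (metis imageI)
  thus "h : directions C (?A \<alpha>)" using s0(1) by (auto simp: directions_def)
 next
  fix h assume "h : directions C (?A \<alpha>)"
  then obtain g where "g : tcone M (supp \<alpha>)" "?A g = h"
   using ray_in_fan[OF aM inj \<alpha>, of h] im by blast
  thus "h : ?A ` tcone M (supp \<alpha>)" by blast
 qed
qed

lemma directions_cone_of:
 assumes aK: "abstract_complex K" and p: "p : cone_of K"
 shows "directions (cone_of K) p = tcone K (supp p)"
proof (intro equalityI subsetI)
 fix h assume "h : tcone K (supp p)"
 then obtain s0 where "s0 > 0" "\<And>s. [|0 < s; s <= s0|] ==> (%v. p v + s * h v) : cone_of K"
  using tcone_step[OF aK p] by blast
 thus "h : directions (cone_of K) p" by (auto simp: directions_def)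
next
 fix h assume "h : directions (cone_of K) p"
 then obtain s0 where s0: "s0 > 0" "\<And>s. 0 < s ==> s <= s0 ==> (%v. p v + s * h v) : cone_of K"
  unfolding directions_def by blast
 have "finite (supp p)" using p acD(4)[OF aK] by (auto simp: cone_of_def)
 moreover have "0 < p v" if "v : supp p" for v using that cone_of_nonneg[OF p, of v] by simp
 ultimately obtain s1 where s1: "s1 > 0" "\<And>s v. [|0 < s; s <= s1; v : supp p|] ==> 0 < p v + s * h v"
  using small_scale[of "supp p" p h] by blast
 define s where "s = min s0 s1"
 have s: "0 < s" "s <= s0" "s <= s1" using s0 s1 by (auto simp: s_def)
 have c: "(%v. p v + s * h v) : cone_of K" by (rule s0(2)[OF s(1,2)])
 have "supp h Un supp p <= supp (%v. p v + s * h v)"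
 proof
  fix v assume "v : supp h Un supp p"
  thus "v : supp (%v. p v + s * h v)" using s1(2)[OF s(1,3), of v] s(1) by (cases "v : supp p") auto
 qed
 hence "supp h Un supp p : K" using c acD(3)[OF aK] by (auto simp: cone_of_def)
 moreover have "0 <= h w" if "w \<notin> supp p" for w
  using cone_of_nonneg[OF c, of w] that s(1) by (simp add: zero_le_mult_iff)
 ultimately show "h : tcone K (supp p)" by (auto simp: tcone_def)
qed

text \<open>The complex of a fan for \<open>tcone\<close>: coordinates in \<sigma> take both signs
  and contribute two opposite rays, never in one simplex; the other coordinates contribute the
  positive ray only.\<close>

definition signed_star :: "'w set set => 'w set => (bool \<times> 'w) set set" where
 "signed_star K \<sigma> = {\<rho>. snd ` \<rho> Un \<sigma> : K & (\<forall>w. ~ ((True, w) : \<rho> & (False, w) : \<rho>)) \<and>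
   (\<forall>w. (False, w) : \<rho> --> w : \<sigma>)}"

lemma fan_signed_star:
 fixes K :: "'w set set"
 assumes aK: "abstract_complex K" and \<sigma>: "\<sigma> : K" and bij: "bij_betw (aff K \<phi>) (tcone K \<sigma>) T"
 shows "fan (signed_star K \<sigma>) (%(b, w) v. if b then \<phi> w v else - \<phi> w v) T"
proof -
 let ?L = "signed_star K \<sigma>"
 define D where "D f = (%w. f (True, w) - f (False, w))" for f :: "bool \<times> 'w => real"
 have sub: "\<rho> <= UNIV \<times> \<Union>K" if "\<rho> : ?L" for \<rho>
 proof -
  have "snd ` \<rho> <= \<Union>K" using that by (auto simp: signed_star_def)
  hence "snd x : \<Union>K" if "x : \<rho>" for x using that by blast
  thus ?thesis by (metis SigmaI UNIV_I prod.collapse subsetI)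
 qed
 have finK: "finite (\<Union>K)" by (rule acD(1)[OF aK])
 have aL: "abstract_complex ?L"
  unfolding abstract_complex_def
 proof (intro conjI ballI allI impI)
  show "finite (\<Union>?L)" by (rule finite_subset[of _ "UNIV \<times> \<Union>K"]) (use sub finK in auto)
  show "{} : ?L" using \<sigma> by (auto simp: signed_star_def)
  show "\<rho>' : ?L" if "\<rho> : ?L" "\<rho>' <= \<rho>" for \<rho> \<rho>'
   using that acD(3)[OF aK, of "snd ` \<rho> Un \<sigma>" "snd ` \<rho>' Un \<sigma>"]
   by (auto simp: signed_star_def)
 qed
 have ae: "aff ?L (%(b, w) v. if b then \<phi> w v else - \<phi> w v) f = aff K \<phi> (D f)"
  if f: "f : cone_of ?L" for f
 proof
  fix v
  have fin: "finite ((UNIV :: bool set) \<times> \<Union>K)" using finK by simp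
  have "aff ?L (%(b, w) v. if b then \<phi> w v else - \<phi> w v) f v
    = (\<Sum>x\<in>UNIV \<times> \<Union>K. f x * (if fst x then \<phi> (snd x) v else - \<phi> (snd x) v))"
   unfolding affine_extension_def
   by (rule sum.mono_neutral_cong_left) (use fin sub cone_of_supp[OF f] in \<open>auto simp: case_prod_beta\<close>)
  also have "\<dots> = (\<Sum>(b, w)\<in>UNIV \<times> \<Union>K. f (b, w) * (if b then \<phi> w v else - \<phi> w v))"
   by (simp add: case_prod_beta)
  also have "\<dots> = (\<Sum>b\<in>UNIV. \<Sum>w\<in>\<Union>K. f (b, w) * (if b then \<phi> w v else - \<phi> w v))"
   by (rule sum.cartesian_product[symmetric])
  also have "\<dots> = (\<Sum>w\<in>\<Union>K. f (True, w) * \<phi> w v + f (False, w) * - \<phi> w v)"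
   by (simp add: UNIV_bool sum.distrib[symmetric] add.commute)
  finally show "aff ?L (%(b, w) v. if b then \<phi> w v else - \<phi> w v) f v = aff K \<phi> (D f) v"
   by (simp add: affine_extension_def D_def algebra_simps)
 qed
 have "bij_betw D (cone_of ?L) (tcone K \<sigma>)"
 proof (rule bij_betw_byWitness[where f' = "%g (b, w). if b then max (g w) 0 else max (- g w) 0"])
  show "\<forall>f\<in>cone_of ?L. (%(b, w). if b then max (D f w) 0 else max (- D f w) 0) = f"
  proof (intro ballI ext)
   fix f and x :: "bool \<times> 'w" assume f: "f : cone_of ?L"
   obtain b w where x: "x = (b, w)" by (cases x)
   have "f (True, w) = 0 | f (False, w) = 0" using f by (auto simp: cone_of_def signed_star_def)
   thus "(case x of (b, w) => if b then max (D f w) 0 else max (- D f w) 0) = f x"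
    using cone_of_nonneg[OF f, of "(True, w)"] cone_of_nonneg[OF f, of "(False, w)"] x
    by (cases b) (auto simp: D_def)
  qed
  show "\<forall>g\<in>tcone K \<sigma>. D (%(b, w). if b then max (g w) 0 else max (- g w) 0) = g"
   by (auto simp: D_def max_def)
  show "D ` cone_of ?L <= tcone K \<sigma>"
  proof (intro image_subsetI)
   fix f assume f: "f : cone_of ?L"
   have s: "snd ` supp f Un \<sigma> : K" using f by (auto simp: cone_of_def signed_star_def)
   have "supp (D f) <= snd ` supp f"
   proof
    fix w assume "w : supp (D f)"
    hence "(True, w) : supp f | (False, w) : supp f" by (auto simp: D_def)
    thus "w : snd ` supp f" by force
   qed
   hence "supp (D f) Un \<sigma> <= snd ` supp f Un \<sigma>" by blast
   hence "supp (D f) Un \<sigma> : K" by (rule acD(3)[OF aK s])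
   moreover have "0 <= D f w" if "w \<notin> \<sigma>" for w
   proof -
    have "f (False, w) = 0" using f that by (auto simp: cone_of_def signed_star_def)
    thus ?thesis using cone_of_nonneg[OF f] by (simp add: D_def)
   qed
   ultimately show "D f : tcone K \<sigma>" by (simp add: tcone_def)
  qed
  show "(%g (b, w). if b then max (g w) 0 else max (- g w) 0) ` tcone K \<sigma> <= cone_of ?L"
  proof (intro image_subsetI)
   fix g assume g: "g : tcone K \<sigma>"
   let ?f = "%(b, w). if b then max (g w) 0 else max (- g w) 0"
   have "snd ` supp ?f <= supp g" by (auto simp: max_def split: if_splits)
   hence "snd ` supp ?f Un \<sigma> <= supp g Un \<sigma>" by blast
   moreover have "supp g Un \<sigma> : K" using g by (simp add: tcone_def)
   ultimately have "snd ` supp ?f Un \<sigma> : K" using acD(3)[OF aK] by blast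
   moreover have "w : \<sigma>" if "(False, w) : supp ?f" for w
   proof (rule ccontr)
    assume "w \<notin> \<sigma>" hence "0 <= g w" using g by (simp add: tcone_def)
    thus False using that by (auto simp: max_def split: if_splits)
   qed
   moreover have "~ ((True, w) : supp ?f & (False, w) : supp ?f)" for w by (auto simp: max_def)
   ultimately have "supp ?f : ?L" unfolding signed_star_def by blast
   thus "?f : cone_of ?L" by (auto simp: cone_of_def)
  qed
 qed
 hence "bij_betw (aff K \<phi> o D) (cone_of ?L) T" using bij bij_betw_trans by blast
 hence "bij_betw (aff ?L (%(b, w) v. if b then \<phi> w v else - \<phi> w v)) (cone_of ?L) T"
  by (rule iffD1[OF bij_betw_cong, rotated]) (use ae in simp)
 thus ?thesis using aL by (simp add: fan_def)
qed

lemma PLR_I: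
 assumes "fan L \<phi> T" "fan L \<psi> (EU d)" shows "PLR d T"
proof -
 have "abstract_complex L" using assms by (simp add: fan_def)
 then obtain h :: "'a => nat" where "inj_on h (\<Union>L)"
  by (metis acD(1) finite_imp_inj_to_nat_seg)
 thus ?thesis unfolding PLR_def using fan_relabel[OF assms(1)] fan_relabel[OF assms(2)] by blast
qed

lemma EU_directions: "p : EU d ==> directions (EU d) p = EU d"
proof (intro equalityI subsetI)
 fix h assume p: "p : EU d" and "h : directions (EU d) p"
 then obtain s where s: "s > 0" "(%v. p v + s * h v) : EU d" unfolding directions_def by blast
 thus "h : EU d" using p by (auto simp: EU_def)
qed (auto simp: EU_def directions_def intro!: exI[of _ "1::real"])

text \<open>A common fan of the cone over \<open>K\<close> and of Euclidean space induces a common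
  fan of the tangent cones at corresponding points, and the tangent cone of Euclidean space is the
  whole space.\<close>

theorem PLR_tcone_sphere:
 assumes "PL_homeomorphic K (simplex_boundary d)" and aK: "abstract_complex K" and \<rho>: "\<rho> : K"
 shows "PLR d (tcone K \<rho>)"
proof -
 obtain M :: "nat set set" and \<phi> \<psi> where M: "fan M \<phi> (cone_of K)" "fan M \<psi> (EU d)"
  using PL_sphere_fans[OF assms(1,2)] .
 have aM: "abstract_complex M" using M by (simp add: fan_def)
 define p where "p = (%v. if v : \<rho> then 1 else 0::real)"
 have p: "p : cone_of K" "supp p = \<rho>" using \<rho> by (auto simp: p_def cone_of_def)
 hence "p : aff M \<phi> ` cone_of M" using M(1) by (simp add: fan_def bij_betw_def)
 then obtain \<alpha> where \<alpha>: "\<alpha> : cone_of M" "aff M \<phi> \<alpha> = p" by blast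
 have \<sigma>: "supp \<alpha> : M" using \<alpha> by (simp add: cone_of_def)
 have "aff M \<psi> \<alpha> : EU d" using M(2) \<alpha> bij_betwE unfolding fan_def by blast
 hence "bij_betw (aff M \<psi>) (tcone M (supp \<alpha>)) (EU d)"
  using tcone_bij[OF M(2) \<alpha>(1)] EU_directions by simp
 moreover have "bij_betw (aff M \<phi>) (tcone M (supp \<alpha>)) (tcone K \<rho>)"
  using tcone_bij[OF M(1) \<alpha>(1)] directions_cone_of[OF aK p(1)] \<alpha> p by simp
 ultimately show ?thesis using PLR_I[OF fan_signed_star[OF aM \<sigma>, of \<phi>] fan_signed_star[OF aM \<sigma>, of \<psi>]] by blast
qed

text \<open>Adds a line as a direct factor by joining with the opposite rays e and -e; the
  coordinate \<open>iz\<close> separates this factor from \<open>T\<close>.\<close>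

lemma fan_suspension:
 fixes L :: "'w set set"
 assumes L: "fan L \<phi> T" and e: "e iz = 1" "\<And>t. t : T ==> t iz = 0"
  and T': "T' = {%v. t v + r * e v |t r. t : T}"
 shows "fan (join_complex S0 L) (case_sum (%b v. if b then e v else - e v) \<phi>) T'"
proof -
 let ?J = "join_complex S0 L" and ?\<psi> = "case_sum (%b v. if b then e v else - e v) \<phi>"
 have aL: "abstract_complex L" using L by (simp add: fan_def)
 have S0: "\<sigma> : S0 <-> \<sigma> = {} | (\<exists>b. \<sigma> = {b})" for \<sigma> :: "bool set" by (auto simp: S0_def discrete_complex_def)
 have J: "\<rho> : ?J <-> Inl -` \<rho> : S0 & Inr -` \<rho> : L" for \<rho>
 proof
  assume "Inl -` \<rho> : S0 & Inr -` \<rho> : L"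
  moreover have "\<rho> = Inl -` \<rho> <+> Inr -` \<rho>"
  proof (intro equalityI subsetI)
   fix x assume "x : \<rho>" thus "x : Inl -` \<rho> <+> Inr -` \<rho>" by (cases x) auto
  qed auto
  ultimately show "\<rho> : ?J" unfolding join_complex_def by blast
 next
  assume "\<rho> : ?J"
  then obtain \<sigma> \<tau> where "\<rho> = \<sigma> <+> \<tau>" "\<sigma> : S0" "\<tau> : L" by (auto simp: join_complex_def)
  moreover have "Inl -` (\<sigma> <+> \<tau>) = \<sigma>" "Inr -` (\<sigma> <+> \<tau>) = \<tau>" by auto
  ultimately show "Inl -` \<rho> : S0 & Inr -` \<rho> : L" by simp
 qed
 have U: "\<Union>?J = UNIV <+> \<Union>L"
 proof (intro equalityI subsetI)
  fix x :: "bool + 'w" assume "x : UNIV <+> \<Union>L"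
  then consider b where "x = Inl b" | w where "x = Inr w" "w : \<Union>L" by auto
  hence "{x} : ?J"
  proof cases
   case 1
   hence "Inl -` {x} = {b}" "Inr -` {x} = {}" by auto
   thus ?thesis using J S0 acD(2)[OF aL] by auto
  next
   case 2
   hence "Inl -` {x} = {}" "Inr -` {x} = {w}" by auto
   thus ?thesis using J S0 acD(5)[OF aL 2(2)] by auto
  qed
  thus "x : \<Union>?J" by blast
 qed (auto simp: join_complex_def)
 have aJ: "abstract_complex ?J"
  unfolding abstract_complex_def
 proof (intro conjI ballI allI impI)
  show "finite (\<Union>?J)" unfolding U using acD(1)[OF aL] by simp
  show "{} : ?J" using J S0 acD(2)[OF aL] by auto
  show "\<rho>' : ?J" if "\<rho> : ?J" "\<rho>' <= \<rho>" for \<rho> \<rho>'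
  proof -
   have "Inl -` \<rho>' <= Inl -` \<rho>" "Inr -` \<rho>' <= Inr -` \<rho>" using that by auto
   moreover have "Inl -` \<rho> : S0" "Inr -` \<rho> : L" using that(1) J by auto
   moreover have "\<tau>' : S0" if "\<tau> : S0" "\<tau>' <= \<tau>" for \<tau> \<tau>' :: "bool set"
    using that unfolding S0 by (metis subset_empty subset_singleton_iff)
   ultimately have "Inl -` \<rho>' : S0" "Inr -` \<rho>' : L"
    using acD(3)[OF aL, of "Inr -` \<rho>"] by blast+
   thus ?thesis using J by blast
  qed
 qed
 have ae: "aff ?J ?\<psi> f = (%v. aff L \<phi> (f o Inr) v + (f (Inl True) - f (Inl False)) * e v)" for f
 proof
  fix v
  have "aff ?J ?\<psi> f v = (\<Sum>b\<in>UNIV. f (Inl b) * (if b then e v else - e v)) + aff L \<phi> (f o Inr) v"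
   unfolding affine_extension_def U using acD(1)[OF aL] by (simp add: sum.Plus)
  thus "aff ?J ?\<psi> f v = aff L \<phi> (f o Inr) v + (f (Inl True) - f (Inl False)) * e v"
   by (simp add: UNIV_bool algebra_simps)
 qed
 have cJ: "f : cone_of ?J <-> f o Inr : cone_of L & 0 <= f (Inl True) & 0 <= f (Inl False) \<and>
   (f (Inl True) = 0 | f (Inl False) = 0)" for f
 proof -
  have nn: "(\<forall>x. 0 <= f x) <-> (\<forall>w. 0 <= f (Inr w)) & 0 <= f (Inl True) & 0 <= f (Inl False)"
   by (metis (full_types) sum.exhaust)
  have "Inr -` supp f = supp (f o Inr)" by auto
  moreover have "Inl -` supp f : S0 <-> f (Inl True) = 0 | f (Inl False) = 0"
  proof -
   have "B = {} | (\<exists>b. B = {b}) <-> ~ (True : B & False : B)" for B :: "bool set"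
   proof -
    have "B : Pow {False, True}" unfolding UNIV_bool[symmetric] by simp
    hence "B = {} | B = {False} | B = {True} | B = {False, True}" by (auto simp: Pow_insert)
    thus ?thesis by auto
   qed
   from this[of "Inl -` supp f"] show ?thesis unfolding S0 by simp
  qed
  ultimately show ?thesis unfolding cone_of_def using nn J[of "supp f"] by auto
 qed
 have bij: "inj_on (aff L \<phi>) (cone_of L)" "aff L \<phi> ` cone_of L = T"
  using L by (auto simp: fan_def bij_betw_def)
 have "bij_betw (aff ?J ?\<psi>) (cone_of ?J) T'"
  unfolding bij_betw_def
 proof (intro conjI inj_onI equalityI subsetI)
  fix f g assume fg: "f : cone_of ?J" "g : cone_of ?J" "aff ?J ?\<psi> f = aff ?J ?\<psi> g"
  have tt: "aff L \<phi> (f o Inr) : T" "aff L \<phi> (g o Inr) : T" using fg cJ bij by blast+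
  have r: "f (Inl True) - f (Inl False) = g (Inl True) - g (Inl False)"
   using fun_cong[OF fg(3), of iz] e(1) e(2)[OF tt(1)] e(2)[OF tt(2)] by (simp add: ae)
  hence "aff L \<phi> (f o Inr) = aff L \<phi> (g o Inr)"
   using fg(3) by (intro ext) (metis (no_types, lifting) add_right_cancel ae)
  hence "f o Inr = g o Inr" using fg cJ bij(1) unfolding inj_on_def by blast
  hence "f (Inr w) = g (Inr w)" for w by (metis comp_apply)
  moreover have "f (Inl b) = g (Inl b)" for b using r fg cJ by (cases b) (smt (verit))+
  ultimately show "f = g" by (intro ext) (metis sum.exhaust)
 next
  fix h assume "h : aff ?J ?\<psi> ` cone_of ?J"
  then obtain f where f: "f : cone_of ?J" "h = aff ?J ?\<psi> f" by blast
  hence "aff L \<phi> (f o Inr) : T" using cJ bij by blast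
  thus "h : T'" unfolding T' f(2) ae by blast
 next
  fix h assume "h : T'"
  then obtain t r where h: "t : T" "h = (%v. t v + r * e v)" unfolding T' by blast
  then obtain f0 where f0: "f0 : cone_of L" "aff L \<phi> f0 = t" using bij by blast
  define f where "f = case_sum (%b. if b then max r 0 else max (- r) 0) f0"
  have "f o Inr = f0" by (auto simp: f_def)
  hence "f : cone_of ?J" using cJ f0 by (auto simp: f_def)
  moreover have "aff ?J ?\<psi> f = h" unfolding ae using \<open>f o Inr = f0\<close> f0 h by (auto simp: f_def max_def)
  ultimately show "h : aff ?J ?\<psi> ` cone_of ?J" by blast
 qed
 thus ?thesis using aJ by (simp add: fan_def)
qed

lemma PLR_suspension:
 assumes "PLR d T" and e: "e iz = 1" "\<And>t. t : T ==> t iz = 0"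
  and T': "T' = {%v. t v + r * e v |t r. t : T}"
 shows "PLR (Suc d) T'"
proof -
 obtain L :: "nat set set" and \<phi> \<psi> where L: "fan L \<phi> T" "fan L \<psi> (EU d)" using assms(1) by (auto simp: PLR_def)
 define e' :: "nat => real" where "e' = (%i. if i = d then 1 else 0)"
 have "EU (Suc d) = {%v. t v + r * e' v |t r. t : EU d}"
 proof (intro equalityI subsetI)
  fix k assume k: "k : EU (Suc d)"
  have "k = (%v. (k(d := 0)) v + k d * e' v)" by (auto simp: e'_def)
  moreover have "k(d := 0) : EU d" using k by (auto simp: EU_def)
  ultimately show "k : {%v. t v + r * e' v |t r. t : EU d}" by blast
 qed (auto simp: EU_def e'_def)
 hence "fan (join_complex S0 L) (case_sum (%b v. if b then e' v else - e' v) \<psi>) (EU (Suc d))"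
  by (intro fan_suspension[OF L(2), of e' d]) (auto simp: e'_def EU_def)
 moreover have "fan (join_complex S0 L) (case_sum (%b v. if b then e v else - e v) \<phi>) T'"
  by (rule fan_suspension[OF L(1) _ _ T']) (use e in auto)
 ultimately show ?thesis using PLR_I by blast
qed

lemma link_complex:
 assumes "abstract_complex K" "w : \<Union>K" shows "abstract_complex (link_of K w)"
 using acD(1)[OF assms(1)] acD(5)[OF assms] acD(3)[OF assms(1)]
 unfolding abstract_complex_def link_of_def
 by (auto intro: finite_subset[of _ "\<Union>K"]) (metis insert_mono subsetD)

text \<open>At a point of a simplex containing w, the tangent cone is a line in direction w times a
  tangent cone of the link of w. Thus the sphere condition is used for a vertex link, in one
  dimension less than the cone.\<close>

lemma PLR_tcone:
 assumes aK: "abstract_complex K" and \<sigma>: "\<sigma> : K" "w : \<sigma>"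
  and sph: "PL_homeomorphic (link_of K w) (simplex_boundary d)"
 shows "PLR (Suc d) (tcone K \<sigma>)"
proof (rule PLR_suspension[where e = "%v. if v = w then 1 else 0" and iz = w
   and T = "tcone (link_of K w) (\<sigma> - {w})"])
 let ?e = "%v. if v = w then 1 else 0::real"
 have wK: "w : \<Union>K" using \<sigma> by auto
 have ins: "insert w (\<sigma> - {w}) = \<sigma>" using \<sigma> by auto
 hence "\<sigma> - {w} : link_of K w" using \<sigma> by (auto simp: link_of_def)
 thus "PLR d (tcone (link_of K w) (\<sigma> - {w}))" by (rule PLR_tcone_sphere[OF sph link_complex[OF aK wK]])
 show "?e w = 1" by simp
 show "t w = 0" if "t : tcone (link_of K w) (\<sigma> - {w})" for t using that by (auto simp: tcone_def link_of_def)
 show "tcone K \<sigma> = {%v. t v + r * ?e v |t r. t : tcone (link_of K w) (\<sigma> - {w})}"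
 proof (intro equalityI subsetI)
  fix h assume h: "h : tcone K \<sigma>"
  have "insert w (supp (h(w := 0)) Un (\<sigma> - {w})) = supp h Un \<sigma>" using \<sigma> by auto
  hence "h(w := 0) : tcone (link_of K w) (\<sigma> - {w})" using h by (auto simp: tcone_def link_of_def)
  moreover have "h = (%v. (h(w := 0)) v + h w * ?e v)" by auto
  ultimately show "h : {%v. t v + r * ?e v |t r. t : tcone (link_of K w) (\<sigma> - {w})}" by blast
 next
  fix h assume "h : {%v. t v + r * ?e v |t r. t : tcone (link_of K w) (\<sigma> - {w})}"
  then obtain t r where t: "h = (%v. t v + r * ?e v)" "t : tcone (link_of K w) (\<sigma> - {w})" by blast
  have "insert w (supp t Un (\<sigma> - {w})) : K" "w \<notin> supp t" using t by (auto simp: tcone_def link_of_def)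
  moreover have "supp h Un \<sigma> = insert w (supp t Un (\<sigma> - {w}))" using t(1) \<sigma> by auto
  ultimately show "h : tcone K \<sigma>" using t \<sigma> by (auto simp: tcone_def)
 qed
qed

lemma fan_linear_image:
 assumes f: "fan K \<phi> T" and bij: "bij_betw G T E"
  and G: "\<And>f. G (aff K \<phi> f) = aff K (%w. G (\<phi> w)) f"
 shows "fan K (%w. G (\<phi> w)) E"
proof -
 have "bij_betw (G o aff K \<phi>) (cone_of K) E" using f bij bij_betw_trans unfolding fan_def by blast
 moreover have "G o aff K \<phi> = aff K (%w. G (\<phi> w))" using G by auto
 ultimately show ?thesis using f by (simp add: fan_def)
qed

text \<open>All rays lie in the slice \<omega> = 1, because \<omega> is the total of the
  coefficients. Tangent directions of the slice at \<open>p v\<close> are combinations with total 0,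
  and the coefficient of v is determined by those on the link.\<close>

lemma link_fan:
 fixes K :: "'w set set" and p :: "'w => 'v => real"
 assumes f: "fan K p C" and v: "v : \<Union>K"
  and \<omega>: "\<And>g. \<omega> (aff K p g) = (\<Sum>w\<in>\<Union>K. g w)"
 shows "fan (link_of K v) (%w j. p w j - p v j) {h : directions C (p v). \<omega> h = (0::real)}"
proof -
 have aK: "abstract_complex K" using f by (simp add: fan_def)
 let ?\<delta> = "%x. if x = v then 1 else 0::real"
 have d: "?\<delta> : cone_of K" "supp ?\<delta> = {v}" using delta_in_cone[OF aK v] by auto
 have bij: "bij_betw (aff K p) (tcone K {v}) (directions C (p v))"
  using tcone_bij[OF f d(1)] unfolding d(2) affine_extension_delta[OF aK v] .
 let ?L = "link_of K v"
 have aL: "abstract_complex ?L" by (rule link_complex[OF aK v])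
 have UL: "\<Union>?L <= \<Union>K - {v}" by (auto simp: link_of_def)
 have finK: "finite (\<Union>K)" by (rule acD(1)[OF aK])
 define D where "D f = (%w. if w = v then - sum f (\<Union>?L) else f w)" for f :: "'w => real"
 have sumD: "sum (D f) (\<Union>K) = 0 & aff ?L (%w j. p w j - p v j) f = aff K p (D f)"
  if f: "f : cone_of ?L" for f
 proof
  have s: "(\<Sum>w\<in>\<Union>K. D f w * c w) = - sum f (\<Union>?L) * c v + (\<Sum>w\<in>\<Union>?L. f w * c w)" for c
  proof -
   have "(\<Sum>w\<in>\<Union>K. D f w * c w) = D f v * c v + (\<Sum>w\<in>\<Union>K - {v}. D f w * c w)"
    using finK v by (simp add: sum.remove)
   also have "(\<Sum>w\<in>\<Union>K - {v}. D f w * c w) = (\<Sum>w\<in>\<Union>?L. f w * c w)"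
    by (rule sum.mono_neutral_cong_right) (use finK UL cone_of_supp[OF f] in \<open>auto simp: D_def\<close>)
   finally show ?thesis by (simp add: D_def)
  qed
  show "sum (D f) (\<Union>K) = 0" using s[of "%_. 1"] by simp
  show "aff ?L (%w j. p w j - p v j) f = aff K p (D f)"
  proof
   fix j
   show "aff ?L (%w j. p w j - p v j) f j = aff K p (D f) j"
    using s[of "%w. p w j"]
    by (simp add: affine_extension_def right_diff_distrib sum_subtractf sum_distrib_right[symmetric])
  qed
 qed
 have "bij_betw D (cone_of ?L) {g : tcone K {v}. sum g (\<Union>K) = 0}"
 proof (rule bij_betw_byWitness[where f' = "%g. g(v := 0)"])
  show "\<forall>f\<in>cone_of ?L. (D f)(v := 0) = f"
   using UL cone_of_supp by (fastforce simp: D_def fun_eq_iff)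
  show "D ` cone_of ?L <= {g : tcone K {v}. sum g (\<Union>K) = 0}"
  proof (intro image_subsetI CollectI conjI)
   fix f assume f: "f : cone_of ?L"
   have "supp f : ?L" using f by (simp add: cone_of_def)
   hence "insert v (supp f) : K" "v \<notin> supp f" by (auto simp: link_of_def)
   moreover have "supp (D f) Un {v} = insert v (supp f)" by (auto simp: D_def)
   ultimately show "D f : tcone K {v}" using cone_of_nonneg[OF f] by (auto simp: tcone_def D_def)
   show "sum (D f) (\<Union>K) = 0" using sumD[OF f] by blast
  qed
  have pull: "g(v := 0) : cone_of ?L" if g: "g : tcone K {v}" for g
  proof -
   have "insert v (supp (g(v := 0))) = supp g Un {v}" by auto
   thus ?thesis using g by (auto simp: tcone_def cone_of_def link_of_def)
  qed
  thus "(%g. g(v := 0)) ` {g : tcone K {v}. sum g (\<Union>K) = 0} <= cone_of ?L" by auto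
  show "\<forall>g\<in>{g : tcone K {v}. sum g (\<Union>K) = 0}. D (g(v := 0)) = g"
  proof (intro ballI ext)
   fix g w assume g: "g : {g : tcone K {v}. sum g (\<Union>K) = 0}"
   have "g i = 0" if "i \<notin> \<Union>?L" "i ~= v" for i
   proof (rule ccontr)
    assume "g i ~= 0"
    hence "i : supp (g(v := 0))" using that by simp
    thus False using that(1) cone_of_supp[OF pull, of g] g by blast
   qed
   hence "sum (g(v := 0)) (\<Union>?L) = sum g (\<Union>K - {v})"
    by (intro sum.mono_neutral_cong_left) (use finK UL in auto)
   also have "\<dots> = - g v" using g finK v by (simp add: sum_diff1)
   finally show "D (g(v := 0)) w = g w" by (simp add: D_def)
  qed
 qed
 moreover have "bij_betw (aff K p) {g : tcone K {v}. sum g (\<Union>K) = 0} {h : directions C (p v). \<omega> h = 0}"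
  using bij \<omega> unfolding bij_betw_def inj_on_def by (auto 4 3)
 ultimately have "bij_betw (aff K p o D) (cone_of ?L) {h : directions C (p v). \<omega> h = 0}"
  by (rule bij_betw_trans)
 hence "bij_betw (aff ?L (%w j. p w j - p v j)) (cone_of ?L) {h : directions C (p v). \<omega> h = 0}"
  by (rule iffD1[OF bij_betw_cong, rotated]) (use sumD in simp)
 thus ?thesis using aL by (simp add: fan_def)
qed

section \<open>The polyhedral model of the manifold, its tangent cones and its triangulation\<close>

section \<open>The modified reflection polyhedron\<close>

text \<open>\<open>CF v\<close> is the value at v, and \<open>CU i b\<close> the distance from the
  mirrors of colour i, on side b. The colour of \<open>v0\<close> has two kinds of faces, with
  distances CT + CA (old mirrors) and CT + CB (the face replacing the mirror of
  \<open>v0\<close>).\<close>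

datatype 'b coord = CF 'b | CU nat bool | CT bool | CA | CB

locale chamber_complex =
 fixes n :: nat and \<Gamma> :: "'b set set" and c :: "'b => nat" and v0 :: 'b
 assumes col: "coloured_complex n \<Gamma> c" and v0: "v0 : \<Union>\<Gamma>"
begin

abbreviation V where "V \<equiv> \<Union>\<Gamma>"

lemma aG: "abstract_complex \<Gamma>"
 using col by (simp add: coloured_complex_def)

lemma finV: "finite (V)"
 by (rule acD(1)[OF aG])

lemma c_range: "v : V ==> c v : {1..n}"
 using col unfolding coloured_complex_def by blast

lemma same_colour: "[|\<sigma> : \<Gamma>; v : \<sigma>; w : \<sigma>; c v = c w|] ==> v = w"
proof (rule ccontr)
 assume a: "\<sigma> : \<Gamma>" "v : \<sigma>" "w : \<sigma>" "c v = c w" "v ~= w"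
 hence "{v, w} : \<Gamma>" using acD(3)[OF aG a(1), of "{v, w}"] by simp
 hence "adjacent_in \<Gamma> v w" using a by (simp add: adjacent_in_def)
 thus False using col a(4) by (simp add: coloured_complex_def)
qed

definition V0 :: "nat => 'b set" where
 "V0 i = {w : V. w ~= v0 & c w = i}"

definition V1 :: "'b set" where
 "V1 = V - {v0}"

definition cols :: "nat set" where
 "cols = {1..n} - {c v0}"

text \<open>Complementary slackness: a point is on one side of each reflection, and since
  \<open>CA\<close> and \<open>CB\<close> never occur together, CT is the minimum of the two
  distances.\<close>

definition supports :: "'b coord set set" where
 "supports = {S. {v. CF v : S} : \<Gamma> & S <= CF ` V Un (%(i, b). CU i b) ` (cols \<times> UNIV) Un range CT Un {CA, CB} \<and>
   (\<forall>i. ~ (CU i True : S & CU i False : S)) & ~ (CT True : S & CT False : S) & ~ (CA : S & CB : S)}"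

text \<open>The homogenising variable, expressed by the equation of the colour of \<open>v0\<close>;
  it is 1 on the manifold.\<close>

definition rr :: "('b coord => real) => real" where
 "rr x = (\<Sum>w\<in>V0 (c v0). x (CF w)) + x (CT True) + x (CT False) + x CA"

text \<open>The homogenised definitions of the slack coordinates: the distance from the mirrors of a
  colour other than that of \<open>v0\<close>, and from the face f v0 + 1/2 = sum over
  \<open>V1\<close>.\<close>

definition eqs :: "('b coord => real) => bool" where
 "eqs x <-> (\<forall>i\<in>cols. (\<Sum>w\<in>V0 i. x (CF w)) + x (CU i True) + x (CU i False) = rr x) \<and>
   x (CF v0) + rr x / 2 + x (CT True) + x (CT False) + x CB = (\<Sum>w\<in>V1. x (CF w))"

definition ZC :: "('b coord => real) set" where
 "ZC = {x : cone_of supports. eqs x}"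

definition X' :: "('b coord => real) set" where
 "X' = {x : ZC. rr x = 1}"

lemma finite_V0: "finite (V0 i)" "finite V1"
 by (rule finite_subset[OF _ finV], auto simp: V0_def V1_def)+

lemma rr_lin: "rr (%j. a * x j + b * y j) = a * rr x + b * rr y"
 by (simp add: rr_def sum.distrib sum_distrib_left[symmetric] algebra_simps)

lemma eqs_lin: "eqs x ==> eqs y ==> eqs (%j. a * x j + b * y j)"
proof -
 assume x: "eqs x" and y: "eqs y"
 have 1: "(\<Sum>w\<in>V0 i. a * x (CF w) + b * y (CF w)) + (a * x (CU i True) + b * y (CU i True))
   + (a * x (CU i False) + b * y (CU i False)) = a * rr x + b * rr y" if "i : cols" for i
 proof -
  have "a * ((\<Sum>w\<in>V0 i. x (CF w)) + x (CU i True) + x (CU i False)) +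
   b * ((\<Sum>w\<in>V0 i. y (CF w)) + y (CU i True) + y (CU i False)) = a * rr x + b * rr y"
   using x y that by (simp add: eqs_def)
  thus ?thesis by (simp add: sum.distrib sum_distrib_left[symmetric] algebra_simps)
 qed
 have "a * (x (CF v0) + rr x / 2 + x (CT True) + x (CT False) + x CB) +
   b * (y (CF v0) + rr y / 2 + y (CT True) + y (CT False) + y CB) = a * (\<Sum>w\<in>V1. x (CF w)) + b * (\<Sum>w\<in>V1. y (CF w))"
  using x y by (simp add: eqs_def)
 hence 2: "(a * x (CF v0) + b * y (CF v0)) + (a * rr x + b * rr y) / 2 + (a * x (CT True) + b * y (CT True))
   + (a * x (CT False) + b * y (CT False)) + (a * x CB + b * y CB) = (\<Sum>w\<in>V1. a * x (CF w) + b * y (CF w))"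
  by (simp add: sum.distrib sum_distrib_left[symmetric] field_simps)
 show ?thesis unfolding eqs_def rr_lin using 1 2 by simp
qed

lemma abstract_supports: "abstract_complex supports"
 unfolding abstract_complex_def
proof (intro conjI ballI allI impI)
 let ?J = "CF ` V Un (%(i, b). CU i b) ` (cols \<times> UNIV) Un range CT Un {CA, CB} :: 'b coord set"
 have "finite ?J" using finV by (simp add: cols_def)
 moreover have "\<Union>supports <= ?J"
 proof (rule Union_least)
  fix S assume "S : supports" thus "S <= ?J" unfolding supports_def mem_Collect_eq by (elim conjE)
 qed
 ultimately show "finite (\<Union>supports)" by (rule finite_subset[rotated])
 show "{} : supports" using acD(2)[OF aG] by (simp add: supports_def)
 show "S' : supports" if "S : supports" "S' <= S" for S S'
 proof -
  have "{v. CF v : S'} <= {v. CF v : S}" using that by auto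
  hence "{v. CF v : S'} : \<Gamma>" using that(1) acD(3)[OF aG] unfolding supports_def by blast
  moreover have "S' <= CF ` V Un (%(i, b). CU i b) ` (cols \<times> UNIV) Un range CT Un {CA, CB}"
  proof (rule order_trans[OF that(2)])
   show "S <= CF ` V Un (%(i, b). CU i b) ` (cols \<times> UNIV) Un range CT Un {CA, CB}"
    using that(1) unfolding supports_def mem_Collect_eq by (elim conjE)
  qed
  moreover have "\<forall>i. ~ (CU i True : S & CU i False : S)" "~ (CT True : S & CT False : S)" "~ (CA : S & CB : S)"
   using that(1) unfolding supports_def mem_Collect_eq by simp_all
  hence "\<forall>i. ~ (CU i True : S' & CU i False : S')" "~ (CT True : S' & CT False : S')" "~ (CA : S' & CB : S')"
   using that(2) by blast+
  ultimately show ?thesis unfolding supports_def mem_Collect_eq by (intro conjI allI) simp_all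
 qed
qed

lemma rr_nonneg: "x : cone_of supports ==> 0 <= rr x"
 using cone_of_nonneg by (auto simp: rr_def intro!: add_nonneg_nonneg sum_nonneg)

text \<open>Makes \<open>rr\<close> a gauge of the cone: every non-zero element can be scaled into
  the slice \<open>X'\<close>.\<close>

lemma rr_zero:
 assumes x: "x : ZC" and r: "rr x = 0" shows "x = (%_. 0)"
proof -
 have nn: "0 <= x j" for j using x cone_of_nonneg by (auto simp: ZC_def)
 have s: "supp x : supports" and e: "eqs x" using x by (auto simp: ZC_def cone_of_def)
 have "(\<Sum>w\<in>V0 (c v0). x (CF w)) \<ge> 0" using nn by (simp add: sum_nonneg)
 hence T: "x (CT True) = 0" "x (CT False) = 0" "x CA = 0" "(\<Sum>w\<in>V0 (c v0). x (CF w)) = 0"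
  using r nn[of "CT True"] nn[of "CT False"] nn[of CA] unfolding rr_def by linarith+
 have i: "(\<Sum>w\<in>V0 i. x (CF w)) = 0 & x (CU i True) = 0 & x (CU i False) = 0" if "i : cols" for i
 proof -
  have "(\<Sum>w\<in>V0 i. x (CF w)) + x (CU i True) + x (CU i False) = 0" using e that r by (simp add: eqs_def)
  moreover have "(\<Sum>w\<in>V0 i. x (CF w)) \<ge> 0" using nn by (simp add: sum_nonneg)
  ultimately show ?thesis using nn[of "CU i True"] nn[of "CU i False"] by linarith
 qed
 have F: "x (CF w) = 0" if "w : V1" for w
 proof -
  have "c w = c v0 | c w : cols" using that c_range[of w] by (auto simp: cols_def V1_def)
  hence "(\<Sum>w\<in>V0 (c w). x (CF w)) = 0" using i T by metis
  thus ?thesis using that finite_V0 nn by (subst (asm) sum_nonneg_eq_0_iff) (auto simp: V0_def V1_def)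
 qed
 hence "x (CF v0) + x CB = 0" using e r T by (simp add: eqs_def)
 hence v: "x (CF v0) = 0" "x CB = 0" using nn[of "CF v0"] nn[of CB] by linarith+
 have "x j = 0" for j
 proof (cases j)
  case (CF w)
  show ?thesis
  proof (rule ccontr)
   assume a: "x j ~= 0"
   hence "w : V" using s CF unfolding supports_def by (auto simp: subset_iff)
   thus False using a F[of w] v CF by (auto simp: V1_def)
  qed
 next
  case (CU k b)
  show ?thesis
  proof (rule ccontr)
   assume a: "x j ~= 0"
   hence "k : cols" using s CU unfolding supports_def by (auto simp: subset_iff)
   thus False using a i[of k] CU by (cases b) auto
  qed
 next
  case (CT b) thus ?thesis using T by (cases b) auto
 qed (use T v in auto)
 thus ?thesis by blast
qed

text \<open>In the tangent cone of \<open>X'\<close> at \<open>q\<close>, a coordinate \<open>CF v\<close> that is on a mirror is replaced by the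
 signed distance from that mirror. The mirror of \<open>v0\<close> is the face on which \<open>CT\<close> and \<open>CB\<close> vanish; there the
 replaced coordinate is \<open>v0\<close> itself, if it belongs to the support, and otherwise an arbitrary vertex of
 the support.\<close>

context
 fixes q assumes q: "q : X'"
begin

definition sg :: "'b set" where "sg = {v. q (CF v) ~= 0}"

definition tang :: "('b coord => real) set" where
 "tang = {h : tcone supports (supp q). eqs h & rr h = 0}"

definition pivot :: 'b where
 "pivot = (if v0 : sg then v0 else SOME w. w : sg)"

definition slotU :: "'b => bool" where
 "slotU v <-> v : sg & c v : cols & q (CU (c v) True) = 0 & q (CU (c v) False) = 0"

definition slotT :: "'b => bool" where
 "slotT v <-> q (CT True) = 0 & q (CT False) = 0 \<and>
   (if q CA = 0 then v : sg & v : V0 (c v0) else v = pivot)"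

definition GG :: "('b coord => real) => 'b => real" where
 "GG h v = (if slotU v then h (CU (c v) True) - h (CU (c v) False)
   else if slotT v then h (CT True) - h (CT False) else h (CF v))"

lemma q_nonneg: "0 <= q j" and q_eqs: "eqs q" and q_rr: "rr q = 1" and q_supp: "supp q : supports"
 using q cone_of_nonneg by (auto simp: X'_def ZC_def cone_of_def)

lemma sg_simplex: "sg : \<Gamma>"
 using q_supp by (simp add: sg_def supports_def)

lemma q_excl: "q (CU i True) = 0 | q (CU i False) = 0" "q (CT True) = 0 | q (CT False) = 0" "q CA = 0 | q CB = 0"
 using q_supp unfolding supports_def by auto

text \<open>A simplex has at most one vertex of each colour.\<close>

lemma sum_single:
 assumes "supp f Un sg : \<Gamma>" "w : sg" "w : V0 i" shows "(\<Sum>w\<in>V0 i. f w) = f w"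
proof -
 have "f v = 0" if "v : V0 i - {w}" for v
 proof (rule ccontr)
  assume "f v ~= 0"
  hence "v = w" using same_colour[OF assms(1), of v w] that assms by (auto simp: V0_def)
  thus False using that by simp
 qed
 thus ?thesis using finite_V0 assms(3) by (simp add: sum.remove)
qed

text \<open>The constant 1/2 of the new face is positive, so the values on \<open>V1\<close> cannot
  all vanish. This supplies the vertex whose link is used for \<open>PLR_tcone\<close>.\<close>

lemma sg_V1: "\<exists>w\<in>sg. w : V1"
proof (rule ccontr)
 assume "~ ?thesis"
 hence "(\<Sum>w\<in>V1. q (CF w)) = 0" by (auto simp: sg_def intro!: sum.neutral)
 hence "q (CF v0) + 1 / 2 + q (CT True) + q (CT False) + q CB = 0" using q_eqs q_rr by (simp add: eqs_def)
 thus False using q_nonneg[of "CF v0"] q_nonneg[of "CT True"] q_nonneg[of "CT False"] q_nonneg[of CB] by linarith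
qed

lemma pivot_sg: "pivot : sg"
 using sg_V1 someI_ex[of "%w. w : sg"] unfolding pivot_def by auto

lemma sg_V: "sg <= V"
 using sg_simplex by blast

lemma q_F_le: "w : sg ==> w : V1 ==> q (CF w) <= (\<Sum>w\<in>V1. q (CF w))"
 using finite_V0(2) q_nonneg by (intro member_le_sum) auto

lemma q_single: "w : sg ==> w : V0 i ==> (\<Sum>w\<in>V0 i. q (CF w)) = q (CF w)"
 using sum_single[of "%w. q (CF w)" w i] sg_simplex by (simp add: sg_def)

lemma slotU_mirror: "slotU v ==> q (CF v) = 1"
proof -
 assume s: "slotU v"
 hence "v : V0 (c v)" using sg_V by (auto simp: slotU_def V0_def cols_def)
 thus ?thesis using q_single[of v "c v"] s q_eqs q_rr by (auto simp: slotU_def eqs_def)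
qed

lemma F_mirror:
 assumes "q (CT True) = 0" "q (CT False) = 0" "q CA ~= 0"
 shows "q CB = 0" "q (CF v0) + 1 / 2 = (\<Sum>w\<in>V1. q (CF w))"
 using assms q_excl(3) q_eqs q_rr by (auto simp: eqs_def)

text \<open>The pivot differs from \<open>v0\<close> only if \<open>v0\<close> is not in the
  support. On the new face the values on \<open>V1\<close> then add up to 1/2, whereas a vertex on
  its mirror has value 1.\<close>

lemma slot_disjoint: "slotU v ==> ~ slotT v"
proof
 assume s: "slotU v" and t: "slotT v"
 have "v ~= v0" "c v ~= c v0" using s by (auto simp: slotU_def cols_def)
 hence T: "q (CT True) = 0" "q (CT False) = 0" "q CA ~= 0" "v = pivot"
  using t by (auto simp: slotT_def V0_def split: if_splits)
 hence "v0 \<notin> sg" using \<open>v ~= v0\<close> unfolding pivot_def by auto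
 hence "(\<Sum>w\<in>V1. q (CF w)) = 1 / 2" using F_mirror T by (simp add: sg_def)
 moreover have "v : V1" using s \<open>v ~= v0\<close> sg_V by (auto simp: slotU_def V1_def)
 ultimately show False using slotU_mirror[OF s] q_F_le[of v] s by (auto simp: slotU_def)
qed

text \<open>On an old mirror of the colour of \<open>v0\<close> the value at \<open>v0\<close> is 0,
  and the new face is at distance at least 1/2: the two kinds of faces of that colour are
  disjoint.\<close>

lemma T_mirror:
 assumes "q (CT True) = 0" "q (CT False) = 0" "q CA = 0"
 shows "q CB ~= 0" "\<exists>w. w : sg & w : V0 (c v0)"
proof -
 have 1: "(\<Sum>w\<in>V0 (c v0). q (CF w)) = 1" using assms q_rr by (simp add: rr_def)
 then obtain w where w: "w : V0 (c v0)" "q (CF w) ~= 0" by (metis (mono_tags, lifting) sum.neutral zero_neq_one)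
 hence ws: "w : sg" by (simp add: sg_def)
 thus "\<exists>w. w : sg & w : V0 (c v0)" using w by blast
 have "v0 \<notin> sg"
  using same_colour[OF sg_simplex ws, of v0] w by (auto simp: V0_def)
 hence "q (CF v0) = 0" by (simp add: sg_def)
 moreover have "w : V1" using w by (auto simp: V0_def V1_def)
 ultimately have "q CB \<ge> 1 / 2" using q_F_le[OF ws] q_single[OF ws w(1)] 1 assms q_eqs q_rr by (simp add: eqs_def)
 thus "q CB ~= 0" by simp
qed

lemma tangD:
 assumes "h : tang"
 shows "supp (%v. h (CF v)) Un sg : \<Gamma>" "\<And>j. q j = 0 ==> 0 <= h j" "eqs h" "rr h = 0"
  "\<And>i. i \<notin> cols ==> h (CU i b) = 0" "\<And>v. v \<notin> V ==> h (CF v) = 0"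
  "\<And>i b. q (CU i b) ~= 0 ==> h (CU i (~ b)) = 0" "\<And>b. q (CT b) ~= 0 ==> h (CT (~ b)) = 0"
  "q CA ~= 0 ==> h CB = 0" "q CB ~= 0 ==> h CA = 0"
  "h (CU i True) = 0 | h (CU i False) = 0" "h (CT True) = 0 | h (CT False) = 0" "h CA = 0 | h CB = 0"
proof -
 have h: "supp h Un supp q : supports" "\<forall>j. j \<notin> supp q --> 0 <= h j" "eqs h" "rr h = 0"
  using assms by (auto simp: tang_def tcone_def)
 show "eqs h" "rr h = 0" by fact+
 show "\<And>j. q j = 0 ==> 0 <= h j" using h(2) by auto
 have "{v. CF v : supp h Un supp q} = supp (%v. h (CF v)) Un sg" by (auto simp: sg_def)
 thus "supp (%v. h (CF v)) Un sg : \<Gamma>" using h(1) unfolding supports_def by simp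
 have s: "supp h <= CF ` V Un (%(i, b). CU i b) ` (cols \<times> UNIV) Un range CT Un {CA, CB}"
  using h(1) unfolding supports_def by blast
 show "h (CU i b) = 0" if "i \<notin> cols" for i
  using s that by (auto simp: subset_iff)
 show "h (CF v) = 0" if "v \<notin> V" for v
  using s that by (auto simp: subset_iff)
 have e: "\<forall>i. ~ (CU i True : supp h Un supp q & CU i False : supp h Un supp q)"
  "~ (CT True : supp h Un supp q & CT False : supp h Un supp q)"
  "~ (CA : supp h Un supp q & CB : supp h Un supp q)"
  using h(1) unfolding supports_def by blast+
 show "h (CU i (~ b)) = 0" if "q (CU i b) ~= 0" for i b using e(1) that by (cases b) auto
 show "h (CT (~ b)) = 0" if "q (CT b) ~= 0" for b using e(2) that by (cases b) auto
 show "q CA ~= 0 ==> h CB = 0" "q CB ~= 0 ==> h CA = 0"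
  "h (CU i True) = 0 | h (CU i False) = 0" "h (CT True) = 0 | h (CT False) = 0" "h CA = 0 | h CB = 0"
  using e by auto
qed

lemma tang_eqs:
 assumes "h : tang"
 shows "\<And>i. i : cols ==> (\<Sum>w\<in>V0 i. h (CF w)) + h (CU i True) + h (CU i False) = 0"
  "(\<Sum>w\<in>V0 (c v0). h (CF w)) + h (CT True) + h (CT False) + h CA = 0"
  "h (CF v0) + h (CT True) + h (CT False) + h CB = (\<Sum>w\<in>V1. h (CF w))"
 using tangD(3,4)[OF assms] by (auto simp: eqs_def rr_def)

lemma GG_in: assumes h: "h : tang" shows "GG h : tcone \<Gamma> sg"
proof -
 have sl: "v : sg" if "slotU v | slotT v" for v
  using that pivot_sg by (auto simp: slotU_def slotT_def split: if_splits)
 have "supp (GG h) Un sg <= supp (%v. h (CF v)) Un sg"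
  using sl by (auto simp: GG_def split: if_splits)
 hence "supp (GG h) Un sg : \<Gamma>" using tangD(1)[OF h] acD(3)[OF aG] by blast
 moreover have "0 <= GG h v" if "v \<notin> sg" for v
  using that sl[of v] tangD(2)[OF h, of "CF v"] by (auto simp: GG_def sg_def)
 ultimately show ?thesis by (simp add: tcone_def)
qed

text \<open>The equations restore what \<open>GG\<close> drops: of two opposite non-negative slack
  directions at most one is non-zero, so their difference determines both, and the replaced
  coordinate is solved from the equation of its mirror.\<close>

lemma GG_inj:
 assumes h: "h : tang" and h': "h' : tang" and e: "GG h = GG h'" shows "h = h'"
proof -
 have U: "h (CU (c v) True) = h' (CU (c v) True) & h (CU (c v) False) = h' (CU (c v) False) & h (CF v) = h' (CF v)"
  if s: "slotU v" for v
 proof -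
  have v: "v : sg" "v : V0 (c v)" "c v : cols" "q (CU (c v) True) = 0" "q (CU (c v) False) = 0"
   using s sg_V by (auto simp: slotU_def V0_def cols_def)
  have "h (CU (c v) True) - h (CU (c v) False) = h' (CU (c v) True) - h' (CU (c v) False)"
   using fun_cong[OF e, of v] s by (simp add: GG_def)
  hence "h (CU (c v) True) = h' (CU (c v) True)" "h (CU (c v) False) = h' (CU (c v) False)"
   using tangD(2)[OF h v(4)] tangD(2)[OF h v(5)] tangD(2)[OF h' v(4)] tangD(2)[OF h' v(5)]
    tangD(11)[OF h, of "c v"] tangD(11)[OF h', of "c v"] by auto
  moreover have "(\<Sum>w\<in>V0 (c v). h (CF w)) = h (CF v)" "(\<Sum>w\<in>V0 (c v). h' (CF w)) = h' (CF v)"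
   using sum_single[OF tangD(1)[OF h] v(1,2)] sum_single[OF tangD(1)[OF h'] v(1,2)] by auto
  ultimately show ?thesis using tang_eqs(1)[OF h v(3)] tang_eqs(1)[OF h' v(3)] by auto
 qed
 have T: "h (CT True) = h' (CT True) & h (CT False) = h' (CT False)" if s: "slotT v" for v
 proof -
  have t: "q (CT True) = 0" "q (CT False) = 0" using s by (auto simp: slotT_def)
  have "~ slotU v" using s slot_disjoint[of v] by blast
  have "h (CT True) - h (CT False) = h' (CT True) - h' (CT False)"
   using fun_cong[OF e, of v] s \<open>~ slotU v\<close> by (simp add: GG_def)
  thus ?thesis
   using tangD(2)[OF h t(1)] tangD(2)[OF h t(2)] tangD(2)[OF h' t(1)] tangD(2)[OF h' t(2)]
    tangD(12)[OF h] tangD(12)[OF h'] by auto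
 qed
 have N: "h (CF v) = h' (CF v)" if "~ slotT v" for v
  using fun_cong[OF e, of v] U that by (cases "slotU v") (auto simp: GG_def)
 have F: "h (CF v) = h' (CF v)" for v
 proof (cases "slotT v")
  case s: True
  hence t: "q (CT True) = 0" "q (CT False) = 0" by (auto simp: slotT_def)
  show ?thesis
  proof (cases "q CA = 0")
   case True
   hence v: "v : sg" "v : V0 (c v0)" using s by (auto simp: slotT_def)
   have "(\<Sum>w\<in>V0 (c v0). h (CF w)) = h (CF v)" "(\<Sum>w\<in>V0 (c v0). h' (CF w)) = h' (CF v)"
    using sum_single[OF tangD(1)[OF h] v] sum_single[OF tangD(1)[OF h'] v] by auto
   thus ?thesis
    using T[OF s] tang_eqs(2)[OF h] tang_eqs(2)[OF h'] tangD(10)[OF h] tangD(10)[OF h'] T_mirror[OF t True] by auto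
  next
   case False
   hence v: "v = pivot" "\<And>w. w ~= v ==> ~ slotT w" using s by (auto simp: slotT_def)
   have B: "h CB = 0" "h' CB = 0" using tangD(9)[OF h False] tangD(9)[OF h' False] by auto
   show ?thesis
   proof (cases "v = v0")
    case True
    have "(\<Sum>w\<in>V1. h (CF w)) = (\<Sum>w\<in>V1. h' (CF w))" using N v True by (intro sum.cong) (auto simp: V1_def)
    thus ?thesis using tang_eqs(3)[OF h] tang_eqs(3)[OF h'] T[OF s] B True by auto
   next
    case ne: False
    hence vV: "v : V1" using v pivot_sg sg_V by (auto simp: V1_def)
    have "(\<Sum>w\<in>V1 - {v}. h (CF w)) = (\<Sum>w\<in>V1 - {v}. h' (CF w))" using N v by (intro sum.cong) auto
    moreover have "h (CF v0) = h' (CF v0)" using N v ne by auto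
    ultimately show ?thesis
     using tang_eqs(3)[OF h] tang_eqs(3)[OF h'] T[OF s] B finite_V0(2) vV by (auto simp: sum.remove)
   qed
  qed
 qed (rule N)
 have Uall: "h (CU i b) = h' (CU i b)" for i b
 proof (cases "i : cols")
  case i: True
  have sums: "h (CU i True) + h (CU i False) = h' (CU i True) + h' (CU i False)"
   using tang_eqs(1)[OF h i] tang_eqs(1)[OF h' i] F by simp
  show ?thesis
  proof (cases "q (CU i True) = 0 & q (CU i False) = 0")
   case True
   hence "(\<Sum>w\<in>V0 i. q (CF w)) = 1" using q_eqs q_rr i by (auto simp: eqs_def)
   then obtain w where w: "w : V0 i" "q (CF w) ~= 0" by (metis (mono_tags, lifting) sum.neutral zero_neq_one)
   hence "slotU w" "c w = i" using True i by (auto simp: slotU_def sg_def V0_def)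
   thus ?thesis using U[of w] by (cases b) auto
  next
   case False
   then obtain d where "q (CU i d) ~= 0" by auto
   hence "h (CU i (~ d)) = 0" "h' (CU i (~ d)) = 0" using tangD(7)[OF h] tangD(7)[OF h'] by auto
   thus ?thesis using sums by (cases b; cases d) auto
  qed
 qed (use tangD(5)[OF h] tangD(5)[OF h'] in auto)
 have sT: "h (CT True) + h (CT False) + h CA = h' (CT True) + h' (CT False) + h' CA"
  "h (CT True) + h (CT False) + h CB = h' (CT True) + h' (CT False) + h' CB"
  using tang_eqs(2,3)[OF h] tang_eqs(2,3)[OF h'] F by auto
 have Tall: "h (CT True) = h' (CT True) & h (CT False) = h' (CT False)"
 proof (cases "q (CT True) = 0 & q (CT False) = 0")
  case True
  hence "\<exists>v. slotT v" using T_mirror(2) by (auto simp: slotT_def)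
  thus ?thesis using T by blast
 next
  case False
  then obtain d where d: "q (CT d) ~= 0" by auto
  have z: "h (CT (~ d)) = 0" "h' (CT (~ d)) = 0" using tangD(8)[OF h d] tangD(8)[OF h' d] by auto
  have "h (CT d) = h' (CT d)"
  proof -
   have eq: "h (CT d) + h CA = h' (CT d) + h' CA" "h (CT d) + h CB = h' (CT d) + h' CB"
    using sT z by (cases d; simp)+
   consider "q CA ~= 0" | "q CB ~= 0" | "q CA = 0" "q CB = 0" by blast
   thus ?thesis
   proof cases
    case 1 thus ?thesis using eq tangD(9)[OF h 1] tangD(9)[OF h' 1] by simp
   next
    case 2 thus ?thesis using eq tangD(10)[OF h 2] tangD(10)[OF h' 2] by simp
   next
    case 3
    thus ?thesis using eq tangD(13)[OF h] tangD(13)[OF h'] tangD(2)[OF h 3(1)] tangD(2)[OF h 3(2)]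
     tangD(2)[OF h' 3(1)] tangD(2)[OF h' 3(2)] by linarith
   qed
  qed
  thus ?thesis using z by (cases d) auto
 qed
 show "h = h'"
 proof
  fix j show "h j = h' j"
  proof (cases j)
   case (CT b) thus ?thesis using Tall by (cases b) auto
  qed (use F Uall Tall sT in auto)
 qed
qed

text \<open>A signed distance is distributed to the two sides, and the coordinate of a vertex on its
  mirror drops by the absolute value. At the pivot on the new face the coordinate is solved from the
  equation of that face.\<close>

lemma GG_surj:
 assumes k: "k : tcone \<Gamma> sg" shows "\<exists>h\<in>tang. GG h = k"
proof -
 have kS: "supp k Un sg : \<Gamma>" and kn: "\<And>v. v \<notin> sg ==> 0 <= k v" using k by (auto simp: tcone_def)
 define mirT where "mirT <-> q (CT True) = 0 & q (CT False) = 0"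
 define face where "face <-> mirT & q CA ~= 0"
 define g where "g v = (if slotU v | (slotT v & ~ face) then - \<bar>k v\<bar> else k v)" for v
 define f where "f = (%v. if face & v = pivot then
   (if pivot = v0 then (\<Sum>w\<in>V1. g w) - \<bar>k v0\<bar> else \<bar>k pivot\<bar> - (\<Sum>w\<in>V1 - {pivot}. g w) + g v0) else g v)"
 have slot_sg: "v : sg" if "slotU v | slotT v" for v
  using that pivot_sg by (auto simp: slotU_def slotT_def split: if_splits)
 have off: "f v = k v" if "v \<notin> sg" for v
  using that slot_sg[of v] pivot_sg by (auto simp: f_def g_def)
 have "supp f Un sg <= supp k Un sg" using off by auto
 hence fS: "supp f Un sg : \<Gamma>" using acD(3)[OF aG kS] by blast
 have fV: "f v = 0" if "v \<notin> V" for v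
 proof (rule ccontr)
  assume "f v ~= 0" hence "v : supp f Un sg" by simp
  thus False using fS that by blast
 qed
 \<comment> \<open>First-order changes of the distances from the old and from the new face of the
   colour of \<open>v0\<close>.\<close>
 define \<delta>a where "\<delta>a = - (\<Sum>w\<in>V0 (c v0). f w)"
 define \<delta>b where "\<delta>b = (\<Sum>w\<in>V1. f w) - f v0"
 define up where "up i = (SOME w. w : sg & w : V0 i)" for i
 have up: "up (c w) = w" if "w : sg" "w : V0 (c w)" for w
 proof -
  have "up (c w) : sg & up (c w) : V0 (c w)" unfolding up_def by (rule someI[of _ w]) (use that in auto)
  thus ?thesis using same_colour[OF sg_simplex, of "up (c w)" w] that by (auto simp: V0_def)
 qed
 define tv where "tv = (if q CA = 0 then up (c v0) else pivot)"
 \<comment> \<open>Away from both faces CT changes like the smaller of the two distances; if they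
   are equal, by the minimum of the two changes.\<close>
 define T where "T b = (if mirT then (if b then max (k tv) 0 else max (- k tv) 0)
   else if q (CT b) = 0 then 0 else if q CA ~= 0 then \<delta>b else if q CB ~= 0 then \<delta>a else min \<delta>a \<delta>b)" for b
 define U where "U i b = (if i \<notin> cols then 0 else if q (CU i True) = 0 & q (CU i False) = 0
   then (if b then max (k (up i)) 0 else max (- k (up i)) 0)
   else if q (CU i b) = 0 then 0 else - (\<Sum>w\<in>V0 i. f w))" for i b
 define h where "h = case_coord f U T (\<delta>a - T True - T False) (\<delta>b - T True - T False)"
 have hs: "h (CF v) = f v" "h (CU i b) = U i b" "h (CT b) = T b" "h CA = \<delta>a - T True - T False"
  "h CB = \<delta>b - T True - T False" for v i b
  by (auto simp: h_def)
 have Ueq: "(\<Sum>w\<in>V0 i. f w) + U i True + U i False = 0" if i: "i : cols" for i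
 proof (cases "q (CU i True) = 0 & q (CU i False) = 0")
  case True
  hence "(\<Sum>w\<in>V0 i. q (CF w)) = 1" using q_eqs q_rr i by (auto simp: eqs_def)
  then obtain w where w: "w : V0 i" "q (CF w) ~= 0" by (metis (mono_tags, lifting) sum.neutral zero_neq_one)
  hence sw: "slotU w" "c w = i" "w : sg" using True i by (auto simp: slotU_def sg_def V0_def)
  have np: "~ (face & w = pivot)"
   using slot_disjoint[OF sw(1)] by (auto simp: face_def mirT_def slotT_def)
  have "f w = g w" unfolding f_def by (rule if_not_P[OF np])
  hence "f w = - \<bar>k w\<bar>" using sw by (simp add: g_def)
  moreover have "(\<Sum>w\<in>V0 i. f w) = f w" using sum_single[OF fS sw(3) w(1)] .
  moreover have "up i = w" using up[of w] w sw by auto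
  ultimately show ?thesis using True i by (auto simp: U_def)
 next
  case False
  thus ?thesis using q_excl(1)[of i] i by (auto simp: U_def)
 qed
 have faceB: "\<delta>b - T True - T False = 0" if fc: "face"
 proof -
  have m: "mirT" "q CA ~= 0" using fc by (auto simp: face_def)
  have TT: "T True + T False = \<bar>k pivot\<bar>" using m by (auto simp: T_def tv_def)
  show ?thesis
  proof (cases "pivot = v0")
   case True
   have "(\<Sum>w\<in>V1. f w) = (\<Sum>w\<in>V1. g w)" using True by (intro sum.cong) (auto simp: f_def V1_def)
   thus ?thesis using TT fc True by (simp add: \<delta>b_def f_def)
  next
   case False
   hence pV: "pivot : V1" using pivot_sg sg_V by (auto simp: V1_def)
   have "(\<Sum>w\<in>V1 - {pivot}. f w) = (\<Sum>w\<in>V1 - {pivot}. g w)" by (intro sum.cong) (auto simp: f_def)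
   hence "(\<Sum>w\<in>V1. f w) = f pivot + (\<Sum>w\<in>V1 - {pivot}. g w)" using finite_V0(2) pV by (simp add: sum.remove)
   moreover have "f v0 = g v0" using False by (auto simp: f_def)
   ultimately show ?thesis using TT fc False by (simp add: \<delta>b_def f_def)
  qed
 qed
 have mirA: "\<delta>a - T True - T False = 0" if m: "mirT" "q CA = 0"
 proof -
  obtain w where w: "w : sg" "w : V0 (c v0)" using T_mirror(2) m by (auto simp: mirT_def)
  have nf: "~ face" using m by (simp add: face_def)
  have "slotT w" using w m by (auto simp: slotT_def mirT_def)
  hence "f w = - \<bar>k w\<bar>" using nf by (simp add: f_def g_def)
  moreover have "up (c v0) = w" using up[of w] w by (auto simp: V0_def)
  ultimately show ?thesis using sum_single[OF fS w] m by (auto simp: \<delta>a_def T_def tv_def)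
 qed
 have TT: "T True + T False = (if q CA ~= 0 then \<delta>b else if q CB ~= 0 then \<delta>a else min \<delta>a \<delta>b)" if "~ mirT"
  using that q_excl(2) by (auto simp: T_def mirT_def)
 have AB: "(q CA ~= 0 --> h CB = 0) & (q CB ~= 0 --> h CA = 0) & (q CA = 0 --> 0 <= h CA) & (q CB = 0 --> 0 <= h CB)
   & (h CA = 0 | h CB = 0)"
 proof (cases mirT)
  case True
  show ?thesis
  proof (cases "q CA = 0")
   case 1: True
   hence "h CA = 0" "q CB ~= 0" using mirA T_mirror(1) True by (auto simp: hs mirT_def)
   thus ?thesis using 1 by auto
  next
   case 2: False
   hence "h CB = 0" "q CB = 0" using faceB F_mirror(1) True by (auto simp: hs face_def mirT_def)
   thus ?thesis using 2 by auto
  qed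
 next
  case False
  thus ?thesis using TT[OF False] q_excl(3) by (auto simp: hs min_def split: if_splits)
 qed
 have Tn: "q (CT b) = 0 ==> 0 <= T b" for b by (auto simp: T_def)
 have Un: "q (CU i b) = 0 ==> 0 <= U i b" for i b by (auto simp: U_def)
 have supp_in: "supp h Un supp q : supports"
  unfolding supports_def
 proof (intro CollectI conjI allI)
  have "{v. CF v : supp h Un supp q} = supp f Un sg" by (auto simp: hs sg_def)
  thus "{v. CF v : supp h Un supp q} : \<Gamma>" using fS by simp
  have "supp h <= CF ` V Un (%(i, b). CU i b) ` (cols \<times> UNIV) Un range CT Un {CA, CB}"
  proof
   fix j assume j: "j : supp h"
   show "j : CF ` V Un (%(i, b). CU i b) ` (cols \<times> UNIV) Un range CT Un {CA, CB}"
   proof (cases j)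
    case (CF v)
    hence "v : V" using j fV[of v] by (auto simp: hs)
    thus ?thesis using CF by blast
   next
    case (CU i b)
    hence "i : cols" using j by (auto simp: hs U_def split: if_splits)
    thus ?thesis using CU by force
   qed auto
  qed
  thus "supp h Un supp q <= CF ` V Un (%(i, b). CU i b) ` (cols \<times> UNIV) Un range CT Un {CA, CB}"
   using q_supp unfolding supports_def by blast
  show "~ (CU i True : supp h Un supp q & CU i False : supp h Un supp q)" for i
   using q_excl(1)[of i] by (auto simp: hs U_def split: if_splits)
  show "~ (CT True : supp h Un supp q & CT False : supp h Un supp q)"
   using q_excl(2) by (auto simp: hs T_def mirT_def split: if_splits)
  show "~ (CA : supp h Un supp q & CB : supp h Un supp q)"
   using AB q_excl(3) by auto
 qed
 have "0 <= h j" if "j \<notin> supp q" for j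
 proof (cases j)
  case (CF v)
  hence "v \<notin> sg" using that by (simp add: sg_def)
  thus ?thesis using CF off kn by (simp add: hs)
 qed (use that Tn Un AB in \<open>auto simp: hs\<close>)
 moreover have "rr h = 0" by (simp add: rr_def hs \<delta>a_def)
 moreover have "eqs h" using \<open>rr h = 0\<close> Ueq by (simp add: eqs_def hs \<delta>b_def)
 ultimately have "h : tang" using supp_in by (simp add: tang_def tcone_def)
 moreover have "GG h = k"
 proof
  fix v
  consider "slotU v" | "~ slotU v" "slotT v" | "~ slotU v" "~ slotT v" by blast
  thus "GG h v = k v"
  proof cases
   case 1
   hence "v : sg" "v : V0 (c v)" "c v : cols" using sg_V by (auto simp: slotU_def V0_def cols_def)
   hence "up (c v) = v" using up by auto
   thus ?thesis using 1 by (auto simp: GG_def hs U_def slotU_def)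
  next
   case 2
   hence "mirT" by (auto simp: slotT_def mirT_def)
   moreover have "tv = v" using 2 up[of v] by (auto simp: slotT_def tv_def V0_def split: if_splits)
   ultimately show ?thesis using 2 by (auto simp: GG_def hs T_def)
  next
   case 3
   hence np: "~ (face & v = pivot)" by (auto simp: slotT_def face_def mirT_def)
   have "f v = g v" unfolding f_def by (rule if_not_P[OF np])
   thus ?thesis using 3 by (simp add: GG_def hs g_def)
  qed
 qed
 ultimately show ?thesis by blast
qed

lemma GG_bij: "bij_betw GG tang (tcone \<Gamma> sg)"
 unfolding bij_betw_def inj_on_def using GG_in GG_inj GG_surj by blast

lemma GG_linear: "GG (aff K \<phi> f) = aff K (%w. GG (\<phi> w)) f"
 by (intro ext) (simp add: GG_def affine_extension_def sum_subtractf algebra_simps)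

lemma directions_ZC: "{h : directions ZC q. rr h = 0} = tang"
proof -
 have "q : cone_of supports" using q by (simp add: X'_def ZC_def)
 hence d: "directions (cone_of supports) q = tcone supports (supp q)"
  by (rule directions_cone_of[OF abstract_supports])
 have "h : directions ZC q <-> h : directions (cone_of supports) q & eqs h" for h
 proof
  assume "h : directions ZC q"
  then obtain s0 where s0: "s0 > 0" "\<And>s. 0 < s ==> s <= s0 ==> (%v. q v + s * h v) : ZC"
   unfolding directions_def by blast
  have "eqs (%v. (1 / s0) * (q v + s0 * h v) + (- 1 / s0) * q v)"
   using s0 q_eqs by (intro eqs_lin) (auto simp: ZC_def)
  moreover have "(%v. (1 / s0) * (q v + s0 * h v) + (- 1 / s0) * q v) = h"
   using s0(1) by (intro ext) (simp add: field_simps)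
  ultimately have "eqs h" by simp
  moreover have "h : directions (cone_of supports) q" using s0 unfolding directions_def ZC_def by blast
  ultimately show "h : directions (cone_of supports) q & eqs h" by blast
 next
  assume h: "h : directions (cone_of supports) q & eqs h"
  have "eqs (%v. q v + s * h v)" for s using eqs_lin[OF q_eqs, of h 1 s] h by simp
  thus "h : directions ZC q" using h unfolding directions_def ZC_def by blast
 qed
 thus ?thesis unfolding tang_def d[symmetric] by blast
qed

end

text \<open>All rays of the barycentric fan are chosen in the slice \<open>rr\<close> = 1, so the
  fan triangulates \<open>X'\<close>. By \<open>link_fan\<close> a vertex link is a fan of
  \<open>tang\<close>, and \<open>GG\<close> moves it linearly to a tangent cone at a non-empty
  simplex of \<Gamma>, where \<open>PLR_tcone\<close> applies.\<close>

theorem X'_triangulation: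
 assumes sph: "\<And>v. v : V ==> PL_homeomorphic (link_of \<Gamma> v) (simplex_boundary 3)"
 obtains K :: "nat set set" and p where "abstract_complex K"
  "bij_betw (aff K p) (realization K) X'"
  "\<And>v. v : \<Union>K ==> PL_homeomorphic (link_of K v) (simplex_boundary 4)"
proof -
 define S where "S = supp ` ZC - {{}}"
 define p where "p A = (SOME x. x : X' & supp x = A)" for A
 have zero: "(%_. 0) : ZC"
  using zero_in_cone[OF abstract_supports] by (simp add: ZC_def eqs_def rr_def)
 have comb: "(%j. a * x j + b * y j) : ZC" if xy: "x : ZC" "y : ZC" "supp y <= supp x" "\<And>j. 0 <= a * x j + b * y j" for x y a b
 proof -
  have "supp x : supports" using xy by (simp add: ZC_def cone_of_def)
  hence "(%j. a * x j + b * y j) : cone_of supports"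
   using xy(3,4) by (intro cone_of_combine[OF abstract_supports]) auto
  thus ?thesis using xy(1,2) eqs_lin by (simp add: ZC_def)
 qed
 have p: "p A : X' & supp (p A) = A" if AS: "A : S" for A
 proof -
  obtain x where x: "x : ZC" "supp x = A" "A ~= {}" using AS S_def by auto
  have "rr x > 0"
  proof -
   have "x ~= (%_. 0)" using x by auto
   hence "rr x ~= 0" using rr_zero x by blast
   thus ?thesis using rr_nonneg[of x] x by (simp add: ZC_def less_le)
  qed
  define y where "y = (%j. (1 / rr x) * x j + 0 * x j)"
  have "y : ZC" unfolding y_def using x \<open>rr x > 0\<close> cone_of_nonneg[of x supports] by (intro comb) (auto simp: ZC_def)
  moreover have "rr y = 1" unfolding y_def rr_lin using \<open>rr x > 0\<close> by simp
  moreover have "supp y = A" using x \<open>rr x > 0\<close> by (auto simp: y_def)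
  ultimately have "\<exists>y. y : X' & supp y = A" by (auto simp: X'_def)
  thus ?thesis unfolding p_def by (rule someI_ex)
 qed
 have fan0: "fan (chains S) p ZC"
 proof (rule barycentric_fan[where J = "\<Union>supports"])
  show "finite (\<Union>supports)" by (rule acD(1)[OF abstract_supports])
  show "(\<forall>j. 0 <= x j) & supp x <= \<Union>supports" if "x : ZC" for x
  proof -
   have "x : cone_of supports" using that by (simp add: ZC_def)
   thus ?thesis using cone_of_nonneg cone_of_supp by metis
  qed
  show "p A : ZC & supp (p A) = A" if "A : S" for A using p[OF that] by (simp add: X'_def)
 qed (use zero comb S_def in auto)
 have "abstract_complex (chains S)" using fan0 by (simp add: fan_def)
 hence "finite (\<Union>(chains S))" by (rule acD(1))
 then obtain \<iota> :: "'b coord set => nat" where \<iota>: "inj_on \<iota> (\<Union>(chains S))"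
  by (metis finite_imp_inj_to_nat_seg)
 define K where "K = (`) \<iota> ` chains S"
 define p' where "p' u = p (inv_into (\<Union>(chains S)) \<iota> u)" for u
 have fanK: "fan K p' ZC" unfolding K_def p'_def[abs_def] by (rule fan_relabel[OF fan0 \<iota>])
 have aK: "abstract_complex K" using fanK by (simp add: fan_def)
 have p'X: "p' u : X'" if u: "u : \<Union>K" for u
 proof -
  have "u : \<iota> ` \<Union>(chains S)" using u unfolding K_def by blast
  hence "inv_into (\<Union>(chains S)) \<iota> u : \<Union>(chains S)" by (rule inv_into_into)
  thus ?thesis using p unfolding p'_def Union_chains by blast
 qed
 have rsum: "rr (aff K p' f) = sum f (\<Union>K)" for f
 proof -
  have "rr (%j. \<Sum>w\<in>A. f w * p' w j) = sum f A" if "finite A" "A <= \<Union>K" for A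
   using that
  proof (induction A)
   case empty
   show ?case by (simp add: rr_def)
  next
   case (insert w A)
   have "rr (%j. f w * p' w j + 1 * (\<Sum>w\<in>A. f w * p' w j)) = f w * rr (p' w) + 1 * sum f A"
    unfolding rr_lin using insert by simp
   thus ?case using insert p'X[of w] by (simp add: X'_def)
  qed
  from this[OF acD(1)[OF aK] order_refl] show ?thesis unfolding affine_extension_def .
 qed
 have bij: "bij_betw (aff K p') (realization K) X'"
 proof -
  have b: "bij_betw (aff K p') (cone_of K) ZC" using fanK by (simp add: fan_def)
  hence "inj_on (aff K p') (realization K)"
   unfolding realization_cone[OF aK] by (auto simp: bij_betw_def intro: inj_on_subset)
  moreover have "aff K p' ` realization K = X'"
   unfolding realization_cone[OF aK] X'_def
  proof (intro equalityI subsetI)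
   fix x assume "x : aff K p' ` {f : cone_of K. sum f (\<Union>K) = 1}"
   then obtain f where "f : cone_of K" "sum f (\<Union>K) = 1" "x = aff K p' f" by blast
   thus "x : {x : ZC. rr x = 1}" using bij_betwE[OF b] rsum by auto
  next
   fix x assume x: "x : {x : ZC. rr x = 1}"
   hence "x : aff K p' ` cone_of K" using b by (simp add: bij_betw_def)
   then obtain f where "f : cone_of K" "x = aff K p' f" by blast
   thus "x : aff K p' ` {f : cone_of K. sum f (\<Union>K) = 1}" using x rsum[of f] by auto
  qed
  ultimately show ?thesis by (simp add: bij_betw_def)
 qed
 have "PL_homeomorphic (link_of K v) (simplex_boundary 4)" if v: "v : \<Union>K" for v
 proof -
  have q: "p' v : X'" by (rule p'X[OF v])
  have "fan (link_of K v) (%w j. p' w j - p' v j) (tang (p' v))"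
   using link_fan[OF fanK v rsum] directions_ZC[OF q] by simp
  hence "fan (link_of K v) (%w. GG (p' v) (%j. p' w j - p' v j)) (tcone \<Gamma> (sg (p' v)))"
   using GG_bij[OF q] GG_linear[OF q] by (rule fan_linear_image)
  moreover obtain w where w: "w : sg (p' v)" using sg_V1[OF q] by blast
  have "PLR (Suc 3) (tcone \<Gamma> (sg (p' v)))"
   using sph w sg_V[OF q] by (intro PLR_tcone[OF aG sg_simplex[OF q] w]) blast
  hence "PLR 4 (tcone \<Gamma> (sg (p' v)))" by simp
  ultimately show ?thesis by (rule PLR_fan_sphere)
 qed
 thus thesis by (rule that[OF aK bij])
qed

end

section \<open>Point-set topology of cones and stars; PL triangulations yield manifolds\<close>

section \<open>Topology of realizations\<close>

text \<open>Points of all spaces in this development are functions; the class instances below make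
  the compactness arguments for Hausdorff spaces applicable to them.\<close>

lemma fun_hausdorff:
 fixes f g :: "'a => 'b :: t2_space"
 assumes "f ~= g" shows "\<exists>U V. open U & open V & f : U & g : V & U Int V = {}"
proof -
 obtain i where "f i ~= g i" using assms by blast
 then obtain U V where UV: "open U" "open V" "f i : U" "g i : V" "U Int V = {}" using hausdorff by meson
 have "open ((%h :: 'a => 'b. h i) -` W)" if "open W" for W :: "'b set"
  using continuous_on_product_coordinates that by (rule open_vimage[rotated])
 thus ?thesis
  using UV by (intro exI[of _ "(%h. h i) -` U"] exI[of _ "(%h. h i) -` V"]) auto
qed

instance "fun" :: (type, t2_space) t0_space
 by standard (use fun_hausdorff in blast)

instance "fun" :: (type, t2_space) t1_space
 by standard (use fun_hausdorff in blast)

instance "fun" :: (type, t2_space) t2_space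
 by standard (rule fun_hausdorff)

lemma continuous_on_affine_extension: "continuous_on S (aff K \<phi>)"
 unfolding affine_extension_def
 by (intro continuous_on_coordinatewise_then_product continuous_intros
   continuous_on_subset[OF continuous_on_product_coordinates]) auto

lemma compact_closed_simplex: "finite \<sigma> ==> compact (closed_simplex \<sigma>)"
proof -
 assume f: "finite \<sigma>"
 let ?B = "PiE UNIV (%v. if v : \<sigma> then {0..1} else {0::real})"
 have "compactin (product_topology (%_. euclidean) UNIV) ?B"
  unfolding compactin_PiE by (auto simp: compactin_euclidean_iff)
 hence B: "compact ?B" by (simp add: euclidean_product_topology)
 have C: "closed {x :: 'a => real. sum x \<sigma> = 1}"
 proof -
  have "continuous_on UNIV (%x :: 'a => real. \<Sum>v\<in>\<sigma>. x v)"
   by (rule continuous_on_sum) (rule continuous_on_product_coordinates)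
  thus ?thesis by (intro closed_Collect_eq continuous_on_const)
 qed
 have "closed_simplex \<sigma> = ?B Int {x. sum x \<sigma> = 1}"
 proof (intro equalityI subsetI)
  fix x assume x: "x : closed_simplex \<sigma>"
  have "x v <= 1" if "v : \<sigma>" for v
   using x member_le_sum[of v \<sigma> x] f that by (auto simp: closed_simplex_def)
  thus "x : ?B Int {x. sum x \<sigma> = 1}" using x by (auto simp: closed_simplex_def PiE_def)
 next
  fix x assume "x : ?B Int {x. sum x \<sigma> = 1}"
  hence x: "x v : (if v : \<sigma> then {0..1} else {0})" "sum x \<sigma> = 1" for v by (auto simp: PiE_def Pi_iff)
  have "0 <= x v" for v using x(1)[of v] by (auto split: if_splits)
  moreover have "v \<notin> \<sigma> ==> x v = 0" for v using x(1)[of v] by auto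
  ultimately show "x : closed_simplex \<sigma>" using x(2) by (simp add: closed_simplex_def)
 qed
 thus ?thesis using compact_Int_closed[OF B C] by simp
qed

lemma compact_realization: "abstract_complex K ==> compact (realization K)"
 unfolding realization_def using acD(4,6) compact_closed_simplex by (metis compact_UN)

lemma homeomorphism_homeomorphic_space:
 assumes "homeomorphism S T f g" shows "top_of_set S homeomorphic_space top_of_set T"
proof -
 have "homeomorphic_maps (top_of_set S) (top_of_set T) f g"
  using assms unfolding homeomorphism_def homeomorphic_maps_def
  by (auto simp: continuous_map_in_subtopology)
 thus ?thesis unfolding homeomorphic_space_def by blast
qed

text \<open>The norm of the image has a positive minimum on the compact realization, and homogeneity
  extends the bound to the cone. This makes the map proper.\<close>

lemma sum_abs_bound:
 fixes M :: "'w set set" and \<phi> :: "'w => 'v => real"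
 assumes f: "fan M \<phi> T" and J: "finite J" "\<And>t. t : T ==> supp t <= J"
 obtains m where "m > 0" "\<And>f. f : cone_of M ==> m * sum f (\<Union>M) <= (\<Sum>j\<in>J. \<bar>aff M \<phi> f j\<bar>)"
proof -
 have aM: "abstract_complex M" and bij: "bij_betw (aff M \<phi>) (cone_of M) T" using f by (auto simp: fan_def)
 define N where "N f = (\<Sum>j\<in>J. \<bar>aff M \<phi> f j\<bar>)" for f
 have Ncont: "continuous_on S N" for S
 proof -
  have "continuous_on S (%x. aff M \<phi> x j)" for j
   by (rule continuous_on_compose2[OF continuous_on_product_coordinates[of j] continuous_on_affine_extension]) simp
  thus ?thesis unfolding N_def by (intro continuous_intros)
 qed
 have Npos: "N f > 0" if "f : cone_of M" "f ~= (%_. 0)" for f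
 proof (rule ccontr)
  assume "~ ?thesis"
  moreover have "0 <= N f" unfolding N_def by (intro sum_nonneg) auto
  ultimately have "N f = 0" by simp
  hence "\<forall>j\<in>J. aff M \<phi> f j = 0" using J(1) unfolding N_def by (subst (asm) sum_nonneg_eq_0_iff) auto
  moreover have "supp (aff M \<phi> f) <= J" using bij_betwE[OF bij] that J(2) by blast
  ultimately have "aff M \<phi> f = aff M \<phi> (%_. 0)"
   unfolding affine_extension_zero by blast
  hence "f = (%_. 0)" using bij that zero_in_cone[OF aM] unfolding bij_betw_def inj_on_def by blast
  thus False using that by simp
 qed
 have scale: "\<exists>m>0. \<forall>f\<in>realization M. m <= N f"
 proof (cases "realization M = {}")
  case True thus ?thesis by (intro exI[of _ 1]) auto
 next
  case False
  then obtain f where f: "f : realization M" "\<forall>g\<in>realization M. N f <= N g"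
   using continuous_attains_inf[OF compact_realization[OF aM] _ Ncont] by blast
  hence "f : cone_of M" "f ~= (%_. 0)" using realization_cone[OF aM] by auto
  thus ?thesis using Npos f by blast
 qed
 then obtain m where m: "m > 0" "\<And>f. f : realization M ==> m <= N f" by blast
 have "m * sum f (\<Union>M) <= N f" if f: "f : cone_of M" for f
 proof (cases "sum f (\<Union>M) = 0")
  case True
  have "0 <= N f" unfolding N_def by (intro sum_nonneg) auto
  thus ?thesis using True by simp
 next
  case False
  define s where "s = sum f (\<Union>M)"
  have s: "s > 0" using False cone_of_nonneg[OF f] by (simp add: s_def sum_nonneg less_le)
  have "(%v. (1 / s) * f v) : realization M"
   using cone_of_scale[OF aM f, of "%_. 1 / s"] s
   by (auto simp: realization_cone[OF aM] sum_divide_distrib[symmetric] s_def)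
  hence "m <= N (%v. (1 / s) * f v)" by (rule m(2))
  also have "\<dots> = (1 / s) * N f"
   unfolding N_def affine_extension_scale using s by (simp add: abs_mult sum_divide_distrib[symmetric])
  finally show ?thesis using s by (simp add: s_def field_simps)
 qed
 thus thesis using that m(1) unfolding N_def by blast
qed

text \<open>The cones are not compact. By \<open>sum_abs_bound\<close> the preimage of a
  neighbourhood of a point lies in a truncated cone \<open>C r\<close>, which is compact, and there
  the inverse is continuous.\<close>

lemma fan_homeomorphism:
 fixes M :: "'w set set" and \<phi> :: "'w => 'v => real"
 assumes f: "fan M \<phi> T" and J: "finite J" "\<And>t. t : T ==> supp t <= J"
 obtains g where "homeomorphism (cone_of M) T (aff M \<phi>) g"
proof -
 let ?A = "aff M \<phi>"
 have aM: "abstract_complex M" and bij: "bij_betw ?A (cone_of M) T" using f by (auto simp: fan_def)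
 obtain m where m: "m > 0" "\<And>f. f : cone_of M ==> m * sum f (\<Union>M) <= (\<Sum>j\<in>J. \<bar>?A f j\<bar>)"
  using sum_abs_bound[OF assms] by blast
 define g where "g = inv_into (cone_of M) ?A"
 have gf: "g (?A f) = f" if "f : cone_of M" for f using bij that unfolding g_def by (simp add: bij_betw_def)
 have fg: "?A (g t) = t" "g t : cone_of M" if "t : T" for t
  using bij that unfolding g_def by (auto simp: bij_betw_def f_inv_into_f inv_into_into)
 define C where "C r = {f : cone_of M. sum f (\<Union>M) <= r}" for r
 have compC: "compact (C r)" if "r > 0" for r
 proof -
  let ?sc = "%(s, f) v. s * f v :: real"
  have "C r <= insert (%_. 0) (?sc ` ({0..r} \<times> realization M))"
  proof
   fix f assume f: "f : C r"
   define s where "s = sum f (\<Union>M)"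
   have fc: "f : cone_of M" "s <= r" using f by (auto simp: C_def s_def)
   show "f : insert (%_. 0) (?sc ` ({0..r} \<times> realization M))"
   proof (cases "f = (%_. 0)")
    case False
    then obtain v where v: "f v ~= 0" by blast
    hence "v : \<Union>M" using cone_of_supp[OF fc(1)] by auto
    hence s: "s > 0" unfolding s_def using v cone_of_nonneg[OF fc(1)] acD(1)[OF aM]
     by (intro sum_pos2[of _ v]) (auto simp: less_le)
    have "(%v. (1 / s) * f v) : realization M"
     using cone_of_scale[OF aM fc(1), of "%_. 1 / s"] s
     by (auto simp: realization_cone[OF aM] sum_divide_distrib[symmetric] s_def)
    moreover have "f = ?sc (s, %v. (1 / s) * f v)" using s by auto
    ultimately show ?thesis using s fc(2) by (intro insertI2 image_eqI[of _ _ "(s, %v. (1 / s) * f v)"]) auto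
   qed simp
  qed
  moreover have "insert (%_. 0) (?sc ` ({0..r} \<times> realization M)) <= C r"
  proof -
   have "?sc (s, f) : C r" if "s : {0..r}" "f : realization M" for s f
    using that cone_of_scale[OF aM, of f "%_. s"]
    by (auto simp: C_def realization_cone[OF aM] sum_distrib_left[symmetric])
   thus ?thesis using zero_in_cone[OF aM] \<open>r > 0\<close> by (auto simp: C_def)
  qed
  moreover have "compact (?sc ` ({0..r} \<times> realization M))"
  proof (rule compact_continuous_image)
   show "continuous_on ({0..r} \<times> realization M) ?sc"
    unfolding case_prod_beta
   proof (rule continuous_on_coordinatewise_then_product)
    fix i
    have "continuous_on ({0..r} \<times> realization M) (%x. snd x i)"
     by (rule continuous_on_compose2[OF continuous_on_product_coordinates[of i] continuous_on_snd]) (auto intro: continuous_intros)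
    thus "continuous_on ({0..r} \<times> realization M) (%x. fst x * snd x i)"
     by (intro continuous_intros)
   qed
  qed (intro compact_Times compact_realization aM compact_Icc)
  ultimately show ?thesis by (metis (no_types, lifting) compact_insert subset_antisym)
 qed
 have "continuous_on T g"
  unfolding continuous_on_eq_continuous_within
 proof
  fix t assume t: "t : T"
  define N where "N t = (\<Sum>j\<in>J. \<bar>t j\<bar>)" for t :: "'v => real"
  have Nc: "continuous_on UNIV N" unfolding N_def
   by (intro continuous_intros continuous_on_product_coordinates)
  define r where "r = (N t + 1) / m"
  have "0 <= N t" unfolding N_def by (intro sum_nonneg) auto
  hence r: "r > 0" using m(1) by (simp add: r_def)
  define W where "W = {x. N x < N t + 1}"
  have "open W" unfolding W_def by (intro open_Collect_less Nc continuous_on_const)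
  have sub: "T Int W <= ?A ` C r"
  proof
   fix x assume x: "x : T Int W"
   hence "m * sum (g x) (\<Union>M) <= N x" using m(2)[of "g x"] fg by (simp add: N_def)
   also have "\<dots> <= N t + 1" using x by (simp add: W_def)
   finally have "g x : C r" using fg(2) x m(1) by (auto simp: C_def r_def pos_le_divide_eq mult.commute)
   thus "x : ?A ` C r" using fg(1) x by (metis IntD1 imageI)
  qed
  have "inj_on ?A (C r)" using bij by (auto simp: bij_betw_def C_def inj_on_def)
  then obtain g' where g': "homeomorphism (C r) (?A ` C r) ?A g'"
   using homeomorphism_compact[OF compC[OF r] continuous_on_affine_extension] by blast
  have "continuous_on (?A ` C r) g"
   by (rule continuous_on_eq[OF homeomorphism_cont2[OF g']])
    (use gf homeomorphism_apply1[OF g'] in \<open>auto simp: C_def\<close>)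
  hence "continuous_on (T Int W) g" using sub continuous_on_subset by blast
  hence "continuous (at t within T Int W) g" using t r \<open>0 <= N t\<close>
   by (simp add: continuous_on_eq_continuous_within W_def)
  moreover have "at t within T Int W = at t within T"
   by (rule at_within_nhd[of t W]) (use \<open>open W\<close> in \<open>auto simp: W_def\<close>)
  ultimately show "continuous (at t within T) g" by simp
 qed
 hence "homeomorphism (cone_of M) T ?A g"
  using bij gf fg continuous_on_affine_extension
  by (auto simp: homeomorphism_def bij_betw_def image_image cong: image_cong)
 thus thesis using that by blast
qed

lemma top_of_set_EU: "top_of_set (EU d) = Euclidean_space d"
 by (simp add: Euclidean_space_def EU_def euclidean_product_topology)

text \<open>Projective chart: division by the coordinate of v, with inverse given by normalising the
  total.\<close>

lemma star_homeomorphism: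
 assumes aK: "abstract_complex K" and v: "v : \<Union>K"
 shows "\<exists>f g. homeomorphism {x : realization K. x v > 0} (cone_of (link_of K v)) f g"
proof -
 let ?L = "link_of K v" and ?St = "{x : realization K. x v > 0}"
 have aL: "abstract_complex ?L" by (rule link_complex[OF aK v])
 have UL: "\<Union>?L <= \<Union>K - {v}" by (auto simp: link_of_def)
 have finK: "finite (\<Union>K)" by (rule acD(1)[OF aK])
 define f where "f x = (%w. if w = v then 0 else x w / x v)" for x :: "'a => real"
 define g where "g h = (%w. (if w = v then 1 else h w) / (1 + sum h (\<Union>?L)))" for h :: "'a => real"
 have pos: "1 + sum h (\<Union>?L) > 0" if "h : cone_of ?L" for h
  using cone_of_nonneg[OF that] sum_nonneg[of "\<Union>?L" h] by (simp add: add_pos_nonneg)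
 have hv: "h v = 0" if "h : cone_of ?L" for h using cone_of_supp[OF that] UL by auto
 have fin: "f x : cone_of ?L" if x: "x : ?St" for x
 proof -
  have "supp x : K" "\<And>w. 0 <= x w" "x v > 0" using x by (auto simp: realization_cone[OF aK] cone_of_def)
  moreover have "insert v (supp (f x)) = supp x" using \<open>x v > 0\<close> by (auto simp: f_def)
  ultimately show ?thesis by (auto simp: cone_of_def link_of_def f_def)
 qed
 have sumK: "sum x (\<Union>K) = x v + sum x (\<Union>?L)" if "x : ?St" for x
 proof -
  have c: "f x : cone_of ?L" by (rule fin[OF that])
  have "sum x (\<Union>K) = x v + sum x (\<Union>K - {v})" using finK v by (simp add: sum.remove)
  also have "sum x (\<Union>K - {v}) = sum x (\<Union>?L)"
  proof (rule sum.mono_neutral_right)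
   show "\<forall>i\<in>\<Union>K - {v} - \<Union>?L. x i = 0"
   proof
    fix i assume i: "i : \<Union>K - {v} - \<Union>?L"
    hence "f x i = 0" using cone_of_supp[OF c] by blast
    thus "x i = 0" using i that by (auto simp: f_def)
   qed
  qed (use finK UL in auto)
  finally show ?thesis .
 qed
 have gin: "g h : ?St" if h: "h : cone_of ?L" for h
 proof -
  have "supp (g h) = insert v (supp h)" using pos[OF h] hv[OF h] by (auto simp: g_def)
  moreover have "insert v (supp h) : K" using h by (auto simp: cone_of_def link_of_def)
  moreover have "0 <= g h w" for w using pos[OF h] cone_of_nonneg[OF h] by (auto simp: g_def)
  ultimately have gc: "g h : cone_of K" by (simp add: cone_of_def)
  have "sum (g h) (\<Union>K) = g h v + sum (g h) (\<Union>K - {v})" using finK v by (simp add: sum.remove)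
  also have "sum (g h) (\<Union>K - {v}) = sum (%w. h w / (1 + sum h (\<Union>?L))) (\<Union>?L)"
  proof (rule sum.mono_neutral_cong_right)
   show "\<forall>i\<in>\<Union>K - {v} - \<Union>?L. g h i = 0" using cone_of_supp[OF h] by (auto simp: g_def)
  qed (use finK UL in \<open>auto simp: g_def\<close>)
  also have "g h v + \<dots> = 1" using pos[OF h] by (simp add: g_def sum_divide_distrib[symmetric] add_divide_distrib[symmetric])
  finally show ?thesis using gc pos[OF h] by (simp add: realization_cone[OF aK] g_def)
 qed
 have gf: "g (f x) = x" if x: "x : ?St" for x
 proof -
  have "sum (f x) (\<Union>?L) = sum x (\<Union>?L) / x v"
  proof -
   have "v \<notin> \<Union>?L" using UL by blast
   hence "sum (f x) (\<Union>?L) = (\<Sum>w\<in>\<Union>?L. x w / x v)" by (intro sum.cong) (auto simp: f_def simp del: Union_iff)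
   thus ?thesis by (simp add: sum_divide_distrib)
  qed
  moreover have "x v + sum x (\<Union>?L) = 1" using sumK[OF x] x by (simp add: realization_cone[OF aK])
  ultimately have "1 + sum (f x) (\<Union>?L) = 1 / x v" using x by (simp add: field_simps)
  thus ?thesis using x by (auto simp: g_def f_def)
 qed
 have fg: "f (g h) = h" if h: "h : cone_of ?L" for h
  using pos[OF h] hv[OF h] by (auto simp: f_def g_def)
 have "continuous_on ?St f"
  unfolding f_def
 proof (rule continuous_on_coordinatewise_then_product)
  fix i
  show "continuous_on ?St (%x. if i = v then 0 else x i / x v)"
  proof (cases "i = v")
   case False
   have "continuous_on ?St (%x. x i / x v)"
    by (intro continuous_intros continuous_on_subset[OF continuous_on_product_coordinates]) auto
   thus ?thesis using False by simp
  qed simp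
 qed
 moreover have "continuous_on (cone_of ?L) g"
  unfolding g_def
 proof (rule continuous_on_coordinatewise_then_product)
  fix i
  have "continuous_on (cone_of ?L) (%h. h i / (1 + sum h (\<Union>?L)))" "continuous_on (cone_of ?L) (%h. 1 / (1 + sum h (\<Union>?L)))"
   using pos by (intro continuous_intros continuous_on_subset[OF continuous_on_product_coordinates]; force)+
  thus "continuous_on (cone_of ?L) (%h. (if i = v then 1 else h i) / (1 + sum h (\<Union>?L)))" by (cases "i = v") auto
 qed
 ultimately have "homeomorphism ?St (cone_of ?L) f g"
  using fin gin gf fg unfolding homeomorphism_def by (auto intro!: image_eqI[of _ f "g _"] image_eqI[of _ g "f _"])
 thus ?thesis by blast
qed

lemma manifold_transfer:
 assumes "Y homeomorphic_space X" "topological_manifold d Y" shows "topological_manifold d X"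
proof -
 obtain f where f: "homeomorphic_map Y X f" using assms(1) homeomorphic_space by blast
 have "\<exists>U. openin X U & x : U & subtopology X U homeomorphic_space Euclidean_space d" if x: "x : topspace X" for x
 proof -
  have "x : f ` topspace Y" using homeomorphic_imp_surjective_map[OF f] x by simp
  then obtain y where y: "y : topspace Y" "f y = x" by blast
  obtain U where U: "openin Y U" "y : U" "subtopology Y U homeomorphic_space Euclidean_space d"
   using assms(2) y unfolding topological_manifold_def by blast
  have UY: "U <= topspace Y" using U openin_subset by blast
  have o: "openin X (f ` U)" using homeomorphic_map_openness[OF f UY] U(1) by blast
  have "homeomorphic_map (subtopology Y U) (subtopology X (f ` U)) f"
   using UY o openin_subset by (intro homeomorphic_map_subtopologies[OF f]) blast
  hence "subtopology X (f ` U) homeomorphic_space subtopology Y U"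
   using homeomorphic_space homeomorphic_space_sym by blast
  thus ?thesis using o U y homeomorphic_space_trans by (intro exI[of _ "f ` U"]) blast
 qed
 thus ?thesis
  using assms homeomorphic_Hausdorff_space homeomorphic_space_second_countability
  unfolding topological_manifold_def by blast
qed

text \<open>Open stars cover, each is the cone over a link, and a common fan turns that cone into
  Euclidean space.\<close>

theorem PL_triangulates_manifold:
 fixes K :: "nat set set"
 assumes "PL_triangulates d K X" shows "topological_manifold d X"
proof (rule manifold_transfer)
 have aK: "abstract_complex K" and hX: "top_of_set (realization K) homeomorphic_space X"
  and sph: "\<And>v. v : \<Union>K ==> PL_homeomorphic (link_of K v) (simplex_boundary d)"
  using assms by (auto simp: PL_triangulates_def)
 show "top_of_set (realization K) homeomorphic_space X" by fact
 have "\<exists>U. openin (top_of_set (realization K)) U & x : U \<and>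
   subtopology (top_of_set (realization K)) U homeomorphic_space Euclidean_space d" if x: "x : realization K" for x
 proof -
  have "sum x (\<Union>K) = 1" using x by (simp add: realization_cone[OF aK])
  then obtain v where v: "v : \<Union>K" "x v ~= 0" by (metis sum.neutral zero_neq_one)
  define U where "U = {y : realization K. y v > 0}"
  have xv: "x : U" using v x cone_of_nonneg[of x K v] by (simp add: U_def realization_cone[OF aK] less_le)
  have "open {y :: nat => real. y v > 0}" by (intro open_Collect_less continuous_intros continuous_on_product_coordinates)
  hence o: "openin (top_of_set (realization K)) U"
   unfolding U_def openin_open by (intro exI[of _ "{y. y v > 0}"]) auto
  obtain f g where fg: "homeomorphism U (cone_of (link_of K v)) f g"
   using star_homeomorphism[OF aK v(1)] unfolding U_def by blast
  have aL: "abstract_complex (link_of K v)" by (rule link_complex[OF aK v(1)])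
  obtain M :: "nat set set" and \<phi> \<psi> where M: "fan M \<phi> (cone_of (link_of K v))" "fan M \<psi> (EU d)"
   using PL_sphere_fans[OF sph[OF v(1)] aL] .
  obtain g1 where g1: "homeomorphism (cone_of M) (cone_of (link_of K v)) (aff M \<phi>) g1"
   using fan_homeomorphism[OF M(1) acD(1)[OF aL] cone_of_supp] by blast
  have "supp t <= {..<d}" if "t : EU d" for t using that by (auto simp: EU_def not_le[symmetric])
  then obtain g2 where g2: "homeomorphism (cone_of M) (EU d) (aff M \<psi>) g2"
   using fan_homeomorphism[OF M(2), of "{..<d}"] by blast
  have "top_of_set U homeomorphic_space top_of_set (EU d)"
   using homeomorphism_homeomorphic_space[OF fg] homeomorphism_homeomorphic_space[OF g1]
    homeomorphism_homeomorphic_space[OF g2] homeomorphic_space_trans homeomorphic_space_sym by meson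
  moreover have "subtopology (top_of_set (realization K)) U = top_of_set U"
   by (simp add: subtopology_subtopology U_def Int_absorb1 Collect_restrict)
  ultimately show ?thesis using o xv top_of_set_EU by auto
 qed
 moreover have "Hausdorff_space (top_of_set (realization K))"
  by (simp add: Hausdorff_space_subtopology)
 moreover have "second_countable (top_of_set (realization K))"
 proof (rule second_countable_subtopology)
  obtain \<B> :: "(nat => real) set set" where B: "countable \<B>" "\<And>C. C : \<B> ==> open C"
   "\<And>S. open S ==> \<exists>U. U <= \<B> & S = \<Union>U"
   using univ_second_countable by blast
  have "\<exists>V\<in>\<B>. x : V & V <= U" if "open U" "x : U" for U x
   using B(3)[OF that(1)] that(2) by blast
  thus "second_countable (euclidean :: (nat => real) topology)"
   unfolding second_countable_def using B(1,2) by (intro exI[of _ \<B>]) auto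
 qed
 ultimately show "topological_manifold d (top_of_set (realization K))" by (simp add: topological_manifold_def)
qed

section \<open>Brown's method: crushing the core of a collared compact set to a point\<close>

section \<open>Shrinking a collared compact subset of Euclidean space\<close>

text \<open>The factor k rises linearly from e at radius R to 1 at radius R+1. Strict growth of t *
  k t gives injectivity, the intermediate value theorem surjectivity.\<close>

lemma radial_shrink:
 fixes e R :: real
 assumes e: "0 < e" "e < 1" and R: "0 < R"
 obtains \<sigma> :: "'a::euclidean_space => 'a"
 where "continuous_on UNIV \<sigma>" "bij \<sigma>" "\<sigma> 0 = 0" "\<And>z. R + 1 <= norm z ==> \<sigma> z = z"
  "\<And>z. norm z <= R ==> \<sigma> z = e *\<^sub>R z"
proof -
 define k where "k t = max e (min 1 (e + (1 - e) * (t - R)))" for t :: real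
 define \<sigma> where "\<sigma> z = k (norm z) *\<^sub>R z" for z :: 'a
 have kpos: "0 < k t" for t using e by (simp add: k_def)
 have kmono: "k s <= k t" if "s <= t" for s t
  unfolding k_def using that e by (intro max.mono min.mono add_mono mult_left_mono) auto
 have smono: "s * k s < t * k t" if "0 <= s" "s < t" for s t
 proof -
  have "s * k s <= s * k t" using that kmono by (intro mult_left_mono) auto
  also have "\<dots> < t * k t" using that kpos[of t] by simp
  finally show ?thesis .
 qed
 have cont: "continuous_on S k" for S unfolding k_def by (intro continuous_intros)
 have nrm: "norm (\<sigma> z) = norm z * k (norm z)" for z using kpos[of "norm z"] by (simp add: \<sigma>_def)
 have "continuous_on UNIV \<sigma>" unfolding \<sigma>_def
  by (intro continuous_intros continuous_on_compose2[OF cont[of UNIV]]) auto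
 moreover have "inj \<sigma>"
 proof (rule injI)
  fix x y assume eq: "\<sigma> x = \<sigma> y"
  hence "norm x * k (norm x) = norm y * k (norm y)" using nrm by metis
  hence "norm x = norm y"
   using smono[of "norm x" "norm y"] smono[of "norm y" "norm x"] by (metis less_irrefl linorder_neqE norm_ge_zero)
  thus "x = y" using eq kpos[of "norm y"] by (simp add: \<sigma>_def)
 qed
 moreover have "surj \<sigma>"
  unfolding surj_def
 proof
  fix w :: 'a
  have "norm w * 1 <= ((norm w + R + 1) * 1)" using R by simp
  have k1: "k t = 1" if "R + 1 <= t" for t
  proof -
   have "(1 - e) * 1 <= (1 - e) * (t - R)" using that e by (intro mult_left_mono) auto
   hence "1 <= e + (1 - e) * (t - R)" by (simp only: mult_1_right)
   hence "min 1 (e + (1 - e) * (t - R)) = 1" by (rule min_absorb1)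
   thus ?thesis using e by (simp add: k_def)
  qed
  have "\<exists>t. 0 <= t & t <= norm w + R + 1 & t * k t = norm w"
  proof (rule IVT')
   show "continuous_on {0..norm w + R + 1} (%t. t * k t)" by (intro continuous_intros cont)
  qed (use R k1 in auto)
  then obtain t where t: "0 <= t" "t * k t = norm w" by blast
  have "norm ((1 / k t) *\<^sub>R w) = t" using t kpos[of t] by (simp add: field_simps)
  thus "\<exists>x. w = \<sigma> x" using kpos[of t] by (intro exI[of _ "(1 / k t) *\<^sub>R w"]) (simp add: \<sigma>_def)
 qed
 moreover have "\<sigma> z = z" if "R + 1 <= norm z" for z
 proof -
  have "(1 - e) * 1 <= (1 - e) * (norm z - R)" using that e by (intro mult_left_mono) auto
  hence "1 <= e + (1 - e) * (norm z - R)" by (simp only: mult_1_right)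
  hence "min 1 (e + (1 - e) * (norm z - R)) = 1" by (rule min_absorb1)
  hence "k (norm z) = 1" using e by (simp add: k_def)
  thus ?thesis by (simp add: \<sigma>_def)
 qed
 moreover have "\<sigma> z = e *\<^sub>R z" if "norm z <= R" for z
 proof -
  have "(1 - e) * (norm z - R) <= 0" using that e by (intro mult_nonneg_nonpos) auto
  thus ?thesis using e by (simp add: \<sigma>_def k_def)
 qed
 ultimately show ?thesis using that[of \<sigma>] by (auto simp: bij_def \<sigma>_def)
qed

text \<open>\<mu> measures the depth in the collar, and \<open>T s\<close> rescales it while fixing
  the core \<mu> = 0. Conjugation by \<open>T s\<close> confines a homeomorphism to a thin collar of
  the core.\<close>

locale collared =
 fixes W :: "'x::topological_space set" and \<mu> :: "'x => real" and T :: "real => 'x => 'x"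
  and \<Phi> :: "'x => 'e::euclidean_space" and \<Psi> p
 assumes homeo: "homeomorphism W UNIV \<Phi> \<Psi>"
  and \<mu>: "continuous_on W \<mu>" "\<And>y. y : W ==> 0 <= \<mu> y"
  and T: "\<And>s. 0 < s ==> continuous_on W (T s)" "\<And>s y. 0 < s ==> y : W ==> T s y : W"
   "\<And>s y. 0 < s ==> y : W ==> T s (T (1 / s) y) = y"
   "\<And>s y. 0 < s ==> y : W ==> \<mu> (T s y) = s * \<mu> y" "\<And>s y. 0 < s ==> y : W ==> \<mu> y = 0 ==> T s y = y"
  and D_compact: "compact {y : W. \<mu> y <= 1}"
  and p: "p : W" "\<mu> p = 0" "\<Phi> p = 0"
begin

lemma \<Phi>\<Psi>: "\<Phi> (\<Psi> z) = z" "\<Psi> z : W" "y : W ==> \<Psi> (\<Phi> y) = y"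
 using homeo by (auto simp: homeomorphism_def)

lemma cont: "continuous_on W \<Phi>" "continuous_on UNIV \<Psi>"
 using homeo by (auto simp: homeomorphism_def)

text \<open>In the chart, a radial shrinking takes {\<mu> \<le> 1} into a small ball and is the
  identity outside a ball on which \<mu> \<le> b. Conjugated by \<open>T s\<close> it takes {\<mu>
  \<le> s} into \<open>U\<close> and moves only points with \<mu> \<le> s b < r.\<close>

lemma shrink:
 assumes r: "0 < r" and \<eta>: "0 < \<eta>" and U: "open U" "p : U"
 obtains \<psi> r' where "continuous_on W \<psi>" "bij_betw \<psi> W W" "\<psi> p = p" "\<And>y. y : W ==> r <= \<mu> y ==> \<psi> y = y"
  "0 < r'" "r' <= \<eta>" "\<And>y. y : W ==> \<mu> y <= r' ==> \<psi> y : U"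
proof -
 have "bounded (\<Phi> ` {y : W. \<mu> y <= 1})"
  by (intro compact_imp_bounded compact_continuous_image D_compact continuous_on_subset[OF cont(1)]) auto
 then obtain R where R: "0 < R" "\<And>y. y : W ==> \<mu> y <= 1 ==> norm (\<Phi> y) <= R"
  unfolding bounded_pos by auto
 have "compact (\<mu> ` \<Psi> ` cball 0 (R + 1))"
  using \<Phi>\<Psi>(2) by (intro compact_continuous_image compact_cball continuous_on_subset[OF cont(2)] continuous_on_subset[OF \<mu>(1)]) auto
 hence "bounded (\<mu> ` \<Psi> ` cball 0 (R + 1))" by (rule compact_imp_bounded)
 then obtain b where b: "0 < b" "\<And>z. norm z <= R + 1 ==> \<bar>\<mu> (\<Psi> z)\<bar> <= b"
  unfolding bounded_pos by auto
 define s where "s = min \<eta> (r / (2 * b))"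
 have s: "0 < s" "s <= \<eta>" using r \<eta> b(1) by (auto simp: s_def)
 have sb: "s * b < r"
 proof -
  have "s * b <= r / (2 * b) * b" using b(1) by (intro mult_right_mono) (auto simp: s_def)
  thus ?thesis using r b(1) by simp
 qed
 have "continuous_on UNIV (%z. T s (\<Psi> z))"
  by (rule continuous_on_compose2[OF T(1)[OF s(1)] cont(2)]) (use \<Phi>\<Psi>(2) in auto)
 hence "open ((%z. T s (\<Psi> z)) -` U)" using U(1) open_vimage by blast
 moreover have "\<Psi> 0 = p" using \<Phi>\<Psi>(3)[OF p(1)] p(3) by simp
 hence "0 : (%z. T s (\<Psi> z)) -` U" using T(5)[OF s(1) p(1,2)] U(2) by simp
 ultimately obtain d where d: "0 < d" "\<And>z. norm z < d ==> T s (\<Psi> z) : U"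
 proof -
  assume *: "\<And>d. [|0 < d; \<And>z. norm z < d ==> T s (\<Psi> z) : U|] ==> thesis"
  assume "open ((%z. T s (\<Psi> z)) -` U)" "0 : (%z. T s (\<Psi> z)) -` U"
  then obtain d where "0 < d" "ball 0 d <= (%z. T s (\<Psi> z)) -` U" unfolding open_contains_ball by blast
  thus thesis by (intro *[of d]) auto
 qed
 define e where "e = min (1 / 2) (d / (2 * R))"
 have e: "0 < e" "e < 1" "e * R < d"
 proof -
  have "e * R <= d / (2 * R) * R" using R(1) by (intro mult_right_mono) (auto simp: e_def)
  thus "e * R < d" using d(1) R(1) by simp
 qed (use d R in \<open>auto simp: e_def\<close>)
 obtain \<sigma> :: "'e => 'e" where \<sigma>: "continuous_on UNIV \<sigma>" "bij \<sigma>" "\<sigma> 0 = 0" "\<And>z. R + 1 <= norm z ==> \<sigma> z = z"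
  "\<And>z. norm z <= R ==> \<sigma> z = e *\<^sub>R z" using radial_shrink[OF e(1,2) R(1)] by blast
 define S where "S y = \<Psi> (\<sigma> (\<Phi> y))" for y
 have s': "0 < 1 / s" using s by simp
 define \<psi> where "\<psi> y = T s (S (T (1 / s) y))" for y
 have SW: "S y : W" for y by (simp add: S_def \<Phi>\<Psi>)
 have bT: "bij_betw (T t) W W" if t: "0 < t" for t
 proof (rule bij_betw_byWitness[where f' = "T (1 / t)"])
  show "\<forall>a\<in>W. T (1 / t) (T t a) = a" using T(3)[of "1 / t"] t by simp
  show "\<forall>a\<in>W. T t (T (1 / t) a) = a" using T(3)[OF t] by simp
 qed (use T(2)[of t] T(2)[of "1 / t"] t in auto)
 have bS: "bij_betw S W W"
 proof (rule bij_betw_byWitness[where f' = "%y. \<Psi> (inv_into UNIV \<sigma> (\<Phi> y))"])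
  show "\<forall>a\<in>W. \<Psi> (inv_into UNIV \<sigma> (\<Phi> (S a))) = a" using \<sigma>(2) by (simp add: S_def \<Phi>\<Psi> bij_def)
  show "\<forall>a\<in>W. S (\<Psi> (inv_into UNIV \<sigma> (\<Phi> a))) = a" using \<sigma>(2) by (simp add: S_def \<Phi>\<Psi> bij_def surj_f_inv_f)
 qed (auto simp: S_def \<Phi>\<Psi>)
 have "continuous_on W S" unfolding S_def
  by (rule continuous_on_compose2[OF cont(2)], rule continuous_on_compose2[OF \<sigma>(1) cont(1)]) auto
 hence "continuous_on W (%y. S (T (1 / s) y))"
  by (rule continuous_on_compose2[OF _ T(1)[OF s']]) (use T(2)[OF s'] in auto)
 hence "continuous_on W \<psi>" unfolding \<psi>_def
  by (rule continuous_on_compose2[OF T(1)[OF s(1)]]) (use SW in auto)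
 moreover have "bij_betw \<psi> W W"
  using bij_betw_trans[OF bT[OF s'] bij_betw_trans[OF bS bT[OF s(1)]]] by (simp add: \<psi>_def[abs_def] o_def)
 moreover have "\<psi> p = p"
  using T(5)[OF s(1) p(1,2)] T(5)[OF s' p(1,2)] \<sigma>(3) p(3) \<Phi>\<Psi>(3)[OF p(1)] by (simp add: \<psi>_def S_def)
 moreover have "\<psi> y = y" if y: "y : W" "r <= \<mu> y" for y
 proof -
  let ?y = "T (1 / s) y"
  have yW: "?y : W" using T(2)[OF s' y(1)] .
  have "~ norm (\<Phi> ?y) <= R + 1"
  proof
   assume "norm (\<Phi> ?y) <= R + 1"
   hence "\<mu> ?y <= b" using b(2)[of "\<Phi> ?y"] \<Phi>\<Psi>(3)[OF yW] by simp
   hence "\<mu> y / s <= b" using T(4)[OF s' y(1)] by simp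
   hence "\<mu> y <= s * b" using s(1) by (simp add: field_simps)
   thus False using sb y(2) by simp
  qed
  hence "S ?y = ?y" using \<sigma>(4)[of "\<Phi> ?y"] \<Phi>\<Psi>(3)[OF yW] by (simp add: S_def)
  thus ?thesis using T(3)[OF s(1) y(1)] by (simp add: \<psi>_def)
 qed
 moreover have "\<psi> y : U" if y: "y : W" "\<mu> y <= s" for y
 proof -
  let ?y = "T (1 / s) y"
  have yW: "?y : W" using T(2)[OF s' y(1)] .
  have "\<mu> ?y <= 1" using T(4)[OF s' y(1)] y(2) s(1) by simp
  hence n: "norm (\<Phi> ?y) <= R" using R(2) yW by blast
  have "norm (e *\<^sub>R \<Phi> ?y) <= e * R" using n e(1) by (simp add: mult_left_mono)
  hence "norm (\<sigma> (\<Phi> ?y)) < d" using \<sigma>(5)[OF n] e(3) by simp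
  thus ?thesis using d(2) by (simp add: \<psi>_def S_def)
 qed
 ultimately show ?thesis using that[of \<psi> s] s by blast
qed

text \<open>An infinite composite of shrinkings whose supports close in on the core. Off the core it
  is eventually constant, and near the core the images shrink to \<open>p\<close> in the chart, so
  the limit is continuous, injective off the core and constant on it.\<close>

theorem collapse:
 obtains q where "continuous_on W q" "q ` {y : W. \<mu> y <= 1} = {y : W. \<mu> y <= 1}" "\<And>y. y : W ==> 1 <= \<mu> y ==> q y = y"
  "\<And>y y'. [|y : W; y' : W|] ==> q y = q y' <-> y = y' | \<mu> y = 0 & \<mu> y' = 0"
proof -
 define good where "good i g r <-> continuous_on W g & bij_betw g W W & g p = p & (\<forall>y\<in>W. 1 <= \<mu> y --> g y = y) \<and>
   0 < r & r <= (1 / 2) ^ i & (\<forall>y\<in>W. \<mu> y <= r --> norm (\<Phi> (g y)) <= (1 / 2) ^ i)" for i :: nat and g r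
 have step: "\<exists>g' r'. good i g' r' & r' <= r & (\<forall>y\<in>W. r <= \<mu> y --> g' y = g y)"
  if g: "continuous_on W g" "bij_betw g W W" "g p = p" "\<forall>y\<in>W. 1 <= \<mu> y --> g y = y" and r: "0 < r" "r <= 1" for g r i
 proof -
  have gW: "g y : W" if "y : W" for y using g(2) that by (auto simp: bij_betw_def)
  have "openin (top_of_set W) (W Int (%y. \<Phi> (g y)) -` ball 0 ((1 / 2) ^ i))"
   by (intro continuous_openin_preimage_gen continuous_on_compose2[OF cont(1) g(1)]) (use gW in auto)
  \<comment> \<open>The next shrinking is applied before \<open>g\<close>; its target is therefore
    the preimage under \<open>g\<close> of a small ball.\<close>
  then obtain U where U: "open U" "W Int (%y. \<Phi> (g y)) -` ball 0 ((1 / 2) ^ i) = W Int U" unfolding openin_open by blast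
  have "p : W Int (%y. \<Phi> (g y)) -` ball 0 ((1 / 2) ^ i)" using p g(3) by simp
  hence pU: "p : U" using U by blast
  have m: "0 < min r ((1 / 2 :: real) ^ i)" using r by simp
  obtain \<psi> r' where \<psi>: "continuous_on W \<psi>" "bij_betw \<psi> W W" "\<psi> p = p" "\<And>y. y : W ==> r <= \<mu> y ==> \<psi> y = y"
    "0 < r'" "r' <= min r ((1 / 2) ^ i)" "\<And>y. y : W ==> \<mu> y <= r' ==> \<psi> y : U"
   using shrink[OF r(1) m U(1) pU] by blast
  have \<psi>W: "\<psi> y : W" if "y : W" for y using \<psi>(2) that by (auto simp: bij_betw_def)
  have "continuous_on W (g o \<psi>)" by (intro continuous_on_compose \<psi> continuous_on_subset[OF g(1)]) (use \<psi>W in auto)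
  moreover have "norm (\<Phi> ((g o \<psi>) y)) <= (1 / 2) ^ i" if y: "y : W" "\<mu> y <= r'" for y
  proof -
   have "\<psi> y : W Int U" using \<psi>(7)[OF y] \<psi>W[OF y(1)] by blast
   hence "\<psi> y : (%y. \<Phi> (g y)) -` ball 0 ((1 / 2) ^ i)" unfolding U(2)[symmetric] by blast
   thus ?thesis by simp
  qed
  ultimately have "good i (g o \<psi>) r'"
   using \<psi>(3,4,5,6) g(3,4) r bij_betw_trans[OF \<psi>(2) g(2)] by (auto simp: good_def)
  thus ?thesis using \<psi>(4,6) by (intro exI[of _ "g o \<psi>"] exI[of _ r']) auto
 qed
 obtain G where G: "\<And>i. good i (fst (G i)) (snd (G i))"
  "\<And>i. snd (G (Suc i)) <= snd (G i) & (\<forall>y\<in>W. snd (G i) <= \<mu> y --> fst (G (Suc i)) y = fst (G i) y)"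
 proof -
  have "\<exists>G. \<forall>i. good i (fst (G i)) (snd (G i)) \<and>
    (snd (G (Suc i)) <= snd (G i) & (\<forall>y\<in>W. snd (G i) <= \<mu> y --> fst (G (Suc i)) y = fst (G i) y))"
  proof (rule dependent_nat_choice)
   have "\<exists>g' r'. good 0 g' r' & r' <= 1 & (\<forall>y\<in>W. 1 <= \<mu> y --> g' y = id y)"
    by (rule step) (auto simp: bij_betw_def inj_on_def)
   thus "\<exists>x. good 0 (fst x) (snd x)" by auto
  next
   fix x i assume x: "good i (fst x) (snd x)"
   have "snd x <= 1" using x power_le_one[of "1 / 2 :: real" i] by (simp add: good_def)
   hence "\<exists>g' r'. good (Suc i) g' r' & r' <= snd x & (\<forall>y\<in>W. snd x <= \<mu> y --> g' y = fst x y)"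
    using x by (intro step) (simp_all add: good_def)
   thus "\<exists>y. good (Suc i) (fst y) (snd y) & (snd y <= snd x & (\<forall>z\<in>W. snd x <= \<mu> z --> fst y z = fst x z))" by auto
  qed
  thus ?thesis using that by blast
 qed
 define g where "g i = fst (G i)" for i
 define r where "r i = snd (G i)" for i
 have g: "continuous_on W (g i)" "bij_betw (g i) W W" "g i p = p" "\<And>y. y : W ==> 1 <= \<mu> y ==> g i y = y"
  "0 < r i" "r i <= (1 / 2) ^ i" "\<And>y. y : W ==> \<mu> y <= r i ==> norm (\<Phi> (g i y)) <= (1 / 2) ^ i" for i
  using G(1)[of i] by (auto simp: good_def g_def r_def)
 have gs: "r (Suc i) <= r i" "\<And>y. y : W ==> r i <= \<mu> y ==> g (Suc i) y = g i y" for i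
  using G(2)[of i] by (auto simp: g_def r_def)
 have rdec: "r j <= r i" if "i <= j" for i j using that by (induction j rule: dec_induct) (use gs(1) order_trans in blast)+
 have gconst: "g j y = g i y" if "i <= j" "y : W" "r i <= \<mu> y" for i j y
  using that(1)
 proof (induction j rule: dec_induct)
  case (step j)
  thus ?case using gs(2)[of y j] that rdec[of i j] by simp
 qed simp
 have giW: "g i y : W" if "y : W" for i y using g(2)[of i] that by (auto simp: bij_betw_def)
 have ginj: "y = y'" if "y : W" "y' : W" "g i y = g i y'" for i y y'
  using g(2)[of i] that by (auto simp: bij_betw_def inj_on_def)
 have small: "\<exists>i. (1 / 2) ^ i < (x :: real)" if "0 < x" for x using real_arch_pow_inv[OF that, of "1 / 2"] by simp
 have ex_i: "\<exists>i. r i <= \<mu> y" if "0 < \<mu> y" for y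
  using small[OF that] g(6) by (meson less_le_not_le order_trans)
 \<comment> \<open>Once r i \<le> \<mu> y, the value g i y no longer changes.\<close>
 define q where "q y = (if 0 < \<mu> y then g (LEAST i. r i <= \<mu> y) y else p)" for y
 have q_eq: "q y = g i y" if y: "y : W" "r i <= \<mu> y" for y i
 proof -
  have pos: "0 < \<mu> y" using g(5)[of i] y by simp
  have "(LEAST i. r i <= \<mu> y) <= i" using y(2) by (rule Least_le)
  moreover have "r (LEAST i. r i <= \<mu> y) <= \<mu> y" using y(2) by (rule LeastI)
  ultimately show ?thesis using gconst[OF _ y(1)] pos by (simp add: q_def)
 qed
 have qW: "q y : W" if "y : W" for y using giW that p by (simp add: q_def)
 \<comment> \<open>The point g j y equals g i z for some z. If z had \<mu> z > r i, then g j z = g i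
   z and hence z = y, contrary to \<mu> y < r i. So z lies where g i is already small.\<close>
 have tail: "norm (\<Phi> (g j y)) <= (1 / 2) ^ i" if y: "y : W" "\<mu> y < r i" and ij: "i <= j" for i j y
 proof -
  have "g j y : g i ` W" using giW[OF y(1)] g(2)[of i] by (simp add: bij_betw_def)
  then obtain z where z: "z : W" "g j y = g i z" by blast
  have "\<mu> z <= r i"
  proof (rule ccontr)
   assume n: "~ \<mu> z <= r i"
   hence "g j z = g i z" using gconst[OF ij z(1)] by simp
   hence "y = z" using ginj[OF y(1) z(1), of j] z(2) by simp
   thus False using n y(2) by simp
  qed
  thus ?thesis using g(7)[OF z(1)] z(2) by simp
 qed
 have close: "dist (\<Phi> (g i y)) (\<Phi> (q y)) <= 2 * (1 / 2) ^ i" if y: "y : W" for i y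
 proof (cases "r i <= \<mu> y")
  case True
  thus ?thesis using q_eq[OF y True] by simp
 next
  case False
  hence mu: "\<mu> y < r i" by simp
  have "norm (\<Phi> (q y)) <= (1 / 2) ^ i"
  proof (cases "0 < \<mu> y")
   case True
   then obtain j where j: "r j <= \<mu> y" using ex_i by blast
   hence "~ j <= i" using rdec[of j i] mu by linarith
   thus ?thesis using tail[OF y mu, of j] q_eq[OF y j] by simp
  qed (simp add: q_def p)
  moreover have "norm (\<Phi> (g i y)) <= (1 / 2) ^ i" using tail[OF y mu order_refl] .
  ultimately show ?thesis using norm_triangle_ineq4[of "\<Phi> (g i y)" "\<Phi> (q y)"] by (simp add: dist_norm)
 qed
 have "continuous_on W (%y. \<Phi> (q y))"
 proof (rule uniform_limit_theorem[of _ "%i y. \<Phi> (g i y)" sequentially])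
  show "\<forall>\<^sub>F i in sequentially. continuous_on W (%y. \<Phi> (g i y))"
   using giW by (intro always_eventually allI continuous_on_compose2[OF cont(1) g(1)]) auto
  show "uniform_limit W (%i y. \<Phi> (g i y)) (%y. \<Phi> (q y)) sequentially"
  proof (rule uniform_limitI)
   fix e :: real assume e: "0 < e"
   then obtain N where N: "(1 / 2) ^ N < e / 2" using small[of "e / 2"] by auto
   have "dist (\<Phi> (g i y)) (\<Phi> (q y)) < e" if "N <= i" "y : W" for i y
   proof -
    have "(1 / 2 :: real) ^ i <= (1 / 2) ^ N" using that(1) by (intro power_decreasing) auto
    thus ?thesis using close[OF that(2), of i] N by linarith
   qed
   thus "\<forall>\<^sub>F i in sequentially. \<forall>y\<in>W. dist (\<Phi> (g i y)) (\<Phi> (q y)) < e"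
    unfolding eventually_sequentially by blast
  qed
 qed simp
 hence "continuous_on W (%y. \<Psi> (\<Phi> (q y)))" by (rule continuous_on_compose2[OF cont(2)]) simp
 hence "continuous_on W q" using \<Phi>\<Psi>(3) qW by (simp cong: continuous_on_cong)
 moreover have q1: "q y = y" if y: "y : W" "1 <= \<mu> y" for y
 proof -
  have "r 0 <= \<mu> y" using g(6)[of 0] y by simp
  thus ?thesis using q_eq[OF y(1)] g(4)[OF y] by simp
 qed
 moreover have q_p: "q y = p <-> \<mu> y = 0" if y: "y : W" for y
 proof
  assume qp: "q y = p"
  show "\<mu> y = 0"
  proof (rule ccontr)
   assume n: "\<mu> y ~= 0"
   hence "0 < \<mu> y" using \<mu>(2)[OF y] by simp
   then obtain i where "r i <= \<mu> y" using ex_i by blast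
   hence "g i y = g i p" using q_eq[OF y] qp g(3)[of i] by simp
   hence "y = p" using ginj[OF y p(1)] by blast
   thus False using n p by simp
  qed
 qed (simp add: q_def)
 moreover have "q y = q y' <-> y = y' | \<mu> y = 0 & \<mu> y' = 0" if y: "y : W" "y' : W" for y y'
 proof (cases "\<mu> y = 0 | \<mu> y' = 0")
  case True
  thus ?thesis using q_p[OF y(1)] q_p[OF y(2)] by metis
 next
  case False
  hence "0 < \<mu> y" "0 < \<mu> y'" using \<mu>(2)[OF y(1)] \<mu>(2)[OF y(2)] by auto
  then obtain i j where "r i <= \<mu> y" "r j <= \<mu> y'" using ex_i by blast
  hence "r (max i j) <= \<mu> y" "r (max i j) <= \<mu> y'" using rdec[of i "max i j"] rdec[of j "max i j"] by linarith+
  thus ?thesis using q_eq[OF y(1)] q_eq[OF y(2)] ginj[OF y] False by metis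
 qed
 moreover have "q ` {y : W. \<mu> y <= 1} = {y : W. \<mu> y <= 1}"
 proof (intro equalityI subsetI)
  fix z assume "z : q ` {y : W. \<mu> y <= 1}"
  then obtain y where y: "y : W" "\<mu> y <= 1" "z = q y" by blast
  have "\<mu> (q y) <= 1"
  proof (rule ccontr)
   assume n: "~ \<mu> (q y) <= 1"
   hence e: "q (q y) = q y" using q1[OF qW[OF y(1)]] by simp
   have "\<mu> y ~= 0" using q_p[OF y(1)] n p by auto
   hence "q y = y" using e \<open>\<And>y y'. [|y : W; y' : W|] ==> q y = q y' <-> y = y' | \<mu> y = 0 & \<mu> y' = 0\<close>[OF qW[OF y(1)] y(1)] n by auto
   thus False using n y(2) by simp
  qed
  thus "z : {y : W. \<mu> y <= 1}" using y qW by simp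
 next
  fix z assume z: "z : {y : W. \<mu> y <= 1}"
  show "z : q ` {y : W. \<mu> y <= 1}"
  proof (cases "z = p")
   case True
   thus ?thesis using q_p[OF p(1)] p by (intro image_eqI[of _ _ p]) auto
  next
   case False
   have "\<Phi> z ~= 0" using False \<Phi>\<Psi>(3)[of z] \<Phi>\<Psi>(3)[OF p(1)] z p(3) by auto
   then obtain i where i: "(1 / 2) ^ i < norm (\<Phi> z)" using small[of "norm (\<Phi> z)"] by auto
   have "z : g i ` W" using z g(2)[of i] by (simp add: bij_betw_def)
   then obtain y where y: "y : W" "z = g i y" by blast
   have "~ \<mu> y <= r i" using g(7)[OF y(1), of i] i y(2) by auto
   hence qy: "q y = z" using q_eq[OF y(1), of i] y(2) by simp
   have "\<mu> y <= 1"
   proof (rule ccontr)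
    assume "~ \<mu> y <= 1"
    thus False using q1[OF y(1)] qy z by simp
   qed
   thus ?thesis using y(1) qy by blast
  qed
 qed
 ultimately show ?thesis using that[of q] by blast
qed

end

section \<open>Gluing\<close>

text \<open>Both unions are quotients of the same finite sum of copies of the compact set
  \<open>Y\<close> by the same relation, because a continuous map from a compact to a Hausdorff
  space is closed.\<close>

lemma glue_homeomorphic:
 fixes A :: "'j => 'y::topological_space => 'a::t2_space" and B :: "'j => 'y => 'b::t2_space"
 assumes J: "finite J" and Y: "compact Y"
  and A: "\<And>j. j : J ==> continuous_on Y (A j)" and B: "\<And>j. j : J ==> continuous_on Y (B j)"
  and fib: "\<And>j k y z. [|j : J; k : J; y : Y; z : Y|] ==> A j y = A k z <-> B j y = B k z"
 shows "compact (\<Union>j\<in>J. A j ` Y)" "(\<Union>j\<in>J. A j ` Y) homeomorphic (\<Union>j\<in>J. B j ` Y)"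
proof -
 let ?X = "\<Union>j\<in>J. A j ` Y" and ?Z = "\<Union>j\<in>J. B j ` Y"
 show cX: "compact ?X" using J by (intro compact_UN compact_continuous_image A Y) auto
 define h where "h x = (SOME z. \<exists>j\<in>J. \<exists>y\<in>Y. x = A j y & z = B j y)" for x
 have h: "h (A j y) = B j y" if "j : J" "y : Y" for j y
  unfolding h_def
 proof (rule some_equality)
  show "\<exists>k\<in>J. \<exists>z\<in>Y. A j y = A k z & B j y = B k z" using that by blast
  fix w assume "\<exists>k\<in>J. \<exists>z\<in>Y. A j y = A k z & w = B k z"
  then obtain k z where "k : J" "z : Y" "A j y = A k z" "w = B k z" by blast
  thus "w = B j y" using fib[OF that(1) _ that(2), of k z] by simp
 qed
 have "continuous_on ?X h"
  unfolding continuous_on_closed_invariant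
 proof (intro allI impI)
  fix C :: "'b set" assume C: "closed C"
  have "\<exists>K. closed K & K Int Y = B j -` C Int Y" if "j : J" for j
   using B[OF that] C unfolding continuous_on_closed_invariant by blast
  then obtain K where K: "\<And>j. j : J ==> closed (K j) & K j Int Y = B j -` C Int Y" by metis
  have "compact (K j Int Y)" if "j : J" for j using K[OF that] Y closed_Int_compact by blast
  hence "compact (\<Union>j\<in>J. A j ` (K j Int Y))"
   using J by (intro compact_UN compact_continuous_image continuous_on_subset[OF A]) auto
  hence cl: "closed (\<Union>j\<in>J. A j ` (K j Int Y))" by (rule compact_imp_closed)
  have "(\<Union>j\<in>J. A j ` (K j Int Y)) Int ?X = h -` C Int ?X"
  proof (intro equalityI subsetI)
   fix x assume "x : (\<Union>j\<in>J. A j ` (K j Int Y)) Int ?X"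
   then obtain j y where j: "j : J" "y : K j Int Y" "x = A j y" by blast
   hence "B j y : C" using K[OF j(1)] by blast
   thus "x : h -` C Int ?X" using j h[of j y] by auto
  next
   fix x assume "x : h -` C Int ?X"
   then obtain j y where j: "j : J" "y : Y" "x = A j y" "h x : C" by blast
   hence "y : K j Int Y" using K[OF j(1)] h[OF j(1,2)] by auto
   thus "x : (\<Union>j\<in>J. A j ` (K j Int Y)) Int ?X" using j by blast
  qed
  thus "\<exists>A. closed A & A Int ?X = h -` C Int ?X" using cl by blast
 qed
 moreover have "inj_on h ?X"
 proof (rule inj_onI)
  fix x x' assume "x : ?X" "x' : ?X" "h x = h x'"
  then obtain j y k z where "j : J" "y : Y" "x = A j y" "k : J" "z : Y" "x' = A k z" by blast
  thus "x = x'" using h[of j y] h[of k z] fib \<open>h x = h x'\<close> by simp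
 qed
 moreover have "h ` ?X = ?Z"
 proof -
  have "h ` A j ` Y = B j ` Y" if "j : J" for j using h[OF that] by (force simp: image_image)
  thus ?thesis by (simp add: image_UN)
 qed
 ultimately show "?X homeomorphic ?Z"
  using homeomorphism_compact[OF cX] unfolding homeomorphic_def by metis
qed

section \<open>The complement of the open star of \<open>v0\<close>, and both chambers as quotients
  of its product with an interval\<close>

section \<open>The complement of an open star\<close>

lemma continuous_coordinate: "continuous_on S (%x :: 'v => real. x v)"
 by (rule continuous_on_subset[OF continuous_on_product_coordinates]) simp

lemma continuous_on_Max_insert:
 assumes "finite F" shows "continuous_on S (%y :: 'v => real. Max (insert 0 (y ` F)))"
 using assms
proof (induction F)
 case (insert a F)
 have "Max (insert 0 (y ` insert a F)) = max (y a) (Max (insert 0 (y ` F)))" for y :: "'v => real"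
 proof -
  have "insert 0 (y ` insert a F) = insert (y a) (insert 0 (y ` F))" by auto
  thus ?thesis using insert.hyps by simp
 qed
 moreover have "continuous_on S (%y :: 'v => real. max (y a) (Max (insert 0 (y ` F))))"
  by (intro continuous_on_max insert.IH continuous_coordinate)
 ultimately show ?case by simp
qed simp

text \<open>For polar coordinates at a cone point: a direction without limit, multiplied by a radius
  k tending to 0.\<close>

lemma continuous_on_bounded_by:
 fixes F :: "'y::topological_space => real"
 assumes k: "continuous_on S k" "\<And>y. y : S ==> \<bar>F y\<bar> <= k y" and F: "continuous_on {y : S. 0 < k y} F"
 shows "continuous_on S F"
 unfolding continuous_on_def
proof
 fix y assume y: "y : S"
 show "(F \<longlongrightarrow> F y) (at y within S)"
 proof (cases "k y = 0")
  case True
  hence "F y = 0" using k(2)[OF y] by simp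
  moreover have "(k \<longlongrightarrow> 0) (at y within S)" using k(1) y True unfolding continuous_on_def by metis
  hence "(F \<longlongrightarrow> 0) (at y within S)"
  proof (rule Lim_null_comparison[rotated])
   show "\<forall>\<^sub>F x in at y within S. norm (F x) <= k x"
    using k(2) by (auto simp: eventually_at_filter)
  qed
  ultimately show ?thesis by simp
 next
  case False
  hence pos: "0 < k y" using k(2)[OF y] by simp
  have "openin (top_of_set S) (S Int k -` {0<..})" by (intro continuous_openin_preimage_gen k) simp
  then obtain O' where O: "open O'" "S Int k -` {0<..} = S Int O'" unfolding openin_open by blast
  have "y : O'" using y pos O(2) by auto
  hence "at y within S = at y within (S Int O')" using O(1) by (intro at_within_nhd[of y O']) auto
  also have "S Int O' = {y : S. 0 < k y}" using O(2) by auto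
  finally have "at y within S = at y within {y : S. 0 < k y}" .
  thus ?thesis using F y pos unfolding continuous_on_def by auto
 qed
qed

lemma nsphere_point: "(%i. if i = 0 then 1 else 0) : topspace (nsphere 3)"
 by (simp add: nsphere numeral_eq_Suc)

context chamber_complex begin

definition nrm :: "('b => real) => real" where
 "nrm y = Max (insert 0 (y ` V1))"

lemma nrm_ge: "w : V1 ==> y w <= nrm y" and nrm_nonneg: "0 <= nrm y"
 using finite_V0(2) by (auto simp: nrm_def)

lemma nrm_le_iff: "nrm y <= r <-> 0 <= r & (\<forall>w\<in>V1. y w <= r)"
 using finite_V0(2) by (simp add: nrm_def)

lemma nrm_attained: "0 < nrm y ==> \<exists>w\<in>V1. y w = nrm y"
proof -
 assume p: "0 < nrm y"
 have "nrm y : insert 0 (y ` V1)" unfolding nrm_def using finite_V0(2) by (intro Max_in) auto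
 thus ?thesis using p by auto
qed

lemma nrm_cong: "(\<And>w. w : V1 ==> y w = z w) ==> nrm y = nrm z"
 by (simp add: nrm_def cong: image_cong)

lemma nrm_scale: assumes a: "0 <= a" shows "nrm (%v. a * y v) = a * nrm y"
proof (rule antisym)
 show "nrm (%v. a * y v) <= a * nrm y"
  using a nrm_ge[of _ y] nrm_nonneg[of y] by (auto simp: nrm_le_iff intro: mult_left_mono)
 show "a * nrm y <= nrm (%v. a * y v)"
 proof (cases "0 < nrm y")
  case True
  then obtain w where "w : V1" "y w = nrm y" using nrm_attained by blast
  thus ?thesis using nrm_ge[of w "%v. a * y v"] by simp
 next
  case False
  hence "nrm y = 0" using nrm_nonneg[of y] by simp
  thus ?thesis using nrm_nonneg by simp
 qed
qed

lemma continuous_nrm: "continuous_on S f ==> continuous_on S (%x. nrm (f x))"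
 unfolding nrm_def by (rule continuous_on_compose2[OF continuous_on_Max_insert[OF finite_V0(2), of UNIV]]) auto

text \<open>The punctured complex \<open>|\<Gamma>| - v0\<close>, with points rescaled so that their largest coordinate
 away from \<open>v0\<close> is 1. In these coordinates \<open>y v0\<close> is a collar parameter of the complement
 of the open star.\<close>

definition W :: "('b => real) set" where
 "W = {y. (\<forall>v. 0 <= y v) & supp y : \<Gamma> & nrm y = 1}"

definition D :: "('b => real) set" where
 "D = {y : W. y v0 <= 1}"

lemma WD: "y : W ==> 0 <= y v" "y : W ==> supp y : \<Gamma>" "y : W ==> nrm y = 1" "y : W ==> w : V1 ==> y w <= 1"
 using nrm_ge[of w y] by (auto simp: W_def)

lemma supp_V: "supp y : \<Gamma> ==> v \<notin> V ==> y v = 0"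
 by blast

lemma V_split: "V = insert v0 V1" "v0 \<notin> V1"
 using v0 by (auto simp: V1_def)

lemma W_sum: "y : W ==> 1 <= sum y V1"
proof -
 assume y: "y : W"
 have "0 < nrm y" using WD(3)[OF y] by simp
 then obtain w where w: "w : V1" "y w = 1" using nrm_attained WD(3)[OF y] by metis
 thus ?thesis using member_le_sum[of w V1 y] finite_V0(2) WD(1)[OF y] by simp
qed

lemma compact_D: "compact D"
proof -
 define B where "B \<sigma> = PiE UNIV (%v. if v : \<sigma> then {0..1} else {0::real})" for \<sigma> :: "'b set"
 have "compact (B \<sigma>)" for \<sigma>
 proof -
  have "compactin (product_topology (%_. euclidean) UNIV) (B \<sigma>)"
   unfolding B_def compactin_PiE by (auto simp: compactin_euclidean_iff)
  thus ?thesis by (simp add: euclidean_product_topology)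
 qed
 moreover have "closed {y. nrm y = 1}"
  by (intro closed_Collect_eq continuous_nrm[OF continuous_on_id] continuous_on_const)
 ultimately have "compact (\<Union>\<sigma>\<in>\<Gamma>. B \<sigma> Int {y. nrm y = 1})"
  using acD(6)[OF aG] by (intro compact_UN compact_Int_closed) auto
 also have "(\<Union>\<sigma>\<in>\<Gamma>. B \<sigma> Int {y. nrm y = 1}) = D"
 proof (intro equalityI subsetI)
  fix y assume "y : (\<Union>\<sigma>\<in>\<Gamma>. B \<sigma> Int {y. nrm y = 1})"
  then obtain \<sigma> where s: "\<sigma> : \<Gamma>" "nrm y = 1" "\<And>v. y v : (if v : \<sigma> then {0..1} else {0})" by (auto simp: B_def PiE_def Pi_iff)
  have "supp y <= \<sigma>" using s(3) by (metis (mono_tags, lifting) mem_Collect_eq singletonD subsetI)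
  hence "supp y : \<Gamma>" using acD(3)[OF aG s(1)] by blast
  moreover have "0 <= y v & y v <= 1" for v using s(3)[of v] by (auto split: if_splits)
  ultimately show "y : D" using s(2) by (simp add: D_def W_def)
 next
  fix y assume y: "y : D"
  hence yW: "y : W" "y v0 <= 1" by (auto simp: D_def)
  have "y v <= 1" for v
  proof (cases "v : V")
   case True
   thus ?thesis using V_split(1) yW(2) WD(4)[OF yW(1)] by auto
  next
   case False
   thus ?thesis using supp_V[OF WD(2)[OF yW(1)]] by simp
  qed
  hence "y : B (supp y)" using WD(1)[OF yW(1)] by (auto simp: B_def)
  thus "y : (\<Union>\<sigma>\<in>\<Gamma>. B \<sigma> Int {y. nrm y = 1})" using WD(2,3)[OF yW(1)] by blast
 qed
 finally show ?thesis .
qed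

text \<open>Both sets are slices of the same cone of functions, one by total 1, the other by
  \<open>nrm\<close> = 1; away from \<open>v0\<close> the value of \<open>nrm\<close> is
  positive.\<close>

lemma W_homeomorphic: "(realization \<Gamma> - {%v. if v = v0 then 1 else 0}) homeomorphic W"
proof -
 let ?\<delta> = "%v. if v = v0 then 1 else 0 :: real"
 let ?R = "realization \<Gamma> - {?\<delta>}"
 note R = realization_cone[OF aG]
 have sV: "sum y (V) = y v0 + sum y V1" for y :: "'b => real"
  using finite_V0(2) V_split by simp
 have npos: "0 < nrm x" if x: "x : ?R" for x
 proof (rule ccontr)
  assume "~ 0 < nrm x"
  hence "nrm x <= 0" by simp
  hence z: "x w = 0" if "w : V1" for w
   using that x by (simp add: nrm_le_iff R cone_of_def antisym)
  hence "x v0 = 1" using x sV[of x] by (simp add: R)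
  moreover have "x v = 0" if "v ~= v0" for v
  proof (cases "v : V")
   case True
   thus ?thesis using z that V_split(1) by blast
  next
   case False
   thus ?thesis using x supp_V[of x v] by (simp add: R cone_of_def)
  qed
  ultimately have "x = ?\<delta>" by auto
  thus False using x by simp
 qed
 have spos: "0 < sum y (V)" if "y : W" for y
  using W_sum[OF that] WD(1)[OF that, of v0] sV[of y] by simp
 have "homeomorphism ?R W (%x v. 1 / nrm x * x v) (%y v. 1 / sum y (V) * y v)"
  unfolding homeomorphism_def
 proof (intro conjI ballI)
  show "continuous_on ?R (%x v. 1 / nrm x * x v)"
   using npos by (intro continuous_on_coordinatewise_then_product continuous_on_mult continuous_on_divide continuous_on_const
    continuous_nrm[OF continuous_on_id] continuous_coordinate) (metis less_irrefl)+
  show "continuous_on W (%y v. 1 / sum y (V) * y v)"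
   using spos by (intro continuous_on_coordinatewise_then_product continuous_on_mult continuous_on_divide continuous_on_const
    continuous_on_sum continuous_coordinate) (metis less_irrefl)+
  have a: "(%v. 1 / nrm x * x v) : W & (%v. 1 / sum (%v. 1 / nrm x * x v) (V) * (1 / nrm x * x v)) = x" if x: "x : ?R" for x
  proof -
   have "nrm (%v. 1 / nrm x * x v) = 1" using nrm_scale[of "1 / nrm x" x] npos[OF x] by simp
   moreover have "supp (%v. 1 / nrm x * x v) = supp x" using npos[OF x] by auto
   ultimately have "(%v. 1 / nrm x * x v) : W" using x npos[OF x] by (simp add: W_def R cone_of_def)
   moreover have "sum (%v. 1 / nrm x * x v) (V) = 1 / nrm x"
    using x by (simp only: sum_distrib_left[symmetric]) (simp add: R)
   ultimately show ?thesis using npos[OF x] by simp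
  qed
  have b: "(%v. 1 / sum y (V) * y v) : ?R & (%v. 1 / nrm (%v. 1 / sum y (V) * y v) * (1 / sum y (V) * y v)) = y" if y: "y : W" for y
  proof -
   let ?s = "sum y (V)" and ?z = "%v. 1 / sum y (V) * y v"
   have "supp ?z = supp y" using spos[OF y] by auto
   hence "?z : cone_of \<Gamma>" using y spos[OF y] by (simp add: W_def cone_of_def)
   moreover have "sum ?z (V) = 1" using spos[OF y] by (simp only: sum_distrib_left[symmetric]) simp
   moreover have nz: "nrm ?z = 1 / ?s" using nrm_scale[of "1 / ?s" y] spos[OF y] WD(3)[OF y] by simp
   moreover have "nrm ?\<delta> <= 0" using V_split(2) by (auto simp: nrm_le_iff)
   hence "?z ~= ?\<delta>" using nz spos[OF y] by (metis divide_pos_pos leD zero_less_one)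
   ultimately show ?thesis using spos[OF y] by (simp add: R)
  qed
  show "(%x v. 1 / nrm x * x v) ` ?R = W"
  proof (intro equalityI subsetI)
   fix y assume "y : W"
   thus "y : (%x v. 1 / nrm x * x v) ` ?R" using b[of y] by (intro image_eqI[of _ _ "%v. 1 / sum y (V) * y v"]) auto
  qed (use a in auto)
  show "(%y v. 1 / sum y (V) * y v) ` W = ?R"
  proof (intro equalityI subsetI)
   fix x assume x: "x : ?R"
   thus "x : (%y v. 1 / sum y (V) * y v) ` W" using a[OF x] by (intro image_eqI[of _ _ "%v. 1 / nrm x * x v"]) auto
  qed (use b in auto)
  show "(%v. 1 / sum (%v. 1 / nrm x * x v) (V) * (1 / nrm x * x v)) = x" if "x : ?R" for x using a[OF that] by blast
  show "(%v. 1 / nrm (%v. 1 / sum y (V) * y v) * (1 / sum y (V) * y v)) = y" if "y : W" for y using b[OF that] by blast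
 qed
 thus ?thesis unfolding homeomorphic_def by blast
qed

lemma homeomorphic_maps_homeomorphism:
 assumes "homeomorphic_maps (top_of_set S) (top_of_set T) f g" shows "homeomorphism S T f g"
proof -
 have fg: "continuous_on S f" "f ` S <= T" "continuous_on T g" "g ` T <= S" "\<forall>x\<in>S. g (f x) = x" "\<forall>y\<in>T. f (g y) = y"
  using assms by (auto simp: homeomorphic_maps_def continuous_map_in_subtopology)
 hence "f ` S = T" "g ` T = S" by force+
 thus ?thesis using fg by (simp add: homeomorphism_def)
qed

text \<open>Stereographic projection: a punctured 3-sphere is homeomorphic to a hyperplane of
  4-space.\<close>

lemma W_Euclidean:
 assumes sph: "top_of_set (realization \<Gamma>) homeomorphic_space nsphere 3"
 shows "W homeomorphic (UNIV :: (real ^ 3) set)"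
proof -
 let ?\<delta> = "%v. if v = v0 then 1 else 0 :: real"
 have \<delta>: "?\<delta> : realization \<Gamma>"
 proof -
  have "supp ?\<delta> = {v0}" by auto
  moreover have "{v0} : \<Gamma>" using acD(5)[OF aG v0] .
  ultimately show ?thesis using v0 finV by (simp add: realization_cone[OF aG] cone_of_def)
 qed
 obtain f g where "homeomorphic_maps (nsphere (4 - 1)) (top_of_set (sphere 0 1 Int span (Basis :: (real ^ 4) set))) f g"
  using homeomorphic_maps_nsphere_euclidean_sphere[of "Basis :: (real ^ 4) set" 4] independent_Basis
  by (auto simp: pairwise_def orthogonal_def inner_Basis)
 hence "nsphere 3 homeomorphic_space top_of_set (sphere 0 1 :: (real ^ 4) set)"
  unfolding homeomorphic_space_def by (auto simp: span_Basis)
 hence "top_of_set (realization \<Gamma>) homeomorphic_space top_of_set (sphere 0 1 :: (real ^ 4) set)"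
  using sph homeomorphic_space_trans by blast
 then obtain h k where "homeomorphic_maps (top_of_set (realization \<Gamma>)) (top_of_set (sphere 0 1 :: (real ^ 4) set)) h k"
  unfolding homeomorphic_space_def by blast
 hence hk: "homeomorphism (realization \<Gamma>) (sphere 0 1) h k"
  by (rule homeomorphic_maps_homeomorphism)
 let ?b = "h ?\<delta>"
 have b: "?b : sphere 0 1" using hk \<delta> by (auto simp: homeomorphism_def)
 have h': "h x ~= ?b" if "x : realization \<Gamma>" "x ~= ?\<delta>" for x
  using hk that \<delta> unfolding homeomorphism_def by metis
 have "homeomorphism (realization \<Gamma> - {?\<delta>}) (sphere 0 1 - {?b}) h k"
 proof (rule homeomorphism_of_subsets[OF hk])
  show "h ` (realization \<Gamma> - {?\<delta>}) = sphere 0 1 - {?b}"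
  proof
   show "h ` (realization \<Gamma> - {?\<delta>}) <= sphere 0 1 - {?b}" using hk h' by (auto simp: homeomorphism_def)
   have "h ` realization \<Gamma> = sphere 0 1" using hk by (simp add: homeomorphism_def)
   thus "sphere 0 1 - {?b} <= h ` (realization \<Gamma> - {?\<delta>})" by blast
  qed
 qed auto
 hence 1: "(realization \<Gamma> - {?\<delta>}) homeomorphic (sphere 0 1 - {?b})" unfolding homeomorphic_def by blast
 have "?b ~= 0" using b by auto
 hence 2: "(sphere 0 1 - {?b}) homeomorphic {x. ?b \<bullet> x = 0}"
  by (intro homeomorphic_punctured_sphere_hyperplane b) auto
 have 3: "{x. ?b \<bullet> x = 0} homeomorphic (UNIV :: (real ^ 3) set)"
  using \<open>?b ~= 0\<close> by (intro homeomorphic_affine_sets) (auto simp: affine_hyperplane aff_dim_hyperplane aff_dim_UNIV)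
 show ?thesis
  using W_homeomorphic 1 2 3 homeomorphic_trans homeomorphic_sym by meson
qed

text \<open>Brown's trick: since the complement of a point is Euclidean, the complement of the open star
 of \<open>v0\<close> can be crushed to a point by a map onto itself that is injective elsewhere.\<close>

lemma crush_exists:
 assumes sph: "top_of_set (realization \<Gamma>) homeomorphic_space nsphere 3"
 obtains q p where "p : D" "p v0 = 0" "continuous_on D q" "q ` D = D" "\<And>y. [|y : D; y v0 = 1|] ==> q y = y"
  "\<And>y y'. [|y : D; y' : D|] ==> q y = q y' <-> y = y' | y v0 = 0 & y' v0 = 0"
proof -
 obtain \<Phi> :: "('b => real) => real ^ 3" and \<Psi> where h: "homeomorphism W UNIV \<Phi> \<Psi>"
  using W_Euclidean[OF sph] unfolding homeomorphic_def by blast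
 have "W ~= {}" using h by (auto simp: homeomorphism_def)
 then obtain y where "y : W" by blast
 hence "0 < nrm y" using WD(3) by simp
 then obtain w where w: "w : V1" using nrm_attained by blast
 define p where "p = (%v. if v = w then 1 else 0 :: real)"
 have pW: "p : W"
 proof -
  have "w : V" using w V_split by blast
  moreover have "supp p = {w}" by (auto simp: p_def)
  ultimately have "supp p : \<Gamma>" using acD(5)[OF aG] by simp
  moreover have "nrm p = 1"
  proof (rule antisym)
   show "nrm p <= 1" by (auto simp: nrm_le_iff p_def)
   show "1 <= nrm p" using nrm_ge[OF w, of p] by (simp add: p_def)
  qed
  ultimately show ?thesis by (simp add: W_def p_def)
 qed
 have p0: "p v0 = 0" using w V_split(2) by (auto simp: p_def)
 \<comment> \<open>The collar flow scales the coordinate of \<open>v0\<close> alone;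
   \<open>nrm\<close> ignores this coordinate, so \<open>W\<close> is preserved.\<close>
 define T where "T s y = y(v0 := s * y v0)" for s :: real and y :: "'b => real"
 have TW: "T s y : W" if "0 < s" "y : W" for s y
 proof -
  have "supp (T s y) = supp y" using that by (auto simp: T_def)
  moreover have "nrm (T s y) = nrm y" using V_split(2) by (intro nrm_cong) (auto simp: T_def)
  ultimately show ?thesis using that by (simp add: W_def T_def)
 qed
 interpret collared W "%y. y v0" T "%y. \<Phi> y - \<Phi> p" "%z. \<Psi> (z + \<Phi> p)" p
 proof
  have "homeomorphism UNIV UNIV (%z. z - \<Phi> p) (%z. z + \<Phi> p)"
   by (auto simp: homeomorphism_def intro!: continuous_intros image_eqI[of _ _ "_ + \<Phi> p"] image_eqI[of _ _ "_ - \<Phi> p"])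
  from homeomorphism_compose[OF h this] show "homeomorphism W UNIV (%y. \<Phi> y - \<Phi> p) (%z. \<Psi> (z + \<Phi> p))"
   by (simp add: o_def)
  show "continuous_on W (%y. y v0)" by (intro continuous_coordinate)
  show "0 <= y v0" if "y : W" for y using WD(1)[OF that] .
  show "continuous_on W (T s)" if "0 < s" for s
  proof (rule continuous_on_coordinatewise_then_product)
   fix v show "continuous_on W (%y. T s y v)"
    by (cases "v = v0") (auto simp: T_def intro!: continuous_on_mult continuous_on_const continuous_coordinate)
  qed
  show "T s y : W" if "0 < s" "y : W" for s y using TW that .
  show "compact {y : W. y v0 <= 1}" using compact_D by (simp add: D_def)
 qed (use pW p0 in \<open>auto simp: T_def\<close>)
 obtain q where q: "continuous_on W q" "q ` D = D" "\<And>y. y : W ==> 1 <= y v0 ==> q y = y"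
   "\<And>y y'. [|y : W; y' : W|] ==> q y = q y' <-> y = y' | y v0 = 0 & y' v0 = 0"
  using collapse unfolding D_def by blast
 have DW: "D <= W" by (auto simp: D_def)
 show ?thesis
 proof (rule that[of p q])
  show "continuous_on D q" using q(1) DW continuous_on_subset by blast
  show "q y = q y' <-> y = y' | y v0 = 0 & y' v0 = 0" if "y : D" "y' : D" for y y' using q(4) that DW by blast
  show "q y = y" if "y : D" "y v0 = 1" for y using q(3) that DW by auto
 qed (use pW p0 q(2) in \<open>auto simp: D_def\<close>)
qed

end

section \<open>Two chambers as quotients of a product\<close>

locale crushed = chamber_complex n \<Gamma> c v0 for n :: nat and \<Gamma> :: "'b set set" and c v0 +
 fixes q :: "('b => real) => 'b => real" and p :: "'b => real"
 assumes p: "p : D" "p v0 = 0" and q: "continuous_on D q" "q ` D = D" "\<And>y. [|y : D; y v0 = 1|] ==> q y = y"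
  and q_eq: "\<And>y y'. [|y : D; y' : D|] ==> q y = q y' <-> y = y' | y v0 = 0 & y' v0 = 0"
begin

definition P :: "('b => real) set" where
 "P = {f. (\<forall>v. 0 <= f v & f v <= 1) & supp f : \<Gamma>}"

definition P' :: "('b => real) set" where
 "P' = {f. (\<forall>v. 0 <= f v) & supp f : \<Gamma> & (\<forall>w\<in>V1. f w <= 1) & f v0 + 1 / 2 <= sum f V1}"

definition Y :: "(('b => real) \<times> real) set" where
 "Y = D \<times> {0..1}"

text \<open>The largest coordinate of the chamber point \<open>A y\<close> (\<open>nrm_A\<close>):
  it is 1 at both ends of the interval and \<open>fst y v0\<close> in the middle.\<close>

definition cc :: "('b => real) \<times> real => real" where
 "cc y = fst y v0 + \<bar>2 * snd y - 1\<bar> * (1 - fst y v0)"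

text \<open>The direction of a chamber point in \<open>D\<close>, with collar coordinate
  \<open>fst y v0 / cc y\<close>; at the centre the quotient is 0/0 = 0.\<close>

definition hi :: "('b => real) \<times> real => 'b => real" where
 "hi y = q ((fst y)(v0 := fst y v0 / cc y))"

text \<open>The chamber is the cone over its mirrors. The upper half of the interval covers the part
  over \<open>D\<close>, the lower half the part over the mirror of \<open>v0\<close>, where
  \<open>v0\<close> has the largest coordinate. The interval thus runs from the mirror of
  \<open>v0\<close> at 0 to the other mirrors at 1.\<close>

definition A :: "('b => real) \<times> real => 'b => real" where
 "A y = (if 1 / 2 <= snd y then (%v. cc y * hi y v) else (%v. if v = v0 then cc y else fst y v0 * fst y v))"

definition len :: "('b => real) => real" where
 "len d = sum d V1"

text \<open>The lower end of a segment in \<open>P'\<close>: the solution of lam d * len d = d v0 *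
  (len d - 1/2) + 1/2, which is the equation of the new face for \<open>A'\<close>.\<close>

definition lam :: "('b => real) => real" where
 "lam d = (d v0 * (len d - 1 / 2) + 1 / 2) / len d"

definition mm :: "('b => real) \<times> real => real" where
 "mm y = snd y + (1 - snd y) * lam (q (fst y))"

text \<open>Over d the coordinate of \<open>v0\<close> is kept and the others are scaled, from the
  new face at 0 to the old mirrors at 1. The factor len d - 1/2 makes the segment degenerate exactly
  for d v0 = 1.\<close>

definition A' :: "('b => real) \<times> real => 'b => real" where
 "A' y = (%v. if v = v0 then q (fst y) v0 * (len (q (fst y)) - 1 / 2) else mm y * q (fst y) v)"

lemma D_W: "e : D ==> e : W" by (simp add: D_def)

lemma De: "e : D ==> 0 <= e v" "e : D ==> e v <= 1" "e : D ==> nrm e = 1" "e : D ==> supp e : \<Gamma>"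
proof -
 assume e: "e : D"
 show "0 <= e v" "nrm e = 1" and s: "supp e : \<Gamma>" using WD[OF D_W[OF e]] by auto
 show "e v <= 1"
 proof (cases "v : V")
  case True
  thus ?thesis using V_split(1) WD(4)[OF D_W[OF e]] e by (auto simp: D_def)
 next
  case False
  thus ?thesis using supp_V[OF s] by simp
 qed
qed

lemma DI: "[|\<And>v. 0 <= e v; supp e : \<Gamma>; nrm e = 1; e v0 <= 1|] ==> e : D"
 by (simp add: D_def W_def)

lemma face': "\<sigma> : \<Gamma> ==> \<tau> <= \<sigma> ==> \<tau> : \<Gamma>"
 using acD(3)[OF aG] .

lemma D_upd:
 assumes e: "e : D" and h: "0 <= h" "h <= 1" "e v0 = 0 ==> h = 0" shows "e(v0 := h) : D"
proof (rule DI)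
 have "supp (e(v0 := h)) <= supp e" using h(3) by auto
 thus "supp (e(v0 := h)) : \<Gamma>" using De(4)[OF e] face' by blast
 have "nrm (e(v0 := h)) = nrm e" using V_split(2) by (intro nrm_cong) auto
 thus "nrm (e(v0 := h)) = 1" using De(3)[OF e] by simp
qed (use De(1)[OF e] h in auto)

lemma q_D: "e : D ==> q e : D" using q(2) by blast

lemma q_v0: assumes e: "e : D" shows "q e v0 = 1 <-> e v0 = 1"
proof
 assume "q e v0 = 1"
 hence "q (q e) = q e" using q(3)[OF q_D[OF e]] by blast
 thus "e v0 = 1" using q_eq[OF q_D[OF e] e] \<open>q e v0 = 1\<close> by auto
qed (use q(3)[OF e] in simp)

lemma YD: "y : Y ==> fst y : D" "y : Y ==> 0 <= snd y" "y : Y ==> snd y <= 1"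
 by (auto simp: Y_def)

lemma cc_facts:
 assumes y: "y : Y"
 shows "0 <= cc y" "fst y v0 <= cc y" "cc y <= 1" "cc y = 0 <-> fst y v0 = 0 & snd y = 1 / 2"
  "cc y = 1 <-> fst y v0 = 1 | snd y = 0 | snd y = 1"
proof -
 let ?h = "fst y v0" and ?a = "\<bar>2 * snd y - 1\<bar>"
 have h: "0 <= ?h" "?h <= 1" using De(1,2)[OF YD(1)[OF y]] by auto
 have a: "0 <= ?a" "?a <= 1" using YD[OF y] by auto
 have 1: "1 - cc y = (1 - ?h) * (1 - ?a)" by (simp add: cc_def algebra_simps)
 have 2: "0 <= ?a * (1 - ?h)" using h a by simp
 show "0 <= cc y" "?h <= cc y" using 2 h by (simp_all add: cc_def)
 have "0 <= (1 - ?h) * (1 - ?a)" using h a by simp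
 thus "cc y <= 1" using 1 by simp
 show "cc y = 0 <-> ?h = 0 & snd y = 1 / 2" using 2 h by (auto simp: cc_def add_nonneg_eq_0_iff)
 have "cc y = 1 <-> 1 - cc y = 0" by linarith
 also have "\<dots> <-> (1 - ?h) * (1 - ?a) = 0" unfolding 1 ..
 also have "\<dots> <-> ?h = 1 | ?a = 1" by auto
 also have "?a = 1 <-> snd y = 0 | snd y = 1" by linarith
 finally show "cc y = 1 <-> ?h = 1 | snd y = 0 | snd y = 1" .
qed

lemma pre_hi_D: assumes y: "y : Y" shows "(fst y)(v0 := fst y v0 / cc y) : D"
proof (rule D_upd[OF YD(1)[OF y]])
 show "0 <= fst y v0 / cc y" using De(1)[OF YD(1)[OF y]] cc_facts(1)[OF y] by simp
 show "fst y v0 / cc y <= 1" using cc_facts(1,2)[OF y] by (cases "cc y = 0") (auto simp: divide_le_eq_1)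
qed simp

lemma hi_D: "y : Y ==> hi y : D"
 unfolding hi_def by (rule q_D[OF pre_hi_D])

lemma A_top:
 assumes y: "y : Y" and h: "fst y v0 = 1" shows "A y = fst y"
proof -
 have "cc y = 1" using cc_facts(5)[OF y] h by blast
 hence "hi y = fst y" using h q(3)[OF YD(1)[OF y] h] by (simp add: hi_def fun_upd_idem)
 thus ?thesis using h \<open>cc y = 1\<close> by (auto simp: A_def)
qed

text \<open>The two formulas agree at 1/2, at the centre because both give 0 and elsewhere because
  \<open>q\<close> fixes the boundary d v0 = 1.\<close>

lemma A_half:
 assumes y: "y : Y" and t: "snd y <= 1 / 2" shows "A y = (%v. if v = v0 then cc y else fst y v0 * fst y v)"
proof (cases "snd y = 1 / 2")
 case True
 have c: "cc y = fst y v0" using True by (simp add: cc_def)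
 show ?thesis
 proof (cases "fst y v0 = 0")
  case True
  thus ?thesis using c by (auto simp: A_def)
 next
  case False
  hence "(fst y)(v0 := fst y v0 / cc y) = (fst y)(v0 := 1)" using c by simp
  moreover have "(fst y)(v0 := 1) : D" using pre_hi_D[OF y] calculation by simp
  ultimately have "hi y = (fst y)(v0 := 1)" using q(3)[of "(fst y)(v0 := 1)"] by (simp add: hi_def)
  thus ?thesis using True c by (auto simp: A_def)
 qed
qed (use t in \<open>simp add: A_def\<close>)

lemma A_P: assumes y: "y : Y" shows "A y : P"
proof (cases "1 / 2 <= snd y")
 case True
 have "supp (A y) <= supp (hi y)" using True by (auto simp: A_def)
 hence "supp (A y) : \<Gamma>" using face' De(4)[OF hi_D[OF y]] by blast
 moreover have "0 <= A y v & A y v <= 1" for v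
  using True De(1,2)[OF hi_D[OF y], of v] cc_facts(1,3)[OF y] by (simp add: A_def mult_le_one)
 ultimately show ?thesis by (simp add: P_def)
next
 case False
 have A: "A y = (%v. if v = v0 then cc y else fst y v0 * fst y v)" using False by (simp add: A_def)
 note e = De[OF YD(1)[OF y]]
 have "supp (A y) : \<Gamma>"
 proof (cases "fst y v0 = 0")
  case True
  hence "supp (A y) <= {v0}" by (auto simp: A)
  thus ?thesis using face' acD(5)[OF aG v0] by blast
 next
  case False
  hence "supp (A y) <= supp (fst y)" by (auto simp: A)
  thus ?thesis using face' e(4) by blast
 qed
 moreover have "0 <= A y v & A y v <= 1" for v
  using e(1,2)[of v] e(1,2)[of v0] cc_facts(1,3)[OF y] by (simp add: A mult_le_one)
 ultimately show ?thesis by (simp add: P_def)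
qed

lemma nrm_A: assumes y: "y : Y"
 shows "1 / 2 <= snd y ==> nrm (A y) = cc y" "snd y <= 1 / 2 ==> nrm (A y) = fst y v0" "max (nrm (A y)) (A y v0) = cc y"
proof -
 show 1: "1 / 2 <= snd y ==> nrm (A y) = cc y"
  using nrm_scale[OF cc_facts(1)[OF y], of "hi y"] De(3)[OF hi_D[OF y]] by (simp add: A_def)
 show 2: "snd y <= 1 / 2 ==> nrm (A y) = fst y v0"
 proof -
  assume t: "snd y <= 1 / 2"
  have "nrm (A y) = nrm (%v. fst y v0 * fst y v)" unfolding A_half[OF y t] using V_split(2) by (intro nrm_cong) auto
  thus ?thesis using nrm_scale[OF De(1)[OF YD(1)[OF y], of v0]] De(3)[OF YD(1)[OF y]] by simp
 qed
 show "max (nrm (A y)) (A y v0) = cc y"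
 proof (cases "1 / 2 <= snd y")
  case True
  have "A y v0 <= cc y" using True De(1,2)[OF hi_D[OF y], of v0] cc_facts(1)[OF y] by (simp add: A_def mult_left_le)
  thus ?thesis using 1[OF True] by simp
 next
  case False
  thus ?thesis using 2 cc_facts(2)[OF y] by (simp add: A_def)
 qed
qed

lemma cc_cancel: assumes "cc y = cc z" "fst y v0 = fst z v0" "fst y v0 ~= 1" shows "\<bar>2 * snd y - 1\<bar> = \<bar>2 * snd z - 1\<bar>"
proof -
 have "\<bar>2 * snd y - 1\<bar> * (1 - fst y v0) = \<bar>2 * snd z - 1\<bar> * (1 - fst y v0)" using assms(1,2) by (simp add: cc_def)
 thus ?thesis using assms(3) by simp
qed

text \<open>A common point of the two halves has its largest coordinate both at \<open>v0\<close>
  and in \<open>V1\<close>. This forces the collar coordinate to equal \<open>cc\<close>, which for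
  a parameter below 1/2 happens only if it is 1.\<close>

lemma A_mixed:
 assumes y: "y : Y" "1 / 2 <= snd y" and z: "z : Y" "snd z < 1 / 2" and eq: "A y = A z"
 shows "fst y = fst z & fst y v0 = 1"
proof -
 have c: "cc y = cc z" using nrm_A(3)[OF y(1)] nrm_A(3)[OF z(1)] eq by simp
 have Az: "A z = (%v. if v = v0 then cc z else fst z v0 * fst z v)" using A_half[OF z(1)] z(2) by simp
 have cz: "cc z ~= 0" using cc_facts(4)[OF z(1)] z(2) by auto
 have "A y v0 = cc z" using eq Az by simp
 hence "cc y * hi y v0 = cc y" using y(2) c by (simp add: A_def)
 hence "hi y v0 = 1" using cz c by simp
 hence 1: "fst y v0 / cc y = 1" using q_v0[OF pre_hi_D[OF y(1)]] by (simp add: hi_def)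
 hence h: "fst y v0 = cc y" using cz c by simp
 have "nrm (A y) = nrm (A z)" using eq by simp
 hence hz: "fst z v0 = cc z" using nrm_A(1)[OF y] nrm_A(2)[OF z(1)] z(2) c by simp
 hence "\<bar>2 * snd z - 1\<bar> * (1 - fst z v0) = 0" by (simp add: cc_def)
 hence h1: "fst z v0 = 1" using z(2) by auto
 hence y1: "fst y v0 = 1" using h hz c by simp
 have "A y = fst y" "A z = fst z" using A_top[OF y(1) y1] A_top[OF z(1) h1] by auto
 thus ?thesis using eq y1 by simp
qed

text \<open>The fibres have two sources: \<open>q\<close> crushes the core \<open>fst y v0\<close> =
  0 at each height, and the interval collapses where \<open>fst y v0\<close> = 1.
  \<open>A'_fibre\<close> has the same right-hand side, which is the point of both
  parametrisations.\<close>

lemma A_fibre: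
 assumes y: "y : Y" and z: "z : Y"
 shows "A y = A z <-> q (fst y) = q (fst z) & (snd y = snd z | fst y v0 = 1)"
proof
 note yD = YD(1)[OF y] and zD = YD(1)[OF z]
 assume eq: "A y = A z"
 have c: "cc y = cc z" using nrm_A(3)[OF y] nrm_A(3)[OF z] eq by simp
 consider "1 / 2 <= snd y" "1 / 2 <= snd z" | "snd y < 1 / 2" "snd z < 1 / 2"
  | "1 / 2 <= snd y" "snd z < 1 / 2" | "snd y < 1 / 2" "1 / 2 <= snd z" by linarith
 thus "q (fst y) = q (fst z) & (snd y = snd z | fst y v0 = 1)"
 proof cases
  case 1
  show ?thesis
  proof (cases "cc y = 0")
   case True
   thus ?thesis using cc_facts(4)[OF y] cc_facts(4)[OF z] c q_eq[OF yD zD] by simp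
  next
   case False
   have "cc y * hi y v = cc y * hi z v" for v using fun_cong[OF eq, of v] 1 c by (simp add: A_def)
   hence "hi y = hi z" using False by (intro ext) simp
   then consider "(fst y)(v0 := fst y v0 / cc y) = (fst z)(v0 := fst z v0 / cc z)" | "fst y v0 / cc y = 0" "fst z v0 / cc z = 0"
    unfolding hi_def using q_eq[OF pre_hi_D[OF y] pre_hi_D[OF z]] by auto
   hence *: "fst y v0 = fst z v0 & q (fst y) = q (fst z)"
   proof cases
    case 1
    have "fst y v = fst z v" for v using fun_cong[OF 1, of v] False c by (cases "v = v0") auto
    thus ?thesis by (metis ext)
   next
    case 2
    thus ?thesis using False c q_eq[OF yD zD] by simp
   qed
   thus ?thesis using cc_cancel[OF c] 1 by (cases "fst y v0 = 1") auto
  qed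
 next
  case 2
  have h: "fst y v0 = fst z v0" using nrm_A(2)[OF y] nrm_A(2)[OF z] 2 eq by simp
  have "q (fst y) = q (fst z)"
  proof (cases "fst y v0 = 0")
   case True
   thus ?thesis using h q_eq[OF yD zD] by simp
  next
   case False
   have "fst y v = fst z v" for v using fun_cong[OF eq, of v] 2 h False by (cases "v = v0") (auto simp: A_def)
   thus ?thesis by (metis ext)
  qed
  thus ?thesis using cc_cancel[OF c h] 2 by (cases "fst y v0 = 1") auto
 next
  case 3
  thus ?thesis using A_mixed[OF y _ z _ eq] by auto
 next
  case 4
  thus ?thesis using A_mixed[OF z _ y _ eq[symmetric]] by auto
 qed
next
 note yD = YD(1)[OF y] and zD = YD(1)[OF z]
 assume R: "q (fst y) = q (fst z) & (snd y = snd z | fst y v0 = 1)"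
 then consider "fst y = fst z" "snd y = snd z" | "fst y = fst z" "fst y v0 = 1" | "fst y v0 = 0" "fst z v0 = 0" "snd y = snd z"
  using q_eq[OF yD zD] by auto
 thus "A y = A z"
 proof cases
  case 1
  hence "y = z" by (rule prod_eqI)
  thus ?thesis by simp
 next
  case 2
  thus ?thesis using A_top[OF y] A_top[OF z] by simp
 next
  case 3
  have c: "cc y = cc z" using 3 by (simp add: cc_def)
  have "hi y = hi z" unfolding hi_def using q_eq[OF pre_hi_D[OF y] pre_hi_D[OF z]] 3 by simp
  thus ?thesis using 3 c by (auto simp: A_def fun_eq_iff)
 qed
qed

lemma solve_t:
 fixes h k :: real
 assumes "0 <= h" "h <= k" "k <= 1"
 obtains a where "0 <= a" "a <= 1" "h + a * (1 - h) = k"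
proof (cases "h = 1")
 case True
 thus ?thesis using assms that[of 0] by simp
next
 case False
 thus ?thesis using assms by (intro that[of "(k - h) / (1 - h)"]) (auto simp: field_simps)
qed

lemma A_surj: assumes f: "f : P" shows "f : A ` Y"
proof -
 have f0: "\<And>v. 0 <= f v" "\<And>v. f v <= 1" "supp f : \<Gamma>" using f by (auto simp: P_def)
 have n1: "nrm f <= 1" using f0(2) by (simp add: nrm_le_iff)
 show ?thesis
 proof (cases "nrm f <= f v0")
  case True
  define h where "h = nrm f"
  have h: "0 <= h" "h <= f v0" "f v0 <= 1" using True nrm_nonneg[of f] f0 by (auto simp: h_def)
  obtain a where a: "0 <= a" "a <= 1" "h + a * (1 - h) = f v0" using solve_t[OF h] by blast
  have "\<exists>e\<in>D. e v0 = h & (\<forall>v. v ~= v0 --> h * e v = f v)"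
  proof (cases "h = 0")
   case True
   have "f v = 0" if "v ~= v0" for v
   proof (cases "v : V")
    case True
    hence "v : V1" using that V_split(1) by blast
    thus ?thesis using nrm_ge[of v f] f0(1)[of v] \<open>h = 0\<close> by (simp add: h_def)
   next
    case False
    thus ?thesis using supp_V[OF f0(3)] by simp
   qed
   thus ?thesis using p True by (intro bexI[of _ p]) auto
  next
   case False
   hence hp: "0 < h" using h(1) by simp
   define e where "e = (%v. 1 / h * f v)(v0 := h)"
   have "supp e <= supp f" using hp h(2) by (auto simp: e_def)
   moreover have "nrm e = nrm (%v. 1 / h * f v)" using V_split(2) by (intro nrm_cong) (auto simp: e_def)
   hence "nrm e = 1" using nrm_scale[of "1 / h" f] hp by (simp add: h_def)
   ultimately have "e : D" using f0 face' hp order_trans[OF h(2,3)] by (intro DI) (auto simp: e_def)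
   thus ?thesis using hp by (intro bexI[of _ e]) (auto simp: e_def)
  qed
  then obtain e where e: "e : D" "e v0 = h" "\<And>v. v ~= v0 ==> h * e v = f v" by blast
  \<comment> \<open>\<open>a\<close> is the absolute value of 2t - 1; the sign puts t into the lower
    half, since here \<open>v0\<close> has the largest coordinate.\<close>
  define y where "y = (e, (1 - a) / 2)"
  have yY: "y : Y" using e a by (simp add: y_def Y_def)
  have "2 * snd y - 1 = - a" by (simp add: y_def field_simps)
  hence "\<bar>2 * snd y - 1\<bar> = a" using a(1) by simp
  hence "cc y = f v0" using a(3) e(2) by (simp add: cc_def y_def)
  moreover have "snd y <= 1 / 2" using a(1) by (simp add: y_def)
  ultimately have "A y = f" using A_half[OF yY] e by (auto simp: y_def)
  thus ?thesis using yY by blast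
 next
  case False
  define k where "k = nrm f"
  have k: "f v0 < k" "0 < k" "k <= 1" using False f0(1)[of v0] n1 unfolding k_def by linarith+
  have dD: "(%v. 1 / k * f v) : D"
  proof (rule DI)
   have "supp (%v. 1 / k * f v) = supp f" using k by auto
   thus "supp (%v. 1 / k * f v) : \<Gamma>" using f0 by simp
   show "nrm (%v. 1 / k * f v) = 1" using nrm_scale[of "1 / k" f] k by (simp add: k_def)
  qed (use k f0 in auto)
  then obtain e' where e': "e' : D" "q e' = (%v. 1 / k * f v)" using q(2) by (metis imageE)
  define h where "h = k * e' v0"
  have h: "0 <= h" "h <= k" "k <= 1" using e'(1) De(1,2)[of e' v0] k by (auto simp: h_def mult_left_le)
  obtain a where a: "0 <= a" "a <= 1" "h + a * (1 - h) = k" using solve_t[OF h] by blast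
  have eD: "e'(v0 := h) : D" using D_upd[OF e'(1), of h] h by (simp add: h_def)
  define y where "y = (e'(v0 := h), (1 + a) / 2)"
  have yY: "y : Y" using eD a by (simp add: y_def Y_def)
  have "2 * snd y - 1 = a" by (simp add: y_def field_simps)
  hence "\<bar>2 * snd y - 1\<bar> = a" using a(1) by simp
  hence c: "cc y = k" using a(3) by (simp add: cc_def y_def)
  have "(fst y)(v0 := fst y v0 / cc y) = e'" using c k by (auto simp: y_def h_def)
  hence "hi y = (%v. 1 / k * f v)" using e'(2) by (simp add: hi_def)
  moreover have "1 / 2 <= snd y" using a(1) by (simp add: y_def)
  ultimately have "A y = f" using c k by (simp add: A_def)
  thus ?thesis using yY by blast
 qed
qed

lemma A_image: "A ` Y = P"
 using A_P A_surj by blast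

lemma compact_Y: "compact Y"
 unfolding Y_def by (intro compact_Times compact_D compact_Icc)

lemma continuous_fst_coord: "continuous_on S (%y :: ('b => real) \<times> real. fst y v)"
 by (rule continuous_on_compose2[OF continuous_coordinate[of UNIV v], of S fst]) (auto intro: continuous_on_fst continuous_on_id)

lemma continuous_cc: "continuous_on S cc"
 unfolding cc_def by (intro continuous_intros continuous_fst_coord)

lemma continuous_hi: "continuous_on {y : Y. 0 < cc y} (%y. hi y v)"
proof -
 let ?S = "{y : Y. 0 < cc y}"
 have "continuous_on ?S (%y. (fst y)(v0 := fst y v0 / cc y))"
 proof (rule continuous_on_coordinatewise_then_product)
  fix w show "continuous_on ?S (%y. ((fst y)(v0 := fst y v0 / cc y)) w)"
   by (cases "w = v0") (auto intro!: continuous_on_divide continuous_fst_coord continuous_cc)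
 qed
 hence "continuous_on ?S hi" unfolding hi_def
  by (rule continuous_on_compose2[OF q(1)]) (use pre_hi_D in auto)
 thus ?thesis by (rule continuous_on_product_then_coordinatewise)
qed

lemma continuous_A: "continuous_on Y A"
proof (rule continuous_on_coordinatewise_then_product)
 fix v
 let ?U = "{y : Y. 1 / 2 <= snd y}" and ?L = "{y : Y. snd y <= 1 / 2}"
 \<comment> \<open>\<open>hi\<close> may have no limit where \<open>cc\<close> vanishes; there the
   product is dominated by \<open>cc\<close>.\<close>
 have "continuous_on Y (%y. cc y * hi y v)"
 proof (rule continuous_on_bounded_by[where k = cc])
  show "continuous_on Y cc" by (rule continuous_cc)
  show "\<bar>cc y * hi y v\<bar> <= cc y" if "y : Y" for y
   using De(1,2)[OF hi_D[OF that], of v] cc_facts(1)[OF that] by (simp add: abs_mult mult_left_le)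
  show "continuous_on {y : Y. 0 < cc y} (%y. cc y * hi y v)" by (intro continuous_on_mult continuous_cc continuous_hi)
 qed
 hence "continuous_on ?U (%y. cc y * hi y v)" by (rule continuous_on_subset) auto
 hence U: "continuous_on ?U (%y. A y v)" by (rule continuous_on_eq) (auto simp: A_def)
 have "continuous_on ?L (%y. if v = v0 then cc y else fst y v0 * fst y v)"
  by (cases "v = v0") (auto intro!: continuous_on_mult continuous_fst_coord continuous_cc)
 hence L: "continuous_on ?L (%y. A y v)" by (rule continuous_on_eq) (auto simp: A_half)
 have cl: "closedin (top_of_set Y) ?U" "closedin (top_of_set Y) ?L"
 proof -
  have "closed {y :: ('b => real) \<times> real. 1 / 2 <= snd y}" "closed {y :: ('b => real) \<times> real. snd y <= 1 / 2}"
   by (intro closed_Collect_le continuous_intros)+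
  moreover have "?U = Y Int {y. 1 / 2 <= snd y}" "?L = Y Int {y. snd y <= 1 / 2}" by auto
  ultimately show "closedin (top_of_set Y) ?U" "closedin (top_of_set Y) ?L" unfolding closedin_closed by blast+
 qed
 have "?U Un ?L = Y" by auto
 thus "continuous_on Y (%y. A y v)" using continuous_on_Un_local[of ?U ?L, OF _ _ U L] cl by simp
qed

lemma A_mirror: assumes y: "y : Y"
 shows "w : V1 ==> A y w = 1 <-> (snd y = 1 | fst y v0 = 1) & q (fst y) w = 1"
  "A y v0 = 1 <-> snd y = 0 | fst y v0 = 1"
proof -
 note yD = YD(1)[OF y] and cf = cc_facts[OF y]
 have q1: "q (fst y) = fst y" if "fst y v0 = 1" using q(3)[OF yD that] .
 have mult1: "a * b = 1 <-> a = 1 & b = 1" if "0 <= a" "a <= 1" "0 <= b" "b <= 1" for a b :: real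
 proof
  assume "a * b = 1"
  moreover have "a * b <= a" "a * b <= b" using that by (auto simp: mult_left_le mult_left_le_one_le)
  ultimately show "a = 1 & b = 1" using that by linarith
 qed simp
 have hic: "hi y = q (fst y)" if "cc y = 1" using that by (simp add: hi_def)
 show "A y w = 1 <-> (snd y = 1 | fst y v0 = 1) & q (fst y) w = 1" if w: "w : V1"
 proof (cases "1 / 2 <= snd y")
  case True
  have "A y w = 1 <-> cc y = 1 & hi y w = 1"
   using True mult1[of "cc y" "hi y w"] cf De(1,2)[OF hi_D[OF y], of w] by (simp add: A_def)
  thus ?thesis using hic cf(5) True by auto
 next
  case False
  have "w ~= v0" using w V_split(2) by blast
  hence "A y w = 1 <-> fst y v0 = 1 & fst y w = 1"
   using False mult1[of "fst y v0" "fst y w"] De(1,2)[OF yD] by (simp add: A_def)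
  thus ?thesis using q1 False by auto
 qed
 show "A y v0 = 1 <-> snd y = 0 | fst y v0 = 1"
 proof (cases "1 / 2 <= snd y")
  case True
  have "A y v0 = 1 <-> cc y = 1 & hi y v0 = 1"
   using True mult1[of "cc y" "hi y v0"] cf De(1,2)[OF hi_D[OF y], of v0] by (simp add: A_def)
  thus ?thesis using hic cf(5) True q_v0[OF yD] by auto
 next
  case False
  thus ?thesis using cf(5) by (auto simp: A_def)
 qed
qed

lemma len_ge: "d : D ==> 1 <= len d"
 unfolding len_def using W_sum D_W by blast

lemma lam_facts: assumes d: "d : D" shows "0 < lam d" "lam d <= 1" "lam d = 1 <-> d v0 = 1" "lam d * len d = d v0 * (len d - 1 / 2) + 1 / 2"
proof -
 note l = len_ge[OF d] and d0 = De(1,2)[OF d, of v0]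
 have s: "0 <= d v0 * (len d - 1 / 2)" "d v0 * (len d - 1 / 2) <= len d - 1 / 2" using l d0 by (auto simp: mult_left_le_one_le)
 show e: "lam d * len d = d v0 * (len d - 1 / 2) + 1 / 2" using l by (simp add: lam_def)
 show "0 < lam d" using s l by (simp add: lam_def)
 have "d v0 * (len d - 1 / 2) + 1 / 2 <= len d" using s(2) by linarith
 thus "lam d <= 1" unfolding lam_def using l by (subst divide_le_eq_1_pos) linarith+
 have "lam d = 1 <-> d v0 * (len d - 1 / 2) + 1 / 2 = len d" using l by (auto simp: lam_def divide_eq_eq)
 also have "\<dots> <-> d v0 * (len d - 1 / 2) = 1 * (len d - 1 / 2)" unfolding mult_1 by (rule eq_diff_eq[symmetric])
 also have "\<dots> <-> d v0 = 1" using l by (subst mult_cancel_right) auto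
 finally show "lam d = 1 <-> d v0 = 1" .
qed

lemma mm_facts: assumes y: "y : Y"
 shows "lam (q (fst y)) <= mm y" "mm y <= 1" "mm y = 1 <-> snd y = 1 | fst y v0 = 1" "mm y = lam (q (fst y)) <-> snd y = 0 | fst y v0 = 1"
proof -
 let ?l = "lam (q (fst y))"
 note l = lam_facts[OF q_D[OF YD(1)[OF y]]] and t = YD(2,3)[OF y]
 have 1: "1 - mm y = (1 - snd y) * (1 - ?l)" "mm y - ?l = snd y * (1 - ?l)" by (simp_all add: mm_def algebra_simps)
 have "0 <= 1 - mm y" "0 <= mm y - ?l" unfolding 1 using l t by auto
 thus "?l <= mm y" "mm y <= 1" by simp_all
 have l1: "?l = 1 <-> fst y v0 = 1" using l(3) q_v0[OF YD(1)[OF y]] by simp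
 have "mm y = 1 <-> 1 - mm y = 0" by linarith
 hence "mm y = 1 <-> (1 - snd y) * (1 - ?l) = 0" unfolding 1(1) .
 thus "mm y = 1 <-> snd y = 1 | fst y v0 = 1" using l1 by auto
 have "mm y = ?l <-> mm y - ?l = 0" by linarith
 hence "mm y = ?l <-> snd y * (1 - ?l) = 0" unfolding 1(2) .
 thus "mm y = ?l <-> snd y = 0 | fst y v0 = 1" using l1 by auto
qed

lemma A'_sum: "sum (A' y) V1 = mm y * len (q (fst y))"
proof -
 have "sum (A' y) V1 = (\<Sum>w\<in>V1. mm y * q (fst y) w)" using V_split(2) by (intro sum.cong) (auto simp: A'_def)
 thus ?thesis by (simp add: len_def sum_distrib_left)
qed

lemma A'_P': assumes y: "y : Y" shows "A' y : P'"
proof -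
 let ?d = "q (fst y)"
 have d: "?d : D" using q_D YD(1)[OF y] by blast
 note l = lam_facts[OF d] and m = mm_facts[OF y] and lg = len_ge[OF d]
 have m0: "0 < mm y" using l(1) m(1) by linarith
 have "supp (A' y) <= supp ?d" by (auto simp: A'_def)
 hence "supp (A' y) : \<Gamma>" using face' De(4)[OF d] by blast
 moreover have "0 <= A' y v" for v using De(1)[OF d] m0 lg by (simp add: A'_def)
 moreover have "A' y w <= 1" if "w : V1" for w
  using that V_split(2) De(1,2)[OF d, of w] m0 m(2) by (auto simp: A'_def intro: mult_le_one)
 moreover have "A' y v0 + 1 / 2 = lam ?d * len ?d" using l(4) by (simp add: A'_def)
 moreover have "lam ?d * len ?d <= mm y * len ?d" using m(1) lg by (intro mult_right_mono) auto
 ultimately show ?thesis by (simp add: P'_def A'_sum)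
qed

lemma A'_mirror: assumes y: "y : Y"
 shows "w : V1 ==> A' y w = 1 <-> (snd y = 1 | fst y v0 = 1) & q (fst y) w = 1"
  "A' y v0 + 1 / 2 = sum (A' y) V1 <-> snd y = 0 | fst y v0 = 1"
proof -
 let ?d = "q (fst y)"
 have d: "?d : D" using q_D YD(1)[OF y] by blast
 note l = lam_facts[OF d] and m = mm_facts[OF y] and lg = len_ge[OF d]
 have m0: "0 < mm y" using l(1) m(1) by linarith
 show "A' y w = 1 <-> (snd y = 1 | fst y v0 = 1) & ?d w = 1" if w: "w : V1"
 proof -
  have "mm y * ?d w = 1 <-> mm y = 1 & ?d w = 1"
  proof
   assume "mm y * ?d w = 1"
   moreover have "mm y * ?d w <= mm y" "mm y * ?d w <= ?d w" using m0 m(2) De(1,2)[OF d, of w] by (auto simp: mult_left_le mult_left_le_one_le)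
   ultimately show "mm y = 1 & ?d w = 1" using m(2) De(2)[OF d, of w] by linarith
  qed simp
  moreover have "w ~= v0" using w V_split(2) by blast
  ultimately show ?thesis using m(3) by (simp add: A'_def)
 qed
 have "A' y v0 + 1 / 2 = lam ?d * len ?d" using l(4) by (simp add: A'_def)
 hence "A' y v0 + 1 / 2 = sum (A' y) V1 <-> lam ?d = mm y" using lg by (simp add: A'_sum)
 thus "A' y v0 + 1 / 2 = sum (A' y) V1 <-> snd y = 0 | fst y v0 = 1" using m(4) by metis
qed

text \<open>The image determines in turn \<open>mm\<close> (as its \<open>nrm\<close>), the values
  of d off \<open>v0\<close>, the length of d, and d v0. The parameter is then determined unless lam
  d = 1.\<close>

lemma A'_fibre:
 assumes y: "y : Y" and z: "z : Y"
 shows "A' y = A' z <-> q (fst y) = q (fst z) & (snd y = snd z | fst y v0 = 1)"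
proof
 let ?d = "q (fst y)" and ?d' = "q (fst z)"
 have d: "?d : D" "?d' : D" using q_D YD(1)[OF y] YD(1)[OF z] by auto
 {
  assume eq: "A' y = A' z"
  have nm: "nrm (A' x) = mm x" if x: "x : Y" for x
  proof -
   have dx: "q (fst x) : D" using q_D YD(1)[OF x] by blast
   have m0: "0 <= mm x" using lam_facts(1)[OF dx] mm_facts(1)[OF x] by linarith
   have "nrm (A' x) = nrm (%v. mm x * q (fst x) v)" using V_split(2) by (intro nrm_cong) (auto simp: A'_def)
   thus ?thesis using nrm_scale[OF m0] De(3)[OF dx] by simp
  qed
  have m: "mm y = mm z" using nm[OF y] nm[OF z] eq by simp
  have m0: "0 < mm y" using lam_facts(1)[OF d(1)] mm_facts(1)[OF y] by linarith
  have off: "?d v = ?d' v" if "v ~= v0" for v using fun_cong[OF eq, of v] that m m0 by (simp add: A'_def)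
  have l: "len ?d = len ?d'" unfolding len_def
  proof (intro sum.cong refl)
   fix w assume "w : V1"
   hence "w ~= v0" using V_split(2) by blast
   thus "?d w = ?d' w" by (rule off)
  qed
  have "?d v0 = ?d' v0" using fun_cong[OF eq, of v0] l len_ge[OF d(2)] by (simp add: A'_def)
  hence dd: "?d = ?d'" using off by (intro ext) metis
  have "(snd y - snd z) * (1 - lam ?d) = 0" using m dd by (simp add: mm_def algebra_simps)
  hence "snd y = snd z | fst y v0 = 1" using lam_facts(3)[OF d(1)] q_v0[OF YD(1)[OF y]] by auto
  thus "?d = ?d' & (snd y = snd z | fst y v0 = 1)" using dd by blast
 }
 assume R: "?d = ?d' & (snd y = snd z | fst y v0 = 1)"
 have "mm y = mm z"
 proof (cases "snd y = snd z")
  case True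
  thus ?thesis using R by (simp add: mm_def)
 next
  case False
  hence "fst y v0 = 1" using R by blast
  hence "lam ?d = 1" "lam ?d' = 1" using lam_facts(3)[OF d(1)] q_v0[OF YD(1)[OF y]] R by auto
  thus ?thesis by (simp add: mm_def)
 qed
 show "A' y = A' z" unfolding A'_def conjunct1[OF R] \<open>mm y = mm z\<close> by (rule refl)
qed

lemma A'_image: "A' ` Y = P'"
proof
 show "A' ` Y <= P'" using A'_P' by blast
 show "P' <= A' ` Y"
 proof
  fix g assume g: "g : P'"
  hence g0: "\<And>v. 0 <= g v" "supp g : \<Gamma>" "\<And>w. w : V1 ==> g w <= 1" "g v0 + 1 / 2 <= sum g V1" by (auto simp: P'_def)
  define k where "k = nrm g"
  have k1: "k <= 1" using g0(3) by (simp add: k_def nrm_le_iff)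
  have kp: "0 < k"
  proof (rule ccontr)
   assume "~ 0 < k"
   hence "sum g V1 <= 0" using g0(1) by (intro sum_nonpos) (simp add: k_def nrm_le_iff not_less)
   thus False using g0(1)[of v0] g0(4) by linarith
  qed
  define l where "l = sum g V1 / k"
  have lk: "sum g V1 = l * k" using kp by (simp add: l_def)
  have l0: "g v0 + 1 / 2 <= l * k" using g0(4) lk by simp
  have "0 <= l" using sum_nonneg[of V1 g] g0(1) kp by (simp add: l_def)
  hence "l * k <= l" using k1 by (simp add: mult_left_le)
  hence l1: "g v0 + 1 / 2 <= l" using l0 by linarith
  \<comment> \<open>\<open>l\<close> is the length that d will have, so division by l - 1/2 inverts
    the \<open>v0\<close>-coordinate of \<open>A'\<close>.\<close>
  define d where "d = (%v. 1 / k * g v)(v0 := g v0 / (l - 1 / 2))"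
  have ld: "len d = l"
  proof -
   have "len d = (\<Sum>v\<in>V1. 1 / k * g v)" unfolding len_def using V_split(2) by (intro sum.cong) (auto simp: d_def)
   thus ?thesis by (simp only: sum_distrib_left[symmetric]) (simp add: l_def)
  qed
  have dD: "d : D"
  proof (rule DI)
   have "0 <= g v0 / (l - 1 / 2)" using l1 g0(1)[of v0] by (intro divide_nonneg_nonneg) linarith+
   thus "0 <= d v" for v using g0(1) kp by (simp add: d_def)
   have "supp d <= supp g" by (auto simp: d_def split: if_splits)
   thus "supp d : \<Gamma>" using face' g0(2) by blast
   have "nrm d = nrm (%v. 1 / k * g v)" using V_split(2) by (intro nrm_cong) (auto simp: d_def)
   thus "nrm d = 1" using nrm_scale[of "1 / k" g] kp by (simp add: k_def)
   show "d v0 <= 1" using l1 g0(1)[of v0] by (simp add: d_def divide_le_eq)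
  qed
  have lp: "l - 1 / 2 > 0 | g v0 = 0" using l1 g0(1)[of v0] by linarith
  have dl: "d v0 * (l - 1 / 2) = g v0" using lp by (auto simp: d_def)
  obtain e where e: "e : D" "q e = d" using q(2) dD by (metis imageE)
  have "lam d * l = g v0 + 1 / 2" using lam_facts(4)[OF dD] ld dl by simp
  hence "lam d * l <= k * l" using l0 by (simp add: mult.commute)
  hence lamk: "lam d <= k" using len_ge[OF dD] ld by simp
  obtain t where t: "0 <= t" "t <= 1" "lam d + t * (1 - lam d) = k"
   using solve_t[OF less_imp_le[OF lam_facts(1)[OF dD]] lamk k1] by blast
  define y where "y = (e, t)"
  have "mm y = k" using t(3) e(2) by (simp add: mm_def y_def algebra_simps)
  hence mk: "mm y = k" .
  have "A' y = g"
  proof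
   fix v show "A' y v = g v"
   proof (cases "v = v0")
    case True
    thus ?thesis using e(2) ld dl by (simp add: A'_def y_def)
   next
    case False
    hence "A' y v = k * d v" using e(2) mk by (simp add: A'_def y_def)
    thus ?thesis using False kp by (simp add: d_def)
   qed
  qed
  moreover have "y : Y" using e t by (simp add: y_def Y_def)
  ultimately show "g : A' ` Y" by blast
 qed
qed

lemma continuous_A': "continuous_on Y A'"
proof -
 have qc: "continuous_on Y (%y. q (fst y))"
  by (rule continuous_on_compose2[OF q(1)]) (auto intro: continuous_on_fst continuous_on_id simp: Y_def)
 hence qv: "continuous_on Y (%y. q (fst y) v)" for v by (rule continuous_on_product_then_coordinatewise)
 have lc: "continuous_on Y (%y. len (q (fst y)))" unfolding len_def by (intro continuous_on_sum qv)
 have l0: "len (q (fst y)) ~= 0" if "y : Y" for y using len_ge[OF q_D[OF YD(1)[OF that]]] by linarith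
 have lamc: "continuous_on Y (%y. lam (q (fst y)))" unfolding lam_def using l0
  by (intro continuous_on_divide continuous_on_add continuous_on_mult continuous_on_diff continuous_on_const qv lc) auto
 have mc: "continuous_on Y mm" unfolding mm_def by (intro continuous_intros lamc)
 show ?thesis
 proof (rule continuous_on_coordinatewise_then_product)
  fix v show "continuous_on Y (%y. A' y v)"
   by (cases "v = v0") (auto simp: A'_def intro!: continuous_on_mult continuous_on_diff continuous_on_const qv lc mc)
 qed
qed

end

section \<open>The fundamental group of the coupled link space as a group of mirror words\<close>

section \<open>Homotopy of paths in topological spaces\<close>

text \<open>The homotopy is straight in a convex parameter domain and is pushed forward by h, so the
  target can be any topological space.\<close>

lemma homotopic_paths_convex_image:
 fixes r r' :: "real => 'a::real_normed_vector" and h :: "'a => 'x::topological_space"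
 assumes "convex C" "continuous_on C h" "h ` C <= S" "path r" "path r'" "path_image r <= C" "path_image r' <= C"
  "pathstart r = pathstart r'" "pathfinish r = pathfinish r'"
 shows "homotopic_paths S (h o r) (h o r')"
proof (rule homotopic_paths_continuous_image)
 show "homotopic_paths C r r'"
 proof (rule homotopic_paths_linear)
  show "closed_segment (r t) (r' t) <= C" if "t : {0..1}" for t
   using that assms by (intro closed_segment_subset) (auto simp: path_image_def)
 qed (use assms in auto)
 show "continuous_on C h" "h : C \<rightarrow> S" using assms by auto
qed

lemma homotopic_paths_reparam:
 fixes p :: "real => 'x::topological_space"
 assumes "path p" "path_image p <= S" "path r" "path r'" "path_image r <= {0..1}" "path_image r' <= {0..1}"
  "pathstart r = pathstart r'" "pathfinish r = pathfinish r'"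
 shows "homotopic_paths S (p o r) (p o r')"
 using assms by (intro homotopic_paths_convex_image[where C = "{0..1}"]) (auto simp: path_def path_image_def)

lemma homotopic_paths_eqI:
 "[|homotopic_paths S p q; \<And>t. t : {0..1} ==> p t = p' t; \<And>t. t : {0..1} ==> q t = q' t|] ==> homotopic_paths S p' q'"
proof -
 assume h: "homotopic_paths S p q" and e: "\<And>t. t : {0..1} ==> p t = p' t" "\<And>t. t : {0..1} ==> q t = q' t"
 have "homotopic_paths S p p'" "homotopic_paths S q q'"
  using homotopic_paths_imp_path[OF h] homotopic_paths_imp_subset[OF h] e by (auto intro!: homotopic_paths_eq)
 thus ?thesis using h homotopic_paths_sym homotopic_paths_trans by blast
qed

lemma path_id [simp]: "path (id :: real => real)" "pathstart (id :: real => real) = 0"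
 "pathfinish (id :: real => real) = 1" "path_image (id :: real => real) = {0..1}"
 by (auto simp: path_def pathstart_def pathfinish_def path_image_def)

lemma path_const: "path (%_. x)"
 by (simp add: path_def)

lemma const_paths [simp]: "pathstart (%_. x) = x" "pathfinish (%_. x) = x" "path_image (%_. x) = {x}"
 by (auto simp: pathstart_def pathfinish_def path_image_def)

lemma homotopic_paths_const_left:
 fixes p :: "real => 'x::topological_space"
 assumes "path p" "path_image p <= S" "pathstart p = x" shows "homotopic_paths S ((%_. x) +++ p) p"
proof -
 have "homotopic_paths S (p o ((%_. 0) +++ id)) (p o id)"
  using assms by (intro homotopic_paths_reparam path_join_imp) (simp_all add: path_image_join path_const)
 thus ?thesis
  by (rule homotopic_paths_eqI) (use assms in \<open>auto simp: joinpaths_def pathstart_def\<close>)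
qed

lemma homotopic_paths_inverse_right:
 fixes p :: "real => 'x::topological_space"
 assumes "path p" "path_image p <= S" "pathstart p = x" shows "homotopic_paths S (p +++ reversepath p) (%_. x)"
proof -
 have "homotopic_paths S (p o (id +++ reversepath id)) (p o (%_. 0))"
  using assms by (intro homotopic_paths_reparam path_join_imp) (simp_all add: path_image_join path_const)
 thus ?thesis
  by (rule homotopic_paths_eqI) (use assms in \<open>auto simp: joinpaths_def reversepath_def pathstart_def\<close>)
qed

lemma homotopic_paths_inverse_left:
 fixes p :: "real => 'x::topological_space"
 assumes "path p" "path_image p <= S" "pathfinish p = x" shows "homotopic_paths S (reversepath p +++ p) (%_. x)"
 using homotopic_paths_inverse_right[of "reversepath p" S x] assms by simp

section \<open>The fundamental group\<close>

definition hclass :: "'x::topological_space set => (real => 'x) => (real => 'x) set" where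
 "hclass S p = {q. homotopic_paths S p q}"

lemma hclass_eq: "homotopic_paths S p q ==> hclass S p = hclass S q"
 unfolding hclass_def using homotopic_paths_sym homotopic_paths_trans by blast

lemma hclass_eq_iff:
 "[|path q; path_image q <= S|] ==> hclass S p = hclass S q <-> homotopic_paths S p q"
 using hclass_eq unfolding hclass_def by fastforce

lemma fundamental_group_carrier: "carrier (fundamental_group S x) = hclass S ` loops_at S x"
 by (auto simp: fundamental_group_def quotient_def hclass_def)

lemma fundamental_group_one: "\<one>\<^bsub>fundamental_group S x\<^esub> = hclass S (%_. x)"
 by (simp add: fundamental_group_def hclass_def)

lemma loops_atD: "p : loops_at S x ==> path p & path_image p <= S & pathstart p = x & pathfinish p = x"
 by (simp add: loops_at_def)

lemma loops_join: "[|p : loops_at S x; q : loops_at S x|] ==> p +++ q : loops_at S x"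
 by (auto simp: loops_at_def path_image_join)

lemma fundamental_group_mult:
 assumes "p : loops_at S x" "q : loops_at S x"
 shows "hclass S p \<otimes>\<^bsub>fundamental_group S x\<^esub> hclass S q = hclass S (p +++ q)"
proof -
 have "hclass S p \<otimes>\<^bsub>fundamental_group S x\<^esub> hclass S q =
   {r. \<exists>p'\<in>hclass S p. \<exists>q'\<in>hclass S q. homotopic_paths S (p' +++ q') r}" by (simp add: fundamental_group_def)
 also have "\<dots> = hclass S (p +++ q)"
 proof (intro equalityI subsetI)
  fix r assume "r : {r. \<exists>p'\<in>hclass S p. \<exists>q'\<in>hclass S q. homotopic_paths S (p' +++ q') r}"
  then obtain p' q' where "homotopic_paths S p p'" "homotopic_paths S q q'" "homotopic_paths S (p' +++ q') r"
   by (auto simp: hclass_def)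
  moreover have "pathfinish p = pathstart q" using assms by (simp add: loops_at_def)
  ultimately show "r : hclass S (p +++ q)"
   unfolding hclass_def using homotopic_paths_join homotopic_paths_trans by blast
 next
  fix r assume "r : hclass S (p +++ q)"
  moreover have "p : hclass S p" "q : hclass S q" using assms by (auto simp: hclass_def loops_at_def)
  ultimately show "r : {r. \<exists>p'\<in>hclass S p. \<exists>q'\<in>hclass S q. homotopic_paths S (p' +++ q') r}"
   unfolding hclass_def mem_Collect_eq by blast
 qed
 finally show ?thesis .
qed

lemma group_fundamental_group:
 assumes "x : S" shows "group (fundamental_group S x)"
proof (rule groupI)
 have c: "(%_. x) : loops_at S x" using assms by (simp add: loops_at_def path_const)
 show "\<one>\<^bsub>fundamental_group S x\<^esub> : carrier (fundamental_group S x)"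
  using c by (simp add: fundamental_group_one fundamental_group_carrier)
 fix P assume P: "P : carrier (fundamental_group S x)"
 then obtain p where p: "p : loops_at S x" "P = hclass S p" by (auto simp: fundamental_group_carrier)
 show "\<one>\<^bsub>fundamental_group S x\<^esub> \<otimes>\<^bsub>fundamental_group S x\<^esub> P = P"
  unfolding fundamental_group_one p(2) fundamental_group_mult[OF c p(1)]
  using loops_atD[OF p(1)] by (intro hclass_eq homotopic_paths_const_left) auto
 have r: "reversepath p : loops_at S x" using p by (auto simp: loops_at_def)
 thus "\<exists>Q\<in>carrier (fundamental_group S x). Q \<otimes>\<^bsub>fundamental_group S x\<^esub> P = \<one>\<^bsub>fundamental_group S x\<^esub>"
  unfolding fundamental_group_carrier fundamental_group_one p(2)
  using loops_atD[OF p(1)] fundamental_group_mult[OF r p(1)] hclass_eq[OF homotopic_paths_inverse_left[of p S x]]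
  by (intro bexI[of _ "hclass S (reversepath p)"]) auto
 fix Q assume "Q : carrier (fundamental_group S x)"
 then obtain q where q: "q : loops_at S x" "Q = hclass S q" by (auto simp: fundamental_group_carrier)
 show "P \<otimes>\<^bsub>fundamental_group S x\<^esub> Q : carrier (fundamental_group S x)"
  unfolding p q fundamental_group_mult[OF p(1) q(1)] fundamental_group_carrier using loops_join p q by blast
 fix R assume "R : carrier (fundamental_group S x)"
 then obtain r where r: "r : loops_at S x" "R = hclass S r" by (auto simp: fundamental_group_carrier)
 have "hclass S ((p +++ q) +++ r) = hclass S (p +++ (q +++ r))"
  using loops_atD[OF p(1)] loops_atD[OF q(1)] loops_atD[OF r(1)]
  by (intro hclass_eq homotopic_paths_sym[OF homotopic_paths_assoc]) auto
 thus "P \<otimes>\<^bsub>fundamental_group S x\<^esub> Q \<otimes>\<^bsub>fundamental_group S x\<^esub> R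
   = P \<otimes>\<^bsub>fundamental_group S x\<^esub> (Q \<otimes>\<^bsub>fundamental_group S x\<^esub> R)"
  unfolding p(2) q(2) r(2) using p q r fundamental_group_mult loops_join by metis
qed

section \<open>The coupled link space\<close>

type_synonym 'b point = "nat => (nat \<times> bool) + 'b => real"

locale coloured =
 fixes n :: nat and \<Gamma> :: "'b set set" and c :: "'b => nat"
 assumes coloured: "coloured_complex n \<Gamma> c"
begin

abbreviation V where "V \<equiv> \<Union>\<Gamma>"

lemma abs: "abstract_complex \<Gamma>"
 using coloured by (simp add: coloured_complex_def)

lemma col_range: "v : V ==> c v : {1..n}"
 using coloured unfolding coloured_complex_def by blast

lemma face: "\<sigma> : \<Gamma> ==> \<tau> <= \<sigma> ==> \<tau> : \<Gamma>"
 using abs by (simp add: abstract_complex_def)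

lemma col_inj: "[|\<sigma> : \<Gamma>; v : \<sigma>; w : \<sigma>; c v = c w|] ==> v = w"
proof (rule ccontr)
 assume a: "\<sigma> : \<Gamma>" "v : \<sigma>" "w : \<sigma>" "c v = c w" "v ~= w"
 hence "{v, w} : \<Gamma>" using face[OF a(1), of "{v, w}"] by simp
 hence "adjacent_in \<Gamma> v w" using a by (simp add: adjacent_in_def)
 thus False using coloured a(4) by (simp add: coloured_complex_def)
qed

lemma empty_simplex: "{} : \<Gamma>" using abs by (simp add: abstract_complex_def)

lemma finite_vertices: "finite (V)" using abs by (simp add: abstract_complex_def)

definition X :: "'b point set" where
 "X = coupled_link_space n (join_family {1..n} (%_. S0)) fst \<Gamma> c"

definition \<alpha> :: "'b point => nat => bool => real" where
 "\<alpha> x i b = x i (Inl (i, b))"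

definition \<beta> :: "'b point => 'b => real" where
 "\<beta> x v = x (c v) (Inr v)"

definition bsupp :: "'b point => 'b set" where
 "bsupp x = {v : V. \<beta> x v ~= 0}"

definition VV :: "nat => 'b set" where
 "VV i = {v : V. c v = i}"

text \<open>Factor i carries barycentric coordinates on (i, True), (i, False) and the vertices of
  colour i; what is left out is which cells are allowed.\<close>

definition frame :: "'b point => bool" where
 "frame x <-> x : extensional {1..n} & (\<forall>i\<in>{1..n}. (\<forall>y. 0 <= x i y) \<and>
   (\<forall>j b. j ~= i --> x i (Inl (j, b)) = 0) & (\<forall>v. v \<notin> VV i --> x i (Inr v) = 0) \<and>
   \<alpha> x i True + \<alpha> x i False + (\<Sum>v\<in>VV i. x i (Inr v)) = 1)"

lemma finite_VV: "finite (VV i)" by (rule finite_subset[OF _ finite_vertices]) (auto simp: VV_def)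

text \<open>The cube of a point is recovered from the supports of its coordinates. For the
  octahedral \<Gamma>_A every choice of one vertex per factor has a simplex as A-part, so the signs
  are limited only by the edges of the factors, and on the other side the joint support has to be a
  simplex.\<close>

lemma X_iff: "x : X <-> frame x & bsupp x : \<Gamma> & (\<forall>i\<in>{1..n}. \<alpha> x i True = 0 | \<alpha> x i False = 0)"
proof -
 let ?I = "{1..n}" and ?A = "join_family {1..n} (%_. S0)"
 have S0: "\<sigma> : S0 <-> \<sigma> = {} | (\<exists>b. \<sigma> = {b})" for \<sigma> :: "bool set" by (auto simp: S0_def discrete_complex_def)
 have ccA: "colour_class ?A fst i = {i} \<times> UNIV" if "i : ?I" for i
 proof -
  have "(i, b) : \<Union>?A" for b
  proof -
   have "Sigma ?I (%j. if j = i then {b} else {}) : ?A" unfolding join_family_def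
    by (rule CollectI, rule exI, rule conjI, rule refl) (auto simp: S0_def discrete_complex_def)
   moreover have "(i, b) : Sigma ?I (%j. if j = i then {b} else {})" using that by auto
   ultimately show ?thesis by blast
  qed
  thus ?thesis by (auto simp: colour_class_def)
 qed
 have ccB: "colour_class \<Gamma> c i = VV i" for i by (auto simp: colour_class_def VV_def)
 have dis: "\<sigma> : discrete_complex W <-> \<sigma> = {} | (\<exists>v\<in>W. \<sigma> = {v})" for \<sigma> W by (auto simp: discrete_complex_def)
 have coup: "coupled_vertex n ?A \<Gamma> y <-> {b. \<exists>i\<in>?I. y i = Inr b} : \<Gamma>"
  if y: "\<And>i a. i : ?I ==> y i = Inl a ==> fst a = i" for y :: "nat => (nat \<times> bool) + 'b"
 proof -
  have "{a. \<exists>i\<in>?I. y i = Inl a} = Sigma ?I (%i. {b. y i = Inl (i, b)})"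
  proof (rule Set.set_eqI)
   fix a show "a : {a. \<exists>i\<in>?I. y i = Inl a} <-> a : Sigma ?I (%i. {b. y i = Inl (i, b)})"
    using y by (cases a) fastforce
  qed
  moreover have "{b. y i = Inl (i, b)} : S0" for i
  proof (cases "\<exists>b. y i = Inl (i, b)")
   case True
   then obtain b where "y i = Inl (i, b)" by blast
   hence "{b. y i = Inl (i, b)} = {b}" by simp
   thus ?thesis unfolding S0_def discrete_complex_def by blast
  next
   case False
   hence "{b. y i = Inl (i, b)} = {}" by blast
   thus ?thesis unfolding S0_def discrete_complex_def by blast
  qed
  ultimately have "{a. \<exists>i\<in>?I. y i = Inl a} : ?A" unfolding join_family_def by blast
  thus ?thesis by (simp add: coupled_vertex_def)
 qed
 let ?cubes = "coupled_link_cubes n ?A fst \<Gamma> c"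
 have cubeI: "e i : join_complex (discrete_complex ({i} \<times> UNIV)) (discrete_complex (VV i)) & e i ~= {}"
  if "e : ?cubes" "i : ?I" for e i
 proof -
  have "e : product_cubes ?I (%i. join_complex (discrete_complex (colour_class ?A fst i)) (discrete_complex (colour_class \<Gamma> c i)))"
   using that(1) by (simp add: coupled_link_cubes_def)
  hence "e i : join_complex (discrete_complex (colour_class ?A fst i)) (discrete_complex (colour_class \<Gamma> c i)) - {{}}"
   unfolding product_cubes_def using that(2) by (rule PiE_mem)
  thus ?thesis unfolding ccA[OF that(2)] ccB by blast
 qed
 show ?thesis
 proof
  assume "x : X"
  then obtain e where e: "e : ?cubes" "x : PiE ?I (%i. closed_simplex (e i))"
   by (auto simp: X_def coupled_link_space_def geometric_cube_def)
  have xs: "x i : closed_simplex (e i)" if "i : ?I" for i using e(2) that by (auto simp: PiE_def)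
  have ei: "\<exists>\<sigma> \<tau>. e i = \<sigma> <+> \<tau> & (\<sigma> = {} | (\<exists>b. \<sigma> = {(i, b)})) & (\<tau> = {} | (\<exists>v\<in>VV i. \<tau> = {v}))" if "i : ?I" for i
   using cubeI[OF e(1) that] unfolding join_complex_def dis by blast
  define T where "T = {v. \<exists>i\<in>?I. Inr v : e i}"
  have "T : \<Gamma>"
  proof -
   \<comment> \<open>The vertex of the cube that takes the B-end of each cell that has one; its
     B-part contains all B-ends at once.\<close>
   define y where "y = (\<lambda>i\<in>?I. if \<exists>v. Inr v : e i then Inr (SOME v. Inr v : e i) else (SOME z. z : e i))"
   have yi: "y i : e i" if i: "i : ?I" for i
   proof (cases "\<exists>v. Inr v : e i")
    case True
    thus ?thesis using i someI_ex[OF True] by (simp add: y_def)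
   next
    case False
    thus ?thesis using i cubeI[OF e(1) i] some_in_eq[of "e i"] by (simp add: y_def)
   qed
   have "y : cube_vertices ?I e" using yi by (auto simp: cube_vertices_def y_def)
   hence "coupled_vertex n ?A \<Gamma> y" using e(1) by (simp add: coupled_link_cubes_def)
   moreover have "fst a = i" if i: "i : ?I" "y i = Inl a" for i a
   proof -
    obtain \<sigma> \<tau> where "e i = \<sigma> <+> \<tau>" "\<sigma> = {} | (\<exists>b. \<sigma> = {(i, b)})" using ei[OF i(1)] by blast
    moreover have "Inl a : e i" using yi[OF i(1)] i(2) by simp
    ultimately show ?thesis by auto
   qed
   ultimately have *: "{b. \<exists>i\<in>?I. y i = Inr b} : \<Gamma>" using coup by blast
   have "T <= {b. \<exists>i\<in>?I. y i = Inr b}"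
   proof
    fix v assume "v : T"
    then obtain i where i: "i : ?I" "Inr v : e i" by (auto simp: T_def)
    hence "y i = Inr (SOME v. Inr v : e i)" by (auto simp: y_def)
    moreover obtain \<sigma> \<tau> where st: "e i = \<sigma> <+> \<tau>" "\<tau> = {} | (\<exists>v\<in>VV i. \<tau> = {v})" using ei[OF i(1)] by blast
    have "Inr (SOME v. Inr v : e i) : e i" using i(2) by (rule someI)
    hence "(SOME v. Inr v : e i) : \<tau>" "v : \<tau>" using i(2) unfolding st(1) by (simp_all only: InrI Plus_def UnE, auto)
    hence "(SOME v. Inr v : e i) = v" using st(2) by blast
    ultimately show "v : {b. \<exists>i\<in>?I. y i = Inr b}" using i by auto
   qed
   thus ?thesis using * face by blast
  qed
  have eiD: "e i <= ({i} \<times> UNIV) <+> VV i" "~ (Inl (i, True) : e i & Inl (i, False) : e i)" if i: "i : ?I" for i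
  proof -
   obtain \<sigma> \<tau> where st: "e i = \<sigma> <+> \<tau>" "\<sigma> = {} | (\<exists>b. \<sigma> = {(i, b)})" "\<tau> = {} | (\<exists>v\<in>VV i. \<tau> = {v})"
    using ei[OF i] by blast
   have "\<sigma> <= {i} \<times> UNIV" "\<tau> <= VV i" using st by blast+
   thus "e i <= ({i} \<times> UNIV) <+> VV i" unfolding st(1) by auto
   show "~ (Inl (i, True) : e i & Inl (i, False) : e i)" unfolding st(1) using st(2) by auto
  qed
  have zero: "x i z = 0" if "i : ?I" "z \<notin> e i" for i z using xs[OF that(1)] that(2) by (simp add: closed_simplex_def)
  have sumI: "\<alpha> x i True + \<alpha> x i False + (\<Sum>v\<in>VV i. x i (Inr v)) = 1" if i: "i : ?I" for i
  proof -
   let ?W = "({i} \<times> UNIV) <+> VV i"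
   have "e i <= ?W" by (rule eiD(1)[OF i])
   hence "sum (x i) ?W = sum (x i) (e i)" using finite_VV zero[OF i] by (intro sum.mono_neutral_right) auto
   also have "\<dots> = 1" using xs[OF i] by (simp add: closed_simplex_def)
   finally have "sum (x i) ?W = 1" .
   moreover have "sum (x i) ?W = (\<Sum>a\<in>{i} \<times> UNIV. x i (Inl a)) + (\<Sum>v\<in>VV i. x i (Inr v))"
    using finite_VV by (simp add: sum.Plus)
   moreover have "({i} \<times> UNIV :: (nat \<times> bool) set) = {(i, True), (i, False)}" by (auto simp: UNIV_bool)
   ultimately show ?thesis by (simp add: \<alpha>_def)
  qed
  have "frame x"
   unfolding frame_def
  proof (intro conjI ballI allI impI)
   show "x : extensional ?I" using e(2) by (simp add: PiE_def)
   fix i assume i: "i : ?I"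
   show "0 <= x i y" for y using xs[OF i] by (simp add: closed_simplex_def)
   show "x i (Inl (j, b)) = 0" if "j ~= i" for j b using eiD(1)[OF i] that by (intro zero[OF i]) auto
   show "x i (Inr v) = 0" if "v \<notin> VV i" for v using eiD(1)[OF i] that by (intro zero[OF i]) auto
   show "\<alpha> x i True + \<alpha> x i False + (\<Sum>v\<in>VV i. x i (Inr v)) = 1" by (rule sumI[OF i])
  qed
  moreover have "bsupp x : \<Gamma>"
  proof (rule face[OF \<open>T : \<Gamma>\<close>])
   show "bsupp x <= T"
   proof
    fix v assume "v : bsupp x"
    hence "c v : ?I" "x (c v) (Inr v) ~= 0" using col_range by (auto simp: bsupp_def \<beta>_def)
    thus "v : T" using zero unfolding T_def by blast
   qed
  qed
  moreover have "\<alpha> x i True = 0 | \<alpha> x i False = 0" if i: "i : ?I" for i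
  proof -
   have "Inl (i, True) \<notin> e i | Inl (i, False) \<notin> e i" using eiD(2)[OF i] by blast
   thus ?thesis using zero[OF i] by (auto simp: \<alpha>_def)
  qed
  ultimately show "frame x & bsupp x : \<Gamma> & (\<forall>i\<in>?I. \<alpha> x i True = 0 | \<alpha> x i False = 0)" by blast
 next
  assume x: "frame x & bsupp x : \<Gamma> & (\<forall>i\<in>?I. \<alpha> x i True = 0 | \<alpha> x i False = 0)"
  define e where "e = (\<lambda>i\<in>?I. {z. x i z ~= 0})"
  have f: "\<And>i y. i : ?I ==> 0 <= x i y" "\<And>i j b. i : ?I ==> j ~= i ==> x i (Inl (j, b)) = 0"
   "\<And>i v. i : ?I ==> v \<notin> VV i ==> x i (Inr v) = 0"
   "\<And>i. i : ?I ==> \<alpha> x i True + \<alpha> x i False + (\<Sum>v\<in>VV i. x i (Inr v)) = 1"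
   using x unfolding frame_def by blast+
  have bs: "v : bsupp x" if "i : ?I" "x i (Inr v) ~= 0" for i v
   using that f(3)[of i v] by (auto simp: bsupp_def \<beta>_def VV_def)
  have eform: "e i = ({a. x i (Inl a) ~= 0} <+> {v. x i (Inr v) ~= 0})" if i: "i : ?I" for i
  proof (rule Set.set_eqI)
   fix z show "z : e i <-> z : {a. x i (Inl a) ~= 0} <+> {v. x i (Inr v) ~= 0}" using i by (cases z) (auto simp: e_def)
  qed
  have Apart: "{a. x i (Inl a) ~= 0} : discrete_complex ({i} \<times> UNIV)" if i: "i : ?I" for i
  proof -
   have "{a. x i (Inl a) ~= 0} <= {(i, True), (i, False)}" using f(2)[OF i] by force
   moreover have "(i, True) \<notin> {a. x i (Inl a) ~= 0} | (i, False) \<notin> {a. x i (Inl a) ~= 0}"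
    using x i by (auto simp: \<alpha>_def)
   ultimately have "{a. x i (Inl a) ~= 0} <= {(i, True)} | {a. x i (Inl a) ~= 0} <= {(i, False)}" by blast
   thus ?thesis unfolding dis by (auto simp: subset_singleton_iff)
  qed
  have Bpart: "{v. x i (Inr v) ~= 0} : discrete_complex (VV i)" if i: "i : ?I" for i
  proof (cases "{v. x i (Inr v) ~= 0} = {}")
   case False
   then obtain v where v: "x i (Inr v) ~= 0" by blast
   have "w = v" if "x i (Inr w) ~= 0" for w
   proof (rule col_inj[of "bsupp x"])
    have "w : VV i" "v : VV i" using f(3)[OF i] v that by blast+
    thus "c w = c v" by (simp add: VV_def)
   qed (use x bs[OF i] v that in auto)
   hence "{v. x i (Inr v) ~= 0} = {v}" using v by blast
   moreover have "v : VV i" using f(3)[OF i] v by blast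
   ultimately show ?thesis unfolding dis by blast
  qed (simp add: dis)
  have ecl: "x i : closed_simplex (e i)" "e i ~= {}" if i: "i : ?I" for i
  proof -
   let ?W = "({i} \<times> UNIV) <+> VV i"
   have "{a. x i (Inl a) ~= 0} <= {i} \<times> UNIV" using f(2)[OF i] by force
   moreover have "{v. x i (Inr v) ~= 0} <= VV i" using f(3)[OF i] by blast
   ultimately have sub: "e i <= ?W" unfolding eform[OF i] by auto
   have "({i} \<times> UNIV :: (nat \<times> bool) set) = {(i, True), (i, False)}" by (auto simp: UNIV_bool)
   hence "sum (x i) ?W = 1" using finite_VV f(4)[OF i] by (simp add: sum.Plus \<alpha>_def)
   moreover have "sum (x i) ?W = sum (x i) (e i)"
    using finite_VV sub i by (intro sum.mono_neutral_right) (auto simp: e_def)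
   ultimately have s: "sum (x i) (e i) = 1" by simp
   thus "e i ~= {}" by auto
   show "x i : closed_simplex (e i)" using s f(1)[OF i] i by (auto simp: closed_simplex_def e_def)
  qed
  have "e : ?cubes"
   unfolding coupled_link_cubes_def
  proof (intro CollectI conjI ballI)
   show "e : product_cubes ?I (%i. join_complex (discrete_complex (colour_class ?A fst i)) (discrete_complex (colour_class \<Gamma> c i)))"
    unfolding product_cubes_def
   proof (rule PiE_I)
    fix i assume i: "i : ?I"
    have "e i : join_complex (discrete_complex ({i} \<times> UNIV)) (discrete_complex (VV i))"
     unfolding eform[OF i] join_complex_def using Apart[OF i] Bpart[OF i] by blast
    thus "e i : join_complex (discrete_complex (colour_class ?A fst i)) (discrete_complex (colour_class \<Gamma> c i)) - {{}}"
     using ecl(2)[OF i] ccA[OF i] ccB by simp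
   qed (auto simp: e_def)
   fix y assume y: "y : cube_vertices ?I e"
   hence yi: "x i (y i) ~= 0" if "i : ?I" for i
    using PiE_mem[of y ?I e i] that by (simp add: cube_vertices_def e_def)
   have "{b. \<exists>i\<in>?I. y i = Inr b} <= bsupp x"
   proof
    fix b assume "b : {b. \<exists>i\<in>?I. y i = Inr b}"
    then obtain i where "i : ?I" "y i = Inr b" by blast
    thus "b : bsupp x" using bs[of i b] yi[of i] by simp
   qed
   hence "{b. \<exists>i\<in>?I. y i = Inr b} : \<Gamma>" using x face by blast
   moreover have "fst a = i" if "i : ?I" "y i = Inl a" for i a
    using yi[OF that(1)] f(2)[OF that(1), of "fst a" "snd a"] that(2) by auto
   ultimately show "coupled_vertex n ?A \<Gamma> y" using coup by blast
  qed
  moreover have "x : geometric_cube ?I e"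
   unfolding geometric_cube_def using ecl x by (auto simp: frame_def PiE_def)
  ultimately show "x : X" unfolding X_def coupled_link_space_def by blast
 qed
qed

end

context coloured begin

lemma XD:
 assumes "x : X"
 shows "x : extensional {1..n}" "\<And>i y. i : {1..n} ==> 0 <= x i y"
  "\<And>i j b. i : {1..n} ==> j ~= i ==> x i (Inl (j, b)) = 0" "\<And>i v. i : {1..n} ==> v \<notin> VV i ==> x i (Inr v) = 0"
  "\<And>i. i : {1..n} ==> \<alpha> x i True + \<alpha> x i False + (\<Sum>v\<in>VV i. x i (Inr v)) = 1"
  "bsupp x : \<Gamma>" "\<And>i. i : {1..n} ==> \<alpha> x i b = 0 | \<alpha> x i (~ b) = 0"
  "\<And>i. i : {1..n} ==> 0 <= \<alpha> x i b" "\<And>v. v : V ==> 0 <= \<beta> x v"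
proof -
 note x = assms[unfolded X_iff frame_def]
 show "x : extensional {1..n}" "\<And>i y. i : {1..n} ==> 0 <= x i y"
  "\<And>i j b. i : {1..n} ==> j ~= i ==> x i (Inl (j, b)) = 0" "\<And>i v. i : {1..n} ==> v \<notin> VV i ==> x i (Inr v) = 0"
  "\<And>i. i : {1..n} ==> \<alpha> x i True + \<alpha> x i False + (\<Sum>v\<in>VV i. x i (Inr v)) = 1" "bsupp x : \<Gamma>" using x by blast+
 show "\<And>i. i : {1..n} ==> \<alpha> x i b = 0 | \<alpha> x i (~ b) = 0" using x by (cases b) auto
 show "\<And>i. i : {1..n} ==> 0 <= \<alpha> x i b" "\<And>v. v : V ==> 0 <= \<beta> x v"
  using x col_range by (auto simp: \<alpha>_def \<beta>_def)
qed

text \<open>A straight segment in the product; \<open>undefined\<close> outside {1..n} keeps points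
  extensional.\<close>

definition mix :: "'b point => 'b point => real => 'b point" where
 "mix x a t = (%i. if i : {1..n} then (%z. (1 - t) * x i z + t * a i z) else undefined)"

lemma mix_simps: "i : {1..n} ==> \<alpha> (mix x a t) i b = (1 - t) * \<alpha> x i b + t * \<alpha> a i b"
 "v : V ==> \<beta> (mix x a t) v = (1 - t) * \<beta> x v + t * \<beta> a v"
 using col_range by (auto simp: mix_def \<alpha>_def \<beta>_def)

lemma mix_ends: "x : extensional {1..n} ==> mix x a 0 = x" "a : extensional {1..n} ==> mix x a 1 = a"
 by (auto simp: mix_def extensional_def fun_eq_iff)

lemma mix_swap: "mix a x t = mix x a (1 - t)"
 by (auto simp: mix_def fun_eq_iff)

lemma mix_X:
 assumes x: "x : X" and a: "a : X" and t: "0 <= t" "t <= 1" and T: "T : \<Gamma>" "bsupp x <= T" "bsupp a <= T"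
  and s: "\<And>i. i : {1..n} ==> \<exists>b. \<alpha> x i b = 0 & \<alpha> a i b = 0"
 shows "mix x a t : X"
 unfolding X_iff frame_def
proof (intro conjI ballI allI impI)
 show "mix x a t : extensional {1..n}" by (simp add: mix_def extensional_def)
 fix i assume i: "i : {1..n}"
 have m: "mix x a t i z = (1 - t) * x i z + t * a i z" for z using i by (simp add: mix_def)
 show "0 <= mix x a t i y" for y using m XD(2)[OF x i] XD(2)[OF a i] t by simp
 show "mix x a t i (Inl (j, b)) = 0" if "j ~= i" for j b using m XD(3)[OF x i that] XD(3)[OF a i that] by simp
 show "mix x a t i (Inr v) = 0" if "v \<notin> VV i" for v using m XD(4)[OF x i that] XD(4)[OF a i that] by simp
 have "(\<Sum>v\<in>VV i. mix x a t i (Inr v)) = (1 - t) * (\<Sum>v\<in>VV i. x i (Inr v)) + t * (\<Sum>v\<in>VV i. a i (Inr v))"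
  by (simp add: m sum.distrib sum_distrib_left)
 moreover have "\<alpha> (mix x a t) i True + \<alpha> (mix x a t) i False =
   (1 - t) * (\<alpha> x i True + \<alpha> x i False) + t * (\<alpha> a i True + \<alpha> a i False)"
  by (simp add: mix_simps(1)[OF i] algebra_simps)
 ultimately have "\<alpha> (mix x a t) i True + \<alpha> (mix x a t) i False + (\<Sum>v\<in>VV i. mix x a t i (Inr v)) =
   (1 - t) * (\<alpha> x i True + \<alpha> x i False + (\<Sum>v\<in>VV i. x i (Inr v))) +
   t * (\<alpha> a i True + \<alpha> a i False + (\<Sum>v\<in>VV i. a i (Inr v)))" by (simp add: algebra_simps)
 thus "\<alpha> (mix x a t) i True + \<alpha> (mix x a t) i False + (\<Sum>v\<in>VV i. mix x a t i (Inr v)) = 1"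
  using XD(5)[OF x i] XD(5)[OF a i] by simp
 obtain b where "\<alpha> x i b = 0" "\<alpha> a i b = 0" using s[OF i] by blast
 hence "\<alpha> (mix x a t) i b = 0" by (simp add: mix_simps(1)[OF i])
 thus "\<alpha> (mix x a t) i True = 0 | \<alpha> (mix x a t) i False = 0" by (cases b) auto
next
 have "bsupp (mix x a t) <= T"
 proof
  fix v assume v: "v : bsupp (mix x a t)"
  have vG: "v : V" and "\<beta> (mix x a t) v ~= 0" using v unfolding bsupp_def by blast+
  hence "\<beta> x v ~= 0 | \<beta> a v ~= 0" using mix_simps(2)[OF vG, of x a t] by auto
  hence "v : bsupp x | v : bsupp a" using vG unfolding bsupp_def by blast
  thus "v : T" using T by blast
 qed
 thus "bsupp (mix x a t) : \<Gamma>" using face T by blast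
qed

definition star :: "'b point set => 'b point => bool" where
 "star S a <-> S <= X & a : S & (\<forall>x\<in>S. \<forall>t\<in>{0..1}. mix x a t : S)"

lemma continuous_coord: "continuous_on S p ==> continuous_on S (%t. p t i z)"
 for p :: "'t::topological_space => 'b point"
 by (rule continuous_on_product_then_coordinatewise[OF continuous_on_product_then_coordinatewise])

lemma continuous_mix:
 assumes "continuous_on S p" "continuous_on S q" "continuous_on S r"
 shows "continuous_on S (%s. mix (p s) (q s) (r s))"
proof (rule continuous_on_coordinatewise_then_product)
 fix i
 show "continuous_on S (%s. mix (p s) (q s) (r s) i)"
 proof (cases "i : {1..n}")
  case True
  have "continuous_on S (%s z. (1 - r s) * p s i z + r s * q s i z)"
  proof (rule continuous_on_coordinatewise_then_product)
   fix z
   show "continuous_on S (%s. (1 - r s) * p s i z + r s * q s i z)"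
    by (intro continuous_on_add continuous_on_mult continuous_on_diff continuous_on_const assms
     continuous_coord[OF assms(1)] continuous_coord[OF assms(2)])
  qed
  thus ?thesis using True by (simp add: mix_def)
 qed (simp only: mix_def if_False continuous_on_const)
qed

lemma star_path:
 assumes S: "star S a" and x: "x : S"
 shows "path (mix x a)" "path_image (mix x a) <= S" "pathstart (mix x a) = x" "pathfinish (mix x a) = a"
  "path (mix a x)" "path_image (mix a x) <= S" "pathstart (mix a x) = a" "pathfinish (mix a x) = x"
proof -
 have e: "x : extensional {1..n}" "a : extensional {1..n}" using S x XD(1) unfolding star_def by blast+
 show "path (mix x a)" "path (mix a x)" unfolding path_def by (intro continuous_mix continuous_intros)+
 show "path_image (mix x a) <= S" using S x by (auto simp: path_image_def star_def)
 show "path_image (mix a x) <= S" using S x unfolding path_image_def mix_swap[of a x] star_def by auto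
 show "pathstart (mix x a) = x" "pathfinish (mix x a) = a" "pathstart (mix a x) = a" "pathfinish (mix a x) = x"
  using e mix_ends by (auto simp: pathstart_def pathfinish_def)
qed

text \<open>Contraction to the centre moves endpoints. Instead each path, as the bottom side of a
  square, is pushed to the other three sides, whose image depends only on the endpoints and the
  centre.\<close>

lemma star_homotopic:
 assumes S: "star S a" and p: "path p" "path_image p <= S" and q: "path q" "path_image q <= S"
  and e: "pathstart p = pathstart q" "pathfinish p = pathfinish q"
 shows "homotopic_paths S p q"
proof -
 define bot where "bot = (%t. (t, 0) :: real \<times> real)"
 define up where "up = linepath (0, 0) (0, 1 :: real) +++ linepath (0 :: real, 1 :: real) (1, 1) +++ linepath (1 :: real, 1) (1, 0 :: real)"
 define H where "H p = (%(t, s). mix (p t) a s)" for p :: "real => 'b point"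
 let ?Q = "{0..1} \<times> {0..1} :: (real \<times> real) set"
 have bot: "path bot" "path_image bot <= ?Q" "pathstart bot = (0, 0)" "pathfinish bot = (1, 0)"
  by (auto simp: bot_def path_def path_image_def pathstart_def pathfinish_def intro!: continuous_intros)
 have Qc: "convex ?Q" by (intro convex_Times convex_real_interval)
 have up: "path up" "path_image up <= ?Q" "pathstart up = (0, 0)" "pathfinish up = (1, 0)"
  unfolding up_def using closed_segment_subset[OF _ _ Qc] by (auto simp: path_image_join)
 have Hp: "homotopic_paths S p (H p o up)" if p: "path p" "path_image p <= S" for p
 proof -
  have "continuous_on ?Q (H p)"
   unfolding H_def case_prod_beta
   by (intro continuous_mix continuous_intros continuous_on_compose2[OF p(1)[unfolded path_def], of _ fst]) auto
  moreover have "H p ` ?Q <= S" using S p by (auto simp: H_def star_def path_image_def)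
  ultimately have "homotopic_paths S (H p o bot) (H p o up)"
   using bot up Qc by (intro homotopic_paths_convex_image[where C = ?Q]) auto
  thus ?thesis
  proof (rule homotopic_paths_eqI)
   fix t :: real assume "t : {0..1}"
   hence "p t : S" using p by (auto simp: path_image_def)
   hence "p t : X" using S by (auto simp: star_def)
   thus "(H p o bot) t = p t" using mix_ends(1)[OF XD(1)] by (simp add: H_def bot_def)
  qed simp
 qed
 have "(H p o up) t = (H q o up) t" if t: "t : {0..1}" for t
 proof -
  have a: "a : extensional {1..n}" using S XD(1) unfolding star_def by blast
  have pq: "p 0 = q 0" "p 1 = q 1" using e by (auto simp: pathstart_def pathfinish_def)
  have "fst (up t) = 0 | fst (up t) = 1 | snd (up t) = 1"
   by (auto simp: up_def joinpaths_def linepath_def)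
  thus ?thesis using pq mix_ends(2)[OF a] by (auto simp: H_def case_prod_beta)
 qed
 hence "homotopic_paths S q (H p o up)"
  using homotopic_paths_eqI[OF Hp[OF q], of q "H p o up"] by simp
 thus ?thesis using Hp[OF p] homotopic_paths_sym homotopic_paths_trans by blast
qed

text \<open>The point lying on all mirrors of T and, in each colour missing from T, at the sign
  vertex given by E. For empty T it is the centre of a chamber.\<close>

definition ctr :: "'b set => (nat => bool) => 'b point" where
 "ctr T E = (%i. if i : {1..n} then (%z. case z of Inl (j, b) => if j = i & b = E i & i \<notin> c ` T then 1 else 0
   | Inr v => if v : T & c v = i then 1 else 0) else undefined)"

lemma ctr_\<alpha>: "i : {1..n} ==> \<alpha> (ctr T E) i b = (if b = E i & i \<notin> c ` T then 1 else 0)"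
 by (simp add: ctr_def \<alpha>_def)

lemma ctr_\<beta>: "v : V ==> \<beta> (ctr T E) v = (if v : T then 1 else 0)"
 using col_range by (simp add: ctr_def \<beta>_def)

lemma ctr_bsupp: "T : \<Gamma> ==> bsupp (ctr T E) = T"
proof -
 assume "T : \<Gamma>"
 hence "T <= V" by blast
 moreover have "v : bsupp (ctr T E) <-> v : T" if "v : V" for v
  using that ctr_\<beta>[OF that, of T E] unfolding bsupp_def by simp
 ultimately show ?thesis unfolding bsupp_def by blast
qed

lemma ctr_X: assumes T: "T : \<Gamma>" shows "ctr T E : X"
 unfolding X_iff frame_def
proof (intro conjI ballI allI impI)
 show "ctr T E : extensional {1..n}" by (simp add: ctr_def extensional_def)
 fix i assume i: "i : {1..n}"
 show "0 <= ctr T E i y" for y using i by (auto simp: ctr_def split: sum.splits)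
 show "ctr T E i (Inl (j, b)) = 0" if "j ~= i" for j b using i that by (simp add: ctr_def)
 show "ctr T E i (Inr v) = 0" if "v \<notin> VV i" for v using i that T by (auto simp: ctr_def VV_def)
 have "(\<Sum>v\<in>VV i. ctr T E i (Inr v)) = (if i : c ` T then 1 else 0)"
 proof (cases "i : c ` T")
  case True
  then obtain v where v: "v : T" "c v = i" by blast
  hence "v : VV i" using T by (auto simp: VV_def)
  moreover have "ctr T E i (Inr w) = 0" if "w : VV i - {v}" for w
   using col_inj[OF T, of w v] that v i by (auto simp: ctr_def VV_def)
  ultimately show ?thesis using finite_VV True v i by (simp add: sum.remove ctr_def)
 next
  case False
  thus ?thesis using i by (auto simp: ctr_def intro!: sum.neutral)
 qed
 thus "\<alpha> (ctr T E) i True + \<alpha> (ctr T E) i False + (\<Sum>v\<in>VV i. ctr T E i (Inr v)) = 1"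
  by (simp add: ctr_\<alpha>[OF i])
 show "\<alpha> (ctr T E) i True = 0 | \<alpha> (ctr T E) i False = 0" by (simp add: ctr_\<alpha>[OF i])
qed (simp add: ctr_bsupp T)

text \<open>Open sets that cover \<open>X\<close> (\<open>UU_cover\<close>) and inside which only
  mirrors of T can be crossed.\<close>

definition UU :: "'b set => (nat => bool) => 'b point set" where
 "UU T E = {x : X. (\<forall>b\<in>T. 0 < \<beta> x b) & (\<forall>i\<in>{1..n} - c ` T. 0 < \<alpha> x i (E i))}"

definition Ch :: "(nat => bool) => 'b point set" where
 "Ch E = {x : X. \<forall>i\<in>{1..n}. \<alpha> x i (~ E i) = 0}"

text \<open>A star-shaped piece that contains the edge paths of all words in the letters of
  T.\<close>

definition Block :: "'b set => (nat => bool) => 'b point set" where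
 "Block T E = {x : X. bsupp x <= T & (\<forall>i\<in>{1..n} - c ` T. \<alpha> x i (~ E i) = 0)}"

lemma UU_sign: "x : UU T E ==> i : {1..n} - c ` T ==> \<alpha> x i (~ E i) = 0"
proof -
 assume "x : UU T E" and i: "i : {1..n} - c ` T"
 hence "x : X" "0 < \<alpha> x i (E i)" unfolding UU_def by blast+
 thus ?thesis using XD(7)[of x i "E i"] i by auto
qed

lemma star_UU: assumes T: "T : \<Gamma>" shows "star (UU T E) (ctr T E)"
 unfolding star_def
proof (intro conjI ballI)
 show "UU T E <= X" by (auto simp: UU_def)
 have "T <= V" using T by blast
 hence "\<And>b. b : T ==> \<beta> (ctr T E) b = 1" using ctr_\<beta> by (metis subsetD)
 thus "ctr T E : UU T E" using ctr_X[OF T] by (simp add: UU_def ctr_\<alpha>)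
 fix x t assume x: "x : UU T E" and t: "t : {0..1 :: real}"
 have xX: "x : X" using x by (simp add: UU_def)
 have "T <= bsupp x" using x T by (auto simp: UU_def bsupp_def)
 moreover have "\<exists>b. \<alpha> x i b = 0 & \<alpha> (ctr T E) i b = 0" if i: "i : {1..n}" for i
 proof (cases "i : c ` T")
  case True
  thus ?thesis using XD(7)[OF xX i, of True] ctr_\<alpha>[OF i, of T E] by auto
 next
  case False
  thus ?thesis using UU_sign[OF x, of i] i ctr_\<alpha>[OF i, of T E] by auto
 qed
 ultimately have m: "mix x (ctr T E) t : X"
  using t ctr_bsupp[OF T] XD(6)[OF xX] by (intro mix_X[OF xX ctr_X[OF T], of t "bsupp x"]) auto
 have pos: "0 < (1 - t) * y + t" if "0 < y" for y :: real
 proof (cases "t = 1")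
  case False
  hence "0 < (1 - t) * y" using that t by simp
  thus ?thesis using t by simp
 qed simp
 have "0 < \<beta> (mix x (ctr T E) t) b" if "b : T" for b
 proof -
  have "b : V" using that T by blast
  thus ?thesis using mix_simps(2)[of b] ctr_\<beta>[of b] x that pos[of "\<beta> x b"] by (simp add: UU_def)
 qed
 moreover have "0 < \<alpha> (mix x (ctr T E) t) i (E i)" if "i : {1..n} - c ` T" for i
  using that x mix_simps(1)[of i] ctr_\<alpha>[of i] pos[of "\<alpha> x i (E i)"] by (simp add: UU_def)
 ultimately show "mix x (ctr T E) t : UU T E" using m by (simp add: UU_def)
qed

lemma star_Block: assumes T: "T : \<Gamma>" shows "star (Block T E) (ctr T E)"
 unfolding star_def
proof (intro conjI ballI)
 show "Block T E <= X" by (auto simp: Block_def)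
 show "ctr T E : Block T E" using ctr_X[OF T] ctr_bsupp[OF T] ctr_\<alpha> by (auto simp: Block_def)
 fix x t assume x: "x : Block T E" and t: "t : {0..1 :: real}"
 have xX: "x : X" using x by (simp add: Block_def)
 have s: "bsupp x <= T" using x by (simp add: Block_def)
 have "\<exists>b. \<alpha> x i b = 0 & \<alpha> (ctr T E) i b = 0" if i: "i : {1..n}" for i
 proof (cases "i : c ` T")
  case True
  thus ?thesis using XD(7)[OF xX i, of True] ctr_\<alpha>[OF i, of T E] by auto
 next
  case False
  thus ?thesis using x i ctr_\<alpha>[OF i, of T E] by (intro exI[of _ "~ E i"]) (auto simp: Block_def)
 qed
 hence m: "mix x (ctr T E) t : X"
  using t ctr_bsupp[OF T] s by (intro mix_X[OF xX ctr_X[OF T], of t T] T) auto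
 have "bsupp (mix x (ctr T E) t) <= T"
 proof
  fix v assume v: "v : bsupp (mix x (ctr T E) t)"
  show "v : T"
  proof (rule ccontr)
   assume "v \<notin> T"
   hence "\<beta> x v = 0" using s v by (auto simp: bsupp_def)
   thus False using v \<open>v \<notin> T\<close> mix_simps(2)[of v] ctr_\<beta>[of v] by (auto simp: bsupp_def)
  qed
 qed
 moreover have "\<alpha> (mix x (ctr T E) t) i (~ E i) = 0" if "i : {1..n} - c ` T" for i
  using that x mix_simps(1)[of i] ctr_\<alpha>[of i] by (simp add: Block_def)
 ultimately show "mix x (ctr T E) t : Block T E" using m by (simp add: Block_def)
qed

abbreviation Oct :: "(nat => bool) => 'b point" where "Oct E \<equiv> ctr {} E"

lemma star_Ch: "star (Ch E) (Oct E)"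
 unfolding star_def
proof (intro conjI ballI)
 show "Ch E <= X" by (auto simp: Ch_def)
 show "Oct E : Ch E" using ctr_X[OF empty_simplex] ctr_\<alpha> by (auto simp: Ch_def)
 fix x t assume x: "x : Ch E" and t: "t : {0..1 :: real}"
 have xX: "x : X" using x by (simp add: Ch_def)
 have "\<exists>b. \<alpha> x i b = 0 & \<alpha> (Oct E) i b = 0" if i: "i : {1..n}" for i
  using x i ctr_\<alpha>[OF i, of "{}" E] by (intro exI[of _ "~ E i"]) (auto simp: Ch_def)
 hence m: "mix x (Oct E) t : X"
  using t ctr_bsupp[OF empty_simplex] XD(6)[OF xX] by (intro mix_X[OF xX ctr_X[OF empty_simplex], of t "bsupp x"]) auto
 moreover have "\<alpha> (mix x (Oct E) t) i (~ E i) = 0" if "i : {1..n}" for i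
  using that x mix_simps(1)[of i] ctr_\<alpha>[of i] by (simp add: Ch_def)
 ultimately show "mix x (Oct E) t : Ch E" by (simp add: Ch_def)
qed

lemma star_in_X: "star S a ==> S <= X"
 by (simp add: star_def)

lemma ctr_cong: "(\<And>i. i : {1..n} ==> i \<notin> c ` T ==> E i = E' i) ==> ctr T E = ctr T E'"
 unfolding ctr_def by (intro ext) (auto split: sum.splits)

section \<open>Edge paths\<close>

definition flip :: "(nat => bool) => nat => nat => bool" where
 "flip E i = E(i := ~ E i)"

definition fl :: "(nat => bool) => 'b list => nat => bool" where
 "fl E w = foldl (%E v. flip E (c v)) E w"

text \<open>Crosses the mirror of v, through the point with v-coordinate 1, between the centres of
  the two adjacent chambers.\<close>

definition EE :: "'b => (nat => bool) => real => 'b point" where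
 "EE v E = mix (Oct E) (ctr {v} E) +++ mix (ctr {v} E) (Oct (flip E (c v)))"

primrec Gp :: "(nat => bool) => 'b list => real => 'b point" where
 "Gp E [] = (%_. Oct E)"
| "Gp E (v # w) = EE v E +++ Gp (flip E (c v)) w"

lemma fl_simps [simp]: "fl E [] = E" "fl E (v # w) = fl (flip E (c v)) w" "fl E (u @ w) = fl (fl E u) w"
 by (auto simp: fl_def)

lemma fl_eq: "fl E w i = (E i ~= odd (length (filter (%v. c v = i) w)))"
 by (induction w arbitrary: E) (auto simp: flip_def)

lemma Block_OO: assumes T: "T : \<Gamma>" and e: "\<And>i. i : {1..n} - c ` T ==> E' i = E i" shows "Oct E' : Block T E"
 using ctr_X[OF empty_simplex] ctr_bsupp[OF empty_simplex] ctr_\<alpha>[of _ "{}" E'] e by (auto simp: Block_def)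

lemma EE_path:
 assumes v: "v : T" and T: "T : \<Gamma>" and e: "\<And>i. i : {1..n} - c ` T ==> E' i = E i"
 shows "path (EE v E')" "path_image (EE v E') <= Block T E" "pathstart (EE v E') = Oct E'"
  "pathfinish (EE v E') = Oct (flip E' (c v))"
proof -
 have vG: "{v} : \<Gamma>" using v T face by blast
 have O: "Oct E' : Block {v} E'" "Oct (flip E' (c v)) : Block {v} E'"
  using vG by (auto intro!: Block_OO simp: flip_def)
 note s = star_path[OF star_Block[OF vG] O(1)] star_path[OF star_Block[OF vG] O(2)]
 have sub: "Block {v} E' <= Block T E"
 proof
  fix x assume x: "x : Block {v} E'"
  have "\<alpha> x i (~ E i) = 0" if i: "i : {1..n} - c ` T" for i
  proof -
   have "i : {1..n} - c ` {v}" using i v by auto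
   hence "\<alpha> x i (~ E' i) = 0" using x unfolding Block_def by blast
   thus ?thesis using e[OF i] by simp
  qed
  moreover have "x : X" "bsupp x <= T" using x v by (auto simp: Block_def)
  ultimately show "x : Block T E" unfolding Block_def by blast
 qed
 show "path (EE v E')" "pathstart (EE v E') = Oct E'" "pathfinish (EE v E') = Oct (flip E' (c v))"
  using s by (auto simp: EE_def)
 show "path_image (EE v E') <= Block T E" using s sub by (auto simp: EE_def path_image_join)
qed

lemma Gp_path_Block:
 assumes "set w <= T" "T : \<Gamma>" "\<And>i. i : {1..n} - c ` T ==> E' i = E i"
 shows "path (Gp E' w) & path_image (Gp E' w) <= Block T E & pathstart (Gp E' w) = Oct E' & pathfinish (Gp E' w) = Oct (fl E' w)"
 using assms(1,3)
proof (induction w arbitrary: E')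
 case Nil
 thus ?case using Block_OO[OF assms(2)] by (auto simp: path_const)
next
 case (Cons v w)
 have "flip E' (c v) i = E i" if "i : {1..n} - c ` T" for i using Cons.prems that by (auto simp: flip_def)
 hence IH: "path (Gp (flip E' (c v)) w)" "path_image (Gp (flip E' (c v)) w) <= Block T E"
   "pathstart (Gp (flip E' (c v)) w) = Oct (flip E' (c v))" "pathfinish (Gp (flip E' (c v)) w) = Oct (fl (flip E' (c v)) w)"
  using Cons.IH[of "flip E' (c v)"] Cons.prems(1) by auto
 have v: "v : T" using Cons.prems by simp
 show ?case using IH EE_path[OF v assms(2) Cons.prems(2)] by (auto simp: path_image_join)
qed

lemma EE_X:
 assumes "v : V"
 shows "path (EE v E)" "path_image (EE v E) <= X" "pathstart (EE v E) = Oct E" "pathfinish (EE v E) = Oct (flip E (c v))"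
proof -
 have v: "{v} : \<Gamma>" using assms face by blast
 show "path (EE v E)" "path_image (EE v E) <= X" "pathstart (EE v E) = Oct E" "pathfinish (EE v E) = Oct (flip E (c v))"
  using EE_path[of v "{v}" E E] v star_in_X[OF star_Block[OF v, of E]] by auto
qed

lemma Gp_X:
 assumes "set w <= V"
 shows "path (Gp E w)" "path_image (Gp E w) <= X" "pathstart (Gp E w) = Oct E" "pathfinish (Gp E w) = Oct (fl E w)"
proof -
 have "path (Gp E w) & path_image (Gp E w) <= X & pathstart (Gp E w) = Oct E & pathfinish (Gp E w) = Oct (fl E w)"
  using assms
 proof (induction w arbitrary: E)
  case Nil
  thus ?case using ctr_X[OF empty_simplex] by (auto simp: path_const)
 next
  case (Cons v w)
  have "v : V" using Cons.prems by simp
  thus ?case using EE_X[of v E] Cons.IH[of "flip E (c v)"] Cons.prems by (auto simp: path_image_join)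
 qed
 thus "path (Gp E w)" "path_image (Gp E w) <= X" "pathstart (Gp E w) = Oct E" "pathfinish (Gp E w) = Oct (fl E w)" by blast+
qed

lemma Gp_append:
 assumes "set u <= V" "set w <= V"
 shows "homotopic_paths X (Gp E (u @ w)) (Gp E u +++ Gp (fl E u) w)"
 using assms(1)
proof (induction u arbitrary: E)
 case Nil
 show ?case using homotopic_paths_sym[OF homotopic_paths_const_left] Gp_X[OF assms(2), of E] by simp
next
 case (Cons v u)
 let ?E = "flip E (c v)"
 have v: "v : V" and u: "set u <= V" using Cons.prems by auto
 note E = EE_X[OF v, of E] and U = Gp_X[OF u, of ?E] and W = Gp_X[OF assms(2), of "fl ?E u"]
 have uw: "set (u @ w) <= V" using u assms(2) by simp
 have "homotopic_paths X (EE v E +++ Gp ?E (u @ w)) (EE v E +++ (Gp ?E u +++ Gp (fl ?E u) w))"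
  using Cons.IH[OF u] E Gp_X[OF uw, of ?E] by (intro homotopic_paths_join) auto
 also have "homotopic_paths X (EE v E +++ (Gp ?E u +++ Gp (fl ?E u) w)) ((EE v E +++ Gp ?E u) +++ Gp (fl ?E u) w)"
  using E U W by (intro homotopic_paths_assoc) auto
 finally show ?case by simp
qed

text \<open>The source of both relations, exchange of commuting letters and cancellation: the two
  prefixes run in one star-shaped \<open>Block\<close> and end at the same chamber centre.\<close>

lemma Gp_replace_prefix:
 assumes T: "T : \<Gamma>" "set u <= T" "set u' <= T" "\<And>i. i : {1..n} ==> fl E u i = fl E u' i" and w: "set w <= V"
  and wf: "fl E u = fl E u'"
 shows "homotopic_paths X (Gp E (u @ w)) (Gp E (u' @ w))"
proof -
 have uV: "set u <= V" "set u' <= V" using T by auto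
 have "homotopic_paths (Block T E) (Gp E u) (Gp E u')"
  using Gp_path_Block[OF T(2,1), of E E] Gp_path_Block[OF T(3,1), of E E] wf
  by (intro star_homotopic[OF star_Block[OF T(1)]]) auto
 hence h: "homotopic_paths X (Gp E u) (Gp E u')"
  using homotopic_paths_subset star_in_X[OF star_Block[OF T(1)]] by blast
 have "homotopic_paths X (Gp E u +++ Gp (fl E u) w) (Gp E u' +++ Gp (fl E u') w)"
  using h Gp_X[OF w, of "fl E u"] Gp_X[OF uV(1), of E] wf by (intro homotopic_paths_join) auto
 thus ?thesis
  using Gp_append[OF uV(1) w, of E] Gp_append[OF uV(2) w, of E] homotopic_paths_sym homotopic_paths_trans by blast
qed

sublocale racg "adjacent_in \<Gamma>"
 by unfold_locales (auto simp: adjacent_in_def insert_commute)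

lemma Gp_Cons_cong:
 assumes "v : V" "homotopic_paths X (Gp (flip E (c v)) w) (Gp (flip E (c v)) w')" "set w <= V"
 shows "homotopic_paths X (Gp E (v # w)) (Gp E (v # w'))"
 using assms EE_X[OF assms(1), of E] Gp_X[OF assms(3)] by (auto intro!: homotopic_paths_join)

lemma fl_swap: "fl E [s, x] = fl E [x, s]" "fl E [s, s] = E"
 by (auto simp: flip_def fun_eq_iff)

lemma Gp_init:
 assumes "init s w" "set w <= V"
 shows "homotopic_paths X (Gp E (s # remove1 s w)) (Gp E w)"
 using assms
proof (induction w arbitrary: E)
 case (Cons x w)
 show ?case
 proof (cases "x = s")
  case True
  thus ?thesis using Gp_X[OF Cons.prems(2), of E] by simp
 next
  case False
  hence x: "adjacent_in \<Gamma> s x" "init s w" using Cons.prems by auto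
  have w: "set w <= V" "x : V" "s : V" using Cons.prems init_in_set[OF x(2)] by auto
  have r: "set (remove1 s w) <= V" using w(1) set_remove1_subset by fast
  have T: "{s, x} : \<Gamma>" using x by (simp add: adjacent_in_def)
  have "homotopic_paths X (Gp E ([s, x] @ remove1 s w)) (Gp E ([x, s] @ remove1 s w))"
   using T r fl_swap(1)[of E s x] by (intro Gp_replace_prefix[where T = "{s, x}"]) (auto simp del: fl_simps)
  moreover have "homotopic_paths X (Gp E (x # (s # remove1 s w))) (Gp E (x # w))"
   using Cons.IH[OF x(2) w(1)] w r by (intro Gp_Cons_cong) auto
  ultimately show ?thesis using False homotopic_paths_trans by auto
 qed
qed simp

lemma Gp_push:
 assumes "set w <= V" "s : V"
 shows "homotopic_paths X (Gp E (push s w)) (Gp E (s # w))"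
proof (cases "init s w")
 case True
 have r: "set (remove1 s w) <= V" using assms set_remove1_subset by fast
 have T: "{s} : \<Gamma>" using assms face by blast
 have "homotopic_paths X (Gp E ([s, s] @ remove1 s w)) (Gp E ([] @ remove1 s w))"
  using T r fl_swap(2)[of E s] by (intro Gp_replace_prefix[where T = "{s}"]) (auto simp del: fl_simps(2,3))
 moreover have "homotopic_paths X (Gp E (s # (s # remove1 s w))) (Gp E (s # w))"
  using Gp_init[OF True assms(1)] assms r by (intro Gp_Cons_cong) auto
 ultimately show ?thesis using True homotopic_paths_sym homotopic_paths_trans by (simp add: push_def) blast
next
 case False
 have "set (s # w) <= V" using assms by simp
 thus ?thesis using Gp_X[of "s # w" E] False by (simp add: push_def)
qed

lemma Gp_norm:
 assumes "set w <= V" shows "homotopic_paths X (Gp E (norm w)) (Gp E w)"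
 using assms
proof (induction w arbitrary: E)
 case Nil
 thus ?case using Gp_X[of "[]" E] by (simp add: norm_def)
next
 case (Cons s w)
 have w: "set w <= V" "s : V" using Cons.prems by auto
 have nw: "set (norm w) <= V" using set_norm[of w] w by blast
 have "norm (s # w) = push s (norm w)" by (simp add: norm_def)
 moreover have "homotopic_paths X (Gp E (s # norm w)) (Gp E (s # w))"
  using Cons.IH[OF w(1)] w nw by (intro Gp_Cons_cong) auto
 ultimately show ?case using Gp_push[OF nw w(2), of E] homotopic_paths_trans by metis
qed

end

lemma filter_distinct_single:
 "[|distinct w; \<And>x. x : set w ==> P x ==> x = z|] ==> filter P w = (if z : set w & P z then [z] else [])"
proof (induction w)
 case (Cons a w)
 have IH: "filter P w = (if z : set w & P z then [z] else [])" using Cons by auto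
 show ?case
 proof (cases "P a")
  case True
  hence "a = z" using Cons.prems by simp
  thus ?thesis using IH True Cons.prems(1) by auto
 next
  case False
  thus ?thesis using IH by auto
 qed
qed simp

lemma diameter_square:
 fixes a b :: real
 assumes "0 <= e" shows "diameter ({a..a + e} \<times> {b..b + e}) <= 2 * e"
proof (rule diameter_le)
 fix x y assume "x : {a..a + e} \<times> {b..b + e}" "y : {a..a + e} \<times> {b..b + e}"
 hence "\<bar>fst x - fst y\<bar> <= e" "\<bar>snd x - snd y\<bar> <= e" by auto
 moreover have "norm (x - y) <= \<bar>fst x - fst y\<bar> + \<bar>snd x - snd y\<bar>"
  using norm_Pair_le[of "fst x - fst y" "snd x - snd y"] by (simp add: minus_prod_def)
 ultimately show "norm (x - y) <= 2 * e" by simp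
qed (use assms in simp)

context coloured begin

section \<open>Holonomy of paths\<close>

text \<open>On a mirror both sides vanish and the value is True by convention: coming from the False
  side the sign changes on arrival, going to it on departure.\<close>

definition sgn :: "'b point => nat => bool" where
 "sgn x i <-> \<alpha> x i False = 0"

text \<open>The mirrors that separate two points of one \<open>UU T E\<close>: there signs can
  differ only in colours of T, and the vertices of T have positive values
  (\<open>Dif_UU\<close>).\<close>

definition Dif :: "'b point => 'b point => 'b set" where
 "Dif x x' = {b : V. sgn x (c b) ~= sgn x' (c b) & (0 < \<beta> x b | 0 < \<beta> x' b)}"

definition dl :: "'b set => 'b list" where
 "dl A = (SOME l. set l = A & distinct l)"

lemma dl: "finite A ==> set (dl A) = A & distinct (dl A)"
 unfolding dl_def by (rule someI_ex) (rule finite_distinct_list)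

lemma dl_empty [simp]: "dl {} = []"
 using dl[of "{}"] by simp

lemma dl_single [simp]: "dl {v} = [v]"
 using dl[of "{v}"] by (cases "dl {v}") (auto simp: subset_singleton_iff)

lemma finite_simplex: "T : \<Gamma> ==> finite T"
 by (rule finite_subset[OF _ finite_vertices]) blast

lemma UU_sgn: "[|x : UU T E; i : {1..n} - c ` T|] ==> sgn x i = E i"
proof -
 assume x: "x : UU T E" and i: "i : {1..n} - c ` T"
 have "0 < \<alpha> x i (E i)" using x i unfolding UU_def by blast
 thus ?thesis using UU_sign[OF x i] by (cases "E i") (auto simp: sgn_def)
qed

lemma Dif_UU:
 assumes T: "T : \<Gamma>" and x: "x : UU T E" "x' : UU T E"
 shows "Dif x x' = {b : T. sgn x (c b) ~= sgn x' (c b)}"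
proof (intro equalityI subsetI)
 fix b assume "b : Dif x x'"
 hence b: "b : V" "sgn x (c b) ~= sgn x' (c b)" "0 < \<beta> x b | 0 < \<beta> x' b" unfolding Dif_def by blast+
 have "c b : c ` T" using UU_sgn[OF x(1), of "c b"] UU_sgn[OF x(2), of "c b"] b(1,2) col_range[OF b(1)] by blast
 then obtain t where t: "t : T" "c b = c t" by blast
 have tG: "t : V" using t T by blast
 have *: "b = t" if y: "y : UU T E" "0 < \<beta> y b" for y
 proof (rule col_inj[of "bsupp y"])
  show "bsupp y : \<Gamma>" using y XD(6) unfolding UU_def by blast
  have "\<beta> y t ~= 0" "\<beta> y b ~= 0" using y t unfolding UU_def by force+
  thus "b : bsupp y" "t : bsupp y" using b(1) tG unfolding bsupp_def by blast+
 qed (rule t(2))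
 hence "b = t" using b(3) x by blast
 thus "b : {b : T. sgn x (c b) ~= sgn x' (c b)}" using t b by blast
next
 fix b assume "b : {b : T. sgn x (c b) ~= sgn x' (c b)}"
 thus "b : Dif x x'" using T x(1) unfolding Dif_def UU_def by blast
qed

lemma init_clique: "[|set w <= T; s : T; T : \<Gamma>; s : set w|] ==> init s w"
proof (induction w)
 case (Cons x w)
 show ?case
 proof (cases "x = s")
  case False
  hence "adjacent_in \<Gamma> s x" using Cons.prems face[of T "{s, x}"] by (auto simp: adjacent_in_def)
  thus ?thesis using Cons False by auto
 qed simp
qed simp

lemma red_clique: "[|red w; set w <= T; T : \<Gamma>|] ==> distinct w"
 by (induction w) (use init_clique in auto)

text \<open>The letters of one simplex commute, so they generate a vector space over the field of
  two elements, and parities determine the element.\<close>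

lemma weq_clique:
 assumes T: "T : \<Gamma>" and u: "set u <= T" "set v <= T"
  and par: "\<And>b. b : T ==> even (length (filter (%x. x = b) u)) = even (length (filter (%x. x = b) v))"
 shows "weq u v"
proof -
 have sub: "set (norm w) <= T" if "set w <= T" for w using set_norm[of w] that by blast
 have dis: "distinct (norm w)" if "set w <= T" for w using red_clique[OF red_norm sub[OF that] T] .
 have mem: "b : set (norm w) <-> odd (length (filter (%x. x = b) w))" if w: "set w <= T" for b w
 proof -
  have "filter (%x. x = b) (norm w) = (if b : set (norm w) then [b] else [])"
   using filter_distinct_single[OF dis[OF w], of "%x. x = b" b] by simp
  hence "b : set (norm w) <-> odd (length (filter (%x. x = b) (norm w)))" by simp
  thus ?thesis using even_norm[of "%x. x = b" w] by simp
 qed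
 have eq: "b : set (norm u) <-> b : set (norm v)" for b
 proof (cases "b : T")
  case True
  thus ?thesis using mem[OF u(1)] mem[OF u(2)] par by simp
 next
  case False
  thus ?thesis using sub u by blast
 qed
 have "tr (norm u) a b = tr (norm v) a b" for a b
 proof (cases "adjacent_in \<Gamma> a b")
  case False
  define P where "P = (%x. x = a | x = b)"
  define z where "z = (if a : T then a else b)"
  have z: "x = z" if "x : T" "P x" for x
  proof (rule ccontr)
   assume "x ~= z"
   hence "a : T" "b : T" "a ~= b" using that by (auto simp: P_def z_def split: if_splits)
   thus False using False face[OF T, of "{a, b}"] by (simp add: adjacent_in_def)
  qed
  have "filter P (norm w) = (if z : set (norm w) & P z then [z] else [])" if "set w <= T" for w
   using filter_distinct_single[OF dis[OF that], of P z] z sub[OF that] by blast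
  hence "filter P (norm u) = filter P (norm v)" using u eq by simp
  thus ?thesis using False by (simp add: tr_def P_def)
 qed (simp add: tr_def)
 thus ?thesis unfolding weq_def by (intro ext)
qed

lemma dl_parity:
 assumes "finite A" shows "odd (length (filter (%x. x = b) (dl A))) <-> b : A"
 using filter_distinct_single[of "dl A" "%x. x = b" b] dl[OF assms] by simp

text \<open>Sign changes in one colour add modulo 2.\<close>

lemma dl_add:
 assumes T: "T : \<Gamma>" and x: "x : UU T E" "x' : UU T E" "x'' : UU T E"
 shows "weq (dl (Dif x x') @ dl (Dif x' x'')) (dl (Dif x x''))"
proof (rule weq_clique[OF T])
 note D = Dif_UU[OF T x(1,2)] Dif_UU[OF T x(2,3)] Dif_UU[OF T x(1,3)]
 have f: "finite (Dif x x')" "finite (Dif x' x'')" "finite (Dif x x'')" unfolding D using finite_simplex[OF T] by auto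
 show "set (dl (Dif x x') @ dl (Dif x' x'')) <= T" "set (dl (Dif x x'')) <= T"
  using dl[OF f(1)] dl[OF f(2)] dl[OF f(3)] D by auto
 fix b assume "b : T"
 have "odd (length (filter (%y. y = b) (dl (Dif x x') @ dl (Dif x' x'')))) =
   odd (length (filter (%y. y = b) (dl (Dif x x''))))"
  using dl_parity[OF f(1), of b] dl_parity[OF f(2), of b] dl_parity[OF f(3), of b] \<open>b : T\<close>
  unfolding filter_append length_append odd_add D by auto
 thus "even (length (filter (%y. y = b) (dl (Dif x x') @ dl (Dif x' x'')))) =
   even (length (filter (%y. y = b) (dl (Dif x x''))))" by argo
qed

text \<open>\<open>l t\<close> is the word of mirrors crossed up to time t, like a lift to a
  covering space that is never constructed. Only intervals mapped into one \<open>UU T E\<close> are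
  constrained.\<close>

definition lift :: "(real => 'b point) => (real => 'b list) => bool" where
 "lift p l <-> (\<forall>t t' T E. 0 <= t & t <= t' & t' <= 1 & T : \<Gamma> & p ` {t..t'} <= UU T E -->
   weq (l t') (l t @ dl (Dif (p t) (p t'))))"

lemma liftD: "[|lift p l; 0 <= t; t <= t'; t' <= 1; T : \<Gamma>; p ` {t..t'} <= UU T E|] ==> weq (l t') (l t @ dl (Dif (p t) (p t')))"
 unfolding lift_def by blast

lemma Dif_refl [simp]: "Dif x x = {}" by (simp add: Dif_def)

lemma openin_UU: "T : \<Gamma> ==> openin (top_of_set X) (UU T E)"
proof -
 assume T: "T : \<Gamma>"
 define A where "A = (\<Inter>b\<in>T. {x :: 'b point. 0 < x (c b) (Inr b)})"
 define B where "B = (\<Inter>i\<in>{1..n} - c ` T. {x :: 'b point. 0 < x i (Inl (i, E i))})"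
 have o: "open {x :: 'b point. 0 < x i z}" for i z
  by (intro open_Collect_less continuous_on_const continuous_coord continuous_on_id)
 have "open A" "open B" unfolding A_def B_def using finite_simplex[OF T] by (auto intro!: open_INT o)
 hence "open (A Int B)" by blast
 moreover have "UU T E = X Int (A Int B)" by (auto simp: UU_def A_def B_def \<alpha>_def \<beta>_def)
 ultimately show ?thesis unfolding openin_open by blast
qed

lemma UU_cover:
 assumes "x : X" shows "\<exists>T\<in>\<Gamma>. \<exists>E. x : UU T E"
proof (intro bexI exI)
 show bG: "bsupp x : \<Gamma>" by (rule XD(6)[OF assms])
 have "0 < \<beta> x b" if "b : bsupp x" for b
  using that XD(9)[OF assms, of b] unfolding bsupp_def by force
 moreover have "0 < \<alpha> x i (\<alpha> x i True ~= 0)" if i: "i : {1..n} - c ` bsupp x" for i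
 proof -
  have "x i (Inr v) = 0" if "v : VV i" for v
   using that i by (auto simp: VV_def bsupp_def \<beta>_def)
  hence "\<alpha> x i True + \<alpha> x i False = 1" using XD(5)[OF assms, of i] i by simp
  thus ?thesis using XD(8)[OF assms, of i True] XD(8)[OF assms, of i False] i by (cases "\<alpha> x i True = 0") auto
 qed
 ultimately show "x : UU (bsupp x) (%i. \<alpha> x i True ~= 0)" using assms by (simp add: UU_def)
qed

lemma Lebesgue_UU:
 fixes Q :: "'q::{metric_space} set"
 assumes "compact Q" and f: "continuous_on Q f" "f ` Q <= X"
 shows "\<exists>d>0. \<forall>A\<subseteq>Q. diameter A < d --> (\<exists>T\<in>\<Gamma>. \<exists>E. f ` A <= UU T E)"
proof -
 define C where "C = {B :: 'q set. open B & (\<exists>T\<in>\<Gamma>. \<exists>E. Q Int B = Q Int f -` UU T E)}"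
 have op: "\<exists>B. open B & Q Int B = Q Int f -` UU T E" if "T : \<Gamma>" for T E
  using continuous_openin_preimage[OF f(1) _ openin_UU[OF that, of E]] f(2) unfolding openin_open by (metis image_subset_iff_funcset)
 have cov: "Q <= \<Union>C"
 proof
  fix q assume q: "q : Q"
  hence "f q : X" using f by blast
  then obtain T E where T: "T : \<Gamma>" "f q : UU T E" using UU_cover by blast
  obtain B where B: "open B" "Q Int B = Q Int f -` UU T E" using op[OF T(1), of E] by blast
  hence "B : C" using T unfolding C_def by blast
  moreover have "q : B" using B T q by blast
  ultimately show "q : \<Union>C" by blast
 qed
 show ?thesis
 proof (cases "C = {}")
  case True
  hence "Q = {}" using cov by simp
  hence "f ` A <= UU {} (%_. True)" if "A <= Q" for A using that by simp
  thus ?thesis using empty_simplex zero_less_one by blast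
 next
  case False
  obtain d where d: "0 < d" "\<And>A. A <= Q ==> diameter A < d ==> \<exists>B\<in>C. A <= B"
   using Lebesgue_number_lemma[OF assms(1) False cov] by (metis (no_types, lifting) C_def mem_Collect_eq)
  have "\<exists>T\<in>\<Gamma>. \<exists>E. f ` A <= UU T E" if A: "A <= Q" "diameter A < d" for A
  proof -
   obtain B where "B : C" "A <= B" using d(2)[OF A] by blast
   thus ?thesis using A(1) unfolding C_def by blast
  qed
  thus ?thesis using d(1) by blast
 qed
qed

lemma grid_exists:
 fixes h :: "real \<times> real => 'b point"
 assumes h: "continuous_on ({0..1} \<times> {0..1}) h" "h ` ({0..1} \<times> {0..1}) <= X"
 obtains N :: nat where "0 < N" "\<And>i j. [|i < N; j < N|] ==>
  \<exists>T\<in>\<Gamma>. \<exists>E. h ` ({i / N..Suc i / N} \<times> {j / N..Suc j / N}) <= UU T E"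
proof -
 let ?Q = "{0..1} \<times> {0..1} :: (real \<times> real) set"
 obtain d where d: "0 < d" "\<And>A. A <= ?Q ==> diameter A < d ==> \<exists>T\<in>\<Gamma>. \<exists>E. h ` A <= UU T E"
  using Lebesgue_UU[OF _ h] compact_Times[OF compact_Icc compact_Icc] by metis
 obtain N :: nat where N: "2 / d < real N" using reals_Archimedean2 by blast
 have N0: "0 < N" using N d(1) by (metis divide_pos_pos less_trans of_nat_0_less_iff zero_less_numeral)
 have "\<exists>T\<in>\<Gamma>. \<exists>E. h ` ({i / N..Suc i / N} \<times> {j / N..Suc j / N}) <= UU T E" if ij: "i < N" "j < N" for i j
 proof (rule d(2))
  have "real (Suc i) / N <= 1" "real (Suc j) / N <= 1" using ij N0 by auto
  moreover have "0 <= real i / N" "0 <= real j / N" by auto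
  ultimately show "{i / N..Suc i / N} \<times> {j / N..Suc j / N} <= ?Q"
   by (intro Sigma_mono) (auto simp del: of_nat_Suc)
  have "diameter ({i / N..Suc i / N} \<times> {j / N..Suc j / N}) <= 2 / N"
   using diameter_square[of "1 / N" "i / N" "j / N"] by (simp add: add_divide_distrib add.commute)
  also have "2 / N < d" using N N0 d(1) by (simp add: field_simps)
  finally show "diameter ({i / N..Suc i / N} \<times> {j / N..Suc j / N}) < d" .
 qed
 thus ?thesis using that N0 by blast
qed

text \<open>Words along neighbouring grid rows are compared cell by cell: a cell lies in one set
  \<open>UU\<close>, where \<open>dl_add\<close> makes the crossings independent of the way around
  the cell. At the two ends of the rows the homotopy is constant.\<close>

lemma lift_homotopic:
 assumes hom: "homotopic_paths X p q" and l: "lift p l" "lift q l'" and e: "weq (l 0) (l' 0)"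
 shows "weq (l 1) (l' 1)"
proof -
 let ?Q = "{0..1} \<times> {0..1} :: (real \<times> real) set"
 obtain h where h: "continuous_on ?Q h" "h : ?Q \<rightarrow> X" "\<forall>x\<in>{0..1}. h (0, x) = p x" "\<forall>x\<in>{0..1}. h (1, x) = q x"
   "\<forall>t\<in>{0..1::real}. pathstart (h o Pair t) = pathstart p & pathfinish (h o Pair t) = pathfinish p"
  using hom unfolding homotopic_paths by blast
 obtain N :: nat where N: "0 < N" and g: "\<And>i j. [|i < N; j < N|] ==>
   \<exists>T\<in>\<Gamma>. \<exists>E. h ` ({i / N..Suc i / N} \<times> {j / N..Suc j / N}) <= UU T E"
  using grid_exists[OF h(1)] h(2) by (metis image_subset_iff_funcset)
 define x where "x i j = h (real i / N, real j / N)" for i j :: nat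
 define A where "A i j = concat (map (%k. dl (Dif (x i k) (x i (Suc k)))) [0..<j])" for i j
 have x01: "x i 0 = p 0" "x i N = p 1" if "i <= N" for i
  using h(5) that N by (auto simp: x_def pathstart_def pathfinish_def)
 have A_Suc: "A i (Suc j) = A i j @ dl (Dif (x i j) (x i (Suc j)))" for i j by (simp add: A_def)
 have A0: "A i 0 = []" for i by (simp add: A_def)
 have step: "weq (A i j @ dl (Dif (x i j) (x (Suc i) j))) (A (Suc i) j)" if i: "i < N" and j: "j <= N" for i j
  using j
 proof (induction j)
  case 0
  show ?case using x01(1)[of i] x01(1)[of "Suc i"] i by (simp add: A0)
 next
  case (Suc j)
  hence IH: "weq (A i j @ dl (Dif (x i j) (x (Suc i) j))) (A (Suc i) j)" and jN: "j < N" by auto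
  obtain T E where T: "T : \<Gamma>" and sub: "h ` ({i / N..Suc i / N} \<times> {j / N..Suc j / N}) <= UU T E" using g[OF i jN] by blast
  have in_cell: "x i' j' : UU T E" if "i' = i | i' = Suc i" "j' = j | j' = Suc j" for i' j'
  proof -
   have "(real i' / N, real j' / N) : {i / N..Suc i / N} \<times> {j / N..Suc j / N}"
    using that by (auto simp: divide_right_mono)
   thus ?thesis using sub unfolding x_def by blast
  qed
  note c = in_cell[of i j] in_cell[of i "Suc j"] in_cell[of "Suc i" j] in_cell[of "Suc i" "Suc j"]
  have "weq (A i (Suc j) @ dl (Dif (x i (Suc j)) (x (Suc i) (Suc j))))
    (A i j @ (dl (Dif (x i j) (x i (Suc j))) @ dl (Dif (x i (Suc j)) (x (Suc i) (Suc j)))))" by (simp add: A_Suc)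
  also have "weq \<dots> (A i j @ dl (Dif (x i j) (x (Suc i) (Suc j))))"
   using c by (intro weq_append weq_refl dl_add[OF T]) auto
  also have "weq \<dots> (A i j @ (dl (Dif (x i j) (x (Suc i) j)) @ dl (Dif (x (Suc i) j) (x (Suc i) (Suc j)))))"
   using c by (intro weq_append weq_refl) (rule weq_sym, intro dl_add[OF T], auto)
  also have "weq \<dots> (A (Suc i) j @ dl (Dif (x (Suc i) j) (x (Suc i) (Suc j))))"
   using weq_append[OF IH weq_refl] by simp
  finally show ?case by (simp add: A_Suc)
 qed
 have row: "weq (A 0 N) (A i N)" if "i <= N" for i
  using that
 proof (induction i)
  case (Suc i)
  hence "weq (A 0 N) (A i N)" by simp
  also have "weq (A i N) (A (Suc i) N)" using step[of i N] Suc.prems x01(2)[of i] x01(2)[of "Suc i"] by simp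
  finally show ?case .
 qed simp
 have along: "weq (m (real j / N)) (m 0 @ A i j)"
  if m: "lift r m" "i = 0 | i = N" "\<And>t. t : {0..1} ==> h (real i / N, t) = r t" and j: "j <= N" for r m i j
  using j
 proof (induction j)
  case 0
  thus ?case by (simp add: A0)
 next
  case (Suc j)
  hence IH: "weq (m (real j / N)) (m 0 @ A i j)" and jN: "j < N" by auto
  \<comment> \<open>Row 0 or N is a side of the square; it belongs to the first or the last strip of
    cells.\<close>
  define k where "k = (if i = 0 then 0 else N - 1)"
  have k: "k < N" "real i / N : {k / N..Suc k / N}" using m(2) N by (auto simp: k_def divide_right_mono)
  obtain T E where T: "T : \<Gamma>" and sub: "h ` ({k / N..Suc k / N} \<times> {j / N..Suc j / N}) <= UU T E" using g[OF k(1) jN] by blast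
  have le: "real (Suc j) / N <= 1" "0 <= real j / N" "real j / N <= real (Suc j) / N" using jN by (auto simp: divide_right_mono)
  have "r ` {j / N..Suc j / N} <= UU T E"
  proof
   fix y assume "y : r ` {j / N..Suc j / N}"
   then obtain t where t: "t : {j / N..Suc j / N}" "y = r t" by blast
   hence "t : {0..1}" using le(1,2) unfolding atLeastAtMost_iff by linarith
   hence "y = h (real i / N, t)" using m(3) t by simp
   thus "y : UU T E" using sub k(2) t(1) by blast
  qed
  hence "weq (m (real (Suc j) / N)) (m (real j / N) @ dl (Dif (r (real j / N)) (r (real (Suc j) / N))))"
   using liftD[OF m(1) le(2,3,1) T] by blast
  also have "r (real j / N) = x i j" using m(3)[of "real j / N"] le by (simp add: x_def)
  also have "r (real (Suc j) / N) = x i (Suc j)" using m(3)[of "real (Suc j) / N"] le by (simp add: x_def)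
  also have "weq (m (real j / N) @ dl (Dif (x i j) (x i (Suc j)))) ((m 0 @ A i j) @ dl (Dif (x i j) (x i (Suc j))))"
   by (intro weq_append IH weq_refl)
  finally show ?case by (simp add: A_Suc)
 qed
 have "weq (l 1) (l 0 @ A 0 N)" using along[OF l(1), of 0 N] h(3) N by simp
 also have "weq \<dots> (l' 0 @ A N N)" by (intro weq_append e row) simp
 also have "weq \<dots> (l' 1)" using along[OF l(2), of N N] h(4) N weq_sym by simp
 finally show ?thesis .
qed

definition hol :: "(real => 'b point) => 'b list => bool" where
 "hol p u <-> (\<exists>l. lift p l & l 0 = [] & l 1 = u)"

lemma hol_unique: "[|homotopic_paths X p q; hol p u; hol q v|] ==> weq u v"
 unfolding hol_def using lift_homotopic weq_refl by metis

lemma hol_join: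
 assumes p: "hol p u" and q: "hol q v" and e: "pathfinish p = pathstart q"
 shows "hol (p +++ q) (u @ v)"
proof -
 obtain l l' where l: "lift p l" "l 0 = []" "l 1 = u" "lift q l'" "l' 0 = []" "l' 1 = v" using p q by (auto simp: hol_def)
 define m where "m t = (if t <= 1 / 2 then l (2 * t) else u @ l' (2 * t - 1))" for t
 have m2: "m t = u @ l' (2 * t - 1)" if "1 / 2 <= t" for t
 proof (cases "t = 1 / 2")
  case True
  show ?thesis unfolding True m_def using l by simp
 qed (use that in \<open>simp add: m_def\<close>)
 have j2: "(p +++ q) t = q (2 * t - 1)" if "1 / 2 <= t" for t

 proof (cases "t = 1 / 2")
  case True
  show ?thesis unfolding True joinpaths_def using e by (simp add: pathstart_def pathfinish_def)
 qed (use that in \<open>simp add: joinpaths_def\<close>)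
 have first: "weq (m t') (m t @ dl (Dif ((p +++ q) t) ((p +++ q) t')))"
  if h: "0 <= t" "t <= t'" "t' <= 1 / 2" "T : \<Gamma>" "(p +++ q) ` {t..t'} <= UU T E" for t t' T E
 proof -
  have "p ` {2 * t..2 * t'} <= UU T E"
  proof
   fix y assume "y : p ` {2 * t..2 * t'}"
   then obtain s where s: "s : {2 * t..2 * t'}" "y = p s" by blast
   have "(p +++ q) (s / 2) = y" using s h by (simp add: joinpaths_def)
   thus "y : UU T E" using h(5) s(1) by (force simp: image_subset_iff)
  qed
  thus ?thesis using liftD[OF l(1), of "2 * t" "2 * t'" T E] h by (simp add: m_def joinpaths_def)
 qed
 have second: "weq (m t') (m t @ dl (Dif ((p +++ q) t) ((p +++ q) t')))"
  if h: "1 / 2 <= t" "t <= t'" "t' <= 1" "T : \<Gamma>" "(p +++ q) ` {t..t'} <= UU T E" for t t' T E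
 proof -
  have "q ` {2 * t - 1..2 * t' - 1} <= UU T E"
  proof
   fix y assume "y : q ` {2 * t - 1..2 * t' - 1}"
   then obtain s where s: "s : {2 * t - 1..2 * t' - 1}" "y = q s" by blast
   have "2 * ((s + 1) / 2) - 1 = s" by (simp add: field_simps)
   hence "(p +++ q) ((s + 1) / 2) = y" using s h j2[of "(s + 1) / 2"] by simp
   thus "y : UU T E" using h(5) s(1) by (force simp: image_subset_iff)
  qed
  hence "weq (l' (2 * t' - 1)) (l' (2 * t - 1) @ dl (Dif (q (2 * t - 1)) (q (2 * t' - 1))))"
   using liftD[OF l(4), of "2 * t - 1" "2 * t' - 1" T E] h by simp
  thus ?thesis using weq_append[OF weq_refl[of u]] h m2 j2 by simp
 qed
 have "lift (p +++ q) m"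
  unfolding lift_def
 proof (intro allI impI, elim conjE)
  fix t t' T E assume h: "0 <= t" "t <= t'" "t' <= 1" "T : \<Gamma>" "(p +++ q) ` {t..t'} <= UU T E"
  consider "t' <= 1 / 2" | "1 / 2 <= t" | "t <= 1 / 2" "1 / 2 <= t'" by linarith
  thus "weq (m t') (m t @ dl (Dif ((p +++ q) t) ((p +++ q) t')))"
  proof cases
   case 1
   thus ?thesis using first h by blast
  next
   case 2
   thus ?thesis using second h by blast
  next
   \<comment> \<open>An interval across 1/2 is cut there, and \<open>dl_add\<close> recombines the
     two words.\<close>
   case 3
   let ?y = "(p +++ q) (1 / 2)"
   have i: "(p +++ q) t : UU T E" "?y : UU T E" "(p +++ q) t' : UU T E" using h 3 by auto
   have s: "(p +++ q) ` {t..1 / 2} <= UU T E" "(p +++ q) ` {1 / 2..t'} <= UU T E" using h(5) 3 by (force simp: image_subset_iff)+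
   have "weq (m t') (m (1 / 2) @ dl (Dif ?y ((p +++ q) t')))" using second[OF _ 3(2) h(3,4) s(2)] by simp
   also have "weq \<dots> ((m t @ dl (Dif ((p +++ q) t) ?y)) @ dl (Dif ?y ((p +++ q) t')))"
    using first[OF h(1) 3(1) _ h(4) s(1)] by (intro weq_append weq_refl) simp
   also have "weq \<dots> (m t @ dl (Dif ((p +++ q) t) ((p +++ q) t')))"
    using weq_append[OF weq_refl dl_add[OF h(4) i]] by simp
   finally show ?thesis .
  qed
 qed
 moreover have "m 0 = []" "m 1 = u @ v" using l by (auto simp: m_def)
 ultimately show ?thesis unfolding hol_def by blast
qed

lemma hol_const:
 assumes "\<And>t i. t : {0..1} ==> i : {1..n} ==> sgn (p t) i = s i"
 shows "hol p []"
proof -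
 have "Dif (p t) (p t') = {}" if "0 <= t" "t <= t'" "t' <= 1" for t t'
  using assms[of t] assms[of t'] that col_range unfolding Dif_def by force
 hence "lift p (%_. [])" unfolding lift_def by simp
 thus ?thesis unfolding hol_def by blast
qed

text \<open>The word is read off the current sign of colour \<open>c v\<close>, so repeated
  crossings of the mirror cancel in pairs.\<close>

lemma hol_edge:
 assumes v: "v : V" and s: "\<And>t i. t : {0..1} ==> i : {1..n} ==> i ~= c v ==> sgn (p t) i = s i"
  and b: "\<And>t b. t : {0..1} ==> b : V ==> 0 < \<beta> (p t) b ==> b = v"
  and e: "sgn (p 0) (c v) = s (c v)" "sgn (p 1) (c v) ~= s (c v)"
 shows "hol p [v]"
proof -
 define l where "l t = (if sgn (p t) (c v) = s (c v) then [] else [v])" for t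
 have "lift p l"
  unfolding lift_def
 proof (intro allI impI, elim conjE)
  fix t t' T E assume h: "0 <= t" "t <= t'" "t' <= 1" "T : \<Gamma>" "p ` {t..t'} <= UU T E"
  have u: "p t : UU T E" "p t' : UU T E" using h by auto
  have tt: "t : {0..1}" "t' : {0..1}" using h by auto
  have sub: "Dif (p t) (p t') <= {v}" using b[OF tt(1)] b[OF tt(2)] unfolding Dif_def by blast
  show "weq (l t') (l t @ dl (Dif (p t) (p t')))"
  proof (cases "sgn (p t) (c v) = sgn (p t') (c v)")
   case True
   hence "v \<notin> Dif (p t) (p t')" unfolding Dif_def by blast
   hence "Dif (p t) (p t') = {}" using sub by blast
   thus ?thesis using True by (simp add: l_def)
  next
   case False
   have "c v : c ` T" using False UU_sgn[OF u(1), of "c v"] UU_sgn[OF u(2), of "c v"] col_range[OF v] by blast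
   then obtain w where w: "w : T" "c w = c v" by (metis imageE)
   hence "w : Dif (p t) (p t')" using Dif_UU[OF h(4) u] False by auto
   hence "Dif (p t) (p t') = {v}" using sub by blast
   moreover have "weq [] ([v, v])" using weq_sym[OF weq_cancel[of v "[]"]] by simp
   ultimately show ?thesis using False by (auto simp: l_def)
  qed
 qed
 moreover have "l 0 = []" "l 1 = [v]" using e by (auto simp: l_def)
 ultimately show ?thesis unfolding hol_def by blast
qed

lemma hol_EE:
 assumes v: "v : V" shows "hol (EE v E) [v]"
proof (rule hol_edge[OF v, where s = E])
 have form: "\<exists>s\<in>{0..1}. EE v E t = mix (Oct E) (ctr {v} E) s | EE v E t = mix (ctr {v} E) (Oct (flip E (c v))) s"
  if "t : {0..1}" for t
 proof (cases "t <= 1 / 2")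
  case True
  thus ?thesis using that by (intro bexI[of _ "2 * t"]) (auto simp: EE_def joinpaths_def)
 next
  case False
  thus ?thesis using that by (intro bexI[of _ "2 * t - 1"]) (auto simp: EE_def joinpaths_def)
 qed
 show "sgn (EE v E t) i = E i" if t: "t : {0..1}" "i : {1..n}" "i ~= c v" for t i
 proof -
  obtain s where "s : {0..1}" "EE v E t = mix (Oct E) (ctr {v} E) s | EE v E t = mix (ctr {v} E) (Oct (flip E (c v))) s"
   using form[OF t(1)] by blast
  thus ?thesis using t(3) unfolding sgn_def
   by (cases "E i") (auto simp: mix_simps(1)[OF t(2)] ctr_\<alpha>[OF t(2)] flip_def)
 qed
 show "b = v" if t: "t : {0..1}" "b : V" "0 < \<beta> (EE v E t) b" for t b
 proof -
  obtain s where "EE v E t = mix (Oct E) (ctr {v} E) s | EE v E t = mix (ctr {v} E) (Oct (flip E (c v))) s"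
   using form[OF t(1)] by blast
  thus ?thesis using t(3) by (auto simp: mix_simps(2)[OF t(2)] ctr_\<beta>[OF t(2)] split: if_splits)
 qed
 have c: "c v : {1..n}" by (rule col_range[OF v])
 show "sgn (EE v E 0) (c v) = E (c v)" "sgn (EE v E 1) (c v) ~= E (c v)"
  using EE_X(3,4)[OF v, of E] unfolding pathstart_def pathfinish_def sgn_def
  by (auto simp: ctr_\<alpha>[OF c] flip_def)
qed

lemma hol_Gp: "set w <= V ==> hol (Gp E w) w"
proof (induction w arbitrary: E)
 case Nil
 show ?case using hol_const[of "Gp E []" "sgn (Oct E)"] by simp
next
 case (Cons v w)
 hence v: "v : V" and w: "set w <= V" by auto
 show ?case using hol_join[OF hol_EE[OF v, of E] Cons.IH[OF w, of "flip E (c v)"]] EE_X(4)[OF v, of E] Gp_X(3)[OF w, of "flip E (c v)"]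
  by simp
qed

lemma Ch_sgn: assumes x: "x : X" and s: "\<And>i. i : {1..n} ==> s i = sgn x i" shows "x : Ch s"
proof -
 have "\<alpha> x i (~ s i) = 0" if i: "i : {1..n}" for i
  using XD(7)[OF x i, of False] s[OF i] unfolding sgn_def by (cases "\<alpha> x i False = 0") auto
 thus ?thesis using x by (simp add: Ch_def)
qed

lemma hol_to_Oct:
 assumes x: "x : X" shows "hol (mix x (Oct (sgn x))) []" "hol (mix (Oct (sgn x)) x) []"
proof -
 have *: "sgn (mix x (Oct (sgn x)) t) i = sgn x i" if t: "t : {0..1}" "i : {1..n}" for t i
 proof (cases "sgn x i")
  case True
  thus ?thesis by (simp add: sgn_def mix_simps(1)[OF t(2)] ctr_\<alpha>[OF t(2)])
 next
  case False
  hence "0 < \<alpha> x i False" using XD(8)[OF x t(2), of False] by (simp add: sgn_def)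
  hence "0 < (1 - t) * \<alpha> x i False + t"
   using t(1) by (cases "t = 0") (auto intro: add_nonneg_pos)
  thus ?thesis using False by (simp add: sgn_def[of "mix x (Oct (sgn x)) t"] mix_simps(1)[OF t(2)] ctr_\<alpha>[OF t(2)])
 qed
 thus "hol (mix x (Oct (sgn x))) []" by (rule hol_const)
 show "hol (mix (Oct (sgn x)) x) []"
 proof (rule hol_const)
  show "sgn (mix (Oct (sgn x)) x t) i = sgn x i" if "t : {0..1}" "i : {1..n}" for t i
   using *[of "1 - t" i] that unfolding mix_swap[of "Oct (sgn x)"] by simp
 qed
qed

end

context coloured begin

section \<open>The fundamental group of the coupled link space\<close>

lemma Oct_X: "Oct E : X" by (rule ctr_X[OF empty_simplex])

lemma mix_Oct_X:
 assumes "x : Ch E"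
 shows "path (mix x (Oct E))" "path_image (mix x (Oct E)) <= X" "pathstart (mix x (Oct E)) = x" "pathfinish (mix x (Oct E)) = Oct E"
  "path (mix (Oct E) x)" "path_image (mix (Oct E) x) <= X" "pathstart (mix (Oct E) x) = Oct E" "pathfinish (mix (Oct E) x) = x"
 using star_path[OF star_Ch assms] star_in_X[OF star_Ch[of E]] by auto

lemma sgn_Ch: "x : X ==> x : Ch (sgn x)"
 by (rule Ch_sgn) auto

lemma mix_Ch:
 assumes x: "x : Ch s" "a : Ch s" and m: "path_image (mix x a) <= X" shows "path_image (mix x a) <= Ch s"
proof
 fix y assume y: "y : path_image (mix x a)"
 then obtain t where t: "y = mix x a t" by (auto simp: path_image_def)
 have "\<alpha> y i (~ s i) = 0" if "i : {1..n}" for i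
  using x that unfolding t mix_simps(1)[OF that] Ch_def by simp
 thus "y : Ch s" using y m unfolding Ch_def by blast
qed

lemma UU_Ch: assumes "x : UU T E" "x : Ch s" "i : {1..n} - c ` T" shows "s i = E i"
proof (rule ccontr)
 assume "s i ~= E i"
 hence "\<alpha> x i (E i) = 0"
 proof -
  have "(~ s i) = E i" using \<open>s i ~= E i\<close> by blast
  moreover have "\<alpha> x i (~ s i) = 0" using assms(2,3) by (simp add: Ch_def)
  ultimately show ?thesis by simp
 qed
 moreover have "0 < \<alpha> x i (E i)" using assms(1,3) unfolding UU_def by blast
 ultimately show False by simp
qed

text \<open>The path is rerouted through \<open>a = ctr T E\<close>, which lies in
  \<open>UU T E\<close>, in both chambers and in \<open>Block T E\<close>; all of these are
  star-shaped, so each triangle of the rerouting is null-homotopic.\<close>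

lemma piece:
 assumes T: "T : \<Gamma>" and x: "x : UU T E" "x : Ch s" "x' : UU T E" "x' : Ch (fl s u)" and u: "set u <= T"
  and r: "path r" "path_image r <= UU T E" "pathstart r = x" "pathfinish r = x'"
 shows "homotopic_paths X (mix (Oct s) x +++ r) (Gp s u +++ mix (Oct (fl s u)) x')"
proof -
 define a where "a = ctr T E"
 define s' where "s' = fl s u"
 have sT: "\<And>i. i : {1..n} - c ` T ==> s i = E i" using UU_Ch[OF x(1,2)] .
 have sT': "\<And>i. i : {1..n} - c ` T ==> s' i = E i" using UU_Ch[OF x(3,4)] unfolding s'_def .
 have xs': "x' : Ch s'" using x(4) by (simp add: s'_def)
 note sU = star_UU[OF T, of E, folded a_def] and sB = star_Block[OF T, of E, folded a_def]
 note X' = star_in_X[OF sU] star_in_X[OF sB] star_in_X[OF star_Ch]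
 have aX: "a : X" unfolding a_def by (rule ctr_X[OF T])
 have aCh: "a : Ch w" if w: "\<And>i. i : {1..n} - c ` T ==> w i = E i" for w
 proof -
  have "\<alpha> a i (~ w i) = 0" if i: "i : {1..n}" for i
   using w[of i] i unfolding a_def ctr_\<alpha>[OF i] by auto
  thus ?thesis using aX by (simp add: Ch_def)
 qed
 note pU = star_path[OF sU x(1)] and pU' = star_path[OF sU x(3)]
 have OB: "Oct s : Block T E" "Oct s' : Block T E" using Block_OO[OF T sT] Block_OO[OF T sT'] by auto
 note pB = star_path[OF sB OB(1)] and pB' = star_path[OF sB OB(2)]
 note pC = star_path[OF star_Ch x(2)] and pC' = star_path[OF star_Ch xs'] and aC = star_path[OF star_Ch aCh[OF sT]] and aC' = star_path[OF star_Ch aCh[OF sT']]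
 have m: "path_image (mix x a) <= Ch s" "path_image (mix a x') <= Ch s'"
  using mix_Ch[OF x(2) aCh[OF sT] order_trans[OF pU(2) X'(1)]] mix_Ch[OF aCh[OF sT'] xs' order_trans[OF pU'(6) X'(1)]] by auto
 have 1: "homotopic_paths X r (mix x a +++ mix a x')"
  by (rule homotopic_paths_subset[OF star_homotopic[OF sU] X'(1)]) (use r pU pU' in \<open>auto simp: path_image_join\<close>)
 have 2: "homotopic_paths X (mix (Oct s) x +++ mix x a) (mix (Oct s) a)"
  by (rule homotopic_paths_subset[OF star_homotopic[OF star_Ch] X'(3)]) (use pC pU m aC in \<open>auto simp: path_image_join\<close>)
 have 3: "homotopic_paths X (mix a x') (mix a (Oct s') +++ mix (Oct s') x')"
  by (rule homotopic_paths_subset[OF star_homotopic[OF star_Ch] X'(3)]) (use pC' pU' m aC' in \<open>auto simp: path_image_join\<close>)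
 have G: "path (Gp s u)" "path_image (Gp s u) <= Block T E" "pathstart (Gp s u) = Oct s" "pathfinish (Gp s u) = Oct s'"
  using Gp_path_Block[OF u T sT] by (auto simp: s'_def)
 have 4: "homotopic_paths X (mix (Oct s) a +++ mix a (Oct s')) (Gp s u)"
  by (rule homotopic_paths_subset[OF star_homotopic[OF sB] X'(2)]) (use pB pB' G in \<open>auto simp: path_image_join\<close>)
 have XX: "path_image (mix (Oct s) x) <= X" "path_image (mix x a) <= X" "path_image (mix a x') <= X"
  "path_image (mix (Oct s) a) <= X" "path_image (mix a (Oct s')) <= X" "path_image (mix (Oct s') x') <= X" "path_image (Gp s u) <= X"
  using order_trans[OF pC(6) X'(3)] order_trans[OF pU(2) X'(1)] order_trans[OF pU'(6) X'(1)] order_trans[OF pB(2) X'(2)]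
   order_trans[OF pB'(6) X'(2)] order_trans[OF pC'(6) X'(3)] order_trans[OF G(2) X'(2)] aC(6) order_trans[OF aC(6) X'(3)] by auto
 have "homotopic_paths X (mix (Oct s) x +++ r) (mix (Oct s) x +++ (mix x a +++ mix a x'))"
  using 1 pC XX r by (intro homotopic_paths_join) auto
 also have "homotopic_paths X \<dots> ((mix (Oct s) x +++ mix x a) +++ mix a x')"
  using pC pU pU' XX by (intro homotopic_paths_assoc) auto
 also have "homotopic_paths X \<dots> (mix (Oct s) a +++ (mix a (Oct s') +++ mix (Oct s') x'))"
  using 2 3 pC pU pU' by (intro homotopic_paths_join) auto
 also have "homotopic_paths X \<dots> ((mix (Oct s) a +++ mix a (Oct s')) +++ mix (Oct s') x')"
  using pB pB' pC' XX by (intro homotopic_paths_assoc) auto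
 also have "homotopic_paths X \<dots> (Gp s u +++ mix (Oct s') x')"
  using 4 pB' pC' XX by (intro homotopic_paths_join) auto
 finally show ?thesis by (simp add: s'_def)
qed

lemma next_word:
 assumes T: "T : \<Gamma>" and s: "\<And>i. i : {1..n} - c ` T ==> s i = s' i"
 obtains u where "set u <= T" "\<And>i. i : {1..n} ==> fl s u i = s' i"
proof
 define A where "A = {t : T. s (c t) ~= s' (c t)}"
 have fA: "finite A" using finite_simplex[OF T] by (simp add: A_def)
 note d = dl[OF fA]
 show "set (dl A) <= T" using d by (auto simp: A_def)
 fix i assume i: "i : {1..n}"
 show "fl s (dl A) i = s' i"
 proof (cases "i : c ` T")
  case True
  then obtain t where t: "t : T" "c t = i" by blast
  have "filter (%v. c v = i) (dl A) = (if t : set (dl A) & c t = i then [t] else [])"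
   using d t by (intro filter_distinct_single) (auto simp: A_def intro: col_inj[OF T])
  thus ?thesis using t d by (auto simp: fl_eq A_def)
 next
  case False
  hence "filter (%v. c v = i) (dl A) = []" using d by (auto simp: filter_empty_conv A_def)
  thus ?thesis using s i False by (simp add: fl_eq)
 qed
qed

text \<open>Surjectivity of words onto homotopy classes: the path is cut into pieces, each inside
  some \<open>UU T E\<close>, and \<open>piece\<close> replaces them one after the other by word
  paths.\<close>

lemma loop_word:
 assumes p: "path p" "path_image p <= X" and x0: "pathstart p = x0"
 obtains w where "set w <= V" "\<And>i. i : {1..n} ==> fl (sgn x0) w i = sgn (pathfinish p) i"
  "homotopic_paths X p (mix x0 (Oct (sgn x0)) +++ (Gp (sgn x0) w +++ mix (Oct (fl (sgn x0) w)) (pathfinish p)))"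
proof -
 define s where "s = sgn x0"
 define q where "q = mix x0 (Oct s)"
 have xX: "p t : X" if "t : {0..1}" for t using p that by (auto simp: path_image_def)
 have x0X: "x0 : X" using xX[of 0] x0 by (simp add: pathstart_def)
 note Q = mix_Oct_X[OF sgn_Ch[OF x0X], folded s_def, folded q_def]
 obtain d where d: "0 < d" "\<And>A. A <= {0..1} ==> diameter A < d ==> \<exists>T\<in>\<Gamma>. \<exists>E. p ` A <= UU T E"
  using Lebesgue_UU[OF compact_Icc, of 0 1 p] p unfolding path_def path_image_def by metis
 obtain N :: nat where N: "1 / d < real N" using reals_Archimedean2 by blast
 have N0: "0 < N" using N d(1) by (metis divide_pos_pos less_trans of_nat_0_less_iff zero_less_one)
 define P where "P a b = p o linepath a b" for a b :: real
 have P: "path (P a b)" "path_image (P a b) <= X" "pathstart (P a b) = p a" "pathfinish (P a b) = p b" "path_image (P a b) = p ` {a..b}"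
  if "0 <= a" "a <= b" "b <= 1" for a b
 proof -
  have sub: "path_image (linepath a b) = {a..b}" using that by (simp add: closed_segment_eq_real_ivl)
  show "path (P a b)" unfolding P_def
   using that by (intro path_continuous_image) (auto simp: closed_segment_eq_real_ivl intro: continuous_on_subset[OF p(1)[unfolded path_def]])
  show pi: "path_image (P a b) = p ` {a..b}" unfolding P_def path_image_compose sub ..
  show "path_image (P a b) <= X" unfolding pi using xX that by auto
  show "pathstart (P a b) = p a" "pathfinish (P a b) = p b" by (auto simp: P_def pathstart_def pathfinish_def linepath_def)
 qed
 have Pjoin: "homotopic_paths X (P 0 b) (P 0 a +++ P a b)" if "0 <= a" "a <= b" "b <= 1" for a b
 proof -
  have "homotopic_paths X (p o linepath 0 b) (p o (linepath 0 a +++ linepath a b))"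
   using that p by (intro homotopic_paths_reparam) (auto simp: path_image_join closed_segment_eq_real_ivl)
  thus ?thesis by (simp add: P_def path_compose_join)
 qed
 have "\<exists>w. set w <= V & (\<forall>i\<in>{1..n}. fl s w i = sgn (p (real j / N)) i) \<and>
   homotopic_paths X (P 0 (real j / N)) (q +++ (Gp s w +++ mix (Oct (fl s w)) (p (real j / N))))" if "j <= N" for j
  using that
 proof (induction j)
  case 0
  have p0: "p 0 = x0" using x0 by (simp add: pathstart_def)
  have e: "homotopic_paths X (q +++ mix (Oct s) x0) (%_. x0)"
  proof (rule homotopic_paths_subset[OF star_homotopic[OF star_Ch] star_in_X[OF star_Ch]])
   show "path_image (q +++ mix (Oct s) x0) <= Ch s"
    using star_path[OF star_Ch sgn_Ch[OF x0X], folded s_def] by (auto simp: q_def path_image_join)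
   show "path_image (%_. x0) <= Ch s" using sgn_Ch[OF x0X] by (auto simp: s_def path_image_def)
  qed (use Q in \<open>auto simp: path_const\<close>)
  have "homotopic_paths X (q +++ (Gp s [] +++ mix (Oct s) x0)) (q +++ mix (Oct s) x0)"
   unfolding Gp.simps using Q Gp_X[of "[]" s] by (intro homotopic_paths_join homotopic_paths_const_left) auto
  hence "homotopic_paths X (P 0 0) (q +++ (Gp s [] +++ mix (Oct s) x0))"
   using e homotopic_paths_trans homotopic_paths_sym by (simp add: P_def o_def linepath_def p0) blast
  thus ?case using p0 by (intro exI[of _ "[]"]) (auto simp: s_def)
 next
  case (Suc j)
  let ?a = "real j / N" and ?b = "real (Suc j) / N"
  have le: "0 <= ?a" "?a <= ?b" "?b <= 1" using Suc.prems by (auto simp: divide_right_mono)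
  let ?x = "p ?a" and ?x' = "p ?b"
  obtain w where w: "set w <= V" "\<And>i. i : {1..n} ==> fl s w i = sgn ?x i"
   and h: "homotopic_paths X (P 0 ?a) (q +++ (Gp s w +++ mix (Oct (fl s w)) ?x))" using Suc by auto
  have "diameter {?a..?b} < d"
  proof -
   have "diameter {?a..?b} = 1 / N" using le by (simp add: diameter_closed_interval add_divide_distrib)
   also have "\<dots> < d" using N N0 d(1) by (simp add: field_simps)
   finally show ?thesis .
  qed
  moreover have "{?a..?b} <= {0..1}" using le by auto
  ultimately obtain T E where T: "T : \<Gamma>" and sub: "p ` {?a..?b} <= UU T E" using d(2) by blast
  have xU: "?x : UU T E" "?x' : UU T E" using sub le by auto
  have xXX: "?x : X" "?x' : X" using xX le by auto
  have xC: "?x : Ch (fl s w)" using Ch_sgn[OF xXX(1)] w(2) by blast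
  have "fl s w i = sgn ?x' i" if i: "i : {1..n} - c ` T" for i
   using UU_Ch[OF xU(1) xC i] UU_sgn[OF xU(2) i] by simp
  then obtain u where u: "set u <= T" "\<And>i. i : {1..n} ==> fl (fl s w) u i = sgn ?x' i" using next_word[OF T] by metis
  have xC': "?x' : Ch (fl (fl s w) u)" using Ch_sgn[OF xXX(2)] u(2) by blast
  have uV: "set u <= V" using u(1) T by blast
  note PP = P[OF order_refl le(1), OF order_trans[OF le(2,3)]] P[OF le]
  note W = Gp_X[OF w(1), of s] and U = Gp_X[OF uV, of "fl s w"] and M = mix_Oct_X[OF xC] and M' = mix_Oct_X[OF xC']
  have pc: "homotopic_paths X (mix (Oct (fl s w)) ?x +++ P ?a ?b) (Gp (fl s w) u +++ mix (Oct (fl (fl s w) u)) ?x')"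
   by (rule piece[OF T xU(1) xC xU(2) xC' u(1)]) (use PP sub in auto)
  let ?m = "mix (Oct (fl s w)) ?x" and ?m' = "mix (Oct (fl (fl s w) u)) ?x'"
  have "homotopic_paths X (P 0 ?b) (P 0 ?a +++ P ?a ?b)" by (rule Pjoin[OF le])
  also have "homotopic_paths X \<dots> ((q +++ (Gp s w +++ ?m)) +++ P ?a ?b)"
   using h PP by (intro homotopic_paths_join) auto
  also have "homotopic_paths X \<dots> (q +++ ((Gp s w +++ ?m) +++ P ?a ?b))"
   using Q W M PP by (intro homotopic_paths_sym[OF homotopic_paths_assoc]) (auto simp: path_image_join)
  also have "homotopic_paths X \<dots> (q +++ (Gp s w +++ (?m +++ P ?a ?b)))"
   using Q W M PP by (intro homotopic_paths_join homotopic_paths_sym[OF homotopic_paths_assoc]) (auto simp: path_image_join)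
  also have "homotopic_paths X \<dots> (q +++ (Gp s w +++ (Gp (fl s w) u +++ ?m')))"
   using Q W M PP by (intro homotopic_paths_join[OF _ homotopic_paths_join[OF _ pc]]) (auto simp: path_image_join)
  also have "homotopic_paths X \<dots> (q +++ ((Gp s w +++ Gp (fl s w) u) +++ ?m'))"
   using Q W U M' PP by (intro homotopic_paths_join homotopic_paths_assoc) (auto simp: path_image_join)
  also have "homotopic_paths X \<dots> (q +++ (Gp s (w @ u) +++ ?m'))"
   using homotopic_paths_sym[OF Gp_append[OF w(1) uV, of s]] Q W U M'
   by (intro homotopic_paths_join) (auto simp: path_image_join)
  finally have "homotopic_paths X (P 0 ?b) (q +++ (Gp s (w @ u) +++ mix (Oct (fl s (w @ u))) ?x'))" by simp
  thus ?case using w uV u(2) by (intro exI[of _ "w @ u"]) simp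
 qed
 from this[of N] obtain w where w: "set w <= V" "\<forall>i\<in>{1..n}. fl s w i = sgn (p 1) i"
   "homotopic_paths X (P 0 1) (q +++ (Gp s w +++ mix (Oct (fl s w)) (p 1)))" using N0 by auto
 have "P 0 1 = p" by (auto simp: P_def o_def linepath_def fun_eq_iff)
 thus ?thesis using that[of w] w by (simp add: s_def q_def pathfinish_def)
qed

definition kw :: "'b list set" where
 "kw = {u : lists (V). \<forall>i. even (length (filter (%v. c v = i) u))}"

definition \<theta>1 :: "'b point => 'b list => (real => 'b point)" where
 "\<theta>1 x w = mix x (Oct (sgn x)) +++ (Gp (sgn x) w +++ mix (Oct (sgn x)) x)"

lemma fl_kw: "w : kw ==> fl E w = E"
 by (auto simp: kw_def fl_eq fun_eq_iff)

lemma \<theta>1_loop: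
 assumes x: "x : X" and w: "w : kw" shows "\<theta>1 x w : loops_at X x"
proof -
 have "set w <= V" using w by (auto simp: kw_def)
 thus ?thesis
  using mix_Oct_X[OF sgn_Ch[OF x]] Gp_X[of w "sgn x"] fl_kw[OF w] by (auto simp: loops_at_def \<theta>1_def path_image_join)
qed

lemma mix_inverse:
 assumes x: "x : X"
 shows "homotopic_paths X (mix x (Oct (sgn x)) +++ mix (Oct (sgn x)) x) (%_. x)"
  "homotopic_paths X (mix (Oct (sgn x)) x +++ mix x (Oct (sgn x))) (%_. Oct (sgn x))"
proof -
 have "reversepath (mix (Oct (sgn x)) x) = mix x (Oct (sgn x))"
  by (simp add: reversepath_def mix_swap[of "Oct (sgn x)" x])
 thus "homotopic_paths X (mix x (Oct (sgn x)) +++ mix (Oct (sgn x)) x) (%_. x)"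
  "homotopic_paths X (mix (Oct (sgn x)) x +++ mix x (Oct (sgn x))) (%_. Oct (sgn x))"
  using homotopic_paths_inverse_left[of "mix (Oct (sgn x)) x" X x] homotopic_paths_inverse_right[of "mix (Oct (sgn x)) x" X "Oct (sgn x)"]
   mix_Oct_X[OF sgn_Ch[OF x]] by simp_all
qed

lemma \<theta>1_mult:
 assumes x: "x : X" and u: "u : kw" and v: "v : kw"
 shows "homotopic_paths X (\<theta>1 x (u @ v)) (\<theta>1 x u +++ \<theta>1 x v)"
proof -
 have uV: "set u <= V" "set v <= V" using u v by (auto simp: kw_def)
 let ?s = "sgn x"
 let ?q = "mix x (Oct ?s)" and ?r = "mix (Oct ?s) x"
 note M = mix_Oct_X[OF sgn_Ch[OF x]] and U = Gp_X[OF uV(1), of ?s] and W = Gp_X[OF uV(2), of ?s]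
 have f: "fl ?s u = ?s" "fl ?s v = ?s" using fl_kw u v by auto
 have "homotopic_paths X ((Gp ?s u +++ ?r) +++ (?q +++ (Gp ?s v +++ ?r))) (Gp ?s u +++ (?r +++ (?q +++ (Gp ?s v +++ ?r))))"
  using M U W f by (intro homotopic_paths_sym[OF homotopic_paths_assoc]) (auto simp: path_image_join)
 also have "homotopic_paths X \<dots> (Gp ?s u +++ ((?r +++ ?q) +++ (Gp ?s v +++ ?r)))"
  using M U W f by (intro homotopic_paths_join homotopic_paths_assoc) (auto simp: path_image_join)
 also have "homotopic_paths X \<dots> (Gp ?s u +++ ((%_. Oct ?s) +++ (Gp ?s v +++ ?r)))"
  using M U W f mix_inverse(2)[OF x] by (intro homotopic_paths_join) (auto simp: path_image_join)
 also have "homotopic_paths X \<dots> (Gp ?s u +++ (Gp ?s v +++ ?r))"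
  using M U W f Oct_X[of ?s] by (intro homotopic_paths_join homotopic_paths_const_left) (auto simp: path_image_join)
 also have "homotopic_paths X \<dots> ((Gp ?s u +++ Gp ?s v) +++ ?r)"
  using M U W f by (intro homotopic_paths_assoc) (auto simp: path_image_join)
 also have "homotopic_paths X \<dots> (Gp ?s (u @ v) +++ ?r)"
  using homotopic_paths_sym[OF Gp_append[OF uV, of ?s]] M U W f by (intro homotopic_paths_join) (auto simp: path_image_join)
 finally have a: "homotopic_paths X ((Gp ?s u +++ ?r) +++ (?q +++ (Gp ?s v +++ ?r))) (Gp ?s (u @ v) +++ ?r)" .
 have "homotopic_paths X (\<theta>1 x u +++ \<theta>1 x v) (?q +++ ((Gp ?s u +++ ?r) +++ (?q +++ (Gp ?s v +++ ?r))))"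
  unfolding \<theta>1_def using M U W f by (intro homotopic_paths_sym[OF homotopic_paths_assoc]) (auto simp: path_image_join)
 also have "homotopic_paths X \<dots> (\<theta>1 x (u @ v))"
  unfolding \<theta>1_def by (rule homotopic_paths_join) (use a M U W f in \<open>auto simp: path_image_join\<close>)
 finally show ?thesis by (rule homotopic_paths_sym)
qed

text \<open>The loop of u has holonomy u and the constant loop the empty word, so homotopy
  invariance gives one direction; the other follows from \<open>Gp_norm\<close>.\<close>

lemma \<theta>1_one:
 assumes x: "x : X" and u: "u : kw"
 shows "homotopic_paths X (\<theta>1 x u) (%_. x) <-> weq u []"
proof
 have uV: "set u <= V" using u by (auto simp: kw_def)
 let ?s = "sgn x"
 let ?q = "mix x (Oct ?s)" and ?r = "mix (Oct ?s) x"
 note M = mix_Oct_X[OF sgn_Ch[OF x]] and U = Gp_X[OF uV, of ?s]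
 have f: "fl ?s u = ?s" using fl_kw u by auto
 {
  assume h: "homotopic_paths X (\<theta>1 x u) (%_. x)"
  have "hol (\<theta>1 x u) ([] @ (u @ []))"
   unfolding \<theta>1_def using hol_to_Oct[OF x] hol_Gp[OF uV, of ?s] M U f by (intro hol_join) auto
  moreover have "hol (%_. x) []" by (rule hol_const[where s = ?s]) simp
  ultimately show "weq u []" using hol_unique[OF h] by simp
 }
 assume "weq u []"
 hence "wlen u = 0" by (simp add: wlen_0)
 hence "norm u = []" by (simp add: wlen_def)
 hence g: "homotopic_paths X (Gp ?s u) (%_. Oct ?s)" using homotopic_paths_sym[OF Gp_norm[OF uV, of ?s]] by simp
 have "homotopic_paths X (\<theta>1 x u) (?q +++ ((%_. Oct ?s) +++ ?r))"
  unfolding \<theta>1_def using g M U f by (intro homotopic_paths_join) auto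
 also have "homotopic_paths X \<dots> (?q +++ ?r)"
  using M Oct_X[of ?s] by (intro homotopic_paths_join homotopic_paths_const_left) auto
 also have "homotopic_paths X \<dots> (%_. x)" by (rule mix_inverse(1)[OF x])
 finally show "homotopic_paths X (\<theta>1 x u) (%_. x)" .
qed

theorem fundamental_group_hyperbolic:
 assumes x: "x : X" and five: "five_large \<Gamma>"
 shows "hyperbolic_group (fundamental_group X x)"
proof -
 interpret racg_quotient "adjacent_in \<Gamma>" "fundamental_group X x" "V" c n "%w. hclass X (\<theta>1 x w)" kw
 proof (intro racg_quotient.intro racg_quotient_axioms.intro)
  show "racg (adjacent_in \<Gamma>)" by (rule racg_axioms)
  show "group (fundamental_group X x)" by (rule group_fundamental_group[OF x])
  show "finite (V)" by (rule finite_vertices)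
  show "c v : {1..n}" if "v : V" for v using col_range that .
  show "adjacent_in \<Gamma> a d | adjacent_in \<Gamma> b e"
   if h: "adjacent_in \<Gamma> a b" "adjacent_in \<Gamma> b d" "adjacent_in \<Gamma> d e" "adjacent_in \<Gamma> e a" "a ~= d" "b ~= e" for a b d e
  proof -
   have "distinct [a, b, d, e]" using h by (auto simp: adjacent_in_def)
   thus ?thesis using five h unfolding five_large_def by blast
  qed
  show "kw = {u : lists (V). \<forall>i. even (length (filter (%v. c v = i) u))}" by (rule kw_def)
  show "(%w. hclass X (\<theta>1 x w)) ` kw = carrier (fundamental_group X x)"
  proof (intro equalityI subsetI)
   fix P assume "P : (%w. hclass X (\<theta>1 x w)) ` kw"
   thus "P : carrier (fundamental_group X x)" unfolding fundamental_group_carrier using \<theta>1_loop[OF x] by blast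
  next
   fix P assume "P : carrier (fundamental_group X x)"
   then obtain p where p: "p : loops_at X x" "P = hclass X p" unfolding fundamental_group_carrier by blast
   note pl = loops_atD[OF p(1)]
   have pf: "pathfinish p = x" and pp: "path p" "path_image p <= X" "pathstart p = x" using pl by auto
   obtain w where w: "set w <= V" "\<And>i. i : {1..n} ==> fl (sgn x) w i = sgn x i"
    "homotopic_paths X p (mix x (Oct (sgn x)) +++ (Gp (sgn x) w +++ mix (Oct (fl (sgn x) w)) x))"
    using loop_word[OF pp, unfolded pf] by metis
   have "even (length (filter (%v. c v = i) w))" for i
   proof (cases "i : {1..n}")
    case True
    thus ?thesis using w(2)[OF True] unfolding fl_eq by argo
   next
    case False
    hence "filter (%v. c v = i) w = []" using w(1) col_range by (auto simp: filter_empty_conv)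
    thus ?thesis by simp
   qed
   hence wk: "w : kw" using w(1) by (auto simp: kw_def)
   hence "homotopic_paths X p (\<theta>1 x w)" using w(3) fl_kw[OF wk] by (simp add: \<theta>1_def)
   thus "P : (%w. hclass X (\<theta>1 x w)) ` kw" using wk hclass_eq p(2) by blast
  qed
  show "hclass X (\<theta>1 x (u @ v)) = hclass X (\<theta>1 x u) \<otimes>\<^bsub>fundamental_group X x\<^esub> hclass X (\<theta>1 x v)" if "u : kw" "v : kw" for u v
   using hclass_eq[OF \<theta>1_mult[OF x that]] fundamental_group_mult[OF \<theta>1_loop[OF x that(1)] \<theta>1_loop[OF x that(2)]] by simp
  show "hclass X (\<theta>1 x u) = \<one>\<^bsub>fundamental_group X x\<^esub> <-> weq u []" if "u : kw" for u
   using hclass_eq_iff[of "%_. x" X "\<theta>1 x u"] \<theta>1_one[OF x that] x unfolding fundamental_group_one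
   by (simp add: path_const)
 qed
 show ?thesis by (rule hyperbolic)
qed

section \<open>Topology of the coupled link space\<close>

text \<open>A letter of colour i switches the sign i, so word paths join all chamber centres. This
  is where every colour has to occur.\<close>

lemma path_connected_X:
 assumes cols: "\<And>i. i : {1..n} ==> \<exists>v\<in>V. c v = i"
 shows "path_connected X"
proof -
 have OO: "\<exists>p. path p & path_image p <= X & pathstart p = Oct E & pathfinish p = Oct E'" for E E'
 proof -
  obtain v where v: "\<And>i. i : {1..n} ==> v i : V & c (v i) = i" using cols by metis
  define w where "w = map v (filter (%i. E i ~= E' i) [1..<Suc n])"
  have w: "set w <= V" using v by (auto simp: w_def simp del: upt_Suc)
  have "fl E w i = E' i" if i: "i : {1..n}" for i
  proof -
   have "filter (%x. c x = i) w = map v (filter (%j. E j ~= E' j & c (v j) = i) [1..<Suc n])"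
    by (simp add: w_def filter_map o_def conj_commute del: upt_Suc)
   also have "filter (%j. E j ~= E' j & c (v j) = i) [1..<Suc n] = filter (%j. E j ~= E' j & j = i) [1..<Suc n]"
    using v by (intro filter_cong) auto
   also have "\<dots> = (if E i ~= E' i then [i] else [])"
    using filter_distinct_single[of "[1..<Suc n]" "%j. E j ~= E' j & j = i" i] i by (simp del: upt_Suc)
   finally show ?thesis by (auto simp: fl_eq)
  qed
  hence "Oct (fl E w) = Oct E'" by (intro ctr_cong) auto
  thus ?thesis using Gp_X[OF w, of E] by metis
 qed
 show ?thesis
  unfolding path_connected_def
 proof (intro ballI)
  fix x y assume x: "x : X" and y: "y : X"
  obtain p where p: "path p" "path_image p <= X" "pathstart p = Oct (sgn x)" "pathfinish p = Oct (sgn y)" using OO by blast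
  show "\<exists>g. path g & path_image g <= X & pathstart g = x & pathfinish g = y"
   using p mix_Oct_X[OF sgn_Ch[OF x]] mix_Oct_X[OF sgn_Ch[OF y]]
   by (intro exI[of _ "mix x (Oct (sgn x)) +++ (p +++ mix (Oct (sgn y)) y)"]) (auto simp: path_image_join)
 qed
qed

end

section \<open>Assembly: the two reflected spaces are glued from copies of \<open>Y\<close> in the
  same way\<close>

section \<open>Reflecting the chambers\<close>

context crushed begin

interpretation C: coloured n \<Gamma> c
 by unfold_locales (rule col)

text \<open>A simplex contains at most one vertex of a colour, so the sum has at most one non-zero
  term.\<close>

lemma colour_sum:
 assumes s: "supp f : \<Gamma>" and F: "finite F" "\<And>w. w : F ==> c w = i" and f: "\<And>w. w : F ==> f w <= (1 :: real)"
 shows "sum f F = 1 <-> (\<exists>w\<in>F. f w = 1)" "sum f F <= 1"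
proof -
 have one: "sum f F = f w" if w: "w : F" "f w ~= 0" for w
 proof -
  have "f x = 0" if "x : F - {w}" for x
  proof (rule ccontr)
   assume "f x ~= 0"
   hence "x = w" using C.col_inj[OF s, of x w] w F(2)[of x] F(2)[of w] that by auto
   thus False using that by simp
  qed
  thus ?thesis using F(1) w(1) by (simp add: sum.remove)
 qed
 have "sum f F = 0 | (\<exists>w\<in>F. sum f F = f w)"
 proof (cases "\<exists>w\<in>F. f w ~= 0")
  case True
  thus ?thesis using one by blast
 next
  case False
  hence "sum f F = 0" by (intro sum.neutral) blast
  thus ?thesis ..
 qed
 hence e: "sum f F ~= 0 ==> \<exists>w\<in>F. sum f F = f w" by blast
 show "sum f F <= 1"
 proof (cases "sum f F = 0")
  case False
  then obtain w where "w : F" "sum f F = f w" using e by blast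
  thus ?thesis using f[of w] by simp
 qed simp
 show "sum f F = 1 <-> (\<exists>w\<in>F. f w = 1)"
 proof
  assume "sum f F = 1"
  thus "\<exists>w\<in>F. f w = 1" using e by auto
 next
  assume "\<exists>w\<in>F. f w = 1"
  then obtain w where "w : F" "f w = 1" by blast
  thus "sum f F = 1" using one[of w] by simp
 qed
qed

text \<open>The copy of the chamber point f in the chamber with sign True exactly for the colours in
  S; the slack 1 - sum f goes to that side.\<close>

definition RX :: "nat set => ('b => real) => 'b point" where
 "RX S f = (%i. if i : {1..n} then (%z. case z of
   Inl jb => if jb = (i, i : S) then 1 - sum f (C.VV i) else 0
  | Inr v => if v : C.VV i then f v else 0) else undefined)"

lemma RX_\<alpha>: "i : {1..n} ==> C.\<alpha> (RX S f) i b = (if b = (i : S) then 1 - sum f (C.VV i) else 0)"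
 by (auto simp: C.\<alpha>_def RX_def)

lemma RX_\<beta>: "v : V ==> C.\<beta> (RX S f) v = f v"
proof -
 assume v: "v : V"
 hence "v : C.VV (c v)" "c v : {1..n}" using C.col_range unfolding C.VV_def by blast+
 thus ?thesis by (simp add: C.\<beta>_def RX_def)
qed

lemma VV_sum: assumes "f : P" shows "sum f (C.VV i) = 1 <-> (\<exists>w\<in>C.VV i. f w = 1)" "sum f (C.VV i) <= 1"
proof -
 have s: "supp f : \<Gamma>" and le: "\<And>w. f w <= 1" using assms by (simp_all add: P_def)
 have v: "c w = i" if "w : C.VV i" for w using that by (simp add: C.VV_def)
 show "sum f (C.VV i) = 1 <-> (\<exists>w\<in>C.VV i. f w = 1)" "sum f (C.VV i) <= 1"
  by (rule colour_sum[OF s C.finite_VV v le]; assumption)+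
qed

lemma RX_X: assumes f: "f : P" shows "RX S f : C.X"
 unfolding C.X_iff C.frame_def
proof (intro conjI ballI allI impI)
 show "RX S f : extensional {1..n}" by (simp add: RX_def extensional_def)
 have f0: "0 <= f v" "supp f : \<Gamma>" for v using f by (auto simp: P_def)
 fix i assume i: "i : {1..n}"
 show "0 <= RX S f i y" for y using i f0 VV_sum(2)[OF f, of i] by (cases y) (auto simp: RX_def)
 show "RX S f i (Inl (j, b)) = 0" if "j ~= i" for j b using that i by (simp add: RX_def)
 show "RX S f i (Inr v) = 0" if "v \<notin> C.VV i" for v using that i by (simp add: RX_def)
 have "(\<Sum>v\<in>C.VV i. RX S f i (Inr v)) = sum f (C.VV i)" using i by (intro sum.cong) (auto simp: RX_def)
 thus "C.\<alpha> (RX S f) i True + C.\<alpha> (RX S f) i False + (\<Sum>v\<in>C.VV i. RX S f i (Inr v)) = 1"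
  using RX_\<alpha>[OF i] by simp
 show "C.\<alpha> (RX S f) i True = 0 | C.\<alpha> (RX S f) i False = 0" using RX_\<alpha>[OF i] by simp
next
 have "C.bsupp (RX S f) <= supp f" unfolding C.bsupp_def using RX_\<beta>[of _ S f] by fastforce
 thus "C.bsupp (RX S f) : \<Gamma>" using f C.face unfolding P_def by blast
qed

lemma RX_surj: assumes x: "x : C.X" shows "\<exists>S\<in>Pow {1..n}. \<exists>f\<in>P. x = RX S f"
proof -
 note x' = x[unfolded C.X_iff C.frame_def]
 define S where "S = {i : {1..n}. C.\<alpha> x i False = 0}"
 define f where "f v = (if v : V then C.\<beta> x v else 0)" for v
 have fV: "f v = x i (Inr v)" if "v : C.VV i" for v i using that by (auto simp: f_def C.VV_def C.\<beta>_def)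
 have s: "C.\<alpha> x i True + C.\<alpha> x i False + sum f (C.VV i) = 1" if "i : {1..n}" for i
  using x' that fV by (simp cong: sum.cong)
 have f0: "0 <= f v" for v
 proof (cases "v : V")
  case True
  hence "c v : {1..n}" using C.col_range by blast
  thus ?thesis using x' True by (simp add: f_def C.\<beta>_def)
 qed (simp only: f_def if_False order_refl)
 have f1: "f v <= 1" for v
 proof (cases "v : V")
  case True
  hence c: "c v : {1..n}" "v : C.VV (c v)" using C.col_range unfolding C.VV_def by blast+
  have "0 <= C.\<alpha> x (c v) b" for b using x' c(1) by (simp add: C.\<alpha>_def)
  hence "sum f (C.VV (c v)) <= 1" using s[OF c(1)] by (metis add_increasing add_nonneg_nonneg order_refl)
  moreover have "f v <= sum f (C.VV (c v))" using member_le_sum[of v "C.VV (c v)" f] c(2) f0 C.finite_VV by simp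
  ultimately show ?thesis by linarith
 qed (simp only: f_def if_False zero_le_one)
 have "supp f <= C.bsupp x" by (auto simp: f_def C.bsupp_def split: if_splits)
 hence "supp f : \<Gamma>" using x' C.face by blast
 hence fP: "f : P" using f0 f1 by (simp add: P_def)
 have "x = RX S f"
 proof
  fix i show "x i = RX S f i"
  proof (cases "i : {1..n}")
   case i: True
   show ?thesis
   proof
    fix z show "x i z = RX S f i z"
    proof (cases z)
     case (Inr v)
     thus ?thesis using i fV[of v i] x' by (cases "v : C.VV i") (auto simp: RX_def)
    next
     case (Inl jb)
     obtain j b where jb: "jb = (j, b)" by (cases jb)
     show ?thesis
     proof (cases "j = i")
      case False
      thus ?thesis using i Inl jb x' by (simp add: RX_def)
     next
      case True
      have "x i z = C.\<alpha> x i b" using Inl jb True by (simp add: C.\<alpha>_def)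
      moreover have "RX S f i z = C.\<alpha> (RX S f) i b" using Inl jb True by (simp add: C.\<alpha>_def)
      moreover have "C.\<alpha> x i b = (if b = (i : S) then 1 - sum f (C.VV i) else 0)"
      proof -
       have "C.\<alpha> x i True = 0 | C.\<alpha> x i False = 0" using x' i by blast
       moreover have "i : S <-> C.\<alpha> x i False = 0" using i by (simp add: S_def)
       ultimately show ?thesis using s[OF i] by (cases b; cases "C.\<alpha> x i False = 0") auto
      qed
      ultimately show ?thesis using RX_\<alpha>[OF i] by simp
     qed
    qed
   qed
  next
   case False
   thus ?thesis using x' by (simp only: RX_def if_False) (auto simp: extensional_def)
  qed
 qed
 moreover have "S : Pow {1..n}" by (auto simp: S_def)
 ultimately show ?thesis using fP by blast
qed

text \<open>The B-coordinates give back f, and a sign is invisible exactly where its slack is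
  0.\<close>

lemma RX_fibre:
 assumes f: "f : P" "f' : P"
 shows "RX S f = RX S' f' <-> f = f' & (\<forall>i\<in>{1..n}. (i : S) ~= (i : S') --> sum f (C.VV i) = 1)"
proof
 assume eq: "RX S f = RX S' f'"
 have "f v = f' v" for v
 proof (cases "v : V")
  case True
  thus ?thesis using RX_\<beta>[OF True, of S f] RX_\<beta>[OF True, of S' f'] eq by simp
 next
  case False
  thus ?thesis using f supp_V[of f v] supp_V[of f' v] by (simp add: P_def)
 qed
 moreover have "sum f (C.VV i) = 1" if "i : {1..n}" "(i : S) ~= (i : S')" for i
  using RX_\<alpha>[OF that(1), of S f "i : S"] RX_\<alpha>[OF that(1), of S' f' "i : S"] eq that(2) by simp
 ultimately show "f = f' & (\<forall>i\<in>{1..n}. (i : S) ~= (i : S') --> sum f (C.VV i) = 1)" by blast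
next
 assume R: "f = f' & (\<forall>i\<in>{1..n}. (i : S) ~= (i : S') --> sum f (C.VV i) = 1)"
 show "RX S f = RX S' f'"
 proof
  fix i show "RX S f i = RX S' f' i"
  proof (cases "i : {1..n}")
   case True
   show ?thesis
   proof (cases "(i : S) = (i : S')")
    case False
    hence "sum f (C.VV i) = 1" using R True by blast
    thus ?thesis using R True by (auto simp: RX_def fun_eq_iff split: sum.split)
   qed (use R True in \<open>simp add: RX_def\<close>)
  next
   case False
   thus ?thesis by (simp only: RX_def if_False)
  qed
 qed
qed

lemma continuous_RX: "continuous_on UNIV (RX S)"
proof (rule continuous_on_coordinatewise_then_product, rule continuous_on_coordinatewise_then_product)
 fix i z
 show "continuous_on UNIV (%f. RX S f i z)"
 proof (cases "i : {1..n}")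
  case True
  have s: "continuous_on UNIV (%f :: 'b => real. 1 - sum f (C.VV i))"
   by (intro continuous_on_diff continuous_on_const continuous_on_sum continuous_coordinate)
  show ?thesis
  proof (cases z)
   case (Inl jb)
   thus ?thesis using True s by (cases "jb = (i, i : S)") (auto simp: RX_def)
  next
   case (Inr v)
   thus ?thesis using True continuous_coordinate[of UNIV v] by (cases "v : C.VV i") (auto simp: RX_def)
  qed
 qed (simp only: RX_def if_False continuous_on_const)
qed

text \<open>Distances from the two kinds of faces reflected by the colour of \<open>v0\<close>:
  \<open>aa\<close> from the old mirrors of that colour, \<open>bb\<close> from the new
  face.\<close>

definition aa :: "('b => real) => real" where "aa g = 1 - sum g (V0 (c v0))"
definition bb :: "('b => real) => real" where "bb g = sum g V1 - 1 / 2 - g v0"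

text \<open>The minimum of \<open>aa\<close> and \<open>bb\<close> is the distance that gets
  reflected; the excesses in \<open>CA\<close> and \<open>CB\<close> record which face is
  nearer.\<close>

definition RX' :: "nat set => ('b => real) => 'b coord => real" where
 "RX' S g = (%z. case z of CF v => g v | CU i b => if i : cols & b = (i : S) then 1 - sum g (V0 i) else 0
  | CT b => if b = (c v0 : S) then min (aa g) (bb g) else 0 | CA => aa g - min (aa g) (bb g) | CB => bb g - min (aa g) (bb g))"

lemma P'D: assumes "g : P'"
 shows "0 <= g v" "supp g : \<Gamma>" "w : V1 ==> g w <= 1" "0 <= bb g" "sum g (V0 i) = 1 <-> (\<exists>w\<in>V0 i. g w = 1)" "sum g (V0 i) <= 1" "0 <= aa g"
proof -
 show "0 <= g v" "supp g : \<Gamma>" "w : V1 ==> g w <= 1" "0 <= bb g" using assms by (auto simp: P'_def bb_def)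
 have s: "supp g : \<Gamma>" and le: "\<And>w. w : V0 j ==> g w <= 1" for j
  using assms unfolding P'_def V0_def V1_def by blast+
 have v: "c w = j" if "w : V0 j" for w j using that by (simp add: V0_def)
 have "sum g (V0 j) = 1 <-> (\<exists>w\<in>V0 j. g w = 1)" "sum g (V0 j) <= 1" for j
  by (rule colour_sum[OF s finite_V0(1) v le]; assumption)+
 thus "sum g (V0 i) = 1 <-> (\<exists>w\<in>V0 i. g w = 1)" "sum g (V0 i) <= 1" "0 <= aa g" by (simp_all add: aa_def)
qed

lemma CT_sum: "RX' S g (CT True) + RX' S g (CT False) = min (aa g) (bb g)"
 and CU_sum: "i : cols ==> RX' S g (CU i True) + RX' S g (CU i False) = 1 - sum g (V0 i)"
 by (auto simp: RX'_def)

lemma RX'_X': assumes g: "g : P'" shows "RX' S g : X'"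
proof -
 note d = P'D[OF g]
 have CF: "RX' S g (CF v) = g v" for v by (simp add: RX'_def)
 have "rr (RX' S g) = 1"
  using CT_sum[of S g] by (simp add: rr_def CF) (simp add: RX'_def aa_def)
 moreover have "eqs (RX' S g)"
  unfolding eqs_def
 proof (intro conjI ballI)
  fix i assume i: "i : cols"
  show "(\<Sum>w\<in>V0 i. RX' S g (CF w)) + RX' S g (CU i True) + RX' S g (CU i False) = rr (RX' S g)"
   using CU_sum[OF i, of S g] \<open>rr (RX' S g) = 1\<close> by (simp add: CF)
 next
  have "RX' S g CB = bb g - min (aa g) (bb g)" by (simp add: RX'_def)
  thus "RX' S g (CF v0) + rr (RX' S g) / 2 + RX' S g (CT True) + RX' S g (CT False) + RX' S g CB = (\<Sum>w\<in>V1. RX' S g (CF w))"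
   using CT_sum[of S g] \<open>rr (RX' S g) = 1\<close> by (simp add: CF bb_def)
 qed
 moreover have "RX' S g : cone_of supports"
  unfolding cone_of_def
 proof (intro CollectI conjI allI)
  show "0 <= RX' S g z" for z using d(1,4,6,7) by (cases z) (auto simp: RX'_def)
  have 1: "{v. CF v : supp (RX' S g)} = supp g" by (simp add: CF)
  have 2: "supp (RX' S g) <= CF ` V Un (%(i, b). CU i b) ` (cols \<times> UNIV) Un range CT Un {CA, CB}"
  proof
   fix z assume z: "z : supp (RX' S g)"
   show "z : CF ` V Un (%(i, b). CU i b) ` (cols \<times> UNIV) Un range CT Un {CA, CB}"
   proof (cases z)
    case (CF v)
    hence "g v ~= 0" using z by (simp add: RX'_def)
    hence "v : V" using d(2) by blast
    thus ?thesis using CF by blast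
   next
    case (CU i b)
    hence "i : cols" using z by (auto simp: RX'_def split: if_splits)
    thus ?thesis using CU by force
   qed auto
  qed
  show "supp (RX' S g) : supports"
   unfolding supports_def mem_Collect_eq[of _ "%S. {v. CF v : S} : \<Gamma> & _ S"] 1[symmetric]
   using 1 2 d(2) by (intro CollectI conjI allI) (simp_all, auto simp: RX'_def)
 qed
 ultimately show ?thesis by (simp add: X'_def ZC_def)
qed

lemma RX'_surj: assumes x: "x : X'" shows "\<exists>S\<in>Pow {1..n}. \<exists>g\<in>P'. x = RX' S g"
proof -
 have x0: "\<And>z. 0 <= x z" "supp x : supports" "eqs x" "rr x = 1" using x by (auto simp: X'_def ZC_def cone_of_def)
 define S where "S = {i : cols. x (CU i False) = 0} Un (if x (CT False) = 0 then {c v0} else {})"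
 define g where "g v = x (CF v)" for v
 have sup: "{v. CF v : supp x} : \<Gamma>" "supp x <= CF ` V Un (%(i, b). CU i b) ` (cols \<times> UNIV) Un range CT Un {CA, CB}"
  "\<And>i. x (CU i True) = 0 | x (CU i False) = 0" "x (CT True) = 0 | x (CT False) = 0" "x CA = 0 | x CB = 0"
  using x0(2) unfolding supports_def by auto
 have e: "sum g (V0 i) + x (CU i True) + x (CU i False) = 1" if "i : cols" for i
  using x0(3,4) that by (simp add: eqs_def g_def)
 have e2: "g v0 + 1 / 2 + x (CT True) + x (CT False) + x CB = sum g V1" using x0(3,4) by (simp add: eqs_def g_def)
 have e3: "sum g (V0 (c v0)) + x (CT True) + x (CT False) + x CA = 1" using x0(4) by (simp add: rr_def g_def)
 have n0: "0 <= x (CT True)" "0 <= x (CT False)" "0 <= x CA" "0 <= x CB" using x0(1) by auto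
 have V0le: "sum g (V0 (c w)) <= 1" if "w : V1" for w
 proof (cases "c w = c v0")
  case True
  thus ?thesis using e3 n0 by simp
 next
  case False
  hence "c w : cols" using that c_range[of w] unfolding cols_def V1_def by blast
  thus ?thesis using e[of "c w"] x0(1)[of "CU (c w) True"] x0(1)[of "CU (c w) False"] by linarith
 qed
 have "g : P'"
  unfolding P'_def
 proof (intro CollectI conjI allI ballI)
  show "0 <= g v" for v using x0(1) by (simp add: g_def)
  show "supp g : \<Gamma>" using sup(1) by (simp add: g_def)
  show "g v0 + 1 / 2 <= sum g V1" using e2 n0 by linarith
  fix w assume w: "w : V1"
  have "w : V0 (c w)" using w by (simp add: V0_def V1_def)
  hence "g w <= sum g (V0 (c w))" using member_le_sum[of w "V0 (c w)" g] finite_V0(1) x0(1) by (simp add: g_def)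
  thus "g w <= 1" using V0le[OF w] by linarith
 qed
 moreover have "x = RX' S g"
 proof
  have ab: "aa g = x (CT True) + x (CT False) + x CA" "bb g = x (CT True) + x (CT False) + x CB"
   using e2 e3 by (auto simp: aa_def bb_def)
  have mn: "min (aa g) (bb g) = x (CT True) + x (CT False)" using ab sup(5) n0 by auto
  fix z show "x z = RX' S g z"
  proof (cases z)
   case (CU i b)
   show ?thesis
   proof (cases "i : cols")
    case True
    hence "i ~= c v0" by (simp add: cols_def)
    hence "i : S <-> x (CU i False) = 0" using True by (simp add: S_def)
    thus ?thesis using CU True e[OF True] sup(3)[of i] by (cases b; cases "x (CU i False) = 0") (auto simp: RX'_def)
   next
    case False
    hence "CU i b \<notin> supp x" using sup(2) by auto
    thus ?thesis using CU False by (simp add: RX'_def)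
   qed
  next
   case (CT b)
   have "c v0 \<notin> cols" by (simp add: cols_def)
   hence "c v0 : S <-> x (CT False) = 0" by (simp add: S_def)
   thus ?thesis using CT mn sup(4) by (cases b; cases "x (CT False) = 0") (auto simp: RX'_def)
  qed (use ab mn in \<open>auto simp: RX'_def g_def\<close>)
 qed
 moreover have "S : Pow {1..n}" using c_range[OF v0] by (auto simp: S_def cols_def split: if_splits)
 ultimately show ?thesis by blast
qed

lemma RX'_fibre:
 assumes g: "g : P'" "g' : P'"
 shows "RX' S g = RX' S' g' <-> g = g' & (\<forall>i\<in>cols. (i : S) ~= (i : S') --> sum g (V0 i) = 1) \<and>
  ((c v0 : S) ~= (c v0 : S') --> aa g = 0 | bb g = 0)"
proof -
 have m: "min (aa g) (bb g) = 0 <-> aa g = 0 | bb g = 0" using P'D(4,7)[OF g(1)] by (auto simp: min_def)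
 have "RX' S g = RX' S' g' <-> g = g' & (\<forall>i\<in>cols. (i : S) ~= (i : S') --> sum g (V0 i) = 1) \<and>
  ((c v0 : S) ~= (c v0 : S') --> min (aa g) (bb g) = 0)"
 proof
  assume eq: "RX' S g = RX' S' g'"
  have "g v = g' v" for v using fun_cong[OF eq, of "CF v"] by (simp add: RX'_def)
  hence gg: "g = g'" ..
  have "sum g (V0 i) = 1" if "i : cols" "(i : S) ~= (i : S')" for i
   using fun_cong[OF eq, of "CU i (i : S)"] that by (simp add: RX'_def)
  moreover have "min (aa g) (bb g) = 0" if "(c v0 : S) ~= (c v0 : S')"
   using fun_cong[OF eq, of "CT (c v0 : S)"] that by (simp add: RX'_def)
  ultimately show "g = g' & (\<forall>i\<in>cols. (i : S) ~= (i : S') --> sum g (V0 i) = 1) \<and>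
   ((c v0 : S) ~= (c v0 : S') --> min (aa g) (bb g) = 0)" using gg by blast
 next
  assume R: "g = g' & (\<forall>i\<in>cols. (i : S) ~= (i : S') --> sum g (V0 i) = 1) \<and>
   ((c v0 : S) ~= (c v0 : S') --> min (aa g) (bb g) = 0)"
  show "RX' S g = RX' S' g'"
  proof
   fix z show "RX' S g z = RX' S' g' z"
    using R by (cases z) (auto simp: RX'_def)
  qed
 qed
 thus ?thesis using m by simp
qed

lemma continuous_RX': "continuous_on UNIV (RX' S)"
proof (rule continuous_on_coordinatewise_then_product)
 fix z
 have s: "continuous_on UNIV (%g :: 'b => real. 1 - sum g (V0 i))" for i
  by (intro continuous_on_diff continuous_on_const continuous_on_sum continuous_coordinate)
 have a: "continuous_on UNIV aa" unfolding aa_def[abs_def] by (rule s)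
 have b: "continuous_on UNIV bb" unfolding bb_def[abs_def]
  by (intro continuous_on_diff continuous_on_const continuous_on_sum continuous_coordinate)
 have m: "continuous_on UNIV (%g. min (aa g) (bb g))" by (intro continuous_on_min a b)
 show "continuous_on UNIV (%g. RX' S g z)"
 proof (cases z)
  case (CF v)
  thus ?thesis using continuous_coordinate[of UNIV v] by (simp add: RX'_def)
 next
  case (CU i b)
  show ?thesis
  proof (cases "i : cols & b = (i : S)")
   case True
   hence e: "\<And>g. 1 - sum g (V0 i) = RX' S g z" using CU by (simp add: RX'_def)
   show ?thesis by (rule continuous_on_eq[OF s[of i] e])
  next
   case False
   hence e: "\<And>g. 0 = RX' S g z" using CU by (auto simp: RX'_def)
   show ?thesis by (rule continuous_on_eq[OF continuous_on_const e])
  qed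
 next
  case (CT b)
  show ?thesis
  proof (cases "b = (c v0 : S)")
   case True
   hence e: "\<And>g. min (aa g) (bb g) = RX' S g z" using CT by (simp add: RX'_def)
   show ?thesis by (rule continuous_on_eq[OF m e])
  next
   case False
   hence e: "\<And>g. 0 = RX' S g z" using CT by (simp add: RX'_def)
   show ?thesis by (rule continuous_on_eq[OF continuous_on_const e])
  qed
 next
  case CA
  thus ?thesis using continuous_on_diff[OF a m] by (simp add: RX'_def)
 next
  case CB
  thus ?thesis using continuous_on_diff[OF b m] by (simp add: RX'_def)
 qed
qed

text \<open>Both parametrisations place the mirror of \<open>v0\<close>, respectively the new face,
  at height 0 and the other mirrors at height 1, with the same equation q (fst y) w = 1.\<close>

lemma mirrors:
 assumes y: "y : Y"
 shows "i : cols ==> sum (A y) (C.VV i) = 1 <-> sum (A' y) (V0 i) = 1"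
  "sum (A y) (C.VV (c v0)) = 1 <-> aa (A' y) = 0 | bb (A' y) = 0"
proof -
 have AP: "A y : P" "A' y : P'" using A_P[OF y] A'_P'[OF y] by auto
 have VV: "C.VV i = (if i = c v0 then insert v0 (V0 i) else V0 i)" for i using v0 unfolding C.VV_def V0_def by auto
 have w: "A y w = 1 <-> A' y w = 1" if "w : V0 i" for w i
  using A_mirror(1)[OF y, of w] A'_mirror(1)[OF y, of w] that unfolding V0_def V1_def by auto
 show "sum (A y) (C.VV i) = 1 <-> sum (A' y) (V0 i) = 1" if "i : cols"
 proof -
  have "C.VV i = V0 i" using that VV[of i] by (simp add: cols_def)
  hence "sum (A y) (C.VV i) = 1 <-> (\<exists>w\<in>V0 i. A y w = 1)" using VV_sum(1)[OF AP(1), of i] by simp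
  thus ?thesis using P'D(5)[OF AP(2), of i] w[of _ i] by simp
 qed
 have "bb (A' y) = 0 <-> A' y v0 + 1 / 2 = sum (A' y) V1" unfolding bb_def by linarith
 hence b: "bb (A' y) = 0 <-> A y v0 = 1" using A_mirror(2)[OF y] A'_mirror(2)[OF y] by simp
 have a: "aa (A' y) = 0 <-> (\<exists>w\<in>V0 (c v0). A' y w = 1)" using P'D(5)[OF AP(2), of "c v0"] by (auto simp: aa_def)
 show "sum (A y) (C.VV (c v0)) = 1 <-> aa (A' y) = 0 | bb (A' y) = 0"
  unfolding VV_sum(1)[OF AP(1)] a b using w[of _ "c v0"] by (auto simp: VV)
qed

text \<open>Both spaces are glued from copies of \<open>Y\<close> indexed by sign sets; the
  identifications inside a copy agree by \<open>A_fibre\<close> and \<open>A'_fibre\<close>, those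
  between copies by \<open>mirrors\<close>.\<close>

lemma X_homeomorphic_X': "compact C.X" "C.X homeomorphic X'"
proof -
 have U: "(\<Union>S\<in>Pow {1..n}. (%y. RX S (A y)) ` Y) = C.X"
 proof -
  have "(\<Union>S\<in>Pow {1..n}. (%y. RX S (A y)) ` Y) = (\<Union>S\<in>Pow {1..n}. RX S ` P)"
   unfolding A_image[symmetric] image_image ..
  also have "\<dots> = C.X"
  proof (intro equalityI UN_least image_subsetI subsetI)
   show "RX S f : C.X" if "f : P" for S f using that by (rule RX_X)
   fix x assume "x : C.X"
   then obtain S f where "S : Pow {1..n}" "f : P" "x = RX S f" using RX_surj by blast
   thus "x : (\<Union>S\<in>Pow {1..n}. RX S ` P)" by (intro UN_I[of S]) auto
  qed
  finally show ?thesis .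
 qed
 have U': "(\<Union>S\<in>Pow {1..n}. (%y. RX' S (A' y)) ` Y) = X'"
 proof -
  have "(\<Union>S\<in>Pow {1..n}. (%y. RX' S (A' y)) ` Y) = (\<Union>S\<in>Pow {1..n}. RX' S ` P')"
   unfolding A'_image[symmetric] image_image ..
  also have "\<dots> = X'"
  proof (intro equalityI UN_least image_subsetI subsetI)
   show "RX' S f : X'" if "f : P'" for S f using that by (rule RX'_X')
   fix x assume "x : X'"
   then obtain S f where "S : Pow {1..n}" "f : P'" "x = RX' S f" using RX'_surj by blast
   thus "x : (\<Union>S\<in>Pow {1..n}. RX' S ` P')" by (intro UN_I[of S]) auto
  qed
  finally show ?thesis .
 qed
 have fib: "RX S (A y) = RX S' (A z) <-> RX' S (A' y) = RX' S' (A' z)"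
  if "y : Y" "z : Y" for S S' y z
 proof -
  have "A y = A z <-> A' y = A' z" using A_fibre[OF that] A'_fibre[OF that] by simp
  moreover have "{1..n} = insert (c v0) cols" using c_range[OF v0] by (auto simp: cols_def)
  hence "(\<forall>i\<in>{1..n}. (i : S) ~= (i : S') --> sum (A y) (C.VV i) = 1) \<longleftrightarrow>
    (\<forall>i\<in>cols. (i : S) ~= (i : S') --> sum (A' y) (V0 i) = 1) \<and>
    ((c v0 : S) ~= (c v0 : S') --> aa (A' y) = 0 | bb (A' y) = 0)"
   using mirrors[OF that(1)] by auto
  ultimately show ?thesis
   unfolding RX_fibre[OF A_P[OF that(1)] A_P[OF that(2)]] RX'_fibre[OF A'_P'[OF that(1)] A'_P'[OF that(2)]] by blast
 qed
 have c1: "continuous_on Y (%y. RX S (A y))" for S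
  by (rule continuous_on_compose2[OF continuous_RX continuous_A]) simp
 have c2: "continuous_on Y (%y. RX' S (A' y))" for S
  by (rule continuous_on_compose2[OF continuous_RX' continuous_A']) simp
 note g = glue_homeomorphic[where J = "Pow {1..n}" and A = "%S y. RX S (A y)" and B = "%S y. RX' S (A' y)", OF _ compact_Y c1 c2 fib]
 show "compact C.X" "C.X homeomorphic X'" using g unfolding U U' by auto
qed

end

theorem (in chamber_complex) coupled_link_space_homeomorphic:
 assumes "top_of_set (realization \<Gamma>) homeomorphic_space nsphere 3"
 shows "compact (coloured.X n \<Gamma> c)" "coloured.X n \<Gamma> c homeomorphic X'"
proof -
 obtain q p where "p : D" "p v0 = 0" "continuous_on D q" "q ` D = D" "\<And>y. [|y : D; y v0 = 1|] ==> q y = y"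
  "\<And>y y'. [|y : D; y' : D|] ==> q y = q y' <-> y = y' | y v0 = 0 & y' v0 = 0" by (rule crush_exists[OF assms]) (rule that)
 then interpret crushed n \<Gamma> c v0 q p by unfold_locales
 show "compact (coloured.X n \<Gamma> c)" "coloured.X n \<Gamma> c homeomorphic X'" by (rule X_homeomorphic_X')+
qed

section \<open>The main theorem\<close>

theorem theorem5p18:
  fixes n :: nat
    and \<Gamma>\<^sub>B :: "'b set set"
    and c\<^sub>B :: "'b \<Rightarrow> nat"
    and \<Gamma>\<^sub>A :: "(nat \<times> bool) set set"
    and X :: "(nat \<Rightarrow> (nat \<times> bool) + 'b \<Rightarrow> real) set"
  defines "\<Gamma>\<^sub>A \<equiv> join_family {1..n} (\<lambda>_. S0)"
    and "X \<equiv> coupled_link_space n \<Gamma>\<^sub>A fst \<Gamma>\<^sub>B c\<^sub>B"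
  assumes "five_large \<Gamma>\<^sub>B"
    and "PL_triangulates 3 \<Gamma>\<^sub>B (nsphere 3)"
    and "coloured_complex n \<Gamma>\<^sub>B c\<^sub>B"
    and "\<forall>i\<in>{1..n}. colour_class \<Gamma>\<^sub>B c\<^sub>B i \<noteq> {}"
  shows "closed_connected_PL_manifold 4 (top_of_set X) \<and>
         (\<forall>x\<in>X. hyperbolic_group (fundamental_group X x))"
proof -
 interpret C: coloured n \<Gamma>\<^sub>B c\<^sub>B by unfold_locales (rule assms)
 have X: "X = C.X" by (simp add: X_def \<Gamma>\<^sub>A_def C.X_def)
 have sph: "top_of_set (realization \<Gamma>\<^sub>B) homeomorphic_space nsphere 3"
  and links: "\<And>v. v : \<Union>\<Gamma>\<^sub>B ==> PL_homeomorphic (link_of \<Gamma>\<^sub>B v) (simplex_boundary 3)"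
  using assms(4) by (auto simp: PL_triangulates_def)
 \<comment> \<open>A point of the sphere yields a non-empty simplex and thereby the vertex
   \<open>v0\<close>.\<close>
 obtain f g where "homeomorphic_maps (top_of_set (realization \<Gamma>\<^sub>B)) (nsphere 3) f g"
  using sph unfolding homeomorphic_space_def by blast
 hence "g : topspace (nsphere 3) \<rightarrow> realization \<Gamma>\<^sub>B" unfolding homeomorphic_maps_def continuous_map_def by simp
 hence "g (%i. if i = 0 then 1 else 0) : realization \<Gamma>\<^sub>B" using nsphere_point by (rule Pi_mem)
 then obtain \<sigma> x where \<sigma>: "\<sigma> : \<Gamma>\<^sub>B" "x : closed_simplex \<sigma>" unfolding realization_def by blast
 hence "\<sigma> ~= {}" by (auto simp: closed_simplex_def)
 then obtain v0 where v0: "v0 : \<Union>\<Gamma>\<^sub>B" using \<sigma>(1) by blast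
 interpret chamber_complex n \<Gamma>\<^sub>B c\<^sub>B v0 by unfold_locales (rule assms v0)+
 note comp = coupled_link_space_homeomorphic[OF sph, folded X]
 obtain K :: "nat set set" and p where K: "abstract_complex K" "bij_betw (aff K p) (realization K) X'"
  "\<And>v. v : \<Union>K ==> PL_homeomorphic (link_of K v) (simplex_boundary 4)" using X'_triangulation[OF links] by blast
 have "compact (realization K)" by (rule compact_realization[OF K(1)])
 then obtain g where "homeomorphism (realization K) X' (aff K p) g"
  using homeomorphism_compact continuous_on_affine_extension K(2) unfolding bij_betw_def by metis
 hence 1: "top_of_set (realization K) homeomorphic_space top_of_set X'" by (rule homeomorphism_homeomorphic_space)
 obtain f g where "homeomorphism X X' f g" using comp(2) unfolding homeomorphic_def by blast
 hence 2: "top_of_set X homeomorphic_space top_of_set X'" by (rule homeomorphism_homeomorphic_space)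
 have PL: "PL_triangulates 4 K (top_of_set X)"
  unfolding PL_triangulates_def
 proof (intro conjI ballI)
  show "abstract_complex K" by (rule K(1))
  show "top_of_set (realization K) homeomorphic_space top_of_set X"
   by (rule homeomorphic_space_trans[OF 1 iffD1[OF homeomorphic_space_sym 2]])
 qed (rule K(3))
 have "\<exists>v\<in>\<Union>\<Gamma>\<^sub>B. c\<^sub>B v = i" if "i : {1..n}" for i
  using assms(6) that unfolding colour_class_def by blast
 hence "path_connected X" unfolding X by (rule C.path_connected_X)
 hence "connected_space (top_of_set X)"
  using path_connected_imp_connected[of X] by (simp add: connected_space_subtopology)
 moreover have "compact_space (top_of_set X)" using comp(1) by (simp add: compact_space_subtopology)
 moreover have "X ~= {}" unfolding X using C.ctr_X[OF C.empty_simplex] by blast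
 ultimately have "closed_connected_PL_manifold 4 (top_of_set X)"
  using PL PL_triangulates_manifold[OF PL] unfolding closed_connected_PL_manifold_def by auto
 moreover have "\<forall>x\<in>X. hyperbolic_group (fundamental_group X x)"
  unfolding X using C.fundamental_group_hyperbolic assms(3) by blast
 ultimately show ?thesis by blast
qed

end
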